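(* There is an $\tilde{O}(n^{5/3})$-time algorithm for computing all eccentricities in any $n$-vertex median graph.
   Context: All graphs are finite, connected, simple, unweighted and undirected; $d(u,v)$ is the shortest-path distance, $I(a,b)=\{w: d(a,w)+d(w,b)=d(a,b)\}$, and the eccentricity of $u$ is $\mathrm{ecc}(u)=\max_v d(u,v)$. A graph is median if for every triple of distinct vertices $x,y,z$, the set $I(x,y)\cap I(y,z)\cap I(z,x)$ contains exactly one vertex. The notation $\tilde{O}(\cdot)$ suppresses factors polylogarithmic in $n$. *)

theory Defs
  imports
    "Graph_Theory.Graph_Theory"
    "HOL-Library.Landau_Symbols"
    "HOL-Library.Log_Nat"
begin

section \<open>Median graphs and eccentricities\<close>

text \<open>
  An undirected simple graph is a \<^locale>\<open>pair_graph\<close>: a finite, symmetric, loop-free digraph whose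
  arcs are pairs of vertices. Distances are the library's shortest-path distances for unit weights;
  they are finite in a connected graph.
\<close>

definition gdist :: "'a pair_pre_digraph \<Rightarrow> 'a \<Rightarrow> 'a \<Rightarrow> ereal" where
  "gdist G u v = wf_digraph.\<mu> (with_proj G) (\<lambda>_. 1) u v"

definition interval :: "'a pair_pre_digraph \<Rightarrow> 'a \<Rightarrow> 'a \<Rightarrow> 'a set" where
  "interval G a b = {w \<in> pverts G. gdist G a w + gdist G w b = gdist G a b}"

definition eccentricity :: "'a pair_pre_digraph \<Rightarrow> 'a \<Rightarrow> ereal" where
  "eccentricity G u = Max (gdist G u ` pverts G)"

definition median_graph :: "'a pair_pre_digraph \<Rightarrow> bool" where
  "median_graph G \<longleftrightarrow>
     pair_graph G \<and> connected (with_proj G) \<and>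
     (\<forall>x\<in>pverts G. \<forall>y\<in>pverts G. \<forall>z\<in>pverts G. x \<noteq> y \<and> y \<noteq> z \<and> x \<noteq> z \<longrightarrow>
        (\<exists>!w. w \<in> interval G x y \<inter> interval G y z \<inter> interval G z x))"


section \<open>A word RAM\<close>

text \<open>
  Deterministic unit-cost word RAM with word size \<open>w\<close>, programmed in a structured language: every
  register and array cell holds a word, and array indices are words. A program names only finitely
  many registers and arrays, so named arrays can be interleaved in a single memory with constant
  overhead. Every constant, register access, array access, arithmetic operation, assignment and
  test costs one time unit.
\<close>

type_synonym name = string

datatype binop =
  Plus | Minus | Times | Quot | Rem | BitAnd | BitOr | BitXor | ShiftL | ShiftR | Less | Equal

datatype expr = Const nat | Reg name | Get name expr | Bin binop expr expr

datatype prog =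
    Skip
  | Assign name expr
  | Put name expr expr
  | Seq prog prog
  | Cond expr prog prog
  | While expr prog

record state =
  regs :: "name \<Rightarrow> nat"
  arrs :: "name \<Rightarrow> nat \<Rightarrow> nat"

text \<open>
  Results are reduced modulo \<open>2 ^ w\<close>; the summand \<open>2 ^ w\<close> in the subtraction of two words makes it
  wrap around instead of being truncated at zero. Division by zero yields zero.
\<close>

fun binop_val :: "nat \<Rightarrow> binop \<Rightarrow> nat \<Rightarrow> nat \<Rightarrow> nat" where
  "binop_val w Plus x y = (x + y) mod 2 ^ w"
| "binop_val w Minus x y = (x + 2 ^ w - y) mod 2 ^ w"
| "binop_val w Times x y = (x * y) mod 2 ^ w"
| "binop_val w Quot x y = (x div y) mod 2 ^ w"
| "binop_val w Rem x y = (x mod y) mod 2 ^ w"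
| "binop_val w BitAnd x y = (Bit_Operations.and x y) mod 2 ^ w"
| "binop_val w BitOr x y = (Bit_Operations.or x y) mod 2 ^ w"
| "binop_val w BitXor x y = (Bit_Operations.xor x y) mod 2 ^ w"
| "binop_val w ShiftL x y = (push_bit y x) mod 2 ^ w"
| "binop_val w ShiftR x y = (drop_bit y x) mod 2 ^ w"
| "binop_val w Less x y = of_bool (x < y) mod 2 ^ w"
| "binop_val w Equal x y = of_bool (x = y) mod 2 ^ w"

fun expr_val :: "nat \<Rightarrow> state \<Rightarrow> expr \<Rightarrow> nat" where
  "expr_val w s (Const k) = k mod 2 ^ w"
| "expr_val w s (Reg x) = regs s x"
| "expr_val w s (Get a e) = arrs s a (expr_val w s e)"
| "expr_val w s (Bin f e1 e2) = binop_val w f (expr_val w s e1) (expr_val w s e2)"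

fun expr_time :: "expr \<Rightarrow> nat" where
  "expr_time (Const k) = 1"
| "expr_time (Reg x) = 1"
| "expr_time (Get a e) = 1 + expr_time e"
| "expr_time (Bin f e1 e2) = 1 + expr_time e1 + expr_time e2"

text \<open>
  \<open>exec w s p t s'\<close>: with word size \<open>w\<close>, program \<open>p\<close> started in \<open>s\<close> halts in \<open>s'\<close> after exactly
  \<open>t\<close> time units. A condition holds iff its value is nonzero.
\<close>

inductive exec :: "nat \<Rightarrow> state \<Rightarrow> prog \<Rightarrow> nat \<Rightarrow> state \<Rightarrow> bool" for w where
  Skip: "exec w s Skip 1 s"
| Assign: "exec w s (Assign x e) (1 + expr_time e)
     (s\<lparr>regs := (regs s)(x := expr_val w s e)\<rparr>)"
| Put: "exec w s (Put a i e) (1 + expr_time i + expr_time e)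
     (s\<lparr>arrs := (arrs s)(a := (arrs s a)(expr_val w s i := expr_val w s e))\<rparr>)"
| Seq: "exec w s p t1 s' \<Longrightarrow> exec w s' q t2 s'' \<Longrightarrow> exec w s (Seq p q) (t1 + t2) s''"
| CondTrue: "expr_val w s e \<noteq> 0 \<Longrightarrow> exec w s p t s' \<Longrightarrow>
     exec w s (Cond e p q) (1 + expr_time e + t) s'"
| CondFalse: "expr_val w s e = 0 \<Longrightarrow> exec w s q t s' \<Longrightarrow>
     exec w s (Cond e p q) (1 + expr_time e + t) s'"
| WhileFalse: "expr_val w s e = 0 \<Longrightarrow> exec w s (While e p) (1 + expr_time e) s"
| WhileTrue: "expr_val w s e \<noteq> 0 \<Longrightarrow> exec w s p t1 s' \<Longrightarrow> exec w s' (While e p) t2 s'' \<Longrightarrow>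
     exec w s (While e p) (1 + expr_time e + t1 + t2) s''"

inductive_cases exec_SkipE: "exec w s Skip t s'"
inductive_cases exec_AssignE: "exec w s (Assign x e) t s'"
inductive_cases exec_PutE: "exec w s (Put a i e) t s'"
inductive_cases exec_SeqE: "exec w s (Seq p q) t s'"
inductive_cases exec_CondE: "exec w s (Cond e p q) t s'"
inductive_cases exec_WhileE: "exec w s (While e p) t s'"

lemma exec_deterministic:
  "exec w s p t s' \<Longrightarrow> exec w s p u s'' \<Longrightarrow> t = u \<and> s' = s''"
proof (induction arbitrary: u s'' rule: exec.induct)
  case (Skip s)
  from Skip show ?case by (rule exec_SkipE) simp
next
  case (Assign s x e)
  from Assign show ?case by (rule exec_AssignE) simp
next
  case (Put s a i e)
  from Put show ?case by (rule exec_PutE) simp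
next
  case (Seq s p t1 s1 q t2 s2)
  from Seq.prems show ?case
  proof (rule exec_SeqE)
    fix u1 s1' u2
    assume "u = u1 + u2" "exec w s p u1 s1'" "exec w s1' q u2 s''"
    with Seq.IH(1)[of u1 s1'] Seq.IH(2)[of u2 s''] show ?thesis by simp
  qed
next
  case (CondTrue s e p t s1 q)
  from CondTrue.prems show ?case
  proof (rule exec_CondE)
    fix u1
    assume "u = Suc (expr_time e + u1)" "0 < expr_val w s e" "exec w s p u1 s''"
    with CondTrue.hyps CondTrue.IH[of u1 s''] show ?thesis by simp
  next
    fix u1
    assume "u = Suc (expr_time e + u1)" "expr_val w s e = 0" "exec w s q u1 s''"
    with CondTrue.hyps CondTrue.IH[of u1 s''] show ?thesis by simp
  qed
next
  case (CondFalse s e q t s1 p)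
  from CondFalse.prems show ?case
  proof (rule exec_CondE)
    fix u1
    assume "u = Suc (expr_time e + u1)" "0 < expr_val w s e" "exec w s p u1 s''"
    with CondFalse.hyps CondFalse.IH[of u1 s''] show ?thesis by simp
  next
    fix u1
    assume "u = Suc (expr_time e + u1)" "expr_val w s e = 0" "exec w s q u1 s''"
    with CondFalse.hyps CondFalse.IH[of u1 s''] show ?thesis by simp
  qed
next
  case (WhileFalse s e p)
  from WhileFalse.prems show ?case by (rule exec_WhileE) (use WhileFalse.hyps in simp_all)
next
  case (WhileTrue s e p t1 s1 t2 s2)
  from WhileTrue.prems show ?case
  proof (rule exec_WhileE)
    assume "expr_val w s e = 0"
    with WhileTrue.hyps show ?thesis by simp
  next
    fix u1 s1' u2
    assume "u = Suc (expr_time e + u1 + u2)" "0 < expr_val w s e" "exec w s p u1 s1'" "exec w s1' (While e p) u2 s''"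
    with WhileTrue.IH(1)[of u1 s1'] WhileTrue.IH(2)[of u2 s''] show ?thesis by simp
  qed
qed


section \<open>Graphs as inputs, and time bounds\<close>

text \<open>
  The vertices are numbered \<open>0, \<dots>, n - 1\<close>; the neighbours of a vertex may be listed in any order.
\<close>

definition adjacency_lists :: "nat list list \<Rightarrow> nat pair_pre_digraph \<Rightarrow> bool" where
  "adjacency_lists adj G \<longleftrightarrow>
     pverts G = {..<length adj} \<and>
     (\<forall>u<length adj. distinct (adj ! u) \<and> set (adj ! u) = {v. (u, v) \<in> parcs G})"

text \<open>
  Adjacency lists are stored one after the other in the array \<open>nbr\<close>, the list of \<open>u\<close> occupying the
  cells \<open>off[u], \<dots>, off[u + 1] - 1\<close>. All other registers and cells are initially zero.
\<close>

definition graph_input :: "nat list list \<Rightarrow> state" where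
  "graph_input adj =
     \<lparr>regs = (\<lambda>_. 0)(''n'' := length adj),
      arrs = (\<lambda>_ _. 0)
        (''off'' := \<lambda>i. if i \<le> length adj then sum_list (map length (take i adj)) else 0,
         ''nbr'' := \<lambda>j. if j < length (concat adj) then concat adj ! j else 0)\<rparr>"

text \<open>
  The word size is \<open>c\<close> times the bit length of the number \<open>n\<close> of vertices, for a constant \<open>c\<close>
  chosen with the program. As \<open>c \<ge> 2\<close>, all numbers below \<open>n\<^sup>2\<close>, hence all input entries, are words.
  The time \<open>T n\<close> bounds the worst case over all \<open>n\<close>-vertex median graphs and all their adjacency
  list representations.
\<close>

definition computes_median_eccentricities ::
    "prog \<Rightarrow> nat \<Rightarrow> (nat \<Rightarrow> real) \<Rightarrow> bool" where
  "computes_median_eccentricities p c T \<longleftrightarrow>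
     2 \<le> c \<and>
     (\<forall>n G adj. median_graph G \<and> card (pverts G) = n \<and> adjacency_lists adj G \<longrightarrow>
        (\<exists>t s. exec (c * floorlog 2 n) (graph_input adj) p t s \<and> real t \<le> T n \<and>
           (\<forall>u\<in>pverts G. ereal (real (arrs s ''ecc'' u)) = eccentricity G u)))"

definition soft_O :: "(nat \<Rightarrow> real) \<Rightarrow> (nat \<Rightarrow> real) set" where
  "soft_O g = {f. \<exists>k::nat. f \<in> O(\<lambda>n. g n * ln (real n) ^ k)}"

end

theory Submission
  imports Defs "HOL-Library.Discrete_Functions"
begin

text \<open>
  Let a cell be a set of vertices that is an intersection of halfspaces; it is a median metric
  space. Call a halfspace of a cell balanced if it and its complement both have at least
  \<open>sqrt n\<close> elements. As long as the cell under consideration has a balanced halfspace, cut the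
  cell along it. All cells keep at least \<open>sqrt n\<close> elements, so at most \<open>sqrt n\<close> cells arise.

  If a cell has no balanced halfspace, take a vertex \<open>c\<close> that minimises the sum of the distances.
  The halfspace beyond each edge at \<open>c\<close> has at most half of the elements, hence fewer than
  \<open>sqrt n\<close>. If \<open>d u v < d u c + d c v\<close>, then \<open>v\<close> lies beyond the first edge of some geodesic from
  \<open>c\<close> to \<open>u\<close>, and there are at most \<open>log n\<close> such edges, because the neighbours of \<open>c\<close> towards \<open>u\<close>
  span a cube. So \<open>u\<close> has fewer than \<open>sqrt n * log n\<close> such exceptional \<open>v\<close>, which a restricted
  breadth-first search enumerates; for all others the distance is \<open>d u c + d c v\<close>.

  Finally the cuts are undone in reverse order. Every vertex of a halfspace has a gate in the
  opposite one, so its largest distance to that side is the distance to the gate plus the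
  eccentricity of the gate in that side: a multi-source search from the boundary propagates it.

  The halfspaces of a cell are the classes of parallel edges. A class is named after the gate \<open>r\<close> of
  the base point \<open>b\<close> in the halfspace not containing \<open>b\<close>; such gates are the vertices with
  exactly one neighbour closer to \<open>b\<close>. The sum of the names of the classes separating \<open>b\<close> from
  \<open>v\<close> satisfies a recursion over squares, and its differences along edges are the names.
\<close>

section \<open>Total correctness with time bounds\<close>

text \<open>The threshold \<open>sqrt n\<close> balances two costs. Examining a cell and undoing a
  cut each take nearly linear time, as the whole graph has only O(n log n) edges, and at most
  \<open>sqrt n\<close> cells mean O(sqrt n) such steps. In a cell without balanced cuts, the
  searches pay the degree of \<open>v\<close> for every exceptional pair of \<open>u\<close> and
  \<open>v\<close>; bounding the number of pairs would not bound this sum, but being exceptional is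
  symmetric, so each \<open>v\<close> is paid for at most \<open>sqrt n * log n\<close> times. The
  total is \<open>n powr (3 / 2)\<close> up to logarithms. Convexity of halfspaces makes cells
  usable: distances inside a cell are those of the whole graph, so one function \<open>d\<close>
  serves all cells and the adjacency lists need only be filtered by cell number. The obstacle is to
  know all classes and their sizes in nearly linear time. The set of classes separating
  \<open>b\<close> from \<open>v\<close> is too large to store for every \<open>v\<close>; a single
  sum suffices, because adjacent vertices differ in exactly one class and the difference of their
  sums is therefore its name itself, so that nothing like a collision can occur.\<close>

definition runs :: "nat \<Rightarrow> prog \<Rightarrow> nat \<Rightarrow> state \<Rightarrow> (state \<Rightarrow> bool) \<Rightarrow> bool" where
  "runs w p T s Q \<longleftrightarrow> (\<exists>t s'. exec w s p t s' \<and> t \<le> T \<and> Q s')"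

abbreviation assign_infix (infix "::=" 62) where "x ::= e \<equiv> Assign x e"
abbreviation seq_infix (infixr ";;" 60) where "p ;; q \<equiv> Seq p q"
abbreviation plus_infix (infixl "+." 68) where "a +. b \<equiv> Bin Plus a b"
abbreviation minus_infix (infixl "-." 68) where "a -. b \<equiv> Bin Minus a b"
abbreviation times_infix (infixl "*." 70) where "a *. b \<equiv> Bin Times a b"
abbreviation less_infix (infix "<." 66) where "a <. b \<equiv> Bin Less a b"
abbreviation equal_infix (infix "=." 66) where "a =. b \<equiv> Bin Equal a b"

text \<open>A syntactic frame: postconditions then describe only what a program computes, and
  everything outside these name sets is carried along by \<open>runs_frame\<close>.\<close>

fun written_regs :: "prog \<Rightarrow> name set" where
  "written_regs Skip = {}"
| "written_regs (Assign x e) = {x}"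
| "written_regs (Put a i e) = {}"
| "written_regs (Seq p q) = written_regs p \<union> written_regs q"
| "written_regs (Cond e p q) = written_regs p \<union> written_regs q"
| "written_regs (While e p) = written_regs p"

fun written_arrs :: "prog \<Rightarrow> name set" where
  "written_arrs Skip = {}"
| "written_arrs (Assign x e) = {}"
| "written_arrs (Put a i e) = {a}"
| "written_arrs (Seq p q) = written_arrs p \<union> written_arrs q"
| "written_arrs (Cond e p q) = written_arrs p \<union> written_arrs q"
| "written_arrs (While e p) = written_arrs p"

definition same_except :: "name set \<Rightarrow> name set \<Rightarrow> state \<Rightarrow> state \<Rightarrow> bool" where
  "same_except X A s s' \<longleftrightarrow>
     (\<forall>x. x \<notin> X \<longrightarrow> regs s' x = regs s x) \<and> (\<forall>a. a \<notin> A \<longrightarrow> arrs s' a = arrs s a)"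

lemma same_exceptD:
  assumes "same_except X A s s'"
  shows "x \<notin> X \<Longrightarrow> regs s' x = regs s x" "a \<notin> A \<Longrightarrow> arrs s' a = arrs s a"
  using assms by (auto simp: same_except_def)

lemma same_except_refl [simp]: "same_except X A s s"
  by (simp add: same_except_def)

lemma same_except_trans:
  "same_except X A s s' \<Longrightarrow> same_except Y B s' s'' \<Longrightarrow> X \<subseteq> Z \<Longrightarrow> Y \<subseteq> Z \<Longrightarrow> A \<subseteq> C \<Longrightarrow> B \<subseteq> C \<Longrightarrow>
   same_except Z C s s''"
  unfolding same_except_def by (metis subsetD)

lemma same_except_mono:
  "same_except X A s s' \<Longrightarrow> X \<subseteq> Z \<Longrightarrow> A \<subseteq> C \<Longrightarrow> same_except Z C s s'"
  unfolding same_except_def by blast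

lemma exec_frame: "exec w s p t s' \<Longrightarrow> same_except (written_regs p) (written_arrs p) s s'"
proof (induction rule: exec.induct)
  case (Seq s p t1 s1 q t2 s2)
  then show ?case by (auto intro: same_except_trans)
next
  case (WhileTrue s e p t1 s1 t2 s2)
  then show ?case by (auto intro: same_except_trans)
qed (auto simp: same_except_def)

lemma runs_frame:
  "runs w p T s Q \<Longrightarrow> runs w p T s (\<lambda>s'. Q s' \<and> same_except (written_regs p) (written_arrs p) s s')"
  unfolding runs_def using exec_frame by blast

lemma runs_mono:
  "runs w p T s Q \<Longrightarrow> T \<le> T' \<Longrightarrow> (\<And>s'. Q s' \<Longrightarrow> Q' s') \<Longrightarrow> runs w p T' s Q'"
  unfolding runs_def by (meson le_trans)

lemma runs_mono_frame:
  assumes "runs w p T s Q" "T \<le> T'"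
    "\<And>s'. Q s' \<Longrightarrow> same_except (written_regs p) (written_arrs p) s s' \<Longrightarrow> Q' s'"
  shows "runs w p T' s Q'"
  by (rule runs_mono[OF runs_frame[OF assms(1)] assms(2)]) (use assms(3) in blast)

lemma runs_Seq:
  assumes "runs w p T1 s P"
    and "\<And>s1. P s1 \<Longrightarrow> same_except (written_regs p) (written_arrs p) s s1 \<Longrightarrow> runs w q T2 s1 Q"
    and "T1 + T2 \<le> T"
  shows "runs w (p ;; q) T s Q"
proof -
  from assms(1) obtain t1 s1 where 1: "exec w s p t1 s1" "t1 \<le> T1" "P s1"
    unfolding runs_def by blast
  from assms(2)[OF 1(3) exec_frame[OF 1(1)]] obtain t2 s2
    where 2: "exec w s1 q t2 s2" "t2 \<le> T2" "Q s2"
    unfolding runs_def by blast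
  show ?thesis unfolding runs_def
    using exec.Seq[OF 1(1) 2(1)] 1 2 assms(3) by (meson add_mono le_trans)
qed

lemma runs_Cond:
  assumes "expr_val w s e \<noteq> 0 \<Longrightarrow> runs w p T1 s Q" "expr_val w s e = 0 \<Longrightarrow> runs w q T1 s Q"
    "1 + expr_time e + T1 \<le> T"
  shows "runs w (Cond e p q) T s Q"
proof (cases "expr_val w s e = 0")
  case True
  then obtain t1 s1 where 1: "exec w s q t1 s1" "t1 \<le> T1" "Q s1"
    using assms(2) unfolding runs_def by blast
  with True assms(3) have "1 + expr_time e + t1 \<le> T" by linarith
  then show ?thesis unfolding runs_def
    using exec.CondFalse[OF True 1(1)] 1 by blast
next
  case False
  then obtain t1 s1 where 1: "exec w s p t1 s1" "t1 \<le> T1" "Q s1"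
    using assms(1) unfolding runs_def by blast
  with False assms(3) have "1 + expr_time e + t1 \<le> T" by linarith
  then show ?thesis unfolding runs_def
    using exec.CondTrue[OF False 1(1)] 1 by blast
qed

text \<open>\<open>\<Phi>\<close> is the time still to be spent. An iteration may have any cost,
  depending on its state, provided that the drop of \<open>\<Phi>\<close> pays for it and for the
  test. Induction on \<open>\<Phi>\<close> gives termination and the bound at once; the extra
  summand in the last premise pays for the failing test. This is how amortised bounds enter.\<close>

lemma runs_While:
  assumes "I s0"
    and step: "\<And>s. I s \<Longrightarrow> same_except (written_regs p) (written_arrs p) s0 s \<Longrightarrow>
      expr_val w s e \<noteq> 0 \<Longrightarrow>
      \<exists>T. runs w p T s (\<lambda>s'. I s' \<and> \<Phi> s' + T + 1 + expr_time e \<le> \<Phi> s)"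
    and "\<Phi> s0 + 1 + expr_time e \<le> T"
  shows "runs w (While e p) T s0 (\<lambda>s'. I s' \<and> expr_val w s' e = 0)"
proof -
  have "I s \<Longrightarrow> same_except (written_regs p) (written_arrs p) s0 s \<Longrightarrow>
    runs w (While e p) (\<Phi> s + 1 + expr_time e) s (\<lambda>s'. I s' \<and> expr_val w s' e = 0)" for s
  proof (induction "\<Phi> s" arbitrary: s rule: less_induct)
    case less
    show ?case
    proof (cases "expr_val w s e = 0")
      case True
      then show ?thesis unfolding runs_def
        using less.prems exec.WhileFalse[OF True, of p]
        by (metis add.commute add.left_commute le_add2)
    next
      case False
      from step[OF less.prems this] obtain T t1 s1
        where 1: "exec w s p t1 s1" "t1 \<le> T" "I s1" "\<Phi> s1 + T + 1 + expr_time e \<le> \<Phi> s"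
        unfolding runs_def by blast
      have fr: "same_except (written_regs p) (written_arrs p) s0 s1"
        using same_except_trans[OF less.prems(2) exec_frame[OF 1(1)]] by simp
      have "\<Phi> s1 < \<Phi> s" using 1(4) by simp
      from less.hyps[OF this 1(3) fr] obtain t2 s2 where 2: "exec w s1 (While e p) t2 s2"
        "t2 \<le> \<Phi> s1 + 1 + expr_time e" "I s2 \<and> expr_val w s2 e = 0"
        unfolding runs_def by blast
      have "1 + expr_time e + t1 + t2 \<le> \<Phi> s + 1 + expr_time e"
        using 1 2 by linarith
      then show ?thesis unfolding runs_def
        using exec.WhileTrue[OF False 1(1) 2(1)] 2(3) by blast
    qed
  qed
  from this[OF assms(1) same_except_refl] assms(3) show ?thesis
    by (rule runs_mono[where Q = "\<lambda>s'. I s' \<and> expr_val w s' e = 0"]) simp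
qed

definition For :: "name \<Rightarrow> expr \<Rightarrow> expr \<Rightarrow> prog \<Rightarrow> prog" where
  "For x lo hi body =
     (x ::= lo ;; While (Reg x <. hi) (body ;; x ::= Reg x +. Const 1))"

lemma written_For [simp]:
  "written_regs (For x lo hi body) = insert x (written_regs body)"
  "written_arrs (For x lo hi body) = written_arrs body"
  by (auto simp: For_def)

lemma mod_pow_simps [simp]:
  "0 < w \<Longrightarrow> of_bool b mod (2::nat) ^ w = of_bool b"
  "0 < w \<Longrightarrow> Suc 0 mod 2 ^ w = Suc 0"
  by (auto simp: one_less_power)

abbreviation set_reg :: "state \<Rightarrow> name \<Rightarrow> nat \<Rightarrow> state" where
  "set_reg s x v \<equiv> s\<lparr>regs := (regs s)(x := v)\<rparr>"

text \<open>The bound \<open>hi\<close> is evaluated anew at every test, hence the premise that it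
  stays \<open>h\<close>. The invariant is asserted after the increment, and
  \<open>h < 2 ^ w\<close> keeps the counter from wrapping. Per iteration, 3 units and the cost of
  \<open>hi\<close> go to the test and 4 to the increment, which makes 7.\<close>

lemma runs_For:
  assumes w: "0 < w" and lo: "expr_val w s0 lo = l" and "l \<le> h" "h < 2 ^ w"
    and init: "I l (set_reg s0 x l)"
    and hi: "\<And>i s. I i s \<Longrightarrow> regs s x = i \<Longrightarrow>
       same_except (insert x (written_regs body)) (written_arrs body) s0 s \<Longrightarrow> expr_val w s hi = h"
    and step: "\<And>i s. l \<le> i \<Longrightarrow> i < h \<Longrightarrow> regs s x = i \<Longrightarrow> I i s \<Longrightarrow>
       same_except (insert x (written_regs body)) (written_arrs body) s0 s \<Longrightarrow>
       runs w body (B i) s (\<lambda>s'. regs s' x = i \<and> I (Suc i) (set_reg s' x (Suc i)))"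
    and T: "4 + expr_time lo + expr_time hi + (\<Sum>i=l..<h. B i + 7 + expr_time hi) \<le> T"
  shows "runs w (For x lo hi body) T s0 (\<lambda>s. I h s \<and> regs s x = h)"
proof -
  let ?F = "same_except (insert x (written_regs body)) (written_arrs body)"
  let ?J = "\<lambda>s. l \<le> regs s x \<and> regs s x \<le> h \<and> I (regs s x) s \<and> ?F s0 s"
  let ?\<Phi> = "\<lambda>s. \<Sum>i=regs s x..<h. B i + 7 + expr_time hi"
  have a: "runs w (x ::= lo) (1 + expr_time lo) s0 (\<lambda>s. s = set_reg s0 x l)"
    unfolding runs_def using exec.Assign[of w s0 x lo] lo by blast
  have b: "runs w (While (Reg x <. hi) (body ;; x ::= Reg x +. Const 1))
     (?\<Phi> (set_reg s0 x l) + 1 + expr_time (Reg x <. hi)) (set_reg s0 x l)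
     (\<lambda>s. ?J s \<and> expr_val w s (Reg x <. hi) = 0)"
  proof (rule runs_While[where \<Phi> = ?\<Phi>])
    show "?J (set_reg s0 x l)"
      using init \<open>l \<le> h\<close> by (auto simp: same_except_def)
  next
    fix s assume J: "?J s" and nz: "expr_val w s (Reg x <. hi) \<noteq> 0"
    let ?i = "regs s x"
    have h: "expr_val w s hi = h" using hi J by blast
    then have lt: "?i < h" using nz w by (auto split: if_splits)
    have 1: "runs w body (B ?i) s (\<lambda>s'. regs s' x = ?i \<and> I (Suc ?i) (set_reg s' x (Suc ?i)))"
      using step[of ?i s] J lt by blast
    have "runs w (body ;; x ::= Reg x +. Const 1) (B ?i + 4) s
       (\<lambda>s'. ?J s' \<and> regs s' x = Suc ?i)"
    proof (rule runs_Seq[OF 1])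
      fix s1 assume s1: "regs s1 x = ?i \<and> I (Suc ?i) (set_reg s1 x (Suc ?i))"
        and fr: "same_except (written_regs body) (written_arrs body) s s1"
      have "Suc ?i mod 2 ^ w = Suc ?i" using lt \<open>h < 2 ^ w\<close> by simp
      then have e: "expr_val w s1 (Reg x +. Const 1) = Suc ?i"
        using s1 w by (simp add: mod_Suc_eq)
      have "?J (set_reg s1 x (Suc ?i))"
        using s1 lt J fr by (auto simp: same_except_def)
      then show "runs w (x ::= Reg x +. Const 1) 4 s1 (\<lambda>s'. ?J s' \<and> regs s' x = Suc ?i)"
        unfolding runs_def using exec.Assign[of w s1 x "Reg x +. Const 1", unfolded e]
        by (intro exI[of _ 4] exI[of _ "set_reg s1 x (Suc ?i)"]) (simp add: numeral_eq_Suc)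
    qed simp
    then have "runs w (body ;; x ::= Reg x +. Const 1) (B ?i + 4) s
      (\<lambda>s'. ?J s' \<and> ?\<Phi> s' + (B ?i + 4) + 1 + expr_time (Reg x <. hi) \<le> ?\<Phi> s)"
      by (rule runs_mono) (use lt in \<open>auto simp: sum.atLeast_Suc_lessThan\<close>)
    then show "\<exists>T. runs w (body ;; x ::= Reg x +. Const 1) T s
      (\<lambda>s'. ?J s' \<and> ?\<Phi> s' + T + 1 + expr_time (Reg x <. hi) \<le> ?\<Phi> s)" by (intro exI[of _ "B ?i + 4"])
  qed simp
  show ?thesis unfolding For_def
  proof (rule runs_Seq[OF a])
    fix s1 assume "s1 = set_reg s0 x l"
    with b show "runs w (While (Reg x <. hi) (body ;; x ::= Reg x +. Const 1))
      (3 + expr_time hi + (\<Sum>i=l..<h. B i + 7 + expr_time hi)) s1 (\<lambda>s. I h s \<and> regs s x = h)"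
    proof (simp only: , elim runs_mono)
      fix s' assume J: "?J s' \<and> expr_val w s' (Reg x <. hi) = 0"
      then have "expr_val w s' hi = h" using hi by blast
      with J w have "regs s' x = h" by (auto split: if_splits)
      with J show "I h s' \<and> regs s' x = h" by auto
    qed simp
  qed (use T in simp)
qed

section \<open>Symbolic execution of straight-line code\<close>

fun loop_free :: "prog \<Rightarrow> bool" where
  "loop_free (Seq p q) = (loop_free p \<and> loop_free q)"
| "loop_free (Cond e p q) = (loop_free p \<and> loop_free q)"
| "loop_free (While e p) = False"
| "loop_free _ = True"

text \<open>Straight-line code is executed by rewriting, without intermediate assertions. The value
  on \<open>While\<close> is a dummy, excluded by \<open>loop_free\<close>.\<close>

fun eval_prog :: "nat \<Rightarrow> prog \<Rightarrow> state \<Rightarrow> state" where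
  "eval_prog w (Assign x e) s = s\<lparr>regs := (regs s)(x := expr_val w s e)\<rparr>"
| "eval_prog w (Put a i e) s =
     s\<lparr>arrs := (arrs s)(a := (arrs s a)(expr_val w s i := expr_val w s e))\<rparr>"
| "eval_prog w (Seq p q) s = eval_prog w q (eval_prog w p s)"
| "eval_prog w (Cond e p q) s =
     (if expr_val w s e = 0 then eval_prog w q s else eval_prog w p s)"
| "eval_prog w _ s = s"

fun prog_time :: "prog \<Rightarrow> nat" where
  "prog_time Skip = 1"
| "prog_time (Assign x e) = 1 + expr_time e"
| "prog_time (Put a i e) = 1 + expr_time i + expr_time e"
| "prog_time (Seq p q) = prog_time p + prog_time q"
| "prog_time (Cond e p q) = 1 + expr_time e + max (prog_time p) (prog_time q)"
| "prog_time (While e p) = 0"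

lemma exec_loop_free:
  "loop_free p \<Longrightarrow> \<exists>t \<le> prog_time p. exec w s p t (eval_prog w p s)"
proof (induction p arbitrary: s)
  case Skip
  show ?case using exec.Skip[of w s] by auto
next
  case (Assign x e)
  show ?case using exec.Assign[of w s x e] by auto
next
  case (Put a i e)
  show ?case using exec.Put[of w s a i e] by auto
next
  case (Seq p q)
  from Seq.IH(1)[of s] Seq.IH(2)[of "eval_prog w p s"] Seq.prems
  obtain t1 t2 where "t1 \<le> prog_time p" "exec w s p t1 (eval_prog w p s)"
    "t2 \<le> prog_time q" "exec w (eval_prog w p s) q t2 (eval_prog w q (eval_prog w p s))" by auto
  then show ?case by (auto intro!: exI[of _ "t1 + t2"] exec.Seq)
next
  case (Cond e p q)
  from Cond.IH(1)[of s] Cond.IH(2)[of s] Cond.prems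
  obtain t1 t2 where t: "t1 \<le> prog_time p" "exec w s p t1 (eval_prog w p s)"
    "t2 \<le> prog_time q" "exec w s q t2 (eval_prog w q s)" by auto
  show ?case
  proof (cases "expr_val w s e = 0")
    case True
    have "exec w s (Cond e p q) (1 + expr_time e + t2) (eval_prog w (Cond e p q) s)"
      using exec.CondFalse[OF True t(4), of p] True by simp
    with t(3) show ?thesis by (intro exI[of _ "1 + expr_time e + t2"]) (simp del: eval_prog.simps)
  next
    case False
    have "exec w s (Cond e p q) (1 + expr_time e + t1) (eval_prog w (Cond e p q) s)"
      using exec.CondTrue[OF False t(2), of q] False by simp
    with t(1) show ?thesis by (intro exI[of _ "1 + expr_time e + t1"]) (simp del: eval_prog.simps)
  qed
qed simp

lemma runs_loop_free:
  assumes "loop_free p" "Q (eval_prog w p s)" "prog_time p \<le> T"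
  shows "runs w p T s Q"
  using exec_loop_free[OF assms(1), of w s] assms(2,3) unfolding runs_def by (meson le_trans)

section \<open>Median metrics\<close>

text \<open>The carrier \<open>V\<close> varies while \<open>d\<close> stays fixed: all cells are
  instances for the same \<open>d\<close>. By \<open>d_step\<close>, \<open>d\<close> is the path
  metric of its unit-distance graph. Triples with repetitions are included, so that medians can be
  taken without case distinctions.\<close>

locale median_space =
  fixes V :: "'a set" and d :: "'a \<Rightarrow> 'a \<Rightarrow> nat"
  assumes finite_V: "finite V" and V_nonempty: "V \<noteq> {}"
    and d_self [simp]: "d u u = 0"
    and d_sym: "d u v = d v u"
    and d_eq_0: "u \<in> V \<Longrightarrow> v \<in> V \<Longrightarrow> d u v = 0 \<Longrightarrow> u = v"
    and d_tri: "u \<in> V \<Longrightarrow> v \<in> V \<Longrightarrow> z \<in> V \<Longrightarrow> d u z \<le> d u v + d v z"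
    and d_step: "u \<in> V \<Longrightarrow> v \<in> V \<Longrightarrow> u \<noteq> v \<Longrightarrow> \<exists>z\<in>V. d u z = 1 \<and> d u v = Suc (d z v)"
    and median_ex: "x \<in> V \<Longrightarrow> y \<in> V \<Longrightarrow> z \<in> V \<Longrightarrow>
      \<exists>m\<in>V. d x m + d m y = d x y \<and> d y m + d m z = d y z \<and> d x m + d m z = d x z"
    and median_unique: "x \<in> V \<Longrightarrow> y \<in> V \<Longrightarrow> z \<in> V \<Longrightarrow> m \<in> V \<Longrightarrow> m' \<in> V \<Longrightarrow>
      d x m + d m y = d x y \<Longrightarrow> d y m + d m z = d y z \<Longrightarrow> d x m + d m z = d x z \<Longrightarrow>
      d x m' + d m' y = d x y \<Longrightarrow> d y m' + d m' z = d y z \<Longrightarrow> d x m' + d m' z = d x z \<Longrightarrow> m = m'"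
begin

section \<open>Bipartiteness, squares and parallel edges\<close>

definition half :: "'a \<Rightarrow> 'a \<Rightarrow> 'a set" where
  "half x y = {z \<in> V. d z x < d z y}"

lemma half_sub: "half x y \<subseteq> V"
  by (auto simp: half_def)

lemma halfD: "z \<in> half x y \<Longrightarrow> z \<in> V"
  by (auto simp: half_def)

lemma finite_half [simp]: "finite (half x y)"
  using half_sub finite_V by (rule finite_subset)

text \<open>A median of \<open>x\<close>, \<open>y\<close>, \<open>z\<close> lies on the edge
  \<open>x y\<close>, so it is one of its ends, and the other end is then one step farther from
  \<open>z\<close>: median graphs are bipartite.\<close>

lemma adj_dist_neq:
  assumes "x \<in> V" "y \<in> V" "z \<in> V" "d x y = 1"
  shows "d z x \<noteq> d z y"
proof -
  obtain m where m: "m \<in> V" "d x m + d m y = d x y" "d y m + d m z = d y z" "d x m + d m z = d x z"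
    using median_ex assms by blast
  then have "d x m = 0 \<or> d m y = 0" using assms by linarith
  then have "x = m \<or> m = y" using d_eq_0 m(1) assms by blast
  then show ?thesis using m assms(4) d_sym by (metis add_cancel_left_left d_self n_not_Suc_n plus_1_eq_Suc)
qed

lemma adj_dist_cases:
  assumes "x \<in> V" "y \<in> V" "z \<in> V" "d x y = 1"
  shows "d z x = Suc (d z y) \<or> d z y = Suc (d z x)"
  using adj_dist_neq[OF assms] d_tri[of z x y] d_tri[of z y x] assms d_sym[of x y] by simp linarith

lemma half_compl:
  assumes "x \<in> V" "y \<in> V" "d x y = 1" "z \<in> V"
  shows "z \<in> half y x \<longleftrightarrow> z \<notin> half x y"
  using adj_dist_cases[of x y z] assms by (auto simp: half_def)

lemma half_self: "x \<in> V \<Longrightarrow> d x y = 1 \<Longrightarrow> x \<in> half x y"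
  by (simp add: half_def)

lemma dist_two:
  assumes "u \<in> V" "v \<in> V" "z \<in> V" "d z u = 1" "d z v = 1" "u \<noteq> v"
  shows "d u v = 2"
proof -
  have "d u v \<noteq> 0" using d_eq_0 assms by blast
  moreover have "d u v \<noteq> 1" using adj_dist_neq[of u v z] assms by auto
  moreover have "d u v \<le> 2" using d_tri[of u z v] assms d_sym[of u z] by simp
  ultimately show ?thesis by linarith
qed

text \<open>Distinct \<open>u1\<close>, \<open>u2\<close>, \<open>u3\<close> would be pairwise at
  distance 2, so that \<open>a\<close> and \<open>b\<close> would both be their median.\<close>

lemma no_K23:
  assumes V: "a \<in> V" "b \<in> V" "u1 \<in> V" "u2 \<in> V" "u3 \<in> V" and ab: "a \<noteq> b"
    and a: "d a u1 = 1" "d a u2 = 1" "d a u3 = 1"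
    and b: "d b u1 = 1" "d b u2 = 1" "d b u3 = 1"
    and ne: "u1 \<noteq> u2" "u2 \<noteq> u3"
  shows "u1 = u3"
proof (rule ccontr)
  assume ne': "u1 \<noteq> u3"
  have "d u1 u2 = 2" "d u2 u3 = 2" "d u1 u3 = 2"
    using dist_two[of _ _ a] V a ne ne' by auto
  then have "a = b"
    using median_unique[of u1 u2 u3 a b] V a b by (simp add: d_sym)
  with ab show False ..
qed

text \<open>The vertex \<open>q\<close> is the median of \<open>u1\<close>, \<open>u2\<close> and
  \<open>x\<close>: as \<open>u1\<close> and \<open>u2\<close> are at distance 2 and equally far
  from \<open>x\<close>, it is midway between them and one step closer to \<open>x\<close>.\<close>

lemma quadrangle:
  assumes "x \<in> V" "w \<in> V" "u1 \<in> V" "u2 \<in> V" "d w u1 = 1" "d w u2 = 1" "u1 \<noteq> u2"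
    and "d x w = Suc (d x u1)" "d x w = Suc (d x u2)"
  obtains q where "q \<in> V" "d q u1 = 1" "d q u2 = 1" "d x u1 = Suc (d x q)" "d x u2 = Suc (d x q)"
proof -
  obtain m where m: "m \<in> V" "d u1 m + d m u2 = d u1 u2" "d u2 m + d m x = d u2 x" "d u1 m + d m x = d u1 x"
    using median_ex[of u1 u2 x] assms by blast
  have "d u1 u2 = 2" using dist_two[of u1 u2 w] assms by blast
  moreover have "d u1 x = d u2 x" using assms d_sym by (metis old.nat.inject)
  ultimately have "d u1 m = 1" "d u2 m = 1" using m d_sym[of m u2] by linarith+
  moreover have "d x m = d m x" "d x u1 = d u1 x" "d x u2 = d u2 x" "d m u1 = d u1 m" "d m u2 = d u2 m"
    by (rule d_sym)+
  ultimately have "d m u1 = 1" "d m u2 = 1" "d x u1 = Suc (d x m)" "d x u2 = Suc (d x m)"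
    using m(3,4) by linarith+
  with m(1) show ?thesis by (rule that)
qed

text \<open>If the opposite edge \<open>e c\<close> pointed the other way, \<open>a\<close> and
  \<open>c\<close> would be equally far from \<open>z\<close>, and \<open>b\<close> and
  \<open>e\<close> one step farther. The quadrangle below \<open>a\<close> and \<open>c\<close> then
  supplies a third common neighbour \<open>q\<close>, contrary to \<open>no_K23\<close>.\<close>

lemma square_closer:
  assumes V: "a \<in> V" "b \<in> V" "c \<in> V" "e \<in> V" "z \<in> V"
    and adj: "d a b = 1" "d b c = 1" "d c e = 1" "d e a = 1" and ne: "a \<noteq> c" "b \<noteq> e"
    and lt: "d z a < d z b"
  shows "d z e < d z c"
proof (rule ccontr)
  assume "\<not> d z e < d z c"
  then have ec: "d z e = Suc (d z c)" using adj_dist_cases[of c e z] V adj by linarith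
  have ab: "d z b = Suc (d z a)" using adj_dist_cases[of a b z] V adj lt by linarith
  have "d z c = d z a"
    using adj_dist_cases[of b c z] adj_dist_cases[of e a z] V adj ec ab by linarith
  then obtain q where q: "q \<in> V" "d q a = 1" "d q c = 1" "d z a = Suc (d z q)"
    using quadrangle[of z b a c] V adj ne ab d_sym by metis
  have "b = e"
  proof (rule ccontr)
    assume "b \<noteq> e"
    moreover have "b \<noteq> q" "e \<noteq> q" using q(4) ab ec \<open>d z c = d z a\<close> by fastforce+
    ultimately show False
      using no_K23[of a c b e q] V q adj ne d_sym by metis
  qed
  with ne show False by simp
qed

lemma crossing_edge_dist:
  assumes "x \<in> V" "y \<in> V" "d x y = 1" "u \<in> half x y" "w \<in> half y x" "d u w = 1"
  shows "d w y = d u x" "d w x = Suc (d u x)" "d u y = Suc (d u x)"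
proof -
  have V: "u \<in> V" "w \<in> V" using assms halfD by blast+
  have 1: "d u y = Suc (d u x)" "d w x = Suc (d w y)"
    using adj_dist_cases[of x y u] adj_dist_cases[of x y w] V assms by (auto simp: half_def)
  have "d w x \<le> Suc (d u x)" "d u y \<le> Suc (d w y)"
    using d_tri[of w u x] d_tri[of u w y] V assms d_sym[of u w] by auto
  with 1 show "d w y = d u x" "d w x = Suc (d u x)" "d u y = Suc (d u x)" by auto
qed

text \<open>Parallel edges are linked by a ladder of squares, along which \<open>square_closer\<close> propagates.\<close>

lemma half_crossing_eq:
  assumes "x \<in> V" "y \<in> V" "d x y = 1" "u \<in> half x y" "w \<in> half y x" "d u w = 1"
  shows "half u w = half x y"
  using assms(4-6)
proof (induction "d u x" arbitrary: u w rule: less_induct)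
  case less
  have V: "u \<in> V" "w \<in> V" using less.prems halfD by blast+
  note cd = crossing_edge_dist[OF assms(1-3) less.prems]
  show ?case
  proof (cases "u = x")
    case True
    then have "w = y" using cd(1) d_eq_0 V assms by simp
    with True show ?thesis by simp
  next
    case False
    then have pos: "d u x > 0" using d_eq_0 V assms by blast
    then have "w \<noteq> y" using cd(1) by auto
    then obtain w2 where w2: "w2 \<in> V" "d w w2 = 1" "d w y = Suc (d w2 y)"
      using d_step[of w y] V assms by blast
    have w2x: "d w2 x = d u x"
      using d_tri[of w2 y x] d_tri[of w w2 x] w2 cd assms V d_sym[of x y] by auto
    have ne: "u \<noteq> w2" using w2 cd by auto
    obtain q where q: "q \<in> V" "d q u = 1" "d q w2 = 1" "d x u = Suc (d x q)"
      using quadrangle[of x w u w2] V w2 assms ne cd less.prems w2x d_sym by metis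
    have qx: "Suc (d q x) = d u x" using q d_sym by metis
    have "d q y \<ge> d u x" using d_tri[of u q y] cd q V assms d_sym[of u q] by simp
    then have qh: "q \<in> half x y" using qx q by (simp add: half_def)
    have w2h: "w2 \<in> half y x" using w2 w2x cd by (simp add: half_def)
    have IH: "half q w2 = half x y" using less.hyps[OF _ qh w2h q(3)] qx by simp
    have wq: "w \<noteq> q" using cd qx by auto
    have "z \<in> half u w \<longleftrightarrow> z \<in> half q w2" if z: "z \<in> V" for z
      using square_closer[of u w w2 q z] square_closer[of q w2 w u z] z V w2 q ne wq less.prems
      d_sym by (auto simp: half_def)
    then have "half u w = half q w2" using halfD by blast
    with IH show ?thesis by simp
  qed
qed

section \<open>Convexity, heredity and gates of halfspaces\<close>

lemma half_step:
  assumes "x \<in> V" "y \<in> V" "d x y = 1" "u \<in> half x y" "v \<in> half x y" "z \<in> V"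
    "d u z = 1" "d u v = Suc (d z v)"
  shows "z \<in> half x y"
proof (rule ccontr)
  assume "z \<notin> half x y"
  then have z: "z \<in> half y x" using half_compl assms by blast
  \<comment> \<open>An edge leaving the halfspace would itself define it: \<open>half u z\<close>
    equals \<open>half x y\<close> and contains \<open>v\<close>, although \<open>z\<close> is the
    end closer to \<open>v\<close>.\<close>
  have "v \<in> half u z" using half_crossing_eq[OF assms(1-4) z assms(7)] assms by simp
  then show False using assms(8) d_sym[of v] by (simp add: half_def)
qed

text \<open>The step from \<open>u\<close> towards \<open>m\<close> is also a step towards
  \<open>v\<close>, so \<open>half_step\<close> keeps it inside; the induction follows the geodesic
  up to \<open>m\<close>.\<close>

lemma half_convex:
  assumes xy: "x \<in> V" "y \<in> V" "d x y = 1" and "u \<in> half x y" and v: "v \<in> half x y"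
    and m: "m \<in> V" and "d u m + d m v = d u v"
  shows "m \<in> half x y"
  using assms(4,7)
proof (induction "d u m" arbitrary: u)
  case 0
  then show ?case using d_eq_0 halfD m by metis
next
  case (Suc k)
  then have "u \<noteq> m" by auto
  then obtain z where z: "z \<in> V" "d u z = 1" "d u m = Suc (d z m)"
    using d_step Suc.prems halfD m by metis
  have "d z v \<le> d z m + d m v" "d u v \<le> Suc (d z v)"
    using d_tri[of z m v] d_tri[of u z v] z m v Suc.prems halfD by auto
  then have e: "d u v = Suc (d z v)" "d z m + d m v = d z v" using Suc.prems z by linarith+
  have "z \<in> half x y" using half_step[OF xy Suc.prems(1) v z(1,2) e(1)] .
  with Suc.hyps(1)[of z] z Suc.hyps(2) e(2) show ?case by simp
qed

text \<open>Convexity supplies the existential axioms: the vertex of \<open>d_step\<close> and the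
  median both lie on geodesics between members. This heredity is what allows cutting to be
  repeated.\<close>

lemma median_space_half:
  assumes xy: "x \<in> V" "y \<in> V" "d x y = 1"
  shows "median_space (half x y) d"
proof (unfold_locales)
  show "half x y \<noteq> {}" using half_self xy by blast
  show "d u v = d v u" for u v by (rule d_sym)
  show "u = v" if "u \<in> half x y" "v \<in> half x y" "d u v = 0" for u v
    using that d_eq_0 halfD by blast
  show "d u z \<le> d u v + d v z" if "u \<in> half x y" "v \<in> half x y" "z \<in> half x y" for u v z
    using that d_tri halfD by blast
  show "\<exists>z\<in>half x y. d u z = 1 \<and> d u v = Suc (d z v)"
    if uv: "u \<in> half x y" "v \<in> half x y" "u \<noteq> v" for u v
  proof -
    obtain z where "z \<in> V" "d u z = 1" "d u v = Suc (d z v)"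
      using uv d_step[of u v] halfD by meson
    moreover from this have "z \<in> half x y" using half_step[OF xy] uv by blast
    ultimately show ?thesis by blast
  qed
  show "\<exists>m\<in>half x y. d a m + d m b = d a b \<and> d b m + d m c = d b c \<and> d a m + d m c = d a c"
    if abc: "a \<in> half x y" "b \<in> half x y" "c \<in> half x y" for a b c
  proof -
    obtain m where "m \<in> V" "d a m + d m b = d a b" "d b m + d m c = d b c" "d a m + d m c = d a c"
      using abc median_ex[of a b c] halfD by meson
    moreover from this have "m \<in> half x y" using half_convex[OF xy] abc by blast
    ultimately show ?thesis by blast
  qed
  show "m = m'" if "a \<in> half x y" "b \<in> half x y" "c \<in> half x y" "m \<in> half x y" "m' \<in> half x y"
      "d a m + d m b = d a b" "d b m + d m c = d b c" "d a m + d m c = d a c"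
      "d a m' + d m' b = d a b" "d b m' + d m' c = d b c" "d a m' + d m' c = d a c"
    for a b c m m'
    using that median_unique[of a b c m m'] halfD by blast
qed simp_all

text \<open>\<open>g\<close> is a nearest point of the halfspace. The median of \<open>u\<close>,
  \<open>g\<close> and any \<open>v\<close> of the halfspace belongs to it by convexity; it lies
  between \<open>u\<close> and \<open>g\<close> but cannot be closer to \<open>u\<close>, so it is
  \<open>g\<close> itself, and \<open>g\<close> lies between \<open>u\<close> and
  \<open>v\<close>.\<close>

lemma half_gate:
  assumes xy: "x \<in> V" "y \<in> V" "d x y = 1" and u: "u \<in> V"
  obtains g where "g \<in> half x y" "\<And>v. v \<in> half x y \<Longrightarrow> d u v = d u g + d g v"
proof -
  have ne: "half x y \<noteq> {}" using half_self xy by blast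
  define g where "g = arg_min_on (d u) (half x y)"
  have g: "g \<in> half x y" and least: "\<And>v. v \<in> half x y \<Longrightarrow> d u g \<le> d u v"
    unfolding g_def using arg_min_if_finite[OF finite_half ne, of "d u"]
    by (auto simp: not_less[symmetric])
  have "d u v = d u g + d g v" if v: "v \<in> half x y" for v
  proof -
    obtain m where m: "m \<in> V" "d u m + d m g = d u g" "d g m + d m v = d g v" "d u m + d m v = d u v"
      using median_ex[of u g v] u g v halfD by metis
    have "m \<in> half x y" using half_convex[OF xy g v m(1,3)] .
    with least[of m] m(2) have "d m g = 0" by simp
    then have "m = g" using d_eq_0 m(1) g halfD by blast
    with m(4) show ?thesis by simp
  qed
  with g that show ?thesis by blast
qed

definition gate :: "'a set \<Rightarrow> 'a \<Rightarrow> 'a" where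
  "gate B u = (SOME g. g \<in> B \<and> (\<forall>v\<in>B. d u v = d u g + d g v))"

lemma gate_half:
  assumes "x \<in> V" "y \<in> V" "d x y = 1" "u \<in> V"
  shows "gate (half x y) u \<in> half x y"
    and "v \<in> half x y \<Longrightarrow> d u v = d u (gate (half x y) u) + d (gate (half x y) u) v"
proof -
  obtain g where "g \<in> half x y" "\<And>v. v \<in> half x y \<Longrightarrow> d u v = d u g + d g v"
    using half_gate[OF assms] by metis
  then have ex: "\<exists>g. g \<in> half x y \<and> (\<forall>v\<in>half x y. d u v = d u g + d g v)" by blast
  have "gate (half x y) u \<in> half x y \<and>
    (\<forall>v\<in>half x y. d u v = d u (gate (half x y) u) + d (gate (half x y) u) v)"
    unfolding gate_def by (rule someI_ex[OF ex])
  then show "gate (half x y) u \<in> half x y"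
    "v \<in> half x y \<Longrightarrow> d u v = d u (gate (half x y) u) + d (gate (half x y) u) v"
    by blast+
qed

end

section \<open>Naming the classes of parallel edges\<close>

context median_space begin

definition preds :: "'a \<Rightarrow> 'a \<Rightarrow> 'a set" where
  "preds b v = {p \<in> V. d p v = 1 \<and> d b v = Suc (d b p)}"

text \<open>In the order with least element \<open>b\<close> in which \<open>u\<close> is below
  \<open>v\<close> if \<open>u\<close> lies between \<open>b\<close> and \<open>v\<close>, the lower
  covers of a vertex are its \<open>preds\<close>; a single lower cover means join
  irreducibility.\<close>

definition join_irreducible :: "'a \<Rightarrow> 'a \<Rightarrow> bool" where
  "join_irreducible b r \<longleftrightarrow> r \<in> V \<and> card (preds b r) = 1"

text \<open>The join irreducible vertices separating \<open>b\<close> from \<open>z\<close>, one for each halfspace that contains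
  \<open>z\<close> but not \<open>b\<close>.\<close>

definition sig :: "'a \<Rightarrow> 'a \<Rightarrow> 'a set" where
  "sig b z = {r. join_irreducible b r \<and> d b r + d r z = d b z}"

definition lab :: "'a \<Rightarrow> 'a \<Rightarrow> 'a \<Rightarrow> 'a" where
  "lab b p v = gate (half v p) b"

lemma finite_preds [simp]: "finite (preds b v)"
  using finite_V by (simp add: preds_def)

lemma predsD:
  assumes "p \<in> preds b v"
  shows "p \<in> V" "d p v = 1" "d v p = 1" "d b v = Suc (d b p)"
  using assms d_sym[of v p] by (auto simp: preds_def)

lemma preds_nonempty:
  assumes "b \<in> V" "v \<in> V" "v \<noteq> b"
  shows "preds b v \<noteq> {}"
proof -
  obtain z where "z \<in> V" "d v z = 1" "d v b = Suc (d z b)" using d_step assms by blast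
  then have "z \<in> preds b v" using d_sym[of v z] d_sym[of v b] d_sym[of z b] by (simp add: preds_def)
  then show ?thesis by blast
qed

lemma preds_self [simp]: "preds b b = {}"
  by (auto simp: preds_def)

lemma base_notin_half: "b \<in> V \<Longrightarrow> p \<in> preds b v \<Longrightarrow> b \<in> half p v \<and> b \<notin> half v p"
  by (auto simp: half_def preds_def)

text \<open>The gate \<open>r\<close> is the point of the halfspace nearest to \<open>b\<close>, so
  its predecessors lie outside and the edges to them are parallel to \<open>p v\<close>. Of the
  neighbours of \<open>r\<close>, only \<open>q\<close> lies beyond the edge \<open>r q\<close>, so
  there is just one predecessor.\<close>

lemma
  assumes b: "b \<in> V" and v: "v \<in> V" and p: "p \<in> preds b v"
  shows lab_in_half: "lab b p v \<in> half v p"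
    and lab_cone: "half v p = {z \<in> V. d b (lab b p v) + d (lab b p v) z = d b z}"
    and lab_join_irreducible: "join_irreducible b (lab b p v)"
    and lab_half_pred: "q \<in> preds b (lab b p v) \<Longrightarrow> half (lab b p v) q = half v p"
proof -
  define r where "r = lab b p v"
  note pD = predsD[OF p]
  have r: "r \<in> half v p" and gate: "\<And>z. z \<in> half v p \<Longrightarrow> d b z = d b r + d r z"
    unfolding r_def lab_def by (fact gate_half[OF v pD(1) pD(3) b])+
  have rV: "r \<in> V" using r halfD by blast
  have rb: "r \<noteq> b" using r base_notin_half[OF b p] by blast
  have out: "q \<in> half p v" if "q \<in> preds b r" for q
  proof (rule ccontr)
    assume "q \<notin> half p v"
    then have "q \<in> half v p" using half_compl v pD predsD(1)[OF that] by blast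
    from gate[OF this] predsD(4)[OF that] show False by simp
  qed
  have cross: "half r q = half v p" if "q \<in> preds b r" for q
    using half_crossing_eq[OF v pD(1) pD(3) r out[OF that]] predsD[OF that] by blast
  have uniq: "q' = q" if "q \<in> preds b r" "q' \<in> preds b r" for q q'
  proof -
    have "q' \<notin> half r q"
      using cross[OF that(1)] out[OF that(2)] half_compl[OF pD(1) v pD(2)] half_sub by blast
    then have "q' \<in> half q r"
      using half_compl[of q r q'] predsD[OF that(1)] predsD[OF that(2)] rV by blast
    then have "d q' q = 0" using predsD(2)[OF that(2)] by (simp add: half_def)
    then show ?thesis using d_eq_0 predsD(1) that by blast
  qed
  obtain q where q: "q \<in> preds b r" using preds_nonempty[OF b rV rb] by blast
  then have "preds b r = {q}" using uniq by blast
  then show "join_irreducible b (lab b p v)"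
    using rV by (simp add: join_irreducible_def flip: r_def)
  show "lab b p v \<in> half v p" using r by (simp add: r_def)
  show "q \<in> preds b (lab b p v) \<Longrightarrow> half (lab b p v) q = half v p" for q
    using cross by (simp add: r_def)
  \<comment> \<open>If \<open>r\<close> lies between \<open>b\<close> and \<open>z\<close>, then
    \<open>z\<close> must be closer to \<open>r\<close> than to \<open>q\<close>; otherwise the
    route from \<open>b\<close> to \<open>z\<close> through \<open>q\<close> would be too
    short.\<close>
  have cone: "z \<in> half v p" if z: "z \<in> V" "d b r + d r z = d b z" for z
  proof -
    have "d b z \<le> d b q + d q z" using d_tri b z predsD[OF q] by blast
    then have "d r z < d q z" using z predsD(4)[OF q] by simp
    then have "z \<in> half r q" using z(1) d_sym by (simp add: half_def)
    then show ?thesis using cross[OF q] by simp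
  qed
  have "half v p = {z \<in> V. d b r + d r z = d b z}"
  proof (intro set_eqI iffI)
    show "z \<in> {z \<in> V. d b r + d r z = d b z}" if "z \<in> half v p" for z
      using gate[OF that] halfD[OF that] by simp
  qed (use cone in blast)
  then show "half v p = {z \<in> V. d b (lab b p v) + d (lab b p v) z = d b z}" by (simp add: r_def)
qed

text \<open>Were the gate \<open>g\<close> different from \<open>r\<close>, a step from
  \<open>r\<close> towards \<open>g\<close> would lead to a predecessor of \<open>r\<close> inside
  the halfspace; but the only predecessor \<open>q\<close> lies outside.\<close>

lemma lab_join_irreducible_self:
  assumes b: "b \<in> V" and r: "join_irreducible b r" and q: "q \<in> preds b r"
  shows "lab b q r = r"
proof (rule ccontr)
  assume ne: "lab b q r \<noteq> r"
  define g where "g = lab b q r"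
  have rV: "r \<in> V" and single: "\<And>z. z \<in> preds b r \<Longrightarrow> z = q"
    using r q by (auto simp: join_irreducible_def card_1_singleton_iff)
  note qD = predsD[OF q]
  have g: "g \<in> half r q" unfolding g_def using lab_in_half[OF b rV q] .
  have rh: "r \<in> half r q" using half_self rV qD by blast
  have br: "d b r = d b g + d g r"
    using lab_cone[OF b rV q] rh by (auto simp: g_def)
  obtain z where z: "z \<in> V" "d r z = 1" "d r g = Suc (d z g)"
    using d_step[of r g] ne rV g halfD by (metis g_def)
  have "d b z \<le> d b g + d g z" "d b r \<le> d b z + d z r"
    using d_tri[OF b halfD[OF g] z(1)] d_tri[OF b z(1) rV] by simp_all
  then have "d b r = Suc (d b z)" using br z d_sym[of r z] d_sym[of r g] d_sym[of z g] by linarith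
  then have "z \<in> preds b r" using z d_sym[of r z] by (simp add: preds_def)
  then have "z = q" by (rule single)
  moreover have "z \<in> half r q" using half_step[OF rV qD(1) qD(3) rh g z] .
  ultimately show False by (simp add: half_def)
qed

lemma mem_sig_lab_iff:
  assumes "b \<in> V" "v \<in> V" "p \<in> preds b v" "z \<in> V"
  shows "lab b p v \<in> sig b z \<longleftrightarrow> z \<in> half v p"
proof -
  have "z \<in> half v p \<longleftrightarrow> d b (lab b p v) + d (lab b p v) z = d b z"
    using lab_cone[OF assms(1-3)] assms(4) by blast
  then show ?thesis using lab_join_irreducible[OF assms(1-3)] by (simp add: sig_def)
qed

lemma sig_base: "b \<in> V \<Longrightarrow> sig b b = {}"
  using d_eq_0 by (fastforce simp: sig_def join_irreducible_def)

lemma sig_sub: "sig b z \<subseteq> V"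
  by (auto simp: sig_def join_irreducible_def)

lemma finite_sig [simp]: "finite (sig b z)"
  using sig_sub finite_V by (rule finite_subset)

text \<open>A class gained on passing from \<open>p\<close> to \<open>v\<close> has these two
  vertices on different sides, so the edge belongs to it, and by
  \<open>lab_join_irreducible_self\<close> its name is the label of the edge. Nothing is lost,
  because \<open>p\<close> lies between \<open>b\<close> and \<open>v\<close>.\<close>

lemma sig_pred:
  assumes b: "b \<in> V" and v: "v \<in> V" and p: "p \<in> preds b v"
  shows "sig b v = insert (lab b p v) (sig b p)" "lab b p v \<notin> sig b p"
proof -
  note pD = predsD[OF p]
  have vh: "v \<in> half v p" using half_self v pD by blast
  have ph: "p \<in> half p v" using half_self v pD by blast
  have pn: "p \<notin> half v p" by (simp add: half_def)
  have 1: "lab b p v \<in> sig b v" using mem_sig_lab_iff[OF b v p v] vh by simp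
  show 2: "lab b p v \<notin> sig b p" using mem_sig_lab_iff[OF b v p pD(1)] pn by simp
  have 3: "r \<in> sig b v" if "r \<in> sig b p" for r
  proof -
    have "r \<in> V" using that sig_sub by blast
    then have "d b v \<le> d b r + d r v" "d r v \<le> d r p + d p v" using d_tri b v pD by blast+
    then show ?thesis using that pD by (auto simp: sig_def)
  qed
  have 4: "r = lab b p v" if r: "r \<in> sig b v" "r \<notin> sig b p" for r
  proof -
    have ji: "join_irreducible b r" using r by (simp add: sig_def)
    then obtain q where q: "q \<in> preds b r" and rV: "r \<in> V"
      by (force simp: join_irreducible_def card_1_singleton_iff)
    note qD = predsD[OF q]
    have l: "lab b q r = r" using lab_join_irreducible_self[OF b ji q] .
    have "v \<in> half r q" "p \<notin> half r q"
      using mem_sig_lab_iff[OF b rV q] v pD(1) r l by auto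
    then have "half v p = half r q"
      using half_crossing_eq[OF rV qD(1) qD(3), of v p] half_compl[OF rV qD(1) qD(3) pD(1)] pD by blast
    then show ?thesis using l by (simp add: lab_def)
  qed
  from 1 3 4 show "sig b v = insert (lab b p v) (sig b p)" by blast
qed

text \<open>The starting point of the recursion: with one predecessor only, \<open>v\<close> is the
  top of no square, and its downward edge carries a name not inherited from below.\<close>

lemma lab_unique_pred:
  assumes "b \<in> V" "v \<in> V" "preds b v = {p}"
  shows "lab b p v = v"
  using lab_join_irreducible_self[OF assms(1), of v p] assms by (simp add: join_irreducible_def)

lemma lab_square:
  assumes b: "b \<in> V" and v: "v \<in> V" and p: "p1 \<in> preds b v" "p2 \<in> preds b v" "p1 \<noteq> p2"
    and g: "g \<in> preds b p1" "g \<in> preds b p2"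
  shows "lab b p1 v = lab b g p2"
proof -
  note D = predsD[OF p(1)] predsD[OF p(2)] predsD[OF g(1)] predsD[OF g(2)]
  have "v \<noteq> g" using D by auto
  then have "z \<in> half v p1 \<longleftrightarrow> z \<in> half p2 g" if zV: "z \<in> V" for z
  proof -
    have "d z p2 < d z g" if "d z v < d z p1"
      using square_closer[OF v D(1) D(9) D(5) zV D(3) D(11) D(14) D(6) _ _ that] \<open>v \<noteq> g\<close> p(3) by blast
    moreover have "d z v < d z p1" if "d z p2 < d z g"
      using square_closer[OF D(5) D(9) D(1) v zV D(15) D(10) D(2) D(7) _ _ that] \<open>v \<noteq> g\<close> p(3) by blast
    ultimately show ?thesis using zV by (auto simp: half_def)
  qed
  then have "half v p1 = half p2 g" using halfD by blast
  then show ?thesis by (simp add: lab_def)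
qed

text \<open>The program takes the identity on vertex numbers for \<open>f\<close>. A signature is
  thereby compressed into one word, and by \<open>hash_pred\<close> the increment along an edge is
  the class name itself.\<close>

definition hash :: "('a \<Rightarrow> nat) \<Rightarrow> 'a \<Rightarrow> 'a \<Rightarrow> nat" where
  "hash f b v = (\<Sum>r\<in>sig b v. f r)"

lemma hash_pred:
  "b \<in> V \<Longrightarrow> v \<in> V \<Longrightarrow> p \<in> preds b v \<Longrightarrow> hash f b v = hash f b p + f (lab b p v)"
  using sig_pred by (simp add: hash_def)

lemma hash_base: "b \<in> V \<Longrightarrow> hash f b b = 0"
  by (simp add: hash_def sig_base)

text \<open>By \<open>lab_square\<close> the increments along the opposite edges \<open>p1 v\<close>
  and \<open>g p2\<close> agree, which determines the value at \<open>v\<close> from lower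
  vertices.\<close>

lemma hash_square:
  assumes "b \<in> V" "v \<in> V" "p1 \<in> preds b v" "p2 \<in> preds b v" "p1 \<noteq> p2"
    and "g \<in> preds b p1" "g \<in> preds b p2"
  shows "hash f b v + hash f b g = hash f b p1 + hash f b p2"
  using hash_pred[OF assms(1-3), of f] hash_pred[OF assms(1) _ assms(7), of f] lab_square[OF assms]
    predsD(1)[OF assms(4)] by simp

lemma common_pred:
  assumes "b \<in> V" "v \<in> V" "p1 \<in> preds b v" "p2 \<in> preds b v" "p1 \<noteq> p2"
  obtains g where "g \<in> preds b p1" "g \<in> preds b p2"
proof -
  obtain q where "q \<in> V" "d q p1 = 1" "d q p2 = 1" "d b p1 = Suc (d b q)" "d b p2 = Suc (d b q)"
    using quadrangle[of b v p1 p2] assms predsD by metis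
  then show ?thesis using that by (simp add: preds_def)
qed

text \<open>A second \<open>g'\<close> would give \<open>p1\<close> and \<open>p2\<close> three
  common neighbours \<open>v\<close>, \<open>g\<close>, \<open>g'\<close>. Hence any match between
  the two predecessor lists is the right one.\<close>

lemma common_pred_unique:
  assumes "v \<in> V" "p1 \<in> preds b v" "p2 \<in> preds b v" "p1 \<noteq> p2"
    and "g \<in> preds b p1" "g \<in> preds b p2" "g' \<in> preds b p1" "g' \<in> preds b p2"
  shows "g = g'"
proof (rule ccontr)
  assume "g \<noteq> g'"
  moreover have "v \<noteq> g" "v \<noteq> g'" using predsD(4)[OF assms(2)] predsD(4)[OF assms(5)] predsD(4)[OF assms(7)] by auto
  ultimately show False
    using no_K23[of p1 p2 v g g'] predsD assms by metis
qed

lemma card_lab_half: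
  assumes "b \<in> V" "v \<in> V" "p \<in> preds b v"
  shows "(\<Sum>z\<in>V. of_bool (lab b p v \<in> sig b z)) = card (half v p)"
proof -
  have "{z \<in> V. lab b p v \<in> sig b z} = half v p"
    using mem_sig_lab_iff[OF assms] halfD by blast
  then show ?thesis using finite_V by (simp add: of_bool_def sum.If_cases Int_def)
qed

section \<open>Distance sums and the size of intervals\<close>

definition dist_sum :: "'a \<Rightarrow> nat" where
  "dist_sum v = (\<Sum>z\<in>V. d v z)"

text \<open>Moving from \<open>p\<close> to \<open>v\<close> shortens the distance by one to each
  vertex of \<open>half v p\<close> and lengthens it by one to all others; the additive form avoids
  truncated subtraction.\<close>

lemma dist_sum_adj:
  assumes "v \<in> V" "p \<in> V" "d v p = 1"
  shows "dist_sum v + 2 * card (half v p) = dist_sum p + card V"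
proof -
  have "d v z + 2 * of_bool (z \<in> half v p) = d p z + 1" if "z \<in> V" for z
    using adj_dist_cases[OF assms(1,2) that assms(3)] that d_sym[of v z] d_sym[of p z]
    by (auto simp: half_def)
  then have "(\<Sum>z\<in>V. d v z + 2 * of_bool (z \<in> half v p)) = (\<Sum>z\<in>V. d p z + 1)"
    by (rule sum.cong[OF refl])
  moreover have "(\<Sum>z\<in>V. 2 * of_bool (z \<in> half v p)) = 2 * card (half v p)"
    using half_sub[of v p] finite_V
    by (simp add: of_bool_def sum.If_cases Int_absorb1 flip: sum_distrib_left)
  moreover have "(\<Sum>z\<in>V. d p z + 1) = dist_sum p + card V"
    unfolding sum.distrib dist_sum_def by simp
  ultimately show ?thesis unfolding sum.distrib dist_sum_def by linarith
qed

lemma half_partition: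
  assumes "x \<in> V" "y \<in> V" "d x y = 1"
  shows "half x y \<union> half y x = V" "half x y \<inter> half y x = {}"
    "card (half x y) + card (half y x) = card V"
proof -
  show 1: "half x y \<union> half y x = V" using half_compl[OF assms] half_sub by blast
  show 2: "half x y \<inter> half y x = {}" by (auto simp: half_def)
  show "card (half x y) + card (half y x) = card V"
    using card_Un_disjoint[OF finite_half finite_half 2] 1 by simp
qed

text \<open>The edge \<open>p v\<close> separates two disjoint parts of the interval from
  \<open>b\<close> to \<open>v\<close>: the interval from \<open>b\<close> to \<open>p\<close> and
  the one from the gate \<open>r\<close> to \<open>v\<close>. In each of them the top vertex,
  \<open>p\<close> or \<open>v\<close>, has at least \<open>card (preds b v) - 1\<close>
  predecessors, so the lower bound doubles. The base is generalised because it moves from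
  \<open>b\<close> to \<open>r\<close>.\<close>

lemma card_preds:
  assumes "b \<in> V" "v \<in> V"
  shows "2 ^ card (preds b v) \<le> card {z \<in> V. d b z + d z v = d b v}"
  using assms
proof (induction "d b v" arbitrary: b v rule: less_induct)
  case less
  let ?I = "\<lambda>b v. {z \<in> V. d b z + d z v = d b v}"
  have fI: "finite (?I b v)" for b v using finite_V by simp
  show ?case
  proof (cases "preds b v = {}")
    case True
    have "v \<in> ?I b v" using less.prems by simp
    then have "card (?I b v) > 0" using fI[of b v] by (metis card_gt_0_iff empty_iff)
    with True show ?thesis by simp
  next
    case False
    then obtain p where p: "p \<in> preds b v" by blast
    note pD = predsD[OF p]
    define P where "P = preds b v - {p}"
    define r where "r = lab b p v"
    have rh: "r \<in> half v p" unfolding r_def using lab_in_half less.prems p by blast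
    have rV: "r \<in> V" using rh halfD by blast
    have vh: "v \<in> half v p" using half_self less.prems pD by blast
    have cone: "d b z = d b r + d r z" if "z \<in> half v p" for z
      using lab_cone[OF less.prems p] that by (auto simp: r_def)
    have r0: "r \<noteq> b" using rh base_notin_half[OF less.prems(1) p] by blast
    have "P \<subseteq> half v p"
    proof
      fix u assume "u \<in> P"
      then have u: "u \<in> preds b v" "u \<noteq> p" by (auto simp: P_def)
      have "d u p = 2" using dist_two[of u p v] predsD[OF u(1)] pD u(2) less.prems by blast
      then show "u \<in> half v p" using predsD[OF u(1)] by (simp add: half_def)
    qed
    then have sub1: "P \<subseteq> preds r v"
      using cone[OF vh] cone by (auto simp: P_def preds_def)
    \<comment> \<open>The fourth corner of the square on \<open>v\<close>, \<open>p\<close> and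
      \<open>u\<close>; a corner shared by two different \<open>u\<close> is excluded by
      \<open>no_K23\<close>.\<close>
    define q where "q u = (SOME g. g \<in> preds b p \<and> g \<in> preds b u)" for u
    have q: "q u \<in> preds b p \<and> q u \<in> preds b u" if "u \<in> P" for u
    proof -
      have "\<exists>g. g \<in> preds b p \<and> g \<in> preds b u"
        using common_pred[OF less.prems p, of u] that by (auto simp: P_def)
      then show ?thesis unfolding q_def by (rule someI_ex)
    qed
    have "inj_on q P"
    proof (rule inj_onI, rule ccontr)
      fix u1 u2 assume u: "u1 \<in> P" "u2 \<in> P" "q u1 = q u2" "u1 \<noteq> u2"
      have m: "u1 \<in> preds b v" "u2 \<in> preds b v" "u1 \<noteq> p" "u2 \<noteq> p" using u by (auto simp: P_def)
      note D = predsD[OF m(1)] predsD[OF m(2)] predsD[OF conjunct1[OF q[OF u(1)]]]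
        predsD[OF conjunct2[OF q[OF u(1)]]] predsD[OF conjunct2[OF q[OF u(2)]]] u(3)
      have "v \<noteq> q u1" using D by auto
      then have "u1 = p" using no_K23[of v "q u1" u1 u2 p] D pD less.prems u m by simp
      with m show False by simp
    qed
    then have "card P \<le> card (preds b p)"
      using q by (metis card_image card_mono finite_preds image_subsetI)
    moreover have "card P \<le> card (preds r v)" using sub1 by (simp add: card_mono)
    moreover have "card (preds b v) = Suc (card P)"
      unfolding P_def by (rule card.remove[OF finite_preds p])
    moreover have "2 ^ card (preds b p) \<le> card (?I b p)"
      using less.hyps[of b p] pD less.prems by simp
    moreover have "2 ^ card (preds r v) \<le> card (?I r v)"
    proof (rule less.hyps)
      have "d b r \<noteq> 0" using r0 d_eq_0 less.prems rV by blast
      then show "d r v < d b v" using cone[OF vh] by simp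
    qed (use rV less.prems in auto)
    moreover have "card (?I b p) + card (?I r v) \<le> card (?I b v)"
    proof -
      have bh: "b \<in> half p v" using base_notin_half[OF less.prems(1) p] by blast
      have ph: "p \<in> half p v" using half_self pD by blast
      have s1: "?I b p \<subseteq> half p v"
        using half_convex[OF pD(1) less.prems(2) pD(2) bh ph] by blast
      have s2: "?I r v \<subseteq> half v p"
        using half_convex[OF less.prems(2) pD(1) pD(3) rh vh] by blast
      have s3: "?I r v \<subseteq> ?I b v" using s2 cone[OF vh] cone by fastforce
      have s4: "?I b p \<subseteq> ?I b v"
      proof
        fix z assume z: "z \<in> ?I b p"
        then have "d b v \<le> d b z + d z v" "d z v \<le> d z p + d p v"
          using d_tri less.prems pD by blast+
        with z pD show "z \<in> ?I b v" by simp
      qed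
      have "?I b p \<inter> ?I r v = {}" using s1 s2 by (force simp: half_def)
      then have "card (?I b p) + card (?I r v) = card (?I b p \<union> ?I r v)"
        using fI by (simp add: card_Un_disjoint)
      also have "\<dots> \<le> card (?I b v)" using s3 s4 fI by (intro card_mono) auto
      finally show ?thesis .
    qed
    moreover have "(2::nat) ^ card P \<le> 2 ^ card (preds b p)" "(2::nat) ^ card P \<le> 2 ^ card (preds r v)"
      using calculation(1,2) by (simp_all add: power_increasing)
    ultimately show ?thesis by (simp only: power_Suc)
  qed
qed

lemma card_preds_V: "b \<in> V \<Longrightarrow> v \<in> V \<Longrightarrow> 2 ^ card (preds b v) \<le> card V"
  using card_preds[of b v] card_mono[OF finite_V, of "{z \<in> V. d b z + d z v = d b v}"]
  by fastforce

end

section \<open>Eccentricities around a centre and across a cut\<close>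

definition ecc :: "('a \<Rightarrow> 'a \<Rightarrow> nat) \<Rightarrow> 'a set \<Rightarrow> 'a \<Rightarrow> nat" where
  "ecc d A u = Max (d u ` A)"

lemma ecc_shift:
  assumes "finite B" "B \<noteq> {}" "\<And>t. t \<in> B \<Longrightarrow> d' v t = Suc (d u t)"
  shows "ecc d' B v = Suc (ecc d B u)"
proof -
  have "d' v ` B = Suc ` d u ` B" using assms(3) by (auto simp: image_image)
  moreover have "Max (Suc ` d u ` B) = Suc (Max (d u ` B))"
    using assms by (intro mono_Max_commute[symmetric]) (auto simp: mono_def)
  ultimately show ?thesis by (simp add: ecc_def)
qed

lemma ecc_Un:
  assumes "finite A" "A \<noteq> {}" "finite B" "B \<noteq> {}"
  shows "ecc d (A \<union> B) u = max (ecc d A u) (ecc d B u)"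
  using assms by (simp add: ecc_def image_Un Max_Un)

context median_space begin

text \<open>For a cut vertex \<open>c\<close> of the metric one would have \<open>d u v = d u c + d c v\<close>; the vertices
  near \<open>u\<close> are those for which this fails.\<close>

definition near :: "'a \<Rightarrow> 'a \<Rightarrow> 'a set" where
  "near c u = {v \<in> V. d u v < d u c + d c v}"

text \<open>The moves of the search from \<open>u\<close>: steps away from \<open>c\<close>, and
  arbitrary steps from a vertex between \<open>u\<close> and \<open>c\<close>, but never onto
  \<open>c\<close>. All distances that occur are from the centre, except \<open>d u z\<close>, which
  is known when \<open>z\<close> is expanded; the distance \<open>d u y\<close> still to be found is
  not consulted.\<close>

definition near_rel :: "'a \<Rightarrow> 'a \<Rightarrow> ('a \<times> 'a) set" where
  "near_rel c u = {(z, y). z \<in> V \<and> y \<in> V \<and> d z y = 1 \<and> y \<noteq> c \<and>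
     (d c z < d c y \<or> d u z + d c z = d c u)}"

lemma near_sub: "near c u \<subseteq> V"
  by (auto simp: near_def)

lemma finite_near [simp]: "finite (near c u)"
  using near_sub finite_V by (rule finite_subset)

lemma near_sym:
  "u \<in> V \<Longrightarrow> v \<in> near c u \<Longrightarrow> u \<in> near c v"
  using d_sym[of u v] d_sym[of u c] d_sym[of c v] by (auto simp: near_def)

lemma near_self: "u \<in> V \<Longrightarrow> c \<in> V \<Longrightarrow> u \<noteq> c \<Longrightarrow> u \<in> near c u"
  using d_eq_0[of u c] by (auto simp: near_def)

text \<open>A step away from \<open>c\<close> raises \<open>d c y\<close> by one and
  \<open>d u y\<close> by at most one. A step towards \<open>c\<close> from a vertex between
  \<open>u\<close> and \<open>c\<close> gives \<open>d u y + d c y \<le> d u c\<close>, and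
  \<open>y \<noteq> c\<close> makes the inequality of \<open>near\<close> strict.\<close>

lemma near_closed:
  assumes V: "u \<in> V" "c \<in> V" and z: "z \<in> near c u" and y: "(z, y) \<in> near_rel c u"
  shows "y \<in> near c u"
proof -
  have zy: "z \<in> V" "y \<in> V" "d z y = 1" "y \<noteq> c" using y by (auto simp: near_rel_def)
  have t: "d u y \<le> Suc (d u z)" using d_tri[OF V(1) zy(1,2)] zy by simp
  have p: "d c y > 0" using d_eq_0 V zy by blast
  have c: "d c y = Suc (d c z) \<or> d c z = Suc (d c y)"
    using adj_dist_cases[OF zy(1,2) V(2) zy(3)] by blast
  have s: "d u c = d c u" by (rule d_sym)
  have lt: "d u z < d u c + d c z" using z by (simp add: near_def)
  have "d c z < d c y \<or> d u z + d c z = d c u" using y by (simp add: near_rel_def)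
  then have "d u y < d u c + d c y" using t p c s lt by linarith
  then show ?thesis using zy by (simp add: near_def)
qed

text \<open>Let \<open>m\<close> be the median of \<open>u\<close>, \<open>y\<close> and
  \<open>c\<close>. If \<open>m\<close> is \<open>y\<close>, then \<open>y\<close> lies between
  \<open>u\<close> and \<open>c\<close>, and so does the next vertex towards \<open>u\<close>.
  Otherwise a step from \<open>y\<close> towards \<open>m\<close> approaches \<open>u\<close> and
  \<open>c\<close> at once. Either way, a search confined to \<open>near_rel\<close> finds true
  distances.\<close>

lemma near_pred:
  assumes V: "u \<in> V" "c \<in> V" and y: "y \<in> near c u" "y \<noteq> u"
  obtains z where "z \<in> near c u" "(z, y) \<in> near_rel c u" "d u y = Suc (d u z)"
proof -
  have yV: "y \<in> V" and lt: "d u y < d u c + d c y" using y by (auto simp: near_def)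
  obtain m where m: "m \<in> V" "d u m + d m y = d u y" "d y m + d m c = d y c" "d u m + d m c = d u c"
    using median_ex V yV by metis
  note sy = d_sym[of y m] d_sym[of y c] d_sym[of m c] d_sym[of c u] d_sym[of u y]
  have mc: "m \<noteq> c" using m(2) lt by auto
  have mc0: "d c m > 0" using d_eq_0[OF V(2) m(1)] mc by auto
  show ?thesis
  proof (cases "m = y")
    case True
    obtain z where z: "z \<in> V" "d y z = 1" "d y u = Suc (d z u)"
      using d_step[OF yV V(1) y(2)] by blast
    have "d c z \<le> d c y + d y z" "d c u \<le> d c z + d z u" using d_tri V yV z(1) by blast+
    then have e: "d c z = Suc (d c y)" "d z u + d c z = d c u"
      using m(4)[unfolded True] z sy by linarith+
    have "z \<in> near c u" using e z(1) sy d_sym[of u z] by (simp add: near_def)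
    moreover have "(z, y) \<in> near_rel c u"
      using e z yV mc True d_sym[of u z] d_sym[of y z] by (simp add: near_rel_def)
    moreover have "d u y = Suc (d u z)" using z(3) d_sym[of u z] sy by simp
    ultimately show ?thesis by (rule that)
  next
    case False
    obtain z where z: "z \<in> V" "d y z = 1" "d y m = Suc (d z m)"
      using d_step[OF yV m(1)] False by blast
    have "d u z \<le> d u m + d m z" "d u y \<le> d u z + d z y" "d z c \<le> d z m + d m c" "d y c \<le> d y z + d z c"
      using d_tri V yV z(1) m(1) by blast+
    then have e: "d u y = Suc (d u z)" "d c y = Suc (d c z)"
      using m z sy d_sym[of z m] d_sym[of y z] d_sym[of z c] by linarith+
    have "z \<in> near c u" using e z(1) lt by (simp add: near_def)
    moreover have "(z, y) \<in> near_rel c u"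
      using e z yV d_sym[of y z] by (auto simp: near_rel_def)
    ultimately show ?thesis using e(1) by (rule that)
  qed
qed

text \<open>For a near \<open>y\<close> the median \<open>m\<close> of \<open>u\<close>,
  \<open>y\<close> and \<open>c\<close> is not \<open>c\<close>; the first vertex \<open>x\<close>
  on the way from \<open>c\<close> to \<open>m\<close> is a predecessor of \<open>c\<close> as seen
  from \<open>u\<close>, and \<open>y\<close> lies beyond it.\<close>

lemma card_near:
  assumes V: "u \<in> V" "c \<in> V" and M: "\<And>x. x \<in> V \<Longrightarrow> d c x = 1 \<Longrightarrow> card (half x c) \<le> M"
  shows "card (near c u) \<le> card (preds u c) * M"
proof -
  have "near c u \<subseteq> (\<Union>x\<in>preds u c. half x c)"
  proof
    fix y assume "y \<in> near c u"
    then have yV: "y \<in> V" and lt: "d u y < d u c + d c y" by (auto simp: near_def)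
    obtain m where m: "m \<in> V" "d u m + d m y = d u y" "d y m + d m c = d y c" "d u m + d m c = d u c"
      using median_ex V yV by metis
    have mc: "c \<noteq> m" using m(2) lt by auto
    obtain x where x: "x \<in> V" "d c x = 1" "d c m = Suc (d x m)"
      using d_step[OF V(2) m(1) mc] by blast
    have "d u x \<le> d u m + d m x" "d u c \<le> d u x + d x c" "d y x \<le> d y m + d m x"
      using d_tri V yV x(1) m(1) by blast+
    then have "d u c = Suc (d u x)" "d y x < d y c"
      using m x d_sym[of m x] d_sym[of x c] d_sym[of m c] by linarith+
    then have "x \<in> preds u c" "y \<in> half x c"
      using x yV d_sym[of x c] by (auto simp: preds_def half_def)
    then show "y \<in> (\<Union>x\<in>preds u c. half x c)" by blast
  qed
  then have "card (near c u) \<le> card (\<Union>x\<in>preds u c. half x c)"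
    by (intro card_mono) auto
  also have "\<dots> \<le> (\<Sum>x\<in>preds u c. card (half x c))"
    by (rule card_UN_le) simp
  also have "\<dots> \<le> (\<Sum>x\<in>preds u c. M)"
    using M predsD by (intro sum_mono) blast
  finally show ?thesis by simp
qed

lemma ecc_near:
  assumes V: "u \<in> V" "c \<in> V" "u \<noteq> c" and k: "k \<in> near c u" "\<And>v. v \<in> near c u \<Longrightarrow> d u v \<le> d u k"
    and l: "l \<in> V - near c u" "\<And>v. v \<in> V - near c u \<Longrightarrow> d c v \<le> d c l"
  shows "ecc d V u = max (d u k) (d c u + d c l)"
proof -
  have e: "d u v = d c u + d c v" if "v \<in> V - near c u" for v
  proof -
    have "v \<in> V" "\<not> d u v < d u c + d c v" using that by (simp_all add: near_def)
    then show ?thesis using d_tri[OF V(1,2), of v] d_sym[of u c] by linarith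
  qed
  show ?thesis unfolding ecc_def
  proof (rule Max_eqI)
    show "finite (d u ` V)" using finite_V by simp
    show "y \<le> max (d u k) (d c u + d c l)" if y: "y \<in> d u ` V" for y
    proof -
      obtain v where v: "v \<in> V" "y = d u v" using y by blast
      show ?thesis
      proof (cases "v \<in> near c u")
        case True
        then show ?thesis using k(2)[OF True] v by simp
      next
        case False
        then show ?thesis using e[of v] l(2)[of v] v by simp
      qed
    qed
    show "max (d u k) (d c u + d c l) \<in> d u ` V"
    proof (cases "d u k \<le> d c u + d c l")
      case True
      then show ?thesis using l(1) e[OF l(1)] by (auto simp: max_def intro!: rev_image_eqI[of l])
    next
      case False
      then show ?thesis using k(1) near_sub[of c u] by (auto simp: max_def)
    qed
  qed
qed

section \<open>Distances across a cut\<close>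

context
  fixes x y
  assumes x: "x \<in> V" and y: "y \<in> V" and xy: "d x y = 1"
begin

private lemma yx: "d y x = 1" using xy d_sym[of x y] by simp

definition gap :: "'a \<Rightarrow> nat" where
  "gap u = d u (gate (half y x) u)"

private lemma gateB: "u \<in> V \<Longrightarrow> gate (half y x) u \<in> half y x"
  "u \<in> V \<Longrightarrow> v \<in> half y x \<Longrightarrow> d u v = gap u + d (gate (half y x) u) v"
  unfolding gap_def by (fact gate_half[OF y x yx])+

lemma gap_le: "u \<in> V \<Longrightarrow> v \<in> half y x \<Longrightarrow> gap u \<le> d u v"
  using gateB(2)[of u v] by linarith

lemma gap_pos: "u \<in> half x y \<Longrightarrow> gap u > 0"
  using gateB(1)[of u] half_partition(2)[OF x y xy] d_eq_0[of u "gate (half y x) u"] halfD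
  by (metis disjoint_iff gap_def gr0I)

lemma gap_lipschitz:
  assumes "u \<in> V" "v \<in> V" "d u v = 1" shows "gap v \<le> Suc (gap u)"
proof -
  have "gap v \<le> d v (gate (half y x) u)" using gap_le gateB(1) assms by blast
  also have "\<dots> \<le> d v u + d u (gate (half y x) u)"
    using d_tri assms gateB(1)[OF assms(1)] halfD by blast
  finally show ?thesis using assms(3) d_sym[of u v] by (simp add: gap_def)
qed

lemma gap_eq_1_iff:
  assumes "u \<in> half x y" shows "gap u = 1 \<longleftrightarrow> (\<exists>v\<in>half y x. d u v = 1)"
proof
  show "gap u = 1 \<Longrightarrow> \<exists>v\<in>half y x. d u v = 1"
    using gateB(1) halfD[OF assms] by (auto simp: gap_def)
  show "\<exists>v\<in>half y x. d u v = 1 \<Longrightarrow> gap u = 1"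
    using gap_le gap_pos[OF assms] halfD[OF assms] by (metis One_nat_def Suc_leI le_antisym)
qed

text \<open>The first step towards the gate cannot already cross the cut, since only vertices with
  gap 1 have a neighbour across; so \<open>z\<close> remains on the side of
  \<open>u\<close>.\<close>

lemma gap_step:
  assumes u: "u \<in> half x y" and "gap u \<noteq> 1"
  obtains z where "z \<in> half x y" "d z u = 1" "gap u = Suc (gap z)"
proof -
  let ?g = "gate (half y x) u"
  note uV = halfD[OF u]
  have g: "?g \<in> half y x" "?g \<in> V" using gateB(1)[OF uV] halfD by blast+
  have "u \<noteq> ?g" using gap_pos[OF u] by (auto simp: gap_def)
  then obtain z where z: "z \<in> V" "d u z = 1" "d u ?g = Suc (d z ?g)"
    using d_step[OF uV g(2)] by blast
  have zB: "z \<notin> half y x" using gap_le[OF uV, of z] gap_pos[OF u] assms(2) z(2) by auto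
  then have "z \<in> half x y" using half_compl[OF x y xy z(1)] by blast
  moreover have "gap z \<le> d z ?g" using gap_le z(1) g(1) by blast
  moreover have "gap u \<le> Suc (gap z)"
    using gap_lipschitz[OF z(1) uV] z(2) d_sym[of z u] by simp
  ultimately have "z \<in> half x y" "gap u = Suc (gap z)" using z(3) unfolding gap_def by linarith+
  with z(2) d_sym[of z u] show ?thesis by (intro that[of z]) simp_all
qed

lemma half_yx_nonempty: "half y x \<noteq> {}"
  using half_self[OF y yx] by blast

text \<open>Here \<open>v\<close> is the gate of \<open>u\<close>, so all geodesic distances from
  \<open>u\<close> to the other side are measured through \<open>v\<close>.\<close>

lemma ecc_across_edge:
  assumes u: "u \<in> half x y" and v: "v \<in> half y x" and uv: "d u v = 1"
  shows "ecc d (half y x) u = Suc (ecc d (half y x) v)"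
proof (rule ecc_shift)
  have "gap u = 1" using gap_eq_1_iff[OF u] v uv by blast
  then have "d (gate (half y x) u) v = 0" using gateB(2)[OF halfD[OF u] v] uv by simp
  then have "gate (half y x) u = v" using d_eq_0 gateB(1)[OF halfD[OF u]] halfD v by metis
  then show "d u t = Suc (d v t)" if "t \<in> half y x" for t
    using gateB(2)[OF halfD[OF u] that] \<open>gap u = 1\<close> by simp
qed (use half_yx_nonempty in auto)

text \<open>The gate of \<open>u\<close> is within distance \<open>gap v\<close> of
  \<open>v\<close>, hence it is the gate of \<open>v\<close> as well, and all distances to the other
  side grow by exactly one.\<close>

lemma ecc_across_step:
  assumes u: "u \<in> half x y" and v: "v \<in> half x y" and uv: "d u v = 1" and "gap v = Suc (gap u)"
  shows "ecc d (half y x) v = Suc (ecc d (half y x) u)"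
proof (rule ecc_shift)
  let ?g = "gate (half y x) u" and ?h = "gate (half y x) v"
  have V: "u \<in> V" "v \<in> V" using u v halfD by blast+
  have g: "?g \<in> half y x" using gateB(1)[OF V(1)] .
  have "d v ?g \<le> d v u + d u ?g" using d_tri[OF V(2,1) halfD[OF g]] .
  then have "d ?h ?g = 0" using gateB(2)[OF V(2) g] assms(4) uv d_sym[of u v] unfolding gap_def by linarith
  then have "?h = ?g" using d_eq_0 gateB(1) V halfD by metis
  then show "d v t = Suc (d u t)" if "t \<in> half y x" for t
    using gateB(2)[OF V(1) that] gateB(2)[OF V(2) that] assms(4) by simp
qed (use half_yx_nonempty in auto)

end

end

section \<open>Sequences of cuts and their undoing\<close>

text \<open>\<open>cmp\<close> maps the elements to their cells after \<open>k\<close> cuts; the \<open>k\<close>-th cut moves a halfspace of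
  the cell \<open>pa k\<close> to the new cell \<open>k\<close>.\<close>

primrec splitting :: "('a \<Rightarrow> 'a \<Rightarrow> nat) \<Rightarrow> 'a set \<Rightarrow> (nat \<Rightarrow> nat) \<Rightarrow> nat \<Rightarrow> ('a \<Rightarrow> nat) \<Rightarrow> bool" where
  "splitting d V pa 0 = (\<lambda>cmp. \<forall>v\<in>V. cmp v = 0)"
| "splitting d V pa (Suc k) = (\<lambda>cmp. \<exists>cmp0 x y. splitting d V pa k cmp0 \<and> pa (Suc k) \<le> k \<and>
     x \<in> V \<and> y \<in> V \<and> cmp0 x = pa (Suc k) \<and> cmp0 y = pa (Suc k) \<and> d x y = 1 \<and>
     (\<forall>v\<in>V. cmp v = (if cmp0 v = pa (Suc k) \<and> d v y < d v x then Suc k else cmp0 v)))"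

text \<open>Only the entries \<open>1, ..., k\<close> of \<open>pa\<close> and the values of
  \<open>cmp\<close> on \<open>V\<close> count. So an array can serve as \<open>pa\<close> while
  later cuts extend it, and arrays with leftovers outside \<open>V\<close> can serve as
  \<open>cmp\<close>.\<close>

lemma splitting_cong:
  assumes "splitting d V pa k cmp" "\<And>v. v \<in> V \<Longrightarrow> cmp' v = cmp v"
    "\<And>i. 0 < i \<Longrightarrow> i \<le> k \<Longrightarrow> pa' i = pa i"
  shows "splitting d V pa' k cmp'"
  using assms
proof (induction k arbitrary: cmp cmp')
  case 0
  then show ?case by simp
next
  case (Suc k)
  from Suc.prems(1) obtain cmp0 x y where s: "splitting d V pa k cmp0" "pa (Suc k) \<le> k"
     "x \<in> V" "y \<in> V" "cmp0 x = pa (Suc k)" "cmp0 y = pa (Suc k)" "d x y = 1"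
     "\<forall>v\<in>V. cmp v = (if cmp0 v = pa (Suc k) \<and> d v y < d v x then Suc k else cmp0 v)" by auto
  have "splitting d V pa' k cmp0" using Suc.IH[OF s(1) refl] Suc.prems(3) by simp
  moreover have "pa' (Suc k) = pa (Suc k)" using Suc.prems(3) by simp
  moreover have "\<forall>v\<in>V. cmp' v = (if cmp0 v = pa (Suc k) \<and> d v y < d v x then Suc k else cmp0 v)"
    using s(8) Suc.prems(2) by simp
  ultimately have "splitting d V pa' k cmp0 \<and> pa' (Suc k) \<le> k \<and> x \<in> V \<and> y \<in> V \<and>
      cmp0 x = pa' (Suc k) \<and> cmp0 y = pa' (Suc k) \<and> d x y = 1 \<and>
      (\<forall>v\<in>V. cmp' v = (if cmp0 v = pa' (Suc k) \<and> d v y < d v x then Suc k else cmp0 v))"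
    using s(2-7) by simp
  then show ?case unfolding splitting.simps by blast
qed

lemma splitting_le: "splitting d V pa k cmp \<Longrightarrow> v \<in> V \<Longrightarrow> cmp v \<le> k"
proof (induction k arbitrary: cmp v)
  case (Suc k)
  then show ?case by (force simp: le_Suc_eq)
qed simp

text \<open>The two parts of a divided cell are complementary halfspaces of a median space, hence
  median spaces. The second claim restores the state before the last cut by relabelling
  \<open>k\<close> as \<open>pa k\<close>, and it provides the cut edge \<open>x y\<close>, which
  the program does not store.\<close>

lemma
  assumes "median_space V d" "splitting d V pa k cmp"
  shows splitting_median: "a \<le> k \<Longrightarrow> median_space {v \<in> V. cmp v = a} d"
    and splitting_unsplit: "0 < k \<Longrightarrow> \<exists>cmp0 x y. splitting d V pa (k - 1) cmp0 \<and> pa k < k \<and>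
      (\<forall>v\<in>V. cmp0 v = (if cmp v = k then pa k else cmp v)) \<and>
      median_space {v \<in> V. cmp0 v = pa k} d \<and>
      x \<in> V \<and> y \<in> V \<and> cmp0 x = pa k \<and> cmp0 y = pa k \<and> d x y = 1 \<and>
      median_space.half {v \<in> V. cmp0 v = pa k} d x y = {v \<in> V. cmp v = pa k} \<and>
      median_space.half {v \<in> V. cmp0 v = pa k} d y x = {v \<in> V. cmp v = k}"
proof -
  have "(\<forall>a\<le>k. median_space {v \<in> V. cmp v = a} d) \<and>
    (0 < k \<longrightarrow> (\<exists>cmp0 x y. splitting d V pa (k - 1) cmp0 \<and> pa k < k \<and>
      (\<forall>v\<in>V. cmp0 v = (if cmp v = k then pa k else cmp v)) \<and>
      median_space {v \<in> V. cmp0 v = pa k} d \<and>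
      x \<in> V \<and> y \<in> V \<and> cmp0 x = pa k \<and> cmp0 y = pa k \<and> d x y = 1 \<and>
      median_space.half {v \<in> V. cmp0 v = pa k} d x y = {v \<in> V. cmp v = pa k} \<and>
      median_space.half {v \<in> V. cmp0 v = pa k} d y x = {v \<in> V. cmp v = k}))"
    using assms(2)
  proof (induction k arbitrary: cmp)
    case 0
    then have "{v \<in> V. cmp v = 0} = V" by auto
    with assms(1) show ?case by simp
  next
    case (Suc k)
    from Suc.prems(1) obtain cmp0 x y where s: "splitting d V pa k cmp0" "pa (Suc k) \<le> k"
     "x \<in> V" "y \<in> V" "cmp0 x = pa (Suc k)" "cmp0 y = pa (Suc k)" "d x y = 1"
     "\<forall>v\<in>V. cmp v = (if cmp0 v = pa (Suc k) \<and> d v y < d v x then Suc k else cmp0 v)" by auto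
    let ?X = "{v \<in> V. cmp0 v = pa (Suc k)}"
    have ne: "cmp0 v \<noteq> Suc k" if "v \<in> V" for v using splitting_le[OF s(1) that] by simp
    have le: "cmp0 v \<le> k" if "v \<in> V" for v using splitting_le[OF s(1) that] .
    have med: "\<forall>a\<le>k. median_space {v \<in> V. cmp0 v = a} d" using Suc.IH[OF s(1)] by blast
    then interpret X: median_space ?X d using s(2) by blast
    have xy: "x \<in> ?X" "y \<in> ?X" using s by auto
    have yx: "d y x = 1" using s(7) X.d_sym[of x y] by simp
    have hy: "X.half y x = {v \<in> V. cmp v = Suc k}"
      using s(8) ne by (auto simp: X.half_def split: if_splits)
    have "X.half x y = ?X - X.half y x"
      using X.half_partition[OF xy s(7)] by blast
    also have "\<dots> = {v \<in> V. cmp v = pa (Suc k)}"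
      using s(2,8) ne by (auto simp: X.half_def split: if_splits)
    finally have hx: "X.half x y = {v \<in> V. cmp v = pa (Suc k)}" .
    have "median_space {v \<in> V. cmp v = a} d" if "a \<le> Suc k" for a
    proof (cases "a = Suc k \<or> a = pa (Suc k)")
      case True
      then show ?thesis
        using X.median_space_half[OF xy s(7)] X.median_space_half[OF xy(2,1) yx] hx hy by auto
    next
      case False
      then have "{v \<in> V. cmp v = a} = {v \<in> V. cmp0 v = a}" using s(8) by auto
      then show ?thesis using med that False by auto
    qed
    moreover have "\<forall>v\<in>V. cmp0 v = (if cmp v = Suc k then pa (Suc k) else cmp v)"
      using s(8) le by fastforce
    moreover have "splitting d V pa (Suc k - 1) cmp0" "pa (Suc k) < Suc k" using s(1,2) by simp_all
    ultimately show ?case using s(3-7) hx hy X.median_space_axioms by blast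
  qed
  then show "a \<le> k \<Longrightarrow> median_space {v \<in> V. cmp v = a} d"
    "0 < k \<Longrightarrow> \<exists>cmp0 x y. splitting d V pa (k - 1) cmp0 \<and> pa k < k \<and>
      (\<forall>v\<in>V. cmp0 v = (if cmp v = k then pa k else cmp v)) \<and>
      median_space {v \<in> V. cmp0 v = pa k} d \<and>
      x \<in> V \<and> y \<in> V \<and> cmp0 x = pa k \<and> cmp0 y = pa k \<and> d x y = 1 \<and>
      median_space.half {v \<in> V. cmp0 v = pa k} d x y = {v \<in> V. cmp v = pa k} \<and>
      median_space.half {v \<in> V. cmp0 v = pa k} d y x = {v \<in> V. cmp v = k}" by blast+
qed

section \<open>Breadth-first search\<close>

text \<open>Breadth-first search along \<open>R\<close> from the sources
  \<open>src 0, ..., src (m - 1)\<close>. Levels are described by local conditions only, growth by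
  at most one and a predecessor one level lower, so no paths have to be mentioned. Cells, near sets
  and the two sides of a cut are instances.\<close>

locale search_space =
  fixes X :: "nat set" and R :: "(nat \<times> nat) set" and lev :: "nat \<Rightarrow> nat"
    and m :: nat and src :: "nat \<Rightarrow> nat" and n :: nat
  assumes X_sub: "X \<subseteq> {..<n}"
    and closed: "z \<in> X \<Longrightarrow> (z, y) \<in> R \<Longrightarrow> y \<in> X"
    and src_X: "i < m \<Longrightarrow> src i \<in> X" and src_lev: "i < m \<Longrightarrow> lev (src i) = 0"
    and src_inj: "inj_on src {..<m}"
    and lev_n: "y \<in> X \<Longrightarrow> lev y \<le> n"
    and lev_step: "z \<in> X \<Longrightarrow> (z, y) \<in> R \<Longrightarrow> lev y \<le> Suc (lev z)"
    and lev_pred: "y \<in> X \<Longrightarrow> y \<notin> src ` {..<m} \<Longrightarrow> \<exists>z\<in>X. (z, y) \<in> R \<and> lev y = Suc (lev z)"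
begin

text \<open>The queue is \<open>q\<close>, with head \<open>h\<close> and tail \<open>t\<close>; \<open>D\<close> holds those neighbours of the vertex being
  expanded that have been scanned already.\<close>

definition searched ::
  "(nat \<Rightarrow> nat) \<Rightarrow> nat \<Rightarrow> (nat \<Rightarrow> nat) \<Rightarrow> (nat \<Rightarrow> nat) \<Rightarrow> (nat \<Rightarrow> nat) \<Rightarrow> nat \<Rightarrow> nat set \<Rightarrow> bool" where
  "searched q t vis dst par h D \<longleftrightarrow>
     m \<le> t \<and> (\<forall>i<m. q i = src i) \<and> inj_on q {..<t} \<and> q ` {..<t} \<subseteq> X \<and>
     (\<forall>v<n. vis v = of_bool (v \<in> q ` {..<t})) \<and> (\<forall>i<t. dst (q i) = lev (q i)) \<and>
     (\<forall>i j. i \<le> j \<longrightarrow> j < t \<longrightarrow> lev (q i) \<le> lev (q j)) \<and>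
     (h < t \<longrightarrow> (\<forall>i<t. lev (q i) \<le> Suc (lev (q h)))) \<and> h \<le> t \<and>
     (\<forall>i<h. \<forall>y. (q i, y) \<in> R \<longrightarrow> y \<in> q ` {..<t}) \<and> D \<subseteq> q ` {..<t} \<and>
     (\<forall>i. m \<le> i \<longrightarrow> i < t \<longrightarrow> (\<exists>j<i. par (q i) = q j \<and> (q j, q i) \<in> R \<and> lev (q i) = Suc (lev (q j))))"

definition search_done ::
  "(nat \<Rightarrow> nat) \<Rightarrow> nat \<Rightarrow> (nat \<Rightarrow> nat) \<Rightarrow> (nat \<Rightarrow> nat) \<Rightarrow> (nat \<Rightarrow> nat) \<Rightarrow> bool" where
  "search_done q t vis dst par \<longleftrightarrow>
     m \<le> t \<and> (\<forall>i<m. q i = src i) \<and> inj_on q {..<t} \<and> q ` {..<t} = X \<and> t = card X \<and>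
     (\<forall>v<n. vis v = of_bool (v \<in> X)) \<and> (\<forall>v\<in>X. dst v = lev v) \<and>
     (\<forall>i j. i \<le> j \<longrightarrow> j < t \<longrightarrow> lev (q i) \<le> lev (q j)) \<and>
     (\<forall>i. m \<le> i \<longrightarrow> i < t \<longrightarrow> (\<exists>j<i. par (q i) = q j \<and> (q j, q i) \<in> R \<and> lev (q i) = Suc (lev (q j))))"

lemma finite_X: "finite X"
  using X_sub finite_subset by blast

lemma searched_bound:
  assumes "searched q t vis dst par h D" shows "t \<le> n"
proof -
  have "inj_on q {..<t}" "q ` {..<t} \<subseteq> {..<n}" using assms X_sub by (auto simp: searched_def)
  then show ?thesis by (metis card_inj_on_le card_lessThan finite_lessThan)
qed

lemma searched_init:
  assumes "\<forall>i<m. q i = src i" "\<forall>v<n. vis v = of_bool (v \<in> src ` {..<m})" "\<forall>i<m. dst (src i) = 0"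
  shows "searched q m vis dst par 0 {}"
proof -
  have "q ` {..<m} = src ` {..<m}" using assms(1) by (auto simp: image_def)
  moreover have "inj_on q {..<m}" using src_inj assms(1) by (auto simp: inj_on_def)
  ultimately show ?thesis using assms src_X src_lev by (auto simp: searched_def)
qed

text \<open>A vertex of smaller level than the one being processed has been processed already.\<close>

lemma searched_below:
  assumes s: "searched q t vis dst par h D" and h: "h < t"
  shows "x \<in> X \<Longrightarrow> lev x < lev (q h) \<Longrightarrow> \<exists>i<h. x = q i"
proof (induction "lev x" arbitrary: x rule: less_induct)
  case less
  have sorted: "\<And>i j. i \<le> j \<Longrightarrow> j < t \<Longrightarrow> lev (q i) \<le> lev (q j)"
    using s by (auto simp: searched_def)
  have "x \<in> q ` {..<t}"
  proof (cases "x \<in> src ` {..<m}")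
    case True
    then obtain i where "i < m" "x = src i" by blast
    then show ?thesis using s by (auto simp: searched_def intro!: image_eqI[of _ _ i])
  next
    case False
    then obtain z where z: "z \<in> X" "(z, x) \<in> R" "lev x = Suc (lev z)"
      using lev_pred less.prems by blast
    then obtain i where "i < h" "z = q i" using less.hyps[of z] less.prems by auto
    then show ?thesis using s z(2) unfolding searched_def by blast
  qed
  then obtain i where i: "i < t" "x = q i" by blast
  then have "i < h" using sorted[of h i] less.prems(2) by (meson not_le)
  with i show ?case by blast
qed

text \<open>If the level of \<open>y\<close> did not exceed that of the vertex being expanded, a
  predecessor of \<open>y\<close> would have been expanded already by \<open>searched_below\<close>,
  and \<open>y\<close> would be in the queue. So a new vertex always gets the next level.\<close>

lemma searched_add:
  assumes s: "searched q t vis dst par h D" and h: "h < t" and R: "(q h, y) \<in> R" and v: "vis y = 0"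
  shows "searched (q(t := y)) (Suc t) (vis(y := 1)) (dst(y := Suc (dst (q h)))) (par(y := q h)) h (insert y D)"
proof -
  have m: "m \<le> t" and src: "\<forall>i<m. q i = src i" and inj: "inj_on q {..<t}" and sub: "q ` {..<t} \<subseteq> X"
    and vis: "\<forall>v<n. vis v = of_bool (v \<in> q ` {..<t})" and dst: "\<forall>i<t. dst (q i) = lev (q i)"
    and sorted: "\<And>i j. i \<le> j \<Longrightarrow> j < t \<Longrightarrow> lev (q i) \<le> lev (q j)"
    and top: "\<forall>i<t. lev (q i) \<le> Suc (lev (q h))"
    and cl: "\<And>i y. i < h \<Longrightarrow> (q i, y) \<in> R \<Longrightarrow> y \<in> q ` {..<t}" and D: "D \<subseteq> q ` {..<t}"
    and par: "\<forall>i. m \<le> i \<longrightarrow> i < t \<longrightarrow> (\<exists>j<i. par (q i) = q j \<and> (q j, q i) \<in> R \<and> lev (q i) = Suc (lev (q j)))"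
    using s h by (simp_all add: searched_def)
  have hX: "q h \<in> X" using sub h by blast
  have yX: "y \<in> X" using closed hX R by blast
  then have yn: "y < n" using X_sub by blast
  have new: "y \<notin> q ` {..<t}" using vis v yn by (metis of_bool_eq_0_iff)
  have ly: "lev y = Suc (lev (q h))"
  proof (rule ccontr)
    assume "lev y \<noteq> Suc (lev (q h))"
    then have le: "lev y \<le> lev (q h)" using lev_step[OF hX R] by linarith
    have "y \<noteq> src i" if "i < m" for i
      using new src m that by (metis imageI lessThan_iff order_less_le_trans)
    then have "y \<notin> src ` {..<m}" by blast
    then obtain z where z: "z \<in> X" "(z, y) \<in> R" "lev y = Suc (lev z)" using lev_pred yX by blast
    then obtain i where "i < h" "z = q i" using searched_below[OF s h z(1)] le by auto
    then show False using cl z(2) new by blast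
  qed
  have q': "(q(t := y)) i = q i" if "i < t" for i using that by simp
  have qne: "q i \<noteq> y" if "i < t" for i using new that by blast
  have img: "(q(t := y)) ` {..<Suc t} = insert y (q ` {..<t})"
    by (auto simp: lessThan_Suc image_def)
  have "inj_on (q(t := y)) {..<Suc t}"
    using inj new by (auto simp: lessThan_Suc inj_on_def)
  moreover have "\<forall>i j. i \<le> j \<longrightarrow> j < Suc t \<longrightarrow> lev ((q(t := y)) i) \<le> lev ((q(t := y)) j)"
    using sorted top ly by (auto simp: less_Suc_eq)
  moreover have "\<exists>j<i. (par(y := q h)) ((q(t := y)) i) = (q(t := y)) j \<and>
      ((q(t := y)) j, (q(t := y)) i) \<in> R \<and> lev ((q(t := y)) i) = Suc (lev ((q(t := y)) j))"
    if i: "m \<le> i" "i < Suc t" for i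
  proof (cases "i = t")
    case True
    then show ?thesis using h R ly by (intro exI[of _ h]) auto
  next
    case False
    then have it: "i < t" using i by simp
    then obtain j where "j < i" "par (q i) = q j" "(q j, q i) \<in> R" "lev (q i) = Suc (lev (q j))"
      using par i by blast
    then show ?thesis using it qne[OF it] by (intro exI[of _ j]) auto
  qed
  moreover have "\<forall>i<Suc t. (dst(y := Suc (dst (q h)))) ((q(t := y)) i) = lev ((q(t := y)) i)"
    using dst qne ly h by (auto simp: less_Suc_eq)
  moreover have "\<forall>v<n. (vis(y := 1)) v = of_bool (v \<in> (q(t := y)) ` {..<Suc t})"
    using vis unfolding img by auto
  moreover have "(q(t := y)) ` {..<Suc t} \<subseteq> X" using sub yX unfolding img by blast
  moreover have "\<forall>i<m. (q(t := y)) i = src i" using src m by auto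
  moreover have "\<forall>i<h. \<forall>x. ((q(t := y)) i, x) \<in> R \<longrightarrow> x \<in> (q(t := y)) ` {..<Suc t}"
    using cl h unfolding img by auto
  moreover have "insert y D \<subseteq> (q(t := y)) ` {..<Suc t}" using D unfolding img by blast
  moreover have "\<forall>i<Suc t. lev ((q(t := y)) i) \<le> Suc (lev ((q(t := y)) h))"
    using top h ly by (auto simp: less_Suc_eq)
  ultimately show ?thesis unfolding searched_def using m h by auto
qed

lemma searched_skip:
  assumes "searched q t vis dst par h D" "y < n" "vis y \<noteq> 0"
  shows "searched q t vis dst par h (insert y D)"
  using assms by (auto simp: searched_def)

lemma searched_next:
  assumes s: "searched q t vis dst par h D" and "h < t" and "\<And>y. (q h, y) \<in> R \<Longrightarrow> y \<in> D"
  shows "searched q t vis dst par (Suc h) {}"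
proof -
  have "lev (q i) \<le> Suc (lev (q (Suc h)))" if "i < t" "Suc h < t" for i
  proof -
    have "lev (q i) \<le> Suc (lev (q h))" "lev (q h) \<le> lev (q (Suc h))"
      using s that by (simp_all add: searched_def)
    then show ?thesis by simp
  qed
  then show ?thesis using assms by (auto simp: searched_def less_Suc_eq)
qed

lemma searched_final:
  assumes s: "searched q t vis dst par t D"
  shows "search_done q t vis dst par"
proof -
  have src: "m \<le> t" "\<forall>i<m. q i = src i" and inj: "inj_on q {..<t}" and sub: "q ` {..<t} \<subseteq> X"
    and cl: "\<And>i y. i < t \<Longrightarrow> (q i, y) \<in> R \<Longrightarrow> y \<in> q ` {..<t}"
    using s by (simp_all add: searched_def)
  have "x \<in> q ` {..<t}" if "x \<in> X" for x
    using that
  proof (induction "lev x" arbitrary: x rule: less_induct)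
    case less
    show ?case
    proof (cases "x \<in> src ` {..<m}")
      case True
      then obtain i where "i < m" "x = src i" by blast
      then show ?thesis using src by (auto intro!: image_eqI[of _ _ i])
    next
      case False
      then obtain z where z: "z \<in> X" "(z, x) \<in> R" "lev x = Suc (lev z)"
        using lev_pred less.prems by blast
      then have "z \<in> q ` {..<t}" using less.hyps[of z] by simp
      then show ?thesis using cl z(2) by blast
    qed
  qed
  with sub have X: "q ` {..<t} = X" by blast
  moreover have "t = card X" using card_image[OF inj] X by simp
  moreover have "\<forall>v\<in>X. dst v = lev v"
  proof
    fix v assume "v \<in> X"
    then obtain i where "i < t" "v = q i" using X by blast
    then show "dst v = lev v" using s by (simp add: searched_def)
  qed
  ultimately show ?thesis using s unfolding searched_def search_done_def by auto
qed

end

section \<open>The search as a program\<close>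

definition visit :: "expr \<Rightarrow> prog" where
  "visit ok =
     (''y'' ::= Get ''nbr'' (Reg ''j'') ;;
      Cond ok
        (Cond (Get ''vis'' (Reg ''y'')) Skip
          (Put ''vis'' (Reg ''y'') (Const 1) ;;
           Put ''dist'' (Reg ''y'') (Get ''dist'' (Reg ''z'') +. Const 1) ;;
           Put ''par'' (Reg ''y'') (Reg ''z'') ;;
           Put ''q'' (Reg ''tl'') (Reg ''y'') ;;
           ''tl'' ::= Reg ''tl'' +. Const 1))
        Skip)"

text \<open>The admissibility test \<open>ok\<close> is a parameter, evaluated with the edge in the
  registers \<open>z\<close> and \<open>y\<close>. The head advances before the scan, so during it
  the vertex being expanded sits at position \<open>hd - 1\<close>.\<close>

definition bfs :: "expr \<Rightarrow> prog" where
  "bfs ok =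
     While (Reg ''hd'' <. Reg ''tl'')
       (''z'' ::= Get ''q'' (Reg ''hd'') ;;
        ''hd'' ::= Reg ''hd'' +. Const 1 ;;
        For ''j'' (Get ''off'' (Reg ''z'')) (Get ''off'' (Reg ''z'' +. Const 1)) (visit ok))"

lemma written_visit [simp]:
  "written_regs (visit ok) = {''y'', ''tl''}"
  "written_arrs (visit ok) = {''vis'', ''dist'', ''par'', ''q''}"
  by (auto simp: visit_def)

lemma written_bfs [simp]:
  "written_regs (bfs ok) = {''z'', ''hd'', ''j'', ''y'', ''tl''}"
  "written_arrs (bfs ok) = {''vis'', ''dist'', ''par'', ''q''}"
  by (auto simp: bfs_def)

text \<open>The bound \<open>word\<close> leaves room for the sum of two hash values, each up to
  \<open>n * n\<close>, as well as for offsets and squared sizes. The metric \<open>d\<close> is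
  abstract and tied to the adjacency lists only through \<open>nbrs\<close>.\<close>

locale ram_graph =
  fixes w n :: nat and off nbr :: "nat \<Rightarrow> nat" and d :: "nat \<Rightarrow> nat \<Rightarrow> nat"
  assumes median: "median_space {..<n} d"
    and off_step: "u < n \<Longrightarrow> off u \<le> off (Suc u)"
    and off_n: "off n \<le> n * n"
    and nbrs: "u < n \<Longrightarrow> nbr ` {off u..<off (Suc u)} = {v. v < n \<and> d u v = 1}"
    and nbrs_inj: "u < n \<Longrightarrow> inj_on nbr {off u..<off (Suc u)}"
    and word: "64 * (n + 1) * (n + 1) \<le> 2 ^ w"
begin

definition static :: "state \<Rightarrow> bool" where
  "static s \<longleftrightarrow> regs s ''n'' = n \<and> arrs s ''off'' = off \<and> arrs s ''nbr'' = nbr"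

lemma static_same:
  assumes "static s" "same_except X A s s'" "''n'' \<notin> X" "''off'' \<notin> A" "''nbr'' \<notin> A"
  shows "static s'"
  using assms by (simp add: static_def same_except_def)

definition deg :: "nat \<Rightarrow> nat" where
  "deg u = off (Suc u) - off u"

lemma w_pos: "0 < w"
  using word by (cases w) auto

lemma word_gt: "64 * n * n + 128 * n + 64 \<le> 2 ^ w"
  using word by (simp add: algebra_simps)

lemma word_n: "64 * n + 64 \<le> 2 ^ w"
  using word_gt by simp

lemma off_mono:
  assumes "v \<le> n" "u \<le> v" shows "off u \<le> off v"
  using assms(2,1)
proof (induction v rule: dec_induct)
  case (step v)
  then show ?case using off_step[of v] by simp
qed simp

lemma off_le: "u \<le> n \<Longrightarrow> off u \<le> n * n"
  using off_mono[of n u] off_n by simp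

lemma off_word: "u \<le> n \<Longrightarrow> off u + n * n < 2 ^ w"
  using off_le[of u] word_gt by simp

lemma nbr_adj:
  assumes "u < n" "off u \<le> j" "j < off (Suc u)" shows "nbr j < n" "d u (nbr j) = 1"
  using nbrs[OF assms(1)] assms by auto

lemma adj_nbr:
  assumes "u < n" "v < n" "d u v = 1" obtains j where "off u \<le> j" "j < off (Suc u)" "nbr j = v"
proof -
  have "v \<in> nbr ` {off u..<off (Suc u)}" using nbrs[OF assms(1)] assms by blast
  then show ?thesis using that by auto
qed

lemma runs_visit:
  assumes sp: "search_space X R lev m src n"
    and R: "\<And>z y. z \<in> X \<Longrightarrow> (z, y) \<in> R \<Longrightarrow> y < n \<and> d z y = 1"
    and ok: "expr_val w (set_reg s ''y'' (nbr (regs s ''j''))) ok \<noteq> 0 \<longleftrightarrow> (regs s ''z'', nbr (regs s ''j'')) \<in> R"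
    and st: "static s" and j: "nbr (regs s ''j'') < n"
    and inv: "search_space.searched X R lev m src n (arrs s ''q'') (regs s ''tl'') (arrs s ''vis'')
        (arrs s ''dist'') (arrs s ''par'') h D" "h < regs s ''tl''" "arrs s ''q'' h = regs s ''z''"
  shows "runs w (visit ok) (30 + expr_time ok) s (\<lambda>s'.
      search_space.searched X R lev m src n (arrs s' ''q'') (regs s' ''tl'') (arrs s' ''vis'')
        (arrs s' ''dist'') (arrs s' ''par'') h
        (if (regs s ''z'', nbr (regs s ''j'')) \<in> R then insert (nbr (regs s ''j'')) D else D) \<and>
      h < regs s' ''tl'' \<and> (\<forall>i\<le>h. arrs s' ''q'' i = arrs s ''q'' i))"
proof (rule runs_loop_free)
  interpret search_space X R lev m src n by (rule sp)
  let ?y = "nbr (regs s ''j'')"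
  have tl: "regs s ''tl'' \<le> n" using searched_bound[OF inv(1)] .
  have "regs s ''tl'' + 1 < 2 ^ w" using tl word_n by linarith
  then have tl': "Suc (regs s ''tl'') mod 2 ^ w = Suc (regs s ''tl'')" by simp
  have hz: "arrs s ''dist'' (regs s ''z'') = lev (regs s ''z'')"
    using inv by (auto simp: searched_def)
  have zX: "regs s ''z'' \<in> X" using inv by (auto simp: searched_def)
  show "loop_free (visit ok)" by (simp add: visit_def)
  show "prog_time (visit ok) \<le> 30 + expr_time ok" by (simp add: visit_def)
  have ok': "expr_val w (set_reg s ''y'' ?y) ok = 0 \<longleftrightarrow> (regs s ''z'', ?y) \<notin> R"
    using ok by blast
  have ev: "eval_prog w (visit ok) s = (let s1 = set_reg s ''y'' ?y in
      if (regs s ''z'', ?y) \<in> R \<and> arrs s ''vis'' ?y = 0 then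
        s1\<lparr>regs := (regs s1)(''tl'' := Suc (regs s ''tl'')),
           arrs := (arrs s)(''vis'' := (arrs s ''vis'')(?y := 1),
             ''dist'' := (arrs s ''dist'')(?y := Suc (arrs s ''dist'' (regs s ''z'')) mod 2 ^ w),
             ''par'' := (arrs s ''par'')(?y := regs s ''z''),
             ''q'' := (arrs s ''q'')(regs s ''tl'' := ?y))\<rparr> else s1)"
    using ok' st w_pos tl' by (simp add: visit_def Let_def static_def mod_Suc_eq)
  show "search_space.searched X R lev m src n (arrs (eval_prog w (visit ok) s) ''q'')
        (regs (eval_prog w (visit ok) s) ''tl'') (arrs (eval_prog w (visit ok) s) ''vis'')
        (arrs (eval_prog w (visit ok) s) ''dist'') (arrs (eval_prog w (visit ok) s) ''par'') h
        (if (regs s ''z'', ?y) \<in> R then insert ?y D else D) \<and>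
      h < regs (eval_prog w (visit ok) s) ''tl'' \<and>
      (\<forall>i\<le>h. arrs (eval_prog w (visit ok) s) ''q'' i = arrs s ''q'' i)"
  proof (cases "(regs s ''z'', ?y) \<in> R \<and> arrs s ''vis'' ?y = 0")
    case True
    have "?y \<in> X" using closed zX True by blast
    then have "Suc (lev (regs s ''z'')) < 2 ^ w" using lev_n[OF zX] word_n by linarith
    note add = searched_add[OF inv(1,2), of ?y, unfolded inv(3)]
    have "arrs s ''dist'' (regs s ''z'') = lev (regs s ''z'')" by (rule hz)
    with \<open>Suc (lev (regs s ''z'')) < 2 ^ w\<close>
    show ?thesis using add True inv unfolding ev Let_def by simp
  next
    case False
    then show ?thesis using inv searched_skip[OF inv(1) j] unfolding ev Let_def by auto
  qed
qed

text \<open>The test has to be correct only in states that differ from \<open>s0\<close> in the data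
  of the search itself and in which the \<open>dist\<close> entry of the expanded vertex is its
  level; the test for near sets reads that entry.\<close>

lemma runs_bfs:
  assumes sp: "search_space X R lev m (arrs s0 ''q'') n"
    and R: "\<And>z y. z \<in> X \<Longrightarrow> (z, y) \<in> R \<Longrightarrow> y < n \<and> d z y = 1"
    and st: "static s0" and tl: "regs s0 ''tl'' = m" and hd: "regs s0 ''hd'' = 0"
    and vis: "\<forall>v<n. arrs s0 ''vis'' v = of_bool (v \<in> arrs s0 ''q'' ` {..<m})"
    and dst: "\<forall>i<m. arrs s0 ''dist'' (arrs s0 ''q'' i) = 0"
    and ok: "\<And>s z y. same_except {''z'', ''hd'', ''j'', ''y'', ''tl''} {''vis'', ''dist'', ''par'', ''q''} s0 s \<Longrightarrow>
       z \<in> X \<Longrightarrow> y < n \<Longrightarrow> d z y = 1 \<Longrightarrow> regs s ''z'' = z \<Longrightarrow> regs s ''y'' = y \<Longrightarrow>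
       arrs s ''dist'' z = lev z \<Longrightarrow> expr_val w s ok \<noteq> 0 \<longleftrightarrow> (z, y) \<in> R"
    and T: "(\<Sum>v\<in>X. 40 + (50 + expr_time ok) * deg v) + 10 \<le> T"
  shows "runs w (bfs ok) T s0 (\<lambda>s. search_space.search_done X R lev m (arrs s0 ''q'')  n
     (arrs s ''q'') (regs s ''tl'') (arrs s ''vis'') (arrs s ''dist'') (arrs s ''par''))"
proof -
  interpret search_space X R lev m "arrs s0 ''q''" n by (rule sp)
  let ?S = "\<lambda>s. searched (arrs s ''q'') (regs s ''tl'') (arrs s ''vis'') (arrs s ''dist'') (arrs s ''par'')"
  let ?c = "\<lambda>v. 40 + (50 + expr_time ok) * deg v"
  \<comment> \<open>Each vertex of \<open>X\<close> is expanded once, so the scan costs of those not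
    yet expanded bound the remaining time.\<close>
  let ?\<Phi> = "\<lambda>s. \<Sum>v\<in>X - arrs s ''q'' ` {..<regs s ''hd''}. ?c v"
  let ?body = "''z'' ::= Get ''q'' (Reg ''hd'') ;; ''hd'' ::= Reg ''hd'' +. Const 1 ;;
        For ''j'' (Get ''off'' (Reg ''z'')) (Get ''off'' (Reg ''z'' +. Const 1)) (visit ok)"
  have init: "?S s0 (regs s0 ''hd'') {}"
    unfolding hd tl using vis dst by (intro searched_init) auto
  have "runs w (While (Reg ''hd'' <. Reg ''tl'') ?body) T s0
    (\<lambda>s. ?S s (regs s ''hd'') {} \<and> expr_val w s (Reg ''hd'' <. Reg ''tl'') = 0)"
  proof (rule runs_While[where \<Phi> = ?\<Phi>])
    show "?\<Phi> s0 + 1 + expr_time (Reg ''hd'' <. Reg ''tl'') \<le> T" using T hd by simp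
    show "?S s0 (regs s0 ''hd'') {}" by (rule init)
    fix s assume S: "?S s (regs s ''hd'') {}"
      and fr: "same_except (written_regs ?body) (written_arrs ?body) s0 s"
      and nz: "expr_val w s (Reg ''hd'' <. Reg ''tl'') \<noteq> 0"
    define h where "h = regs s ''hd''"
    let ?Q = "\<lambda>s'. \<forall>i\<le>h. arrs s' ''q'' i = arrs s ''q'' i"
    define z where "z = arrs s ''q'' h"
    have hlt: "h < regs s ''tl''" using nz w_pos by (auto simp: h_def split: if_splits)
    have tln: "regs s ''tl'' \<le> n" using searched_bound[OF S] .
    have zX: "z \<in> X" using S hlt by (auto simp: searched_def z_def)
    have zn: "z < n" using zX X_sub by blast
    have st1: "static s" using static_same[OF st fr] by simp
    have hw: "Suc h < 2 ^ w" "Suc z < 2 ^ w" using hlt tln zn word_n by linarith+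
    have offw: "off (Suc z) < 2 ^ w" using off_word[of "Suc z"] zn by simp
    define s1 where "s1 = s\<lparr>regs := (regs s)(''z'' := z, ''hd'' := Suc h)\<rparr>"
    have st1': "static s1" using st1 by (simp add: static_def s1_def)
    have r1: "runs w (''z'' ::= Get ''q'' (Reg ''hd'')) 3 s (\<lambda>s'. s' = set_reg s ''z'' z)"
      by (rule runs_loop_free) (simp_all add: z_def h_def)
    have r2: "runs w (''hd'' ::= Reg ''hd'' +. Const 1) 4 (set_reg s ''z'' z) (\<lambda>s'. s' = s1)"
      using hw w_pos by (intro runs_loop_free) (simp_all add: s1_def h_def mod_Suc_eq)
    define D where "D i = {nbr j | j. off z \<le> j \<and> j < i \<and> (z, nbr j) \<in> R}" for i
    have r3: "runs w (For ''j'' (Get ''off'' (Reg ''z'')) (Get ''off'' (Reg ''z'' +. Const 1)) (visit ok))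
       (10 + (41 + expr_time ok) * deg z) s1
       (\<lambda>s'. (?S s' h (D (off (Suc z))) \<and> h < regs s' ''tl'' \<and> ?Q s') \<and> regs s' ''j'' = off (Suc z))"
    proof (rule runs_For[where I = "\<lambda>i s'. ?S s' h (D i) \<and> h < regs s' ''tl'' \<and> ?Q s'"
          and l = "off z" and B = "\<lambda>_. 30 + expr_time ok"])
      show "0 < w" by (rule w_pos)
      show "expr_val w s1 (Get ''off'' (Reg ''z'')) = off z"
        using st1 by (simp add: s1_def static_def)
      show "off z \<le> off (Suc z)" using off_step[OF zn] .
      show "off (Suc z) < 2 ^ w" by (rule offw)
      have "D (off z) = {}" by (auto simp: D_def)
      then show "?S (set_reg s1 ''j'' (off z)) h (D (off z)) \<and> h < regs (set_reg s1 ''j'' (off z)) ''tl'' \<and>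
        ?Q (set_reg s1 ''j'' (off z))"
        using S hlt by (simp add: s1_def h_def z_def)
      show "expr_val w s' (Get ''off'' (Reg ''z'' +. Const 1)) = off (Suc z)"
        if "same_except (insert ''j'' (written_regs (visit ok))) (written_arrs (visit ok)) s1 s'" for s'
        using same_exceptD[OF that] hw w_pos st1'
        by (simp add: s1_def static_def mod_Suc_eq)
      show "4 + expr_time (Get ''off'' (Reg ''z'')) + expr_time (Get ''off'' (Reg ''z'' +. Const 1)) +
        (\<Sum>i = off z..<off (Suc z). 30 + expr_time ok + 7 + expr_time (Get ''off'' (Reg ''z'' +. Const 1)))
        \<le> 10 + (41 + expr_time ok) * deg z" by (simp add: deg_def algebra_simps)
      fix i s'
      assume i: "off z \<le> i" "i < off (Suc z)" "regs s' ''j'' = i"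
        and I: "?S s' h (D i) \<and> h < regs s' ''tl'' \<and> ?Q s'"
        and fr2: "same_except (insert ''j'' (written_regs (visit ok))) (written_arrs (visit ok)) s1 s'"
      have z': "regs s' ''z'' = z" using same_exceptD(1)[OF fr2, of "''z''"] by (simp add: s1_def)
      have st2: "static s'" using static_same[OF st1' fr2] by simp
      note na = nbr_adj[OF zn i(1,2)]
      let ?s2 = "set_reg s' ''y'' (nbr i)"
      have fr3: "same_except {''z'', ''hd'', ''j'', ''y'', ''tl''} {''vis'', ''dist'', ''par'', ''q''} s0 ?s2"
        using fr fr2 by (auto simp: same_except_def s1_def)
      have qz: "arrs s' ''q'' h = z" using I by (simp add: z_def)
      have "\<forall>i<regs s' ''tl''. arrs s' ''dist'' (arrs s' ''q'' i) = lev (arrs s' ''q'' i)"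
        using I unfolding searched_def by blast
      then have dz: "arrs ?s2 ''dist'' z = lev z" using I qz by auto
      have "expr_val w ?s2 ok \<noteq> 0 \<longleftrightarrow> (z, nbr i) \<in> R"
        by (rule ok[OF fr3 zX na _ _ dz]) (simp_all add: z')
      then have ok2: "expr_val w (set_reg s' ''y'' (nbr (regs s' ''j''))) ok \<noteq> 0 \<longleftrightarrow>
          (regs s' ''z'', nbr (regs s' ''j'')) \<in> R" by (simp add: i(3) z')
      have "D (Suc i) = (if (z, nbr i) \<in> R then insert (nbr i) (D i) else D i)"
        using i(1) by (auto simp: D_def less_Suc_eq)
      then show "runs w (visit ok) (30 + expr_time ok) s' (\<lambda>s''. regs s'' ''j'' = i \<and>
         ?S (set_reg s'' ''j'' (Suc i)) h (D (Suc i)) \<and> h < regs (set_reg s'' ''j'' (Suc i)) ''tl'' \<and>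
         ?Q (set_reg s'' ''j'' (Suc i)))"
        using I na i(3) z' z_def[symmetric]
        by (intro runs_mono_frame[OF runs_visit[OF sp R ok2 st2 _ conjunct1[OF I]]])
          (auto dest: same_exceptD(1)[where x = "''j''"])
    qed
    have "runs w ?body (17 + (41 + expr_time ok) * deg z) s (\<lambda>s'. ?S s' (regs s' ''hd'') {} \<and>
      ?\<Phi> s' + (17 + (41 + expr_time ok) * deg z) + 1 + expr_time (Reg ''hd'' <. Reg ''tl'') \<le> ?\<Phi> s)"
    proof (rule runs_Seq[OF r1])
      fix sa assume "sa = set_reg s ''z'' z"
      then have r2': "runs w (''hd'' ::= Reg ''hd'' +. Const 1) 4 sa (\<lambda>s'. s' = s1)" using r2 by simp
      show "runs w (''hd'' ::= Reg ''hd'' +. Const 1 ;;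
        For ''j'' (Get ''off'' (Reg ''z'')) (Get ''off'' (Reg ''z'' +. Const 1)) (visit ok))
        (14 + (41 + expr_time ok) * deg z) sa (\<lambda>s'. ?S s' (regs s' ''hd'') {} \<and>
      ?\<Phi> s' + (17 + (41 + expr_time ok) * deg z) + 1 + expr_time (Reg ''hd'' <. Reg ''tl'') \<le> ?\<Phi> s)"
      proof (rule runs_Seq[OF r2'])
        fix sb assume "sb = s1"
        then show "runs w (For ''j'' (Get ''off'' (Reg ''z'')) (Get ''off'' (Reg ''z'' +. Const 1)) (visit ok))
          (10 + (41 + expr_time ok) * deg z) sb (\<lambda>s'. ?S s' (regs s' ''hd'') {} \<and>
          ?\<Phi> s' + (17 + (41 + expr_time ok) * deg z) + 1 + expr_time (Reg ''hd'' <. Reg ''tl'') \<le> ?\<Phi> s)"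
        proof (simp only: , intro runs_mono_frame[OF r3])
          fix s' assume a: "(?S s' h (D (off (Suc z))) \<and> h < regs s' ''tl'' \<and> ?Q s') \<and>
               regs s' ''j'' = off (Suc z)"
            and fr4: "same_except (written_regs (For ''j'' (Get ''off'' (Reg ''z'')) (Get ''off'' (Reg ''z'' +. Const 1)) (visit ok)))
              (written_arrs (For ''j'' (Get ''off'' (Reg ''z'')) (Get ''off'' (Reg ''z'' +. Const 1)) (visit ok))) s1 s'"
          have hd': "regs s' ''hd'' = Suc h" using same_exceptD(1)[OF fr4, of "''hd''"] by (simp add: s1_def)
          have "y \<in> D (off (Suc z))" if zy: "(z, y) \<in> R" for y
          proof -
            obtain j where "off z \<le> j" "j < off (Suc z)" "nbr j = y"
              using adj_nbr[OF zn] R[OF zX zy] by metis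
            then show ?thesis using zy by (auto simp: D_def)
          qed
          then have S': "?S s' (Suc h) {}" using a by (intro searched_next[of _ _ _ _ _ h "D (off (Suc z))"]) (auto simp: z_def)
          have "arrs s' ''q'' ` {..<Suc h} = insert z (arrs s ''q'' ` {..<h})"
            using a by (auto simp: z_def lessThan_Suc)
          then have "X - arrs s' ''q'' ` {..<Suc h} = X - arrs s ''q'' ` {..<h} - {z}" by blast
          moreover have "z \<in> X - arrs s ''q'' ` {..<h}"
          proof -
            have "inj_on (arrs s ''q'') {..<regs s ''tl''}" using S by (simp add: searched_def)
            then have "z \<notin> arrs s ''q'' ` {..<h}"
              unfolding z_def using hlt by (subst inj_on_image_mem_iff) auto
            then show ?thesis using zX by blast
          qed
          ultimately have "?\<Phi> s = ?c z + ?\<Phi> s'"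
            using finite_X unfolding hd' by (simp add: sum.remove flip: h_def)
          then have "?\<Phi> s' + (17 + (41 + expr_time ok) * deg z) + 1 + expr_time (Reg ''hd'' <. Reg ''tl'') \<le> ?\<Phi> s"
            by (simp add: algebra_simps)
          with S' hd' show "?S s' (regs s' ''hd'') {} \<and>
            ?\<Phi> s' + (17 + (41 + expr_time ok) * deg z) + 1 + expr_time (Reg ''hd'' <. Reg ''tl'') \<le> ?\<Phi> s" by simp
        qed simp
      qed simp
    qed simp
    then show "\<exists>T. runs w ?body T s (\<lambda>s'. ?S s' (regs s' ''hd'') {} \<and>
      ?\<Phi> s' + T + 1 + expr_time (Reg ''hd'' <. Reg ''tl'') \<le> ?\<Phi> s)"
      by (intro exI[of _ "17 + (41 + expr_time ok) * deg z"])
  qed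
  then show ?thesis unfolding bfs_def
  proof (rule runs_mono)
    fix s assume a: "?S s (regs s ''hd'') {} \<and> expr_val w s (Reg ''hd'' <. Reg ''tl'') = 0"
    then have "regs s ''hd'' = regs s ''tl''"
      using w_pos by (auto simp: searched_def split: if_splits)
    with a show "search_done (arrs s ''q'') (regs s ''tl'') (arrs s ''vis'') (arrs s ''dist'') (arrs s ''par'')"
      using searched_final by metis
  qed simp
qed

end

context median_space begin

text \<open>All smaller values occur along a geodesic from \<open>u\<close>; hence distances stay
  below the number of vertices.\<close>

lemma dist_image: "u \<in> V \<Longrightarrow> v \<in> V \<Longrightarrow> {..d u v} \<subseteq> d u ` V"
proof (induction "d u v" arbitrary: v)
  case 0
  then show ?case by (auto intro!: image_eqI[of _ _ u])
next
  case (Suc k)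
  have "v \<noteq> u" using Suc.hyps(2) by auto
  then obtain z where z: "z \<in> V" "d v z = 1" "d v u = Suc (d z u)"
    using d_step Suc.prems by blast
  have "d u v = Suc (d u z)" using z(3) d_sym[of u v] d_sym[of u z] by simp
  then show ?case using Suc.hyps(1)[of z] Suc.hyps(2) Suc.prems z(1)
    by (auto simp: atMost_Suc intro!: image_eqI[of _ _ v])
qed

lemma dist_less_card: "u \<in> V \<Longrightarrow> v \<in> V \<Longrightarrow> d u v < card V"
  using card_mono[OF _ dist_image, of u v] card_image_le[OF finite_V, of "d u"] finite_V
  by (simp add: less_eq_Suc_le)

end

lemma runs_Assign_Seq:
  assumes "runs w q T' (set_reg s x (expr_val w s e)) Q" "1 + expr_time e + T' \<le> T"
  shows "runs w (x ::= e ;; q) T s Q"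
proof (rule runs_Seq[where P = "\<lambda>s'. s' = set_reg s x (expr_val w s e)"])
  show "runs w (x ::= e) (1 + expr_time e) s (\<lambda>s'. s' = set_reg s x (expr_val w s e))"
    by (rule runs_loop_free) simp_all
qed (use assms in auto)

lemma runs_loop_freeI:
  "s' = eval_prog w p s \<Longrightarrow> loop_free p \<Longrightarrow> prog_time p \<le> T \<Longrightarrow> Q s' \<Longrightarrow> runs w p T s Q"
  using runs_loop_free by simp

lemma runs_loop_free_Seq:
  assumes "loop_free p" "runs w q T' (eval_prog w p s) Q" "prog_time p + T' \<le> T"
  shows "runs w (p ;; q) T s Q"
proof (rule runs_Seq[where P = "\<lambda>s'. s' = eval_prog w p s"])
  show "runs w p (prog_time p) s (\<lambda>s'. s' = eval_prog w p s)"
    by (rule runs_loop_free[OF assms(1)]) simp_all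
qed (use assms in auto)

definition enumerates :: "(nat \<Rightarrow> nat) \<Rightarrow> nat \<Rightarrow> nat set \<Rightarrow> bool" where
  "enumerates q t A \<longleftrightarrow> inj_on q {..<t} \<and> q ` {..<t} = A \<and> t = card A"

lemma enumeratesD:
  assumes "enumerates q t A"
  shows "i < t \<Longrightarrow> q i \<in> A" "v \<in> A \<Longrightarrow> \<exists>i<t. v = q i" "i < t \<Longrightarrow> j < t \<Longrightarrow> q i = q j \<Longrightarrow> i = j" "t = card A"
  using assms by (auto simp: enumerates_def inj_on_def)

lemma sum_enumerates: "enumerates q t A \<Longrightarrow> (\<Sum>i<t. f (q i)) = (\<Sum>v\<in>A. f v)"
  unfolding enumerates_def by (metis sum.reindex_cong)

section \<open>Searching a cell and naming its edge classes\<close>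

definition start_search :: "name \<Rightarrow> prog" where
  "start_search x =
     (Put ''q'' (Const 0) (Reg x) ;; ''hd'' ::= Const 0 ;; ''tl'' ::= Const 1 ;;
      Put ''vis'' (Reg x) (Const 1) ;; Put ''dist'' (Reg x) (Const 0))"

text \<open>Only vertices in the queue are unmarked. Clearing the whole array would cost
  \<open>n\<close> for each source in \<open>leaf\<close> and make that phase quadratic.\<close>

definition clean :: prog where
  "clean = For ''e'' (Const 0) (Reg ''tl'') (Put ''vis'' (Get ''q'' (Reg ''e'')) (Const 0))"

definition cell_search :: "name \<Rightarrow> prog" where
  "cell_search x =
     (start_search x ;; bfs (Get ''comp'' (Reg ''y'') =. Reg ''a'') ;; clean)"

lemma written_search [simp]:
  "written_regs (start_search x) = {''hd'', ''tl''}"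
  "written_arrs (start_search x) = {''q'', ''vis'', ''dist''}"
  "written_regs clean = {''e''}" "written_arrs clean = {''vis''}"
  "written_regs (cell_search x) = {''hd'', ''tl'', ''z'', ''j'', ''y'', ''e''}"
  "written_arrs (cell_search x) = {''q'', ''vis'', ''dist'', ''par''}"
  by (auto simp: start_search_def clean_def cell_search_def)

context ram_graph begin

definition unvisited :: "state \<Rightarrow> bool" where
  "unvisited s \<longleftrightarrow> (\<forall>v<n. arrs s ''vis'' v = 0)"

lemma adjacency_sym: "d u v = d v u"
  using median median_space.d_sym by metis

lemma runs_clean:
  assumes e: "inj_on (arrs s0 ''q'') {..<regs s0 ''tl''}" and A: "arrs s0 ''q'' ` {..<regs s0 ''tl''} = A"
    and "A \<subseteq> {..<n}"
    and v: "\<And>v. v < n \<Longrightarrow> v \<notin> A \<Longrightarrow> arrs s0 ''vis'' v = 0"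
  shows "runs w clean (10 + 20 * card A) s0 unvisited"
proof -
  let ?q = "arrs s0 ''q''" and ?t = "regs s0 ''tl''"
  have t: "?t = card A" using card_image[OF e] A by simp
  also have "\<dots> \<le> n" using card_mono[OF _ \<open>A \<subseteq> {..<n}\<close>] by simp
  finally have tn: "?t \<le> n" .
  have "runs w clean (10 + 20 * card A) s0 (\<lambda>s. (\<forall>v<n. v \<notin> ?q ` {?t..<?t} \<longrightarrow> arrs s ''vis'' v = 0) \<and> regs s ''e'' = ?t)"
    unfolding clean_def
  proof (rule runs_For[where I = "\<lambda>i s. \<forall>v<n. v \<notin> ?q ` {i..<?t} \<longrightarrow> arrs s ''vis'' v = 0" and l = 0 and B = "\<lambda>_. 4"])
    show "?t < 2 ^ w" using tn word_n by linarith
    show "\<forall>v<n. v \<notin> ?q ` {0..<?t} \<longrightarrow> arrs (set_reg s0 ''e'' 0) ''vis'' v = 0"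
      using v A by (auto simp: atLeast0LessThan)
    show "expr_val w s (Reg ''tl'') = ?t"
      if "same_except (insert ''e'' (written_regs (Put ''vis'' (Get ''q'' (Reg ''e'')) (Const 0))))
       (written_arrs (Put ''vis'' (Get ''q'' (Reg ''e'')) (Const 0))) s0 s" for s
      using same_exceptD[OF that] by simp
    fix i s
    assume i: "i < ?t" "regs s ''e'' = i" and I: "\<forall>v<n. v \<notin> ?q ` {i..<?t} \<longrightarrow> arrs s ''vis'' v = 0"
      and fr: "same_except (insert ''e'' (written_regs (Put ''vis'' (Get ''q'' (Reg ''e'')) (Const 0))))
       (written_arrs (Put ''vis'' (Get ''q'' (Reg ''e'')) (Const 0))) s0 s"
    have q: "arrs s ''q'' = ?q" using same_exceptD[OF fr] by simp
    have "{i..<?t} = insert i {Suc i..<?t}" using i by auto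
    then have "?q ` {i..<?t} = insert (?q i) (?q ` {Suc i..<?t})" by simp
    then show "runs w (Put ''vis'' (Get ''q'' (Reg ''e'')) (Const 0)) 4 s
      (\<lambda>s'. regs s' ''e'' = i \<and> (\<forall>v<n. v \<notin> ?q ` {Suc i..<?t} \<longrightarrow> arrs (set_reg s' ''e'' (Suc i)) ''vis'' v = 0))"
      using i I q by (intro runs_loop_free) auto
  qed (use w_pos t in simp_all)
  then show ?thesis by (rule runs_mono) (auto simp: unvisited_def)
qed

definition cell_searched :: "nat set \<Rightarrow> nat \<Rightarrow> state \<Rightarrow> bool" where
  "cell_searched A b s \<longleftrightarrow> enumerates (arrs s ''q'') (regs s ''tl'') A \<and> arrs s ''q'' 0 = b \<and>
     (\<forall>v\<in>A. arrs s ''dist'' v = d b v) \<and>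
     (\<forall>i<regs s ''tl''. 0 < i \<longrightarrow> arrs s ''par'' (arrs s ''q'' i) \<in> median_space.preds A d b (arrs s ''q'' i)) \<and>
     (\<forall>i j. i \<le> j \<longrightarrow> j < regs s ''tl'' \<longrightarrow> d b (arrs s ''q'' i) \<le> d b (arrs s ''q'' j))"

lemma runs_cell_search:
  assumes st: "static s" and un: "unvisited s"
    and A: "A = {v. v < n \<and> arrs s ''comp'' v = regs s ''a''}" and med: "median_space A d"
    and b: "regs s x \<in> A" and x: "x \<notin> {''hd'', ''tl'', ''z'', ''j'', ''y'', ''e''}"
  shows "runs w (cell_search x) (50 + (\<Sum>v\<in>A. 60 + 54 * deg v)) s
     (\<lambda>s'. cell_searched A (regs s x) s' \<and> unvisited s')"
proof -
  interpret A: median_space A d by (rule med)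
  define b where "b = regs s x"
  have An: "A \<subseteq> {..<n}" using A by auto
  have bA: "b \<in> A" and bn: "b < n" using b An by (auto simp: b_def)
  define R where "R = {(z, y). z \<in> A \<and> y \<in> A \<and> d z y = 1}"
  define s1 where "s1 = eval_prog w (start_search x) s"
  have s1: "arrs s1 ''q'' 0 = b" "regs s1 ''hd'' = 0" "regs s1 ''tl'' = 1"
    "arrs s1 ''vis'' = (arrs s ''vis'')(b := 1)" "arrs s1 ''dist'' b = 0"
    using w_pos x by (auto simp: s1_def start_search_def b_def)
  have fr1: "same_except {''hd'', ''tl''} {''q'', ''vis'', ''dist''} s s1"
    by (auto simp: s1_def start_search_def same_except_def)
  have st1: "static s1" using static_same[OF st fr1] by simp
  have sp: "search_space A R (d b) 1 (arrs s1 ''q'') n"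
  proof
    show "A \<subseteq> {..<n}" by (rule An)
    show "y \<in> A" if "(z, y) \<in> R" for z y using that by (auto simp: R_def)
    show "arrs s1 ''q'' i \<in> A" "d b (arrs s1 ''q'' i) = 0" if "i < 1" for i
      using that s1 bA by auto
    show "inj_on (arrs s1 ''q'') {..<1}" by (simp add: lessThan_Suc)
    show "d b y \<le> n" if "y \<in> A" for y
      using A.dist_less_card[OF bA that] card_mono[OF _ An] by simp
    show "d b y \<le> Suc (d b z)" if "z \<in> A" "(z, y) \<in> R" for z y
      using A.d_tri[OF bA, of z y] that by (auto simp: R_def)
    show "\<exists>z\<in>A. (z, y) \<in> R \<and> d b y = Suc (d b z)" if y: "y \<in> A" "y \<notin> arrs s1 ''q'' ` {..<1}" for y
    proof -
      have "y \<noteq> b" using y s1 by auto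
      then obtain p where "p \<in> A.preds b y" using A.preds_nonempty[OF bA y(1)] by blast
      then show ?thesis using A.predsD[of p b y] y(1) by (auto simp: R_def)
    qed
  qed
  interpret S: search_space A R "d b" 1 "arrs s1 ''q''" n by (rule sp)
  let ?P = "\<lambda>s'. S.search_done (arrs s' ''q'') (regs s' ''tl'') (arrs s' ''vis'') (arrs s' ''dist'') (arrs s' ''par'')"
  have r2: "runs w (bfs (Get ''comp'' (Reg ''y'') =. Reg ''a'')) (10 + (\<Sum>v\<in>A. 40 + 54 * deg v)) s1 ?P"
  proof (rule runs_bfs[OF sp _ st1])
    show "y < n \<and> d z y = 1" if "z \<in> A" "(z, y) \<in> R" for z y
      using that An by (auto simp: R_def)
    show "regs s1 ''tl'' = 1" "regs s1 ''hd'' = 0" using s1 by simp_all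
    show "\<forall>v<n. arrs s1 ''vis'' v = of_bool (v \<in> arrs s1 ''q'' ` {..<1})"
      using s1 un by (auto simp: unvisited_def lessThan_Suc)
    show "\<forall>i<1. arrs s1 ''dist'' (arrs s1 ''q'' i) = 0" using s1 by simp
    fix s' z y
    assume fr: "same_except {''z'', ''hd'', ''j'', ''y'', ''tl''} {''vis'', ''dist'', ''par'', ''q''} s1 s'"
      and z: "z \<in> A" and y: "y < n" "d z y = 1" and r: "regs s' ''y'' = y"
    have "arrs s' ''comp'' = arrs s ''comp''" "regs s' ''a'' = regs s ''a''"
      using same_exceptD[OF fr] same_exceptD[OF fr1] by simp_all
    then show "expr_val w s' (Get ''comp'' (Reg ''y'') =. Reg ''a'') \<noteq> 0 \<longleftrightarrow> (z, y) \<in> R"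
      using r y z w_pos by (auto simp: R_def A)
  qed simp
  have fin: "card A \<le> n" using card_mono[OF _ An] by simp
  have Q: "cell_searched A b s'" if "?P s'" for s'
  proof -
    let ?q = "arrs s' ''q''" and ?t = "regs s' ''tl''"
    have 1: "inj_on ?q {..<?t}" "?q ` {..<?t} = A" "?t = card A" "\<forall>v\<in>A. arrs s' ''dist'' v = d b v"
      "\<forall>i j. i \<le> j \<longrightarrow> j < ?t \<longrightarrow> d b (?q i) \<le> d b (?q j)" "?q 0 = b"
      using that s1 unfolding S.search_done_def by auto
    moreover have "arrs s' ''par'' (?q i) \<in> A.preds b (?q i)" if i: "0 < i" "i < ?t" for i
    proof -
      obtain j where "arrs s' ''par'' (?q i) = ?q j" "(?q j, ?q i) \<in> R" "d b (?q i) = Suc (d b (?q j))"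
        using \<open>?P s'\<close> i unfolding S.search_done_def by (metis Suc_leI One_nat_def)
      then show ?thesis by (auto simp: A.preds_def R_def)
    qed
    ultimately show ?thesis by (simp add: cell_searched_def enumerates_def)
  qed
  have r3: "runs w clean (10 + 20 * card A) s2 (\<lambda>s'. cell_searched A b s' \<and> unvisited s')" if "?P s2" for s2
  proof (rule runs_mono_frame[OF runs_clean[where A = A]])
    show "inj_on (arrs s2 ''q'') {..<regs s2 ''tl''}" "arrs s2 ''q'' ` {..<regs s2 ''tl''} = A" "A \<subseteq> {..<n}"
      using that An unfolding S.search_done_def by auto
    show "arrs s2 ''vis'' v = 0" if "v < n" "v \<notin> A" for v
      using \<open>?P s2\<close> that unfolding S.search_done_def by simp
    fix s' assume "unvisited s'" and fr: "same_except (written_regs clean) (written_arrs clean) s2 s'"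
    then show "cell_searched A b s' \<and> unvisited s'"
      using Q[OF that] same_exceptD[OF fr] by (simp add: cell_searched_def)
  qed simp
  show ?thesis unfolding cell_search_def b_def[symmetric]
  proof (rule runs_loop_free_Seq)
    show "runs w (bfs (Get ''comp'' (Reg ''y'') =. Reg ''a'') ;; clean)
      (20 + (\<Sum>v\<in>A. 40 + 54 * deg v) + 20 * card A) (eval_prog w (start_search x) s)
      (\<lambda>s'. cell_searched A b s' \<and> unvisited s')"
      unfolding s1_def[symmetric] by (rule runs_Seq[OF r2 r3]) simp_all
  qed (simp_all add: start_search_def sum.distrib)
qed

end

section \<open>Lists of predecessors\<close>

definition collect_step :: prog where
  "collect_step =
     (''y'' ::= Get ''nbr'' (Reg ''j'') ;;
      Cond (Get ''comp'' (Reg ''y'') =. Reg ''a'')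
        (Cond (Get ''dist'' (Reg ''y'') <. Get ''dist'' (Reg ''v''))
          (Put ''prd'' (Reg ''c'') (Reg ''y'') ;; ''c'' ::= Reg ''c'' +. Const 1) Skip) Skip)"

text \<open>The predecessors of \<open>v\<close> are packed into \<open>prd\<close> from
  \<open>off[v]\<close> on, within the segment that the neighbours of \<open>v\<close> occupy in
  \<open>nbr\<close>; being neighbours themselves, they fit. The entry of \<open>pe\<close> marks
  the end of the list.\<close>

definition collect_vertex :: prog where
  "collect_vertex =
     (''v'' ::= Get ''q'' (Reg ''i'') ;; ''c'' ::= Get ''off'' (Reg ''v'') ;;
      For ''j'' (Get ''off'' (Reg ''v'')) (Get ''off'' (Reg ''v'' +. Const 1)) collect_step ;;
      Put ''pe'' (Reg ''v'') (Reg ''c'') ;; Put ''sz'' (Reg ''v'') (Const 1) ;;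
      Put ''cnt'' (Reg ''v'') (Const 0))"

definition collect :: prog where
  "collect = For ''i'' (Const 0) (Reg ''tl'') collect_vertex"

lemma written_collect [simp]:
  "written_regs collect_step = {''y'', ''c''}" "written_arrs collect_step = {''prd''}"
  "written_regs collect_vertex = {''v'', ''c'', ''j'', ''y''}"
  "written_arrs collect_vertex = {''prd'', ''pe'', ''sz'', ''cnt''}"
  "written_regs collect = {''i'', ''v'', ''c'', ''j'', ''y''}"
  "written_arrs collect = {''prd'', ''pe'', ''sz'', ''cnt''}"
  by (auto simp: collect_step_def collect_vertex_def collect_def)

lemma append_segment:
  assumes "l \<le> c" "f ` {l..<c} = P" "inj_on f {l..<c}" "y \<notin> P"
  shows "(f(c := y)) ` {l..<Suc c} = insert y P" "inj_on (f(c := y)) {l..<Suc c}"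
proof -
  have e: "{l..<Suc c} = insert c {l..<c}" using assms(1) by auto
  have i: "(f(c := y)) ` {l..<c} = P" using assms(2) by (auto simp: image_def)
  show "(f(c := y)) ` {l..<Suc c} = insert y P" by (simp only: e image_insert i fun_upd_same)
  have "inj_on (f(c := y)) {l..<c}" using assms(3) by (simp add: inj_on_def)
  then show "inj_on (f(c := y)) {l..<Suc c}" unfolding e using i assms(4) by (simp add: inj_on_insert)
qed

context ram_graph begin

definition lists_preds :: "nat set \<Rightarrow> nat \<Rightarrow> (nat \<Rightarrow> nat) \<Rightarrow> nat \<Rightarrow> nat \<Rightarrow> bool" where
  "lists_preds A b prd e v \<longleftrightarrow> off v \<le> e \<and> e \<le> off (Suc v) \<and>
     prd ` {off v..<e} = median_space.preds A d b v \<and> inj_on prd {off v..<e}"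

lemma segments_disjoint:
  assumes "u < n" "v < n" "u \<noteq> v" "off u \<le> i" "i < off (Suc u)"
  shows "i < off v \<or> off (Suc v) \<le> i"
proof (cases "u < v")
  case True
  then show ?thesis using off_mono[of v "Suc u"] assms by simp
next
  case False
  then show ?thesis using off_mono[of u "Suc v"] assms by simp
qed

lemma runs_collect_vertex:
  assumes st: "static s0" and A: "A = {v. v < n \<and> arrs s0 ''comp'' v = regs s0 ''a''}"
    and med: "median_space A d" and b: "b \<in> A"
    and dst: "\<forall>v\<in>A. arrs s0 ''dist'' v = d b v" and v: "arrs s0 ''q'' (regs s0 ''i'') = v" "v \<in> A"
  shows "runs w collect_vertex (30 + 40 * deg v) s0 (\<lambda>s.
     lists_preds A b (arrs s ''prd'') (arrs s ''pe'' v) v \<and>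
     (\<forall>x. x < off v \<or> off (Suc v) \<le> x \<longrightarrow> arrs s ''prd'' x = arrs s0 ''prd'' x) \<and>
     (\<forall>u. u \<noteq> v \<longrightarrow> arrs s ''pe'' u = arrs s0 ''pe'' u \<and> arrs s ''sz'' u = arrs s0 ''sz'' u \<and>
        arrs s ''cnt'' u = arrs s0 ''cnt'' u) \<and> arrs s ''sz'' v = 1 \<and> arrs s ''cnt'' v = 0)"
    (is "runs _ _ _ _ ?Q")
proof -
  interpret A: median_space A d by (rule med)
  have An: "A \<subseteq> {..<n}" using A by auto
  have vn: "v < n" using v An by auto
  have vw: "Suc v < 2 ^ w" using vn word_n by linarith
  have offw: "off (Suc v) < 2 ^ w" using off_word[of "Suc v"] vn by simp
  define s1 where "s1 = s0\<lparr>regs := (regs s0)(''v'' := v, ''c'' := off v)\<rparr>"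
  define P where "P i = {nbr j | j. off v \<le> j \<and> j < i \<and> nbr j \<in> A.preds b v}" for i
  define I where "I i s \<longleftrightarrow> off v \<le> regs s ''c'' \<and> regs s ''c'' \<le> i \<and>
      arrs s ''prd'' ` {off v..<regs s ''c''} = P i \<and> inj_on (arrs s ''prd'') {off v..<regs s ''c''} \<and>
      (\<forall>x. x < off v \<or> off (Suc v) \<le> x \<longrightarrow> arrs s ''prd'' x = arrs s0 ''prd'' x)" for i and s :: state
  have r3: "runs w (For ''j'' (Get ''off'' (Reg ''v'')) (Get ''off'' (Reg ''v'' +. Const 1)) collect_step)
     (10 + 40 * deg v) s1 (\<lambda>s. I (off (Suc v)) s \<and> regs s ''j'' = off (Suc v))"
  proof (rule runs_For[where I = I and l = "off v" and B = "\<lambda>_. 29"])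
    show "0 < w" by (rule w_pos)
    show "off v \<le> off (Suc v)" using off_step vn by blast
    show "expr_val w s1 (Get ''off'' (Reg ''v'')) = off v" using st by (simp add: s1_def static_def)
    show "off (Suc v) < 2 ^ w" by (rule offw)
    show "I (off v) (set_reg s1 ''j'' (off v))" by (auto simp: I_def s1_def P_def)
    show "4 + expr_time (Get ''off'' (Reg ''v'')) + expr_time (Get ''off'' (Reg ''v'' +. Const 1)) +
      (\<Sum>i = off v..<off (Suc v). 29 + 7 + expr_time (Get ''off'' (Reg ''v'' +. Const 1))) \<le> 10 + 40 * deg v"
      by (simp add: deg_def)
    fix i s
    assume fr: "same_except (insert ''j'' (written_regs collect_step)) (written_arrs collect_step) s1 s"
    have st': "static s" using static_same[OF _ fr] st by (simp add: s1_def static_def)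
    have e: "regs s ''v'' = v" "arrs s ''comp'' = arrs s0 ''comp''" "regs s ''a'' = regs s0 ''a''"
      "arrs s ''dist'' = arrs s0 ''dist''"
      using same_exceptD[OF fr] by (simp_all add: s1_def)
    show "expr_val w s (Get ''off'' (Reg ''v'' +. Const 1)) = off (Suc v)"
      using e st' vw w_pos by (simp add: static_def mod_Suc_eq)
    assume i: "off v \<le> i" "i < off (Suc v)" "regs s ''j'' = i" and Ii: "I i s"
    note na = nbr_adj[OF vn i(1,2)]
    let ?y = "nbr i"
    \<comment> \<open>Inside the cell, neighbours differ in their distance from \<open>b\<close> by
      exactly one, so comparing two \<open>dist\<close> entries recognises a predecessor.\<close>
    have iff: "?y \<in> A.preds b v \<longleftrightarrow> arrs s ''comp'' ?y = regs s ''a'' \<and> arrs s ''dist'' ?y < arrs s ''dist'' v"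
    proof (cases "?y \<in> A")
      case True
      have "d b v = Suc (d b ?y) \<longleftrightarrow> d b ?y < d b v"
        using A.adj_dist_cases[OF v(2) True b na(2)] by auto
      then show ?thesis using True v(2) dst na adjacency_sym[of ?y v] unfolding A.preds_def e
        by (auto simp: A)
    next
      case False
      then show ?thesis using na unfolding A.preds_def e by (auto simp: A)
    qed
    have new: "?y \<notin> P i"
    proof
      assume "?y \<in> P i"
      then obtain j where "off v \<le> j" "j < i" "nbr j = nbr i" by (auto simp: P_def)
      then show False using inj_onD[OF nbrs_inj[OF vn], of j i] i by simp
    qed
    have Pi: "P (Suc i) = (if ?y \<in> A.preds b v then insert ?y (P i) else P i)"
      using i by (auto simp: P_def less_Suc_eq)
    have cw: "Suc (regs s ''c'') < 2 ^ w" using Ii i offw by (simp add: I_def)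
    define s2 where "s2 = eval_prog w collect_step s"
    have s2: "s2 = (if ?y \<in> A.preds b v then s\<lparr>regs := (regs s)(''y'' := ?y, ''c'' := Suc (regs s ''c'')),
        arrs := (arrs s)(''prd'' := (arrs s ''prd'')(regs s ''c'' := ?y))\<rparr> else set_reg s ''y'' ?y)"
      using cw w_pos i st' e unfolding iff by (simp add: s2_def collect_step_def static_def mod_Suc_eq)
    have "I (Suc i) (set_reg s2 ''j'' (Suc i))"
    proof (cases "?y \<in> A.preds b v")
      case True
      have I': "off v \<le> regs s ''c''" "regs s ''c'' \<le> i" "arrs s ''prd'' ` {off v..<regs s ''c''} = P i"
        "inj_on (arrs s ''prd'') {off v..<regs s ''c''}"
        "\<forall>x. x < off v \<or> off (Suc v) \<le> x \<longrightarrow> arrs s ''prd'' x = arrs s0 ''prd'' x"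
        using Ii by (simp_all add: I_def)
      note app = append_segment[OF I'(1,3,4) new]
      show ?thesis using True I'(1,2,5) i(2) app unfolding s2 by (simp add: I_def Pi)
    next
      case False
      then show ?thesis using Ii unfolding s2 by (auto simp: I_def Pi)
    qed
    moreover have "regs s2 ''j'' = i" using i(3) unfolding s2 by simp
    ultimately show "runs w collect_step 29 s (\<lambda>s'. regs s' ''j'' = i \<and> I (Suc i) (set_reg s' ''j'' (Suc i)))"
      by (intro runs_loop_freeI[OF s2_def]) (simp_all add: collect_step_def)
  qed
  have Pfin: "P (off (Suc v)) = A.preds b v"
  proof -
    have "\<exists>j. off v \<le> j \<and> j < off (Suc v) \<and> nbr j = p" if "p \<in> A.preds b v" for p
      using adj_nbr[OF vn, of p] A.predsD[OF that] An by blast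
    then show ?thesis unfolding P_def by blast
  qed
  have r4: "runs w (Put ''pe'' (Reg ''v'') (Reg ''c'') ;; Put ''sz'' (Reg ''v'') (Const 1) ;;
      Put ''cnt'' (Reg ''v'') (Const 0)) 9 s ?Q"
    if I: "I (off (Suc v)) s \<and> regs s ''j'' = off (Suc v)"
      and fr: "same_except (written_regs (For ''j'' (Get ''off'' (Reg ''v'')) (Get ''off'' (Reg ''v'' +. Const 1)) collect_step))
        (written_arrs (For ''j'' (Get ''off'' (Reg ''v'')) (Get ''off'' (Reg ''v'' +. Const 1)) collect_step)) s1 s" for s
    using I same_exceptD[OF fr] w_pos
    by (intro runs_loop_free) (simp_all add: s1_def I_def Pfin lists_preds_def)
  show ?thesis unfolding collect_vertex_def
  proof (rule runs_Assign_Seq, rule runs_Assign_Seq)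
    have "set_reg (set_reg s0 ''v'' (expr_val w s0 (Get ''q'' (Reg ''i'')))) ''c''
      (expr_val w (set_reg s0 ''v'' (expr_val w s0 (Get ''q'' (Reg ''i'')))) (Get ''off'' (Reg ''v''))) = s1"
      using st v by (simp add: s1_def static_def)
    then show "runs w (For ''j'' (Get ''off'' (Reg ''v'')) (Get ''off'' (Reg ''v'' +. Const 1)) collect_step ;;
      Put ''pe'' (Reg ''v'') (Reg ''c'') ;; Put ''sz'' (Reg ''v'') (Const 1) ;;
      Put ''cnt'' (Reg ''v'') (Const 0)) (19 + 40 * deg v)
     (set_reg (set_reg s0 ''v'' (expr_val w s0 (Get ''q'' (Reg ''i'')))) ''c''
      (expr_val w (set_reg s0 ''v'' (expr_val w s0 (Get ''q'' (Reg ''i'')))) (Get ''off'' (Reg ''v'')))) ?Q"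
      by (simp only:) (rule runs_Seq[OF r3 r4]; simp)
  qed (rule order_refl, simp)
qed

lemma runs_collect:
  assumes st: "static s0" and A: "A = {v. v < n \<and> arrs s0 ''comp'' v = regs s0 ''a''}"
    and med: "median_space A d" and b: "b \<in> A" and cs: "cell_searched A b s0"
  shows "runs w collect (10 + (\<Sum>v\<in>A. 40 + 40 * deg v)) s0 (\<lambda>s.
     \<forall>v\<in>A. lists_preds A b (arrs s ''prd'') (arrs s ''pe'' v) v \<and> arrs s ''sz'' v = 1 \<and> arrs s ''cnt'' v = 0)"
proof -
  interpret A: median_space A d by (rule med)
  let ?q = "arrs s0 ''q''" and ?t = "regs s0 ''tl''"
  have en: "enumerates ?q ?t A" and dst: "\<forall>v\<in>A. arrs s0 ''dist'' v = d b v"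
    using cs by (auto simp: cell_searched_def)
  note en' = enumeratesD[OF en]
  have An: "A \<subseteq> {..<n}" using A by auto
  have tn: "?t \<le> n" using card_mono[OF _ An] en'(4) by simp
  let ?I = "\<lambda>i s. \<forall>k<i. lists_preds A b (arrs s ''prd'') (arrs s ''pe'' (?q k)) (?q k) \<and>
    arrs s ''sz'' (?q k) = 1 \<and> arrs s ''cnt'' (?q k) = 0"
  have "runs w collect (10 + (\<Sum>v\<in>A. 40 + 40 * deg v)) s0 (\<lambda>s. ?I ?t s \<and> regs s ''i'' = ?t)"
    unfolding collect_def
  proof (rule runs_For[where I = ?I and l = 0 and B = "\<lambda>i. 30 + 40 * deg (?q i)"])
    show "?t < 2 ^ w" using tn word_n by linarith
    show "4 + expr_time (Const 0) + expr_time (Reg ''tl'') +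
      (\<Sum>i = 0..<?t. 30 + 40 * deg (?q i) + 7 + expr_time (Reg ''tl'')) \<le> 10 + (\<Sum>v\<in>A. 40 + 40 * deg v)"
      using sum_enumerates[OF en, of "\<lambda>v. 40 + 40 * deg v"] sum_mono[of "{..<?t}" "\<lambda>i. 38 + 40 * deg (?q i)" "\<lambda>i. 40 + 40 * deg (?q i)"]
      by (simp add: atLeast0LessThan)
    fix i s
    assume fr: "same_except (insert ''i'' (written_regs collect_vertex)) (written_arrs collect_vertex) s0 s"
    note e = same_exceptD[OF fr]
    show "expr_val w s (Reg ''tl'') = ?t" using e by simp
    assume i: "i < ?t" "regs s ''i'' = i" and I: "?I i s"
    have st': "static s" using static_same[OF st fr] by simp
    have qA: "?q i \<in> A" using en'(1) i by blast
    show "runs w collect_vertex (30 + 40 * deg (?q i)) s (\<lambda>s'. regs s' ''i'' = i \<and> ?I (Suc i) (set_reg s' ''i'' (Suc i)))"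
    proof (rule runs_mono_frame[OF runs_collect_vertex[OF st' _ med b _ _ qA]])
      show "A = {v. v < n \<and> arrs s ''comp'' v = regs s ''a''}" using e A by simp
      show "\<forall>v\<in>A. arrs s ''dist'' v = d b v" using e dst by simp
      show "arrs s ''q'' (regs s ''i'') = ?q i" using e i by simp
      fix s'
      assume Q: "lists_preds A b (arrs s' ''prd'') (arrs s' ''pe'' (?q i)) (?q i) \<and>
       (\<forall>x. x < off (?q i) \<or> off (Suc (?q i)) \<le> x \<longrightarrow> arrs s' ''prd'' x = arrs s ''prd'' x) \<and>
       (\<forall>u. u \<noteq> ?q i \<longrightarrow> arrs s' ''pe'' u = arrs s ''pe'' u \<and> arrs s' ''sz'' u = arrs s ''sz'' u \<and>
        arrs s' ''cnt'' u = arrs s ''cnt'' u) \<and> arrs s' ''sz'' (?q i) = 1 \<and> arrs s' ''cnt'' (?q i) = 0"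
       and fr2: "same_except (written_regs collect_vertex) (written_arrs collect_vertex) s s'"
      have "lists_preds A b (arrs s' ''prd'') (arrs s' ''pe'' (?q k)) (?q k) \<and>
         arrs s' ''sz'' (?q k) = 1 \<and> arrs s' ''cnt'' (?q k) = 0" if k: "k < Suc i" for k
      proof (cases "k = i")
        case True
        then show ?thesis using Q by simp
      next
        case False
        then have ki: "k < i" using k by simp
        then have ne: "?q k \<noteq> ?q i" using en'(3)[of k i] i by auto
        have qk: "?q k < n" "?q i < n" using en'(1)[of k] qA An ki i by auto
        have lp: "lists_preds A b (arrs s ''prd'') (arrs s ''pe'' (?q k)) (?q k)" using I ki by blast
        have "arrs s' ''prd'' x = arrs s ''prd'' x" if x: "off (?q k) \<le> x" "x < arrs s ''pe'' (?q k)" for x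
          using segments_disjoint[OF qk ne x(1)] x(2) lp Q by (auto simp: lists_preds_def)
        then have "arrs s' ''prd'' ` {off (?q k)..<arrs s ''pe'' (?q k)} = arrs s ''prd'' ` {off (?q k)..<arrs s ''pe'' (?q k)}"
          "inj_on (arrs s' ''prd'') {off (?q k)..<arrs s ''pe'' (?q k)} = inj_on (arrs s ''prd'') {off (?q k)..<arrs s ''pe'' (?q k)}"
          by (auto intro!: image_cong inj_on_cong)
        then show ?thesis using lp I ki Q ne by (simp add: lists_preds_def)
      qed
      then show "regs s' ''i'' = i \<and> ?I (Suc i) (set_reg s' ''i'' (Suc i))"
        using i same_exceptD[OF fr2] by simp
    qed simp
  qed (use w_pos in simp_all)
  then show ?thesis
  proof (rule runs_mono)
    fix s assume a: "?I ?t s \<and> regs s ''i'' = ?t"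
    show "\<forall>v\<in>A. lists_preds A b (arrs s ''prd'') (arrs s ''pe'' v) v \<and> arrs s ''sz'' v = 1 \<and> arrs s ''cnt'' v = 0"
    proof
      fix v assume "v \<in> A"
      from en'(2)[OF this] obtain k where "k < ?t" "v = ?q k" by blast
      with a show "lists_preds A b (arrs s ''prd'') (arrs s ''pe'' v) v \<and>
        arrs s ''sz'' v = 1 \<and> arrs s ''cnt'' v = 0" by simp
    qed
  qed simp
qed

end

section \<open>Sums of class names and labels of tree edges\<close>

definition common_step :: prog where
  "common_step = Cond (Get ''prd'' (Reg ''j'') =. Get ''prd'' (Reg ''k''))
     (''g'' ::= Get ''prd'' (Reg ''j'')) Skip"

text \<open>Comparing all pairs is affordable because predecessor lists have logarithmic length;
  this contributes two logarithmic factors to the running time.\<close>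

definition common :: prog where
  "common = For ''j'' (Get ''off'' (Reg ''p'')) (Get ''pe'' (Reg ''p''))
     (For ''k'' (Get ''off'' (Reg ''r'')) (Get ''pe'' (Reg ''r'')) common_step)"

text \<open>If \<open>p\<close> and \<open>r\<close> are the first two predecessors of \<open>v\<close> and \<open>g\<close> closes the square, the classes
  separating \<open>b\<close> from \<open>v\<close> are those of \<open>p\<close> and those of \<open>r\<close>, the classes of \<open>g\<close> being common.\<close>

definition hash_vertex :: prog where
  "hash_vertex =
     (''v'' ::= Get ''q'' (Reg ''i'') ;;
      Cond (Get ''pe'' (Reg ''v'') =. Get ''off'' (Reg ''v''))
        (Put ''h'' (Reg ''v'') (Const 0))
        (''p'' ::= Get ''prd'' (Get ''off'' (Reg ''v'')) ;;
         Cond (Get ''pe'' (Reg ''v'') =. Get ''off'' (Reg ''v'') +. Const 1)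
           (Put ''h'' (Reg ''v'') (Get ''h'' (Reg ''p'') +. Reg ''v''))
           (''r'' ::= Get ''prd'' (Get ''off'' (Reg ''v'') +. Const 1) ;;
            common ;;
            Put ''h'' (Reg ''v'') (Get ''h'' (Reg ''p'') +. Get ''h'' (Reg ''r'') -. Get ''h'' (Reg ''g'')))) ;;
      Put ''lab'' (Reg ''v'') (Get ''h'' (Reg ''v'') -. Get ''h'' (Get ''par'' (Reg ''v''))))"

definition hashes :: prog where
  "hashes = For ''i'' (Const 0) (Reg ''tl'') hash_vertex"

lemma written_hashes [simp]:
  "written_regs common_step = {''g''}" "written_arrs common_step = {}"
  "written_regs common = {''g'', ''j'', ''k''}" "written_arrs common = {}"
  "written_regs hash_vertex = {''v'', ''p'', ''r'', ''g'', ''j'', ''k''}"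
  "written_arrs hash_vertex = {''h'', ''lab''}"
  "written_regs hashes = {''i'', ''v'', ''p'', ''r'', ''g'', ''j'', ''k''}"
  "written_arrs hashes = {''h'', ''lab''}"
  by (auto simp: common_step_def common_def hash_vertex_def hashes_def)

lemma (in median_space) card_sig: "card (sig b v) \<le> card V"
  using sig_sub finite_V by (rule card_mono[rotated])

context ram_graph begin

text \<open>A signature has at most \<open>n\<close> elements, each below \<open>n\<close>; so the
  sums fit into a word unreduced, and their differences give names exactly.\<close>

lemma hash_le:
  assumes "median_space A d" "A \<subseteq> {..<n}"
  shows "median_space.hash A d (\<lambda>r. r) b v \<le> n * n"
proof -
  interpret A: median_space A d by fact
  have "A.hash (\<lambda>r. r) b v \<le> (\<Sum>r\<in>A.sig b v. n)"
    unfolding A.hash_def using A.sig_sub[of b v] assms(2) by (intro sum_mono) (force intro: less_imp_le)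
  also have "\<dots> \<le> card A * n" using A.card_sig[of b v] by simp
  also have "\<dots> \<le> n * n" using card_mono[OF _ assms(2)] by simp
  finally show ?thesis .
qed

lemma runs_common:
  assumes P: "arrs s0 ''off'' (regs s0 ''p'') = lp" "arrs s0 ''pe'' (regs s0 ''p'') = hp" "lp \<le> hp" "hp < 2 ^ w"
    and R: "arrs s0 ''off'' (regs s0 ''r'') = lr" "arrs s0 ''pe'' (regs s0 ''r'') = hr" "lr \<le> hr" "hr < 2 ^ w"
    and G: "G \<in> arrs s0 ''prd'' ` {lp..<hp}" "G \<in> arrs s0 ''prd'' ` {lr..<hr}"
    and uniq: "\<And>j k. lp \<le> j \<Longrightarrow> j < hp \<Longrightarrow> lr \<le> k \<Longrightarrow> k < hr \<Longrightarrow>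
      arrs s0 ''prd'' j = arrs s0 ''prd'' k \<Longrightarrow> arrs s0 ''prd'' j = G"
  shows "runs w common (10 + (hp - lp) * (30 + 30 * (hr - lr))) s0 (\<lambda>s. regs s ''g'' = G)"
proof -
  let ?prd = "arrs s0 ''prd''"
  let ?I = "\<lambda>j s. G \<in> ?prd ` {lp..<j} \<longrightarrow> regs s ''g'' = G"
  have "runs w common (10 + (hp - lp) * (30 + 30 * (hr - lr))) s0 (\<lambda>s. ?I hp s \<and> regs s ''j'' = hp)"
    unfolding common_def
  proof (rule runs_For[where I = ?I and l = lp and B = "\<lambda>_. 10 + 20 * (hr - lr)"])
    show "4 + expr_time (Get ''off'' (Reg ''p'')) + expr_time (Get ''pe'' (Reg ''p'')) +
      (\<Sum>i = lp..<hp. 10 + 20 * (hr - lr) + 7 + expr_time (Get ''pe'' (Reg ''p''))) \<le>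
      10 + (hp - lp) * (30 + 30 * (hr - lr))" by (simp add: algebra_simps)
    fix j s
    let ?b = "For ''k'' (Get ''off'' (Reg ''r'')) (Get ''pe'' (Reg ''r'')) common_step"
    assume fr: "same_except (insert ''j'' (written_regs ?b)) (written_arrs ?b) s0 s"
    note e = same_exceptD[OF fr]
    show "expr_val w s (Get ''pe'' (Reg ''p'')) = hp" using e P by simp
    assume j: "lp \<le> j" "j < hp" "regs s ''j'' = j" and I: "?I j s"
    \<comment> \<open>Once both occurrences of \<open>G\<close> have been compared, \<open>g\<close>
      holds \<open>G\<close> for good, because by \<open>uniq\<close> any later match assigns
      \<open>G\<close> again.\<close>
    let ?J = "\<lambda>k s. (G \<in> ?prd ` {lp..<j} \<or> ?prd j = G \<and> G \<in> ?prd ` {lr..<k}) \<longrightarrow> regs s ''g'' = G"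
    have "runs w ?b (10 + 20 * (hr - lr)) s (\<lambda>s. ?J hr s \<and> regs s ''k'' = hr)"
    proof (rule runs_For[where I = ?J and l = lr and B = "\<lambda>_. 9"])
      show "expr_val w s (Get ''off'' (Reg ''r'')) = lr" using e R by simp
      show "?J lr (set_reg s ''k'' lr)" using I by simp
      fix k s'
      assume fr': "same_except (insert ''k'' (written_regs common_step)) (written_arrs common_step) s s'"
      note e' = same_exceptD[OF fr']
      show "expr_val w s' (Get ''pe'' (Reg ''r'')) = hr" using e e' R by simp
      assume k: "lr \<le> k" "k < hr" "regs s' ''k'' = k" and J: "?J k s'"
      have pe: "arrs s' ''prd'' = ?prd" "regs s' ''j'' = j" using e e' j by simp_all
      have seg: "{lr..<Suc k} = insert k {lr..<k}" using k by auto
      show "runs w common_step 9 s' (\<lambda>s'. regs s' ''k'' = k \<and> ?J (Suc k) (set_reg s' ''k'' (Suc k)))"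
      proof (cases "?prd j = ?prd k")
        case True
        then show ?thesis unfolding common_step_def using k pe w_pos uniq[OF j(1,2) k(1,2)]
          by (intro runs_loop_free) simp_all
      next
        case False
        then have "?J (Suc k) (set_reg s' ''k'' (Suc k))" using J unfolding seg by auto
        with False show ?thesis unfolding common_step_def using k pe w_pos
          by (intro runs_loop_free) simp_all
      qed
    qed (use w_pos R in auto)
    moreover have "{lp..<Suc j} = insert j {lp..<j}" using j by auto
    ultimately show "runs w ?b (10 + 20 * (hr - lr)) s (\<lambda>s'. regs s' ''j'' = j \<and> ?I (Suc j) (set_reg s' ''j'' (Suc j)))"
      using G(2) j(3) by (elim runs_mono_frame) (auto dest: same_exceptD(1)[where x = "''j''"])
  qed (use w_pos P in auto)
  then show ?thesis by (rule runs_mono) (use G in auto)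
qed

text \<open>The base has no tree edge and its \<open>par\<close> entry is a leftover, hence the
  exception for \<open>lab\<close>.\<close>

definition labelled :: "nat set \<Rightarrow> nat \<Rightarrow> state \<Rightarrow> nat \<Rightarrow> bool" where
  "labelled A b s v \<longleftrightarrow> arrs s ''h'' v = median_space.hash A d (\<lambda>r. r) b v \<and>
     (v \<noteq> b \<longrightarrow> arrs s ''lab'' v = median_space.lab A d b (arrs s ''par'' v) v)"

lemma runs_hash_vertex:
  assumes st: "static s0" and An: "A \<subseteq> {..<n}" and med: "median_space A d" and b: "b \<in> A"
    and v: "arrs s0 ''q'' (regs s0 ''i'') = v" "v \<in> A"
    and lp: "\<And>u. u \<in> A \<Longrightarrow> lists_preds A b (arrs s0 ''prd'') (arrs s0 ''pe'' u) u"
    and h: "\<And>u. u \<in> A \<Longrightarrow> d b u < d b v \<Longrightarrow> arrs s0 ''h'' u = median_space.hash A d (\<lambda>r. r) b u"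
    and par: "v \<noteq> b \<Longrightarrow> arrs s0 ''par'' v \<in> median_space.preds A d b v"
    and L: "\<And>u. u \<in> A \<Longrightarrow> card (median_space.preds A d b u) \<le> L"
  shows "runs w hash_vertex (80 + L * (30 + 30 * L)) s0 (\<lambda>s. labelled A b s v \<and>
     (\<forall>u. u \<noteq> v \<longrightarrow> arrs s ''h'' u = arrs s0 ''h'' u \<and> arrs s ''lab'' u = arrs s0 ''lab'' u))"
proof -
  interpret A: median_space A d by (rule med)
  let ?h = "A.hash (\<lambda>r. r) b"
  let ?Q = "\<lambda>s. arrs s ''h'' = (arrs s0 ''h'')(v := ?h v) \<and> regs s ''v'' = v"
  have vn: "v < n" using v An by auto
  have hle: "?h u \<le> n * n" for u using hash_le[OF med An] .
  have hw: "?h u + ?h u' < 2 ^ w" for u u' using hle[of u] hle[of u'] word_gt by simp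
  have hw2: "?h u + x < 2 ^ w" if "x < n" for u x using hle[of u] that word_gt by simp
  have pe: "arrs s0 ''pe'' u = off u + card (A.preds b u)"
    "off u + card (A.preds b u) \<le> off (Suc u)" if "u \<in> A" for u
  proof -
    have "card (A.preds b u) = arrs s0 ''pe'' u - off u" "off u \<le> arrs s0 ''pe'' u"
      using lp[OF that] card_image[of "arrs s0 ''prd''" "{off u..<arrs s0 ''pe'' u}"]
      by (auto simp: lists_preds_def)
    then show "arrs s0 ''pe'' u = off u + card (A.preds b u)"
      "off u + card (A.preds b u) \<le> off (Suc u)"
      using lp[OF that] by (auto simp: lists_preds_def)
  qed
  have img: "arrs s0 ''prd'' ` {off u..<off u + card (A.preds b u)} = A.preds b u"
    "inj_on (arrs s0 ''prd'') {off u..<off u + card (A.preds b u)}" if "u \<in> A" for u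
    using lp[OF that] pe(1)[OF that] by (simp_all add: lists_preds_def)
  have offw: "off u + card (A.preds b u) < 2 ^ w" if "u \<in> A" for u
    using pe(2)[OF that] off_word[of "Suc u"] that An by auto
  define s1 where "s1 = set_reg s0 ''v'' v"
  have s1: "arrs s1 = arrs s0" "regs s1 ''v'' = v" "arrs s1 ''off'' = off" "static s1"
    using st by (simp_all add: s1_def static_def)
  let ?k = "card (A.preds b v)"
  let ?p = "arrs s0 ''prd'' (off v)" and ?r = "arrs s0 ''prd'' (Suc (off v))"
  have v1: "Suc (off v) < 2 ^ w" using off_le[of v] vn word_gt by simp
  have main: "runs w (Cond (Get ''pe'' (Reg ''v'') =. Get ''off'' (Reg ''v''))
        (Put ''h'' (Reg ''v'') (Const 0))
        (''p'' ::= Get ''prd'' (Get ''off'' (Reg ''v'')) ;;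
         Cond (Get ''pe'' (Reg ''v'') =. Get ''off'' (Reg ''v'') +. Const 1)
           (Put ''h'' (Reg ''v'') (Get ''h'' (Reg ''p'') +. Reg ''v''))
           (''r'' ::= Get ''prd'' (Get ''off'' (Reg ''v'') +. Const 1) ;;
            common ;;
            Put ''h'' (Reg ''v'') (Get ''h'' (Reg ''p'') +. Get ''h'' (Reg ''r'') -. Get ''h'' (Reg ''g''))))) (60 + L * (30 + 30 * L)) s1 ?Q"
  proof (rule runs_Cond)
    assume "expr_val w s1 (Get ''pe'' (Reg ''v'') =. Get ''off'' (Reg ''v'')) \<noteq> 0"
    then have "?k = 0" using s1 pe[OF v(2)] w_pos by (auto split: if_splits)
    then have "v = b" using A.preds_nonempty[OF b v(2)] by fastforce
    then have "?h v = 0" using A.hash_base[OF b] by simp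
    then show "runs w (Put ''h'' (Reg ''v'') (Const 0)) (54 + L * (30 + 30 * L)) s1 ?Q"
      using s1 by (intro runs_loop_free) simp_all
  next
    assume "expr_val w s1 (Get ''pe'' (Reg ''v'') =. Get ''off'' (Reg ''v'')) = 0"
    then have k0: "?k \<noteq> 0" using s1 pe[OF v(2)] w_pos by (auto split: if_splits)
    define s2 where "s2 = set_reg s1 ''p'' ?p"
    have s2: "arrs s2 = arrs s0" "regs s2 ''v'' = v" "regs s2 ''p'' = ?p" using s1 by (simp_all add: s2_def)
    have "?p \<in> arrs s0 ''prd'' ` {off v..<off v + ?k}" using k0 by (intro imageI) (simp add: card_gt_0_iff)
    then have pp: "?p \<in> A.preds b v" using img(1)[OF v(2)] by simp
    note pD = A.predsD[OF pp]
    have vb: "v \<noteq> b" using pp by auto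
    have hp: "arrs s0 ''h'' ?p = ?h ?p" using h pD by simp
    show "runs w (''p'' ::= Get ''prd'' (Get ''off'' (Reg ''v'')) ;;
         Cond (Get ''pe'' (Reg ''v'') =. Get ''off'' (Reg ''v'') +. Const 1)
           (Put ''h'' (Reg ''v'') (Get ''h'' (Reg ''p'') +. Reg ''v''))
           (''r'' ::= Get ''prd'' (Get ''off'' (Reg ''v'') +. Const 1) ;;
            common ;;
            Put ''h'' (Reg ''v'') (Get ''h'' (Reg ''p'') +. Get ''h'' (Reg ''r'') -. Get ''h'' (Reg ''g''))))
       (54 + L * (30 + 30 * L)) s1 ?Q"
    proof (rule runs_Assign_Seq[where T' = "50 + L * (30 + 30 * L)"])
      have "set_reg s1 ''p'' (expr_val w s1 (Get ''prd'' (Get ''off'' (Reg ''v'')))) = s2"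
        using s1 by (simp add: s2_def)
      moreover have "runs w (Cond (Get ''pe'' (Reg ''v'') =. Get ''off'' (Reg ''v'') +. Const 1)
           (Put ''h'' (Reg ''v'') (Get ''h'' (Reg ''p'') +. Reg ''v''))
           (''r'' ::= Get ''prd'' (Get ''off'' (Reg ''v'') +. Const 1) ;;
            common ;;
            Put ''h'' (Reg ''v'') (Get ''h'' (Reg ''p'') +. Get ''h'' (Reg ''r'') -. Get ''h'' (Reg ''g''))))
       (50 + L * (30 + 30 * L)) s2 ?Q"
      proof (rule runs_Cond)
        assume "expr_val w s2 (Get ''pe'' (Reg ''v'') =. Get ''off'' (Reg ''v'') +. Const 1) \<noteq> 0"
        then have "?k = 1" using s1(3) s1(1) s2 pe[OF v(2)] w_pos v1 by (auto simp: mod_Suc_eq split: if_splits)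
        then have "A.preds b v = {?p}" using pp by (metis card_1_singletonE singletonD)
        then have "?h v = ?h ?p + v"
          using A.hash_pred[OF b v(2) pp] A.lab_unique_pred[OF b v(2)] by simp
        then show "runs w (Put ''h'' (Reg ''v'') (Get ''h'' (Reg ''p'') +. Reg ''v'')) (40 + L * (30 + 30 * L)) s2 ?Q"
          using s2 hp hw2[OF vn, of ?p] by (intro runs_loop_free) simp_all
      next
        assume "expr_val w s2 (Get ''pe'' (Reg ''v'') =. Get ''off'' (Reg ''v'') +. Const 1) = 0"
        then have k1: "?k \<noteq> 1" using s1(3) s1(1) s2 pe[OF v(2)] w_pos v1 by (auto simp: mod_Suc_eq split: if_splits)
        then have k2: "2 \<le> ?k" using k0 by linarith
        have "?r \<in> arrs s0 ''prd'' ` {off v..<off v + ?k}" using k2 by (intro imageI) simp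
        then have rr: "?r \<in> A.preds b v" using img(1)[OF v(2)] by simp
        have pr: "?p \<noteq> ?r" using inj_onD[OF img(2)[OF v(2)], of "off v" "Suc (off v)"] k2 by auto
        note rD = A.predsD[OF rr]
        have hr: "arrs s0 ''h'' ?r = ?h ?r" using h rD by simp
        obtain G where G: "G \<in> A.preds b ?p" "G \<in> A.preds b ?r" using A.common_pred[OF b v(2) pp rr pr] by blast
        have Gu: "G' = G" if "G' \<in> A.preds b ?p" "G' \<in> A.preds b ?r" for G'
          using A.common_pred_unique[OF v(2) pp rr pr that G] .
        have hG: "arrs s0 ''h'' G = ?h G" using h[of G] A.predsD[OF G(1)] pD by simp
        have sq: "?h v + ?h G = ?h ?p + ?h ?r" using A.hash_square[OF b v(2) pp rr pr G] .
        define s3 where "s3 = set_reg s2 ''r'' ?r"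
        have s3: "arrs s3 = arrs s0" "regs s3 ''v'' = v" "regs s3 ''p'' = ?p" "regs s3 ''r'' = ?r"
          using s2 by (simp_all add: s3_def)
        have c: "runs w common (10 + L * (30 + 30 * L)) s3 (\<lambda>s. regs s ''g'' = G)"
        proof (rule runs_mono[OF runs_common])
          show "arrs s3 ''off'' (regs s3 ''p'') = off ?p" "arrs s3 ''off'' (regs s3 ''r'') = off ?r"
            using s3 s1 by simp_all
          show "arrs s3 ''pe'' (regs s3 ''p'') = off ?p + card (A.preds b ?p)"
            "arrs s3 ''pe'' (regs s3 ''r'') = off ?r + card (A.preds b ?r)"
            using s3 pe pD rD by simp_all
          show "G \<in> arrs s3 ''prd'' ` {off ?p..<off ?p + card (A.preds b ?p)}"
            "G \<in> arrs s3 ''prd'' ` {off ?r..<off ?r + card (A.preds b ?r)}"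
            unfolding s3(1) img(1)[OF pD(1)] img(1)[OF rD(1)] by (fact G)+
          show "off ?p + card (A.preds b ?p) < 2 ^ w" "off ?r + card (A.preds b ?r) < 2 ^ w"
            using offw pD rD by blast+
          fix j k assume j: "off ?p \<le> j" "j < off ?p + card (A.preds b ?p)"
            "off ?r \<le> k" "k < off ?r + card (A.preds b ?r)" "arrs s3 ''prd'' j = arrs s3 ''prd'' k"
          have "arrs s0 ''prd'' j \<in> arrs s0 ''prd'' ` {off ?p..<off ?p + card (A.preds b ?p)}"
            "arrs s0 ''prd'' k \<in> arrs s0 ''prd'' ` {off ?r..<off ?r + card (A.preds b ?r)}"
            using j by (auto intro!: imageI)
          then have "arrs s3 ''prd'' j \<in> A.preds b ?p" "arrs s3 ''prd'' k \<in> A.preds b ?r"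
            by (simp_all only: s3(1) img(1)[OF pD(1)] img(1)[OF rD(1)])
          then show "arrs s3 ''prd'' j = G" using Gu j(5) by simp
        next
          have "card (A.preds b ?p) \<le> L" "card (A.preds b ?r) \<le> L" using L pD rD by blast+
          then show "10 + (off ?p + card (A.preds b ?p) - off ?p) *
            (30 + 30 * (off ?r + card (A.preds b ?r) - off ?r)) \<le> 10 + L * (30 + 30 * L)"
            by (simp add: mult_le_mono)
        qed simp_all
        show "runs w (''r'' ::= Get ''prd'' (Get ''off'' (Reg ''v'') +. Const 1) ;; common ;;
            Put ''h'' (Reg ''v'') (Get ''h'' (Reg ''p'') +. Get ''h'' (Reg ''r'') -. Get ''h'' (Reg ''g'')))
            (40 + L * (30 + 30 * L)) s2 ?Q"
        proof (rule runs_Assign_Seq[where T' = "30 + L * (30 + 30 * L)"])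
          have "set_reg s2 ''r'' (expr_val w s2 (Get ''prd'' (Get ''off'' (Reg ''v'') +. Const 1))) = s3"
            using s1(1,3) s2 v1 w_pos by (simp add: s3_def mod_Suc_eq)
          moreover have "runs w (common ;;
            Put ''h'' (Reg ''v'') (Get ''h'' (Reg ''p'') +. Get ''h'' (Reg ''r'') -. Get ''h'' (Reg ''g'')))
            (30 + L * (30 + 30 * L)) s3 ?Q"
          proof (rule runs_Seq[OF c])
            fix s assume g: "regs s ''g'' = G" and fr: "same_except (written_regs common) (written_arrs common) s3 s"
            have "(?h ?p + ?h ?r + 2 ^ w - ?h G) mod 2 ^ w = ?h v"
            proof -
              have "?h ?p + ?h ?r + 2 ^ w - ?h G = ?h v + 2 ^ w" using sq by simp
              then show ?thesis using hw2[of 0 v] vn by simp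
            qed
            then show "runs w (Put ''h'' (Reg ''v'') (Get ''h'' (Reg ''p'') +. Get ''h'' (Reg ''r'') -. Get ''h'' (Reg ''g'')))
              15 s ?Q" using g same_exceptD[OF fr] s3 hp hr hG hw[of ?p ?r]
              by (intro runs_loop_free) simp_all
          qed simp
          ultimately show "runs w (common ;;
            Put ''h'' (Reg ''v'') (Get ''h'' (Reg ''p'') +. Get ''h'' (Reg ''r'') -. Get ''h'' (Reg ''g'')))
            (30 + L * (30 + 30 * L)) (set_reg s2 ''r'' (expr_val w s2 (Get ''prd'' (Get ''off'' (Reg ''v'') +. Const 1)))) ?Q"
            by (simp only:)
        qed simp
      qed simp
      ultimately show "runs w (Cond (Get ''pe'' (Reg ''v'') =. Get ''off'' (Reg ''v'') +. Const 1)
           (Put ''h'' (Reg ''v'') (Get ''h'' (Reg ''p'') +. Reg ''v''))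
           (''r'' ::= Get ''prd'' (Get ''off'' (Reg ''v'') +. Const 1) ;;
            common ;;
            Put ''h'' (Reg ''v'') (Get ''h'' (Reg ''p'') +. Get ''h'' (Reg ''r'') -. Get ''h'' (Reg ''g''))))
       (50 + L * (30 + 30 * L)) (set_reg s1 ''p'' (expr_val w s1 (Get ''prd'' (Get ''off'' (Reg ''v''))))) ?Q"
        by (simp only:)
    qed simp
  qed simp
  show ?thesis unfolding hash_vertex_def
  proof (rule runs_Assign_Seq)
    have s1': "set_reg s0 ''v'' (expr_val w s0 (Get ''q'' (Reg ''i''))) = s1" using v by (simp add: s1_def)
    have fin: "runs w (Put ''lab'' (Reg ''v'') (Get ''h'' (Reg ''v'') -. Get ''h'' (Get ''par'' (Reg ''v'')))) 10 s
      (\<lambda>s. labelled A b s v \<and> (\<forall>u. u \<noteq> v \<longrightarrow> arrs s ''h'' u = arrs s0 ''h'' u \<and> arrs s ''lab'' u = arrs s0 ''lab'' u))"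
      if Q: "?Q s" and fr: "same_except X Y s1 s" "Y \<subseteq> {''h''}" for s X Y
    proof -
      have e: "arrs s ''par'' = arrs s0 ''par''" "arrs s ''lab'' = arrs s0 ''lab''"
        using same_exceptD(2)[OF same_except_mono[OF fr(1) order_refl fr(2)]] s1 by simp_all
      let ?x = "arrs s0 ''par'' v"
      have "(?h v + 2 ^ w - arrs s ''h'' ?x) mod 2 ^ w = A.lab b ?x v" if "v \<noteq> b"
      proof -
        note xp = par[OF that]
        have "?x \<noteq> v" using A.predsD[OF xp] by auto
        then have "arrs s ''h'' ?x = ?h ?x" using Q h[of ?x] A.predsD[OF xp] by simp
        moreover have "?h v = ?h ?x + A.lab b ?x v" using A.hash_pred[OF b v(2) xp] .
        moreover have "A.lab b ?x v < n"
          using A.lab_in_half[OF b v(2) xp] A.halfD An by blast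
        ultimately show ?thesis using word_n by simp
      qed
      then show ?thesis using Q e by (intro runs_loop_free) (simp_all add: labelled_def)
    qed
    show "runs w (Cond (Get ''pe'' (Reg ''v'') =. Get ''off'' (Reg ''v''))
        (Put ''h'' (Reg ''v'') (Const 0))
        (''p'' ::= Get ''prd'' (Get ''off'' (Reg ''v'')) ;;
         Cond (Get ''pe'' (Reg ''v'') =. Get ''off'' (Reg ''v'') +. Const 1)
           (Put ''h'' (Reg ''v'') (Get ''h'' (Reg ''p'') +. Reg ''v''))
           (''r'' ::= Get ''prd'' (Get ''off'' (Reg ''v'') +. Const 1) ;;
            common ;;
            Put ''h'' (Reg ''v'') (Get ''h'' (Reg ''p'') +. Get ''h'' (Reg ''r'') -. Get ''h'' (Reg ''g'')))) ;;
      Put ''lab'' (Reg ''v'') (Get ''h'' (Reg ''v'') -. Get ''h'' (Get ''par'' (Reg ''v''))))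
      (70 + L * (30 + 30 * L)) (set_reg s0 ''v'' (expr_val w s0 (Get ''q'' (Reg ''i''))))
      (\<lambda>s. labelled A b s v \<and> (\<forall>u. u \<noteq> v \<longrightarrow> arrs s ''h'' u = arrs s0 ''h'' u \<and> arrs s ''lab'' u = arrs s0 ''lab'' u))"
      unfolding s1' by (rule runs_Seq[OF main], erule fin, assumption, simp, simp)
  qed simp
qed

end

section \<open>Halfspace sizes and the centre of a cell\<close>

text \<open>The queue is traversed backwards, so a vertex has collected the sizes of all its
  children before it passes them on. Several tree edges may share a class, but a tree path to
  \<open>b\<close> crosses each class at most once; adding the subtree sizes over the tree edges of
  a class therefore counts its halfspace.\<close>

definition count_vertex :: prog where
  "count_vertex =
     (''v'' ::= Get ''q'' (Reg ''tl'' -. Reg ''i'') ;;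
      Put ''cnt'' (Get ''lab'' (Reg ''v'')) (Get ''cnt'' (Get ''lab'' (Reg ''v'')) +. Get ''sz'' (Reg ''v'')) ;;
      Put ''sz'' (Get ''par'' (Reg ''v'')) (Get ''sz'' (Get ''par'' (Reg ''v'')) +. Get ''sz'' (Reg ''v'')))"

definition count :: prog where
  "count = For ''i'' (Const 1) (Reg ''tl'') count_vertex"

text \<open>Stepping from a vertex to its child \<open>v\<close> changes the sum of distances by \<open>tl - 2 * x\<close>, where \<open>x\<close>
  is the size of the halfspace containing \<open>v\<close>. Only differences matter, so \<open>D\<close> starts at
  \<open>n * n\<close> to stay nonnegative.\<close>

definition centre_vertex :: prog where
  "centre_vertex =
     (''v'' ::= Get ''q'' (Reg ''i'') ;;
      ''x'' ::= Get ''cnt'' (Get ''lab'' (Reg ''v'')) ;;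
      ''u'' ::= Reg ''tl'' -. Reg ''x'' ;;
      Put ''D'' (Reg ''v'') (Get ''D'' (Get ''par'' (Reg ''v'')) +. Reg ''tl'' -. (Reg ''x'' +. Reg ''x'')) ;;
      Cond (Get ''D'' (Reg ''v'') <. Get ''D'' (Reg ''best'')) (''best'' ::= Reg ''v'') Skip ;;
      Cond (Reg ''x'' *. Reg ''x'' <. Reg ''n'') Skip
        (Cond (Reg ''u'' *. Reg ''u'' <. Reg ''n'') Skip
          (''fnd'' ::= Get ''lab'' (Reg ''v'') +. Const 1)))"

text \<open>\<open>fnd\<close> stores a class name plus one, so that 0 can mean that no balanced
  class was met.\<close>

definition centre :: prog where
  "centre =
     (''best'' ::= Reg ''b'' ;; ''fnd'' ::= Const 0 ;;
      Put ''D'' (Reg ''b'') (Reg ''n'' *. Reg ''n'') ;;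
      For ''i'' (Const 1) (Reg ''tl'') centre_vertex)"

lemma written_centre [simp]:
  "written_regs count_vertex = {''v''}" "written_arrs count_vertex = {''cnt'', ''sz''}"
  "written_regs count = {''i'', ''v''}" "written_arrs count = {''cnt'', ''sz''}"
  "written_regs centre_vertex = {''v'', ''x'', ''u'', ''best'', ''fnd''}" "written_arrs centre_vertex = {''D''}"
  "written_regs centre = {''i'', ''v'', ''x'', ''u'', ''best'', ''fnd''}" "written_arrs centre = {''D''}"
  by (auto simp: count_vertex_def count_def centre_vertex_def centre_def)

lemma runs_Seq_assoc:
  assumes "runs w ((p ;; q) ;; r) T s Q" shows "runs w (p ;; q ;; r) T s Q"
proof -
  obtain t s' where t: "exec w s ((p ;; q) ;; r) t s'" "t \<le> T" "Q s'" using assms by (auto simp: runs_def)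
  from t(1) obtain t1 t2 t3 s1 s2 where e: "exec w s p t1 s1" "exec w s1 q t2 s2" "exec w s2 r t3 s'" "t = (t1 + t2) + t3"
    by (elim exec_SeqE) blast
  have "exec w s (p ;; q ;; r) (t1 + (t2 + t3)) s'" using e by (intro exec.Seq)
  then show ?thesis using t e(4) unfolding runs_def by (auto simp: add.assoc)
qed

lemma eval_centre_vertex:
  assumes w: "0 < w" and v: "arrs s ''q'' (regs s ''i'') = v" and x: "arrs s ''cnt'' (arrs s ''lab'' v) = x"
    and u: "(regs s ''tl'' + 2 ^ w - x) mod 2 ^ w = u"
    and p: "arrs s ''par'' v \<noteq> v" "arrs s ''D'' (arrs s ''par'' v) + regs s ''tl'' < 2 ^ w" "x + x < 2 ^ w"
    and dv: "(arrs s ''D'' (arrs s ''par'' v) + regs s ''tl'' + 2 ^ w - (x + x)) mod 2 ^ w = dv"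
    and b: "regs s ''best'' \<noteq> v" and sq: "x * x < 2 ^ w" "u * u < 2 ^ w" and l: "Suc (arrs s ''lab'' v) < 2 ^ w"
  defines "s' \<equiv> eval_prog w centre_vertex s"
  shows "arrs s' ''D'' = (arrs s ''D'')(v := dv)"
    "regs s' ''best'' = (if dv < arrs s ''D'' (regs s ''best'') then v else regs s ''best'')"
    "regs s' ''fnd'' = (if regs s ''n'' \<le> x * x \<and> regs s ''n'' \<le> u * u then Suc (arrs s ''lab'' v) else regs s ''fnd'')"
    "regs s' ''i'' = regs s ''i''"
proof -
  define s1 where "s1 = s\<lparr>regs := (regs s)(''v'' := v, ''x'' := x, ''u'' := u), arrs := (arrs s)(''D'' := (arrs s ''D'')(v := dv))\<rparr>"
  define s2 where "s2 = (if dv < arrs s ''D'' (regs s ''best'') then set_reg s1 ''best'' v else s1)"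
  have e1: "eval_prog w (''v'' ::= Get ''q'' (Reg ''i'') ;; ''x'' ::= Get ''cnt'' (Get ''lab'' (Reg ''v'')) ;;
      ''u'' ::= Reg ''tl'' -. Reg ''x'' ;;
      Put ''D'' (Reg ''v'') (Get ''D'' (Get ''par'' (Reg ''v'')) +. Reg ''tl'' -. (Reg ''x'' +. Reg ''x''))) s = s1"
    using v x u p dv by (simp add: s1_def)
  have e2: "eval_prog w (Cond (Get ''D'' (Reg ''v'') <. Get ''D'' (Reg ''best'')) (''best'' ::= Reg ''v'') Skip) s1 = s2"
    using w b by (simp add: s1_def s2_def)
  have s2: "arrs s2 = (arrs s)(''D'' := (arrs s ''D'')(v := dv))" "regs s2 ''x'' = x" "regs s2 ''u'' = u"
    "regs s2 ''n'' = regs s ''n''" "regs s2 ''v'' = v" "regs s2 ''fnd'' = regs s ''fnd''" "regs s2 ''i'' = regs s ''i''"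
    "regs s2 ''best'' = (if dv < arrs s ''D'' (regs s ''best'') then v else regs s ''best'')"
    by (simp_all add: s2_def s1_def)
  have e: "s' = eval_prog w (Cond (Reg ''x'' *. Reg ''x'' <. Reg ''n'') Skip
        (Cond (Reg ''u'' *. Reg ''u'' <. Reg ''n'') Skip
          (''fnd'' ::= Get ''lab'' (Reg ''v'') +. Const 1))) s2"
    unfolding s'_def centre_vertex_def e2[symmetric] e1[symmetric] eval_prog.simps(3) ..
  show "arrs s' ''D'' = (arrs s ''D'')(v := dv)"
    "regs s' ''best'' = (if dv < arrs s ''D'' (regs s ''best'') then v else regs s ''best'')"
    "regs s' ''fnd'' = (if regs s ''n'' \<le> x * x \<and> regs s ''n'' \<le> u * u then Suc (arrs s ''lab'' v) else regs s ''fnd'')"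
    "regs s' ''i'' = regs s ''i''"
    unfolding e using w sq l s2 by (auto simp: mod_Suc_eq not_less)
qed

lemma word_minus:
  assumes "y \<le> x" "x < 2 ^ w" shows "(x + 2 ^ w - y) mod 2 ^ w = x - (y::nat)"
proof -
  have "x + 2 ^ w - y = (x - y) + 2 ^ w" using assms(1) by linarith
  moreover have "x - y < 2 ^ w" using assms(2) by linarith
  ultimately show ?thesis by (simp only: mod_add_self2 mod_less)
qed

lemma sum_fun_upd_add:
  fixes f g :: "nat \<Rightarrow> nat"
  assumes "inj_on q {..<m}" "j < m"
  shows "(\<Sum>k<m. f k * (g(q j := g (q j) + x)) (q k)) = (\<Sum>k<m. f k * g (q k)) + f j * x"
proof -
  have "f k * (g(q j := g (q j) + x)) (q k) = f k * g (q k) + (if k = j then f j * x else 0)"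
    if "k < m" for k
    using assms that by (auto simp: inj_on_def algebra_simps)
  then have "(\<Sum>k<m. f k * (g(q j := g (q j) + x)) (q k)) = (\<Sum>k<m. f k * g (q k) + (if k = j then f j * x else 0))"
    by (intro sum.cong) auto
  then show ?thesis using assms(2) by (simp add: sum.distrib)
qed

context ram_graph begin

lemma cell_searchedD:
  assumes "cell_searched A b s" "median_space A d" "b \<in> A"
  defines "q \<equiv> arrs s ''q''" and "t \<equiv> regs s ''tl''" and "par \<equiv> arrs s ''par''"
  shows "enumerates q t A" "q 0 = b" "0 < t" "\<And>v. v \<in> A \<Longrightarrow> arrs s ''dist'' v = d b v"
    "\<And>i. 0 < i \<Longrightarrow> i < t \<Longrightarrow> par (q i) \<in> median_space.preds A d b (q i)"
    "\<And>i. 0 < i \<Longrightarrow> i < t \<Longrightarrow> \<exists>j<i. par (q i) = q j"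
    "\<And>i u. i < t \<Longrightarrow> u \<in> A \<Longrightarrow> d b u < d b (q i) \<Longrightarrow> \<exists>j<i. u = q j"
    "\<And>i. i < t \<Longrightarrow> q i = b \<longleftrightarrow> i = 0"
proof -
  interpret A: median_space A d by fact
  show 1: "enumerates q t A" "q 0 = b" "\<And>v. v \<in> A \<Longrightarrow> arrs s ''dist'' v = d b v"
    "\<And>i. 0 < i \<Longrightarrow> i < t \<Longrightarrow> par (q i) \<in> A.preds b (q i)"
    using assms by (simp_all add: cell_searched_def)
  have srt: "\<And>i j. i \<le> j \<Longrightarrow> j < t \<Longrightarrow> d b (q i) \<le> d b (q j)"
    using assms by (simp add: cell_searched_def)
  show "0 < t" using enumeratesD(2)[OF 1(1) assms(3)] by auto
  show 2: "\<exists>j<i. u = q j" if "i < t" "u \<in> A" "d b u < d b (q i)" for i u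
  proof -
    obtain j where "j < t" "u = q j" using enumeratesD(2)[OF 1(1) \<open>u \<in> A\<close>] by blast
    then show ?thesis using srt[of i j] that by (metis not_le)
  qed
  show "\<exists>j<i. par (q i) = q j" if "0 < i" "i < t" for i
    using 2[OF that(2), of "par (q i)"] A.predsD[OF 1(4)[OF that]] by auto
  show "q i = b \<longleftrightarrow> i = 0" if "i < t" for i
    using enumeratesD(3)[OF 1(1), of i 0] that 1(2) \<open>0 < t\<close> by auto
qed

lemma runs_hashes:
  assumes st: "static s0" and An: "A \<subseteq> {..<n}" and med: "median_space A d" and b: "b \<in> A"
    and cs: "cell_searched A b s0"
    and lp: "\<And>u. u \<in> A \<Longrightarrow> lists_preds A b (arrs s0 ''prd'') (arrs s0 ''pe'' u) u"
    and L: "\<And>u. u \<in> A \<Longrightarrow> card (median_space.preds A d b u) \<le> L"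
  shows "runs w hashes (10 + card A * (90 + L * (30 + 30 * L))) s0 (\<lambda>s. \<forall>v\<in>A. labelled A b s v)"
proof -
  let ?q = "arrs s0 ''q''" and ?t = "regs s0 ''tl''"
  note c = cell_searchedD[OF cs med b]
  note en' = enumeratesD[OF c(1)]
  have tn: "?t \<le> n" using card_mono[OF _ An] en'(4) by simp
  let ?I = "\<lambda>i s. \<forall>k<i. labelled A b s (?q k)"
  have "runs w hashes (10 + card A * (90 + L * (30 + 30 * L))) s0 (\<lambda>s. ?I ?t s \<and> regs s ''i'' = ?t)"
    unfolding hashes_def
  proof (rule runs_For[where I = ?I and l = 0 and B = "\<lambda>_. 80 + L * (30 + 30 * L)"])
    show "?t < 2 ^ w" using tn word_n by linarith
    show "4 + expr_time (Const 0) + expr_time (Reg ''tl'') + (\<Sum>i = 0..<?t. 80 + L * (30 + 30 * L) + 7 + expr_time (Reg ''tl''))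
      \<le> 10 + card A * (90 + L * (30 + 30 * L))" using en'(4) by (simp add: algebra_simps)
    fix i s
    assume fr: "same_except (insert ''i'' (written_regs hash_vertex)) (written_arrs hash_vertex) s0 s"
    note e = same_exceptD[OF fr]
    show "expr_val w s (Reg ''tl'') = ?t" using e by simp
    assume i: "i < ?t" "regs s ''i'' = i" and I: "?I i s"
    have st': "static s" using static_same[OF st fr] by simp
    have qA: "?q i \<in> A" using en'(1) i by blast
    show "runs w hash_vertex (80 + L * (30 + 30 * L)) s (\<lambda>s'. regs s' ''i'' = i \<and> ?I (Suc i) (set_reg s' ''i'' (Suc i)))"
    proof (rule runs_mono_frame[OF runs_hash_vertex[OF st' An med b _ qA _ _ _ L]])
      show "arrs s ''q'' (regs s ''i'') = ?q i" using e i by simp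
      show "lists_preds A b (arrs s ''prd'') (arrs s ''pe'' u) u" if "u \<in> A" for u
        using lp[OF that] e by simp
      show "arrs s ''h'' u = median_space.hash A d (\<lambda>r. r) b u" if "u \<in> A" "d b u < d b (?q i)" for u
        using c(7)[OF i(1) that] I by (auto simp: labelled_def)
      show "arrs s ''par'' (?q i) \<in> median_space.preds A d b (?q i)" if "?q i \<noteq> b"
        using c(5)[of i] c(8)[OF i(1)] that e i by simp
      fix s'
      assume Q: "labelled A b s' (?q i) \<and>
       (\<forall>u. u \<noteq> ?q i \<longrightarrow> arrs s' ''h'' u = arrs s ''h'' u \<and> arrs s' ''lab'' u = arrs s ''lab'' u)"
       and fr2: "same_except (written_regs hash_vertex) (written_arrs hash_vertex) s s'"
      have "labelled A b s' (?q k)" if k: "k < Suc i" for k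
      proof (cases "k = i")
        case False
        then have "?q k \<noteq> ?q i" "k < i" using en'(3)[of k i] k i by auto
        then show ?thesis using I Q same_exceptD[OF fr2] by (simp add: labelled_def)
      qed (use Q in simp)
      then show "regs s' ''i'' = i \<and> ?I (Suc i) (set_reg s' ''i'' (Suc i))"
        using i same_exceptD[OF fr2] by (simp add: labelled_def)
    qed simp_all
  qed (use w_pos in simp_all)
  then show ?thesis
  proof (rule runs_mono)
    fix s assume a: "?I ?t s \<and> regs s ''i'' = ?t"
    show "\<forall>v\<in>A. labelled A b s v"
    proof
      fix v assume "v \<in> A"
      from en'(2)[OF this] obtain k where "k < ?t" "v = ?q k" by blast
      with a show "labelled A b s v" by simp
    qed
  qed simp
qed

text \<open>Each vertex carries a token to \<open>b\<close> along the search tree and drops one count on each label it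
  crosses; the tokens that have yet to cross a label are those resting on a vertex whose signature
  contains it.\<close>

lemma runs_count:
  assumes An: "A \<subseteq> {..<n}" and med: "median_space A d" and b: "b \<in> A"
    and cs: "cell_searched A b s0" and lab: "\<And>v. v \<in> A \<Longrightarrow> labelled A b s0 v"
    and init: "\<And>v. v \<in> A \<Longrightarrow> arrs s0 ''sz'' v = 1 \<and> arrs s0 ''cnt'' v = 0"
  shows "runs w count (10 + 50 * card A) s0 (\<lambda>s. \<forall>v\<in>A - {b}.
     arrs s ''cnt'' (arrs s ''lab'' v) = card (median_space.half A d v (arrs s ''par'' v)))"
proof -
  interpret A: median_space A d by (rule med)
  let ?q = "arrs s0 ''q''" and ?t = "regs s0 ''tl''" and ?par = "arrs s0 ''par''" and ?lab = "arrs s0 ''lab''"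
  note c = cell_searchedD[OF cs med b]
  note en' = enumeratesD[OF c(1)]
  have inj: "inj_on ?q {..<m}" if "m \<le> ?t" for m
    using en'(3) that by (auto simp: inj_on_def)
  have tn: "?t \<le> n" using card_mono[OF _ An] en'(4) by simp
  let ?C = "\<lambda>r. \<Sum>z\<in>A. of_bool (r \<in> A.sig b z) :: nat"
  \<comment> \<open>The first conjunct splits each halfspace into tokens already counted and tokens
    still to cross; the second, that no token is lost, bounds the entries of \<open>sz\<close> and
    thus excludes overflow.\<close>
  let ?I = "\<lambda>i s. (\<forall>r\<in>A. arrs s ''cnt'' r + (\<Sum>k<?t - i + 1. of_bool (r \<in> A.sig b (?q k)) * arrs s ''sz'' (?q k)) = ?C r) \<and>
     (\<Sum>k<?t - i + 1. 1 * arrs s ''sz'' (?q k)) = ?t"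
  have Cle: "?C r \<le> n" for r
  proof -
    have "?C r \<le> (\<Sum>z\<in>A. 1)" by (intro sum_mono) simp
    then show ?thesis using en'(4) tn by simp
  qed
  have "runs w count (10 + 50 * card A) s0 (\<lambda>s. ?I ?t s \<and> regs s ''i'' = ?t)"
    unfolding count_def
  proof (rule runs_For[where I = ?I and l = 1 and B = "\<lambda>_. 30"])
    show "?t < 2 ^ w" using tn word_n by linarith
    show "1 \<le> ?t" using c(3) by simp
    have s1: "arrs s0 ''sz'' (?q k) = 1" if "k < ?t" for k using init en'(1)[OF that] by blast
    have "(\<Sum>k<?t. of_bool (r \<in> A.sig b (?q k)) * arrs s0 ''sz'' (?q k)) = ?C r" for r
    proof -
      have "(\<Sum>k<?t. of_bool (r \<in> A.sig b (?q k)) * arrs s0 ''sz'' (?q k)) = (\<Sum>k<?t. of_bool (r \<in> A.sig b (?q k)))"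
        using s1 by (intro sum.cong) simp_all
      then show ?thesis using sum_enumerates[OF c(1), of "\<lambda>z. of_bool (r \<in> A.sig b z)"] by (rule trans)
    qed
    then show "?I 1 (set_reg s0 ''i'' 1)" using init c(3) s1 by simp
    show "4 + expr_time (Const 1) + expr_time (Reg ''tl'') + (\<Sum>i = 1..<?t. 30 + 7 + expr_time (Reg ''tl'')) \<le> 10 + 50 * card A"
      using en'(4) by simp
    fix i s
    assume fr: "same_except (insert ''i'' (written_regs count_vertex)) (written_arrs count_vertex) s0 s"
    note e = same_exceptD[OF fr]
    show "expr_val w s (Reg ''tl'') = ?t" using e by simp
    assume i: "1 \<le> i" "i < ?t" "regs s ''i'' = i" and I: "?I i s"
    define k0 where "k0 = ?t - i"
    define v where "v = ?q k0"
    have k0: "0 < k0" "k0 < ?t" "?t - i + 1 = Suc k0" "?t - Suc i + 1 = k0" using i by (auto simp: k0_def)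
    have vA: "v \<in> A" unfolding v_def using en'(1) k0 by blast
    obtain j where j: "j < k0" "?par v = ?q j" using c(6)[of k0] k0 by (auto simp: v_def)
    have pv: "?par v \<in> A.preds b v" using c(5)[of k0] k0 by (simp add: v_def)
    have vb: "v \<noteq> b" using pv by auto
    define r where "r = ?lab v"
    have r: "r = A.lab b (?par v) v" using lab[OF vA] vb by (simp add: labelled_def r_def)
    have rA: "r \<in> A" unfolding r using A.lab_in_half[OF b vA pv] A.halfD by blast
    note sig = A.sig_pred[OF b vA pv, folded r]
    let ?x = "arrs s ''sz'' v" and ?g = "arrs s ''sz''"
    have pne: "?q j \<noteq> v" using en'(3)[of j k0] j(1) k0 unfolding v_def by auto
    have sum2: "(\<Sum>k<k0. f k * (?g(?q j := ?g (?q j) + ?x)) (?q k)) = (\<Sum>k<k0. f k * ?g (?q k)) + f j * ?x" for f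
      using inj[of k0] j(1) k0(2) by (intro sum_fun_upd_add) auto
    have It: "(\<Sum>k<k0. 1 * ?g (?q k)) + ?x = ?t" using I unfolding k0(3) by (simp add: v_def)
    have "?g (?q j) \<le> (\<Sum>k<k0. 1 * ?g (?q k))"
      using member_le_sum[of j "{..<k0}" "\<lambda>k. 1 * ?g (?q k)"] j(1) by simp
    then have szw: "?g (?q j) + ?x < 2 ^ w" using It tn word_n by linarith
    have Ir: "arrs s ''cnt'' r' + ((\<Sum>k<k0. of_bool (r' \<in> A.sig b (?q k)) * ?g (?q k)) + of_bool (r' \<in> A.sig b v) * ?x) = ?C r'"
      if "r' \<in> A" for r'
      using I that unfolding k0(3) by (simp add: v_def)
    have cw: "arrs s ''cnt'' r + ?x < 2 ^ w" using Ir[OF rA] sig Cle[of r] word_n by simp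
    define s1 where "s1 = s\<lparr>regs := (regs s)(''v'' := v), arrs := (arrs s)(''cnt'' := (arrs s ''cnt'')(r := arrs s ''cnt'' r + ?x),
        ''sz'' := ?g(?q j := ?g (?q j) + ?x))\<rparr>"
    have "(?t + 2 ^ w - i) mod 2 ^ w = k0" unfolding k0_def using i(2) tn word_n by (intro word_minus) linarith+
    then have ev: "s1 = eval_prog w count_vertex s"
      using e i(3) cw szw pne by (simp add: count_vertex_def s1_def v_def[symmetric] j(2) r_def[symmetric])
    have "?I (Suc i) (set_reg s1 ''i'' (Suc i))"
    proof (unfold k0(4), intro conjI ballI)
      fix r' assume r': "r' \<in> A"
      have "of_bool (r' \<in> A.sig b v) = of_bool (r' \<in> A.sig b (?q j)) + (of_bool (r' = r) :: nat)"
        using sig j(2) by auto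
      then show "arrs (set_reg s1 ''i'' (Suc i)) ''cnt'' r' + (\<Sum>k<k0. of_bool (r' \<in> A.sig b (?q k)) *
        arrs (set_reg s1 ''i'' (Suc i)) ''sz'' (?q k)) = ?C r'"
        using Ir[OF r'] sum2[of "\<lambda>k. of_bool (r' \<in> A.sig b (?q k))"] by (auto simp: s1_def)
    next
      show "(\<Sum>k<k0. 1 * arrs (set_reg s1 ''i'' (Suc i)) ''sz'' (?q k)) = ?t"
        using sum2[of "\<lambda>_. 1"] It by (simp add: s1_def)
    qed
    moreover have "regs s1 ''i'' = i" using i by (simp add: s1_def)
    ultimately show "runs w count_vertex 30 s (\<lambda>s'. regs s' ''i'' = i \<and> ?I (Suc i) (set_reg s' ''i'' (Suc i)))"
      by (intro runs_loop_freeI[OF ev]) (simp_all add: count_vertex_def)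
  qed (use w_pos in simp_all)
  then show ?thesis
  proof (rule runs_mono_frame)
    fix s assume a: "?I ?t s \<and> regs s ''i'' = ?t" and fr: "same_except (written_regs count) (written_arrs count) s0 s"
    note e = same_exceptD[OF fr]
    show "\<forall>v\<in>A - {b}. arrs s ''cnt'' (arrs s ''lab'' v) = card (A.half v (arrs s ''par'' v))"
    proof
      fix v assume v: "v \<in> A - {b}"
      then obtain k where k: "k < ?t" "v = ?q k" using en'(2) by blast
      have pv: "?par v \<in> A.preds b v" using c(5)[of k] c(8)[of k] k v by auto
      have r: "?lab v = A.lab b (?par v) v" using lab v by (simp add: labelled_def)
      have "?lab v \<in> A" unfolding r using A.lab_in_half[OF b _ pv] A.halfD v by blast
      \<comment> \<open>The one remaining summand belongs to \<open>b\<close>, whose signature is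
        empty, so no token is outstanding.\<close>
      then have "arrs s ''cnt'' (?lab v) = ?C (?lab v)" using a A.sig_base[OF b] c(2) by simp
      also have "\<dots> = card (A.half v (?par v))" unfolding r using A.card_lab_half[OF b _ pv] v by simp
      finally show "arrs s ''cnt'' (arrs s ''lab'' v) = card (A.half v (arrs s ''par'' v))" using e by simp
    qed
  qed simp
qed

text \<open>Squares replace comparisons with \<open>sqrt n\<close>, so the machine computes no root;
  \<open>m\<close> is the size of the cell and \<open>x\<close> that of one side.\<close>

definition balanced :: "nat \<Rightarrow> nat \<Rightarrow> bool" where
  "balanced m x \<longleftrightarrow> n \<le> x * x \<and> n \<le> (m - x) * (m - x)"

lemma runs_centre:
  assumes st: "static s0" and An: "A \<subseteq> {..<n}" and med: "median_space A d" and b: "b \<in> A" "regs s0 ''b'' = b"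
    and cs: "cell_searched A b s0" and lab: "\<And>v. v \<in> A \<Longrightarrow> labelled A b s0 v"
    and cnt: "\<And>v. v \<in> A - {b} \<Longrightarrow> arrs s0 ''cnt'' (arrs s0 ''lab'' v) = card (median_space.half A d v (arrs s0 ''par'' v))"
  shows "runs w centre (30 + 70 * card A) s0 (\<lambda>s. regs s ''best'' \<in> A \<and>
     (\<forall>v\<in>A. median_space.dist_sum A d (regs s ''best'') \<le> median_space.dist_sum A d v) \<and>
     (if regs s ''fnd'' = 0
      then \<forall>v\<in>A - {b}. \<not> balanced (card A) (card (median_space.half A d v (arrs s ''par'' v)))
      else \<exists>v\<in>A - {b}. regs s ''fnd'' = Suc (arrs s ''lab'' v) \<and>
        balanced (card A) (card (median_space.half A d v (arrs s ''par'' v)))))"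
proof -
  interpret A: median_space A d by (rule med)
  let ?q = "arrs s0 ''q''" and ?t = "regs s0 ''tl''" and ?par = "arrs s0 ''par''" and ?lab = "arrs s0 ''lab''"
  let ?H = "\<lambda>v. card (A.half v (?par v))"
  note c = cell_searchedD[OF cs med b(1)]
  note en' = enumeratesD[OF c(1)]
  have tn: "?t \<le> n" using card_mono[OF _ An] en'(4) by simp
  have nn: "n * n < 2 ^ w" using word_gt by simp
  have ds: "A.dist_sum v \<le> n * n" if "v \<in> A" for v
  proof -
    have "A.dist_sum v \<le> (\<Sum>z\<in>A. n)" unfolding A.dist_sum_def
      using A.dist_less_card[OF that] tn en'(4) by (intro sum_mono) (metis le_trans less_imp_le)
    also have "\<dots> \<le> n * n" using tn en'(4) by simp
    finally show ?thesis .
  qed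
  let ?D = "\<lambda>v. n * n + A.dist_sum v - A.dist_sum b"
  have Dle: "?D v < ?D u \<longleftrightarrow> A.dist_sum v < A.dist_sum u" for u v
    using ds[OF b(1)] by auto
  let ?I = "\<lambda>i s. (\<forall>k<i. arrs s ''D'' (?q k) = ?D (?q k)) \<and> (\<exists>k<i. regs s ''best'' = ?q k) \<and>
    (\<forall>k<i. A.dist_sum (regs s ''best'') \<le> A.dist_sum (?q k)) \<and>
    (if regs s ''fnd'' = 0 then \<forall>k<i. 0 < k \<longrightarrow> \<not> balanced ?t (?H (?q k))
     else \<exists>k<i. 0 < k \<and> regs s ''fnd'' = Suc (?lab (?q k)) \<and> balanced ?t (?H (?q k)))"
  define s1 where "s1 = s0\<lparr>regs := (regs s0)(''best'' := b, ''fnd'' := 0), arrs := (arrs s0)(''D'' := (arrs s0 ''D'')(b := n * n))\<rparr>"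
  have s1e: "arrs s1 ''q'' = ?q" "regs s1 ''tl'' = ?t" "arrs s1 ''cnt'' = arrs s0 ''cnt''" "arrs s1 ''lab'' = ?lab"
    "arrs s1 ''par'' = ?par" "regs s1 ''n'' = n" using st by (simp_all add: s1_def static_def)
  have "runs w (For ''i'' (Const 1) (Reg ''tl'') centre_vertex) (10 + 70 * card A) s1 (\<lambda>s. ?I ?t s \<and> regs s ''i'' = ?t)"
  proof (rule runs_For[where I = ?I and l = 1 and B = "\<lambda>_. 60"])
    show "?t < 2 ^ w" using tn word_n by linarith
    show "1 \<le> ?t" using c(3) by simp
    show "?I 1 (set_reg s1 ''i'' 1)" using c(2) ds[OF b(1)] by (simp add: s1_def)
    show "4 + expr_time (Const 1) + expr_time (Reg ''tl'') + (\<Sum>i = 1..<?t. 60 + 7 + expr_time (Reg ''tl'')) \<le> 10 + 70 * card A"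
      using en'(4) by simp
    fix i s
    assume fr: "same_except (insert ''i'' (written_regs centre_vertex)) (written_arrs centre_vertex) s1 s"
    note e = same_exceptD[OF fr]
    show "expr_val w s (Reg ''tl'') = ?t" using e s1e by simp
    assume i: "1 \<le> i" "i < ?t" "regs s ''i'' = i" and I: "?I i s"
    define v where "v = ?q i"
    have vA: "v \<in> A" unfolding v_def using en'(1) i by blast
    obtain j where j: "j < i" "?par v = ?q j" using c(6)[of i] i by (auto simp: v_def)
    have pv: "?par v \<in> A.preds b v" using c(5)[of i] i by (simp add: v_def)
    have vb: "v \<noteq> b" using pv by auto
    have cnt': "arrs s0 ''cnt'' (?lab v) = ?H v" using cnt vA vb by simp
    have lw: "?lab v < n" using lab[OF vA] vb A.lab_in_half[OF b(1) vA pv] A.halfD An by (auto simp: labelled_def)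
    have Hle: "?H v \<le> ?t" using card_mono[OF A.finite_V A.half_sub] en'(4) by simp
    have par: "A.dist_sum v + 2 * ?H v = A.dist_sum (?par v) + ?t"
      using A.dist_sum_adj[OF vA _ A.predsD(3)[OF pv]] A.predsD[OF pv] en'(4) by simp
    have Dp: "arrs s ''D'' (?par v) = ?D (?par v)" using I j by simp
    have pn: "?par v \<noteq> v" using A.predsD[OF pv] by auto
    have Dv: "(?D (?par v) + ?t + 2 ^ w - 2 * ?H v) mod 2 ^ w = ?D v"
    proof -
      have "?D (?par v) + ?t + 2 ^ w - 2 * ?H v = ?D v + 2 ^ w"
        using par ds[OF b(1)] by linarith
      moreover have "?D v < 2 ^ w" using ds[OF vA] word_gt by simp
      ultimately show ?thesis by (simp only: mod_add_self2 mod_less)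
    qed
    have w1: "?D (?par v) + ?t < 2 ^ w" using ds[OF A.predsD(1)[OF pv]] tn word_gt by simp
    have w2: "?H v + ?H v < 2 ^ w" using Hle tn word_gt by simp
    have sq: "x * x < 2 ^ w" if "x \<le> n" for x
      using mult_le_mono[OF that that] nn by simp
    have w3: "?H v * ?H v < 2 ^ w" "(?t - ?H v) * (?t - ?H v) < 2 ^ w" using sq Hle tn by simp_all
    have w4: "(?t + 2 ^ w - ?H v) mod 2 ^ w = ?t - ?H v"
      using Hle tn word_n by (intro word_minus) linarith+
    obtain kb where kb: "kb < i" "regs s ''best'' = ?q kb" using I by blast
    have bestne: "regs s ''best'' \<noteq> v" using en'(3)[of kb i] kb i unfolding v_def by auto
    have Db: "arrs s ''D'' (regs s ''best'') = ?D (regs s ''best'')" using I kb by simp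
    define s2 where "s2 = eval_prog w centre_vertex s"
    have s2: "arrs s2 ''D'' = (arrs s ''D'')(v := ?D v)"
      "regs s2 ''best'' = (if ?D v < ?D (regs s ''best'') then v else regs s ''best'')"
      "regs s2 ''fnd'' = (if balanced ?t (?H v) then Suc (?lab v) else regs s ''fnd'')" "regs s2 ''i'' = i"
    proof -
      have c: "arrs s ''q'' = ?q" "regs s ''tl'' = ?t" "arrs s ''cnt'' = arrs s0 ''cnt''"
        "arrs s ''lab'' = ?lab" "arrs s ''par'' = ?par" "regs s ''n'' = n"
        using e s1e by simp_all
      have lw': "Suc (?lab v) < 2 ^ w" using lw word_n by linarith
      note ev = eval_centre_vertex[where w = w and s = s and v = v and x = "?H v" and u = "?t - ?H v" and dv = "?D v",
        folded s2_def, unfolded c i(3) Dp Db, OF w_pos v_def[symmetric] cnt' w4 pn w1 w2 Dv[unfolded mult_2] bestne w3 lw']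
      show "arrs s2 ''D'' = (arrs s ''D'')(v := ?D v)"
        "regs s2 ''best'' = (if ?D v < ?D (regs s ''best'') then v else regs s ''best'')"
        "regs s2 ''fnd'' = (if balanced ?t (?H v) then Suc (?lab v) else regs s ''fnd'')" "regs s2 ''i'' = i"
        unfolding balanced_def by (fact ev)+
    qed
    have "(\<forall>k<Suc i. arrs s2 ''D'' (?q k) = ?D (?q k))"
      using I by (auto simp: s2(1) v_def less_Suc_eq)
    moreover have "\<exists>k<Suc i. regs s2 ''best'' = ?q k"
      using kb by (auto simp: s2(2) v_def less_Suc_eq)
    moreover have "\<forall>k<Suc i. A.dist_sum (regs s2 ''best'') \<le> A.dist_sum (?q k)"
      using I unfolding s2(2) Dle v_def[symmetric] by (auto simp: less_Suc_eq v_def)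
    moreover have "if regs s2 ''fnd'' = 0 then \<forall>k<Suc i. 0 < k \<longrightarrow> \<not> balanced ?t (?H (?q k))
     else \<exists>k<Suc i. 0 < k \<and> regs s2 ''fnd'' = Suc (?lab (?q k)) \<and> balanced ?t (?H (?q k))"
    proof (cases "balanced ?t (?H v)")
      case True
      then show ?thesis using i(1) by (auto simp: s2(3) v_def intro!: exI[of _ i])
    next
      case False
      then have f: "regs s2 ''fnd'' = regs s ''fnd''" by (simp add: s2(3))
      show ?thesis
      proof (cases "regs s ''fnd'' = 0")
        case True
        then have "\<forall>k<i. 0 < k \<longrightarrow> \<not> balanced ?t (?H (?q k))" using I by simp
        then show ?thesis using True False unfolding f v_def by (simp add: less_Suc_eq)
      next
        case False
        then obtain k where "k < i" "0 < k \<and> regs s ''fnd'' = Suc (?lab (?q k)) \<and> balanced ?t (?H (?q k))"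
          using I by auto
        then show ?thesis using False unfolding f by (auto intro!: exI[of _ k])
      qed
    qed
    ultimately have "?I (Suc i) (set_reg s2 ''i'' (Suc i))" by (simp cong: if_cong)
    with s2(4) show "runs w centre_vertex 60 s (\<lambda>s'. regs s' ''i'' = i \<and> ?I (Suc i) (set_reg s' ''i'' (Suc i)))"
      by (intro runs_loop_freeI[OF s2_def]) (simp_all add: centre_vertex_def cong: if_cong)
  qed (use w_pos in simp_all)
  then have loop: "runs w (For ''i'' (Const 1) (Reg ''tl'') centre_vertex) (10 + 70 * card A) s1 (\<lambda>s. regs s ''best'' \<in> A \<and>
     (\<forall>v\<in>A. A.dist_sum (regs s ''best'') \<le> A.dist_sum v) \<and>
     (if regs s ''fnd'' = 0
      then \<forall>v\<in>A - {b}. \<not> balanced (card A) (card (A.half v (arrs s ''par'' v)))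
      else \<exists>v\<in>A - {b}. regs s ''fnd'' = Suc (arrs s ''lab'' v) \<and>
        balanced (card A) (card (A.half v (arrs s ''par'' v)))))"
  proof (rule runs_mono_frame)
    fix s assume a: "?I ?t s \<and> regs s ''i'' = ?t"
      and fr: "same_except (written_regs (For ''i'' (Const 1) (Reg ''tl'') centre_vertex))
        (written_arrs (For ''i'' (Const 1) (Reg ''tl'') centre_vertex)) s1 s"
    have e: "arrs s ''par'' = ?par" "arrs s ''lab'' = ?lab" using same_exceptD[OF fr] s1e by simp_all
    have 1: "\<exists>k<?t. 0 < k \<and> v = ?q k" if "v \<in> A - {b}" for v
      using en'(2)[of v] c(8) that by (metis DiffE insertI1 neq0_conv)
    have 2: "?q k \<in> A - {b}" if "0 < k" "k < ?t" for k using en'(1)[OF that(2)] c(8)[OF that(2)] that by simp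
    have "\<forall>v\<in>A. A.dist_sum (regs s ''best'') \<le> A.dist_sum v" using a en'(2) by metis
    moreover have "regs s ''best'' \<in> A" using a en'(1) by auto
    moreover have "\<forall>v\<in>A - {b}. \<not> balanced (card A) (?H v)" if "regs s ''fnd'' = 0"
      using a that 1 en'(4) by (metis (no_types, lifting))
    moreover have "\<exists>v\<in>A - {b}. regs s ''fnd'' = Suc (?lab v) \<and> balanced (card A) (?H v)" if "regs s ''fnd'' \<noteq> 0"
      using a that 2 en'(4) by (metis (no_types, lifting))
    ultimately show "regs s ''best'' \<in> A \<and> (\<forall>v\<in>A. A.dist_sum (regs s ''best'') \<le> A.dist_sum v) \<and>
     (if regs s ''fnd'' = 0
      then \<forall>v\<in>A - {b}. \<not> balanced (card A) (card (A.half v (arrs s ''par'' v)))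
      else \<exists>v\<in>A - {b}. regs s ''fnd'' = Suc (arrs s ''lab'' v) \<and>
        balanced (card A) (card (A.half v (arrs s ''par'' v))))" unfolding e by simp
  qed simp
  have pre: "eval_prog w ((''best'' ::= Reg ''b'' ;; ''fnd'' ::= Const 0) ;;
      Put ''D'' (Reg ''b'') (Reg ''n'' *. Reg ''n'')) s0 = s1"
    using st b nn by (simp add: s1_def static_def)
  show ?thesis unfolding centre_def
    by (rule runs_Seq_assoc, rule runs_Seq_assoc, rule runs_loop_free_Seq[OF _ loop[folded pre]]) simp_all
qed

end

section \<open>Cutting a cell, and eccentricities in a cell without balanced cuts\<close>

text \<open>A vertex lies in the halfspace named \<open>fnd - 1\<close> iff its tree edge belongs to that class or its
  parent lies in the halfspace.\<close>

definition cut_vertex :: prog where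
  "cut_vertex =
     (''v'' ::= Get ''q'' (Reg ''i'') ;;
      Cond (Get ''lab'' (Reg ''v'') +. Const 1 =. Reg ''fnd'')
        (Put ''comp'' (Reg ''v'') (Reg ''K''))
        (Cond (Get ''comp'' (Get ''par'' (Reg ''v'')) =. Reg ''K'')
          (Put ''comp'' (Reg ''v'') (Reg ''K'')) Skip))"

text \<open>\<open>K\<close> is both the number of cells and the name of the new one.
  \<open>pa\<close> remembers the cell it was taken from, which is all the information that undoing
  the cut requires.\<close>

definition cut :: prog where
  "cut = (For ''i'' (Const 1) (Reg ''tl'') cut_vertex ;;
     Put ''pa'' (Reg ''K'') (Reg ''a'') ;; ''K'' ::= Reg ''K'' +. Const 1)"

text \<open>The relation \<open>near_rel\<close>, with products for conjunctions and sums for disjunctions.\<close>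

definition near_test :: expr where
  "near_test =
     (Get ''comp'' (Reg ''y'') =. Reg ''a'') *. ((Reg ''y'' =. Reg ''best'') =. Const 0) *.
     ((Get ''dep'' (Reg ''z'') <. Get ''dep'' (Reg ''y'')) +.
      (Get ''dist'' (Reg ''z'') +. Get ''dep'' (Reg ''z'') =. Get ''dep'' (Reg ''u'')))"

text \<open>\<open>ord\<close> lists the cell by increasing distance from the centre, so the last unvisited entry is the
  farthest vertex among those reached through the centre. The scan stops at the centre at the latest.\<close>

definition scan :: prog where
  "scan =
     (''k'' ::= Reg ''m'' -. Const 1 ;;
      While (Get ''vis'' (Get ''ord'' (Reg ''k''))) (''k'' ::= Reg ''k'' -. Const 1))"

text \<open>Queue order is distance order, so the last entry of \<open>q\<close> is the farthest
  near vertex, while \<open>scan\<close> locates the farthest of the others in \<open>ord\<close>.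
  By \<open>ecc_near\<close> the larger of the two candidates is the eccentricity.\<close>

definition leaf_vertex :: prog where
  "leaf_vertex =
     (''u'' ::= Get ''ord'' (Reg ''i'') ;;
      start_search ''u'' ;; bfs near_test ;; scan ;;
      (''x'' ::= Get ''dist'' (Get ''q'' (Reg ''tl'' -. Const 1)) ;;
       ''y'' ::= Get ''dep'' (Reg ''u'') +. Get ''dep'' (Get ''ord'' (Reg ''k'')) ;;
       Cond (Reg ''x'' <. Reg ''y'') (Put ''ecc'' (Reg ''u'') (Reg ''y'')) (Put ''ecc'' (Reg ''u'') (Reg ''x''))) ;;
      clean)"

text \<open>The searches in \<open>leaf_vertex\<close> overwrite \<open>q\<close> and
  \<open>dist\<close>, so the order and the distances from the centre are saved first.\<close>

definition copy :: prog where
  "copy = For ''i'' (Const 0) (Reg ''tl'')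
     (Put ''ord'' (Reg ''i'') (Get ''q'' (Reg ''i'')) ;;
      Put ''dep'' (Get ''q'' (Reg ''i'')) (Get ''dist'' (Get ''q'' (Reg ''i''))))"

text \<open>The loop starts at 1 because entry 0 of \<open>ord\<close> is the centre, which has no
  near vertices; its eccentricity is the depth of the last entry.\<close>

definition leaf :: prog where
  "leaf =
     (cell_search ''best'' ;; copy ;;
      (''m'' ::= Reg ''tl'' ;;
       Put ''ecc'' (Reg ''best'') (Get ''dep'' (Get ''ord'' (Reg ''m'' -. Const 1)))) ;;
      For ''i'' (Const 1) (Reg ''m'') leaf_vertex)"

lemma written_leaf [simp]:
  "written_regs cut_vertex = {''v''}" "written_arrs cut_vertex = {''comp''}"
  "written_regs cut = {''v'', ''i'', ''K''}" "written_arrs cut = {''comp'', ''pa''}"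
  "written_regs scan = {''k''}" "written_arrs scan = {}"
  "written_regs leaf_vertex = {''u'', ''hd'', ''tl'', ''z'', ''j'', ''y'', ''k'', ''x'', ''e''}"
  "written_arrs leaf_vertex = {''q'', ''vis'', ''dist'', ''par'', ''ecc''}"
  "written_regs copy = {''i''}" "written_arrs copy = {''ord'', ''dep''}"
  "written_regs leaf = {''u'', ''hd'', ''tl'', ''z'', ''j'', ''y'', ''k'', ''x'', ''e'', ''i'', ''m''}"
  "written_arrs leaf = {''q'', ''vis'', ''dist'', ''par'', ''ecc'', ''ord'', ''dep''}"
  by (auto simp: cut_vertex_def cut_def scan_def leaf_vertex_def copy_def leaf_def)

context ram_graph begin

lemma runs_cut:
  assumes An: "A \<subseteq> {..<n}" and med: "median_space A d" and b: "b \<in> A"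
    and cs: "cell_searched A b s0" and lab: "\<And>v. v \<in> A \<Longrightarrow> labelled A b s0 v"
    and v0: "v0 \<in> A" "v0 \<noteq> b" "regs s0 ''fnd'' = Suc (arrs s0 ''lab'' v0)"
    and K: "\<And>v. v < n \<Longrightarrow> arrs s0 ''comp'' v < regs s0 ''K''" "regs s0 ''K'' \<le> n"
  shows "runs w cut (30 + 30 * card A) s0 (\<lambda>s.
     (\<forall>v<n. arrs s ''comp'' v = (if v \<in> median_space.half A d v0 (arrs s0 ''par'' v0) then regs s0 ''K'' else arrs s0 ''comp'' v)) \<and>
     arrs s ''pa'' = (arrs s0 ''pa'')(regs s0 ''K'' := regs s0 ''a'') \<and> regs s ''K'' = Suc (regs s0 ''K''))"
proof -
  interpret A: median_space A d by (rule med)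
  let ?q = "arrs s0 ''q''" and ?t = "regs s0 ''tl''" and ?par = "arrs s0 ''par''" and ?lab = "arrs s0 ''lab''"
    and ?K = "regs s0 ''K''"
  note c = cell_searchedD[OF cs med b]
  note en' = enumeratesD[OF c(1)]
  have tn: "?t \<le> n" using card_mono[OF _ An] en'(4) by simp
  have lab': "?lab v = A.lab b (?par v) v" "?par v \<in> A.preds b v" if v: "v \<in> A" "v \<noteq> b" for v
  proof -
    show "?lab v = A.lab b (?par v) v" using lab v by (simp add: labelled_def)
    obtain k where "k < ?t" "v = ?q k" using en'(2)[OF v(1)] by blast
    then show "?par v \<in> A.preds b v" using c(5)[of k] c(8)[of k] v by auto
  qed
  define r where "r = ?lab v0"
  define H where "H = A.half v0 (?par v0)"
  have rsig: "r \<in> A.sig b z \<longleftrightarrow> z \<in> H" if "z \<in> A" for z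
    using A.mem_sig_lab_iff[OF b v0(1) lab'(2)[OF v0(1,2)] that] lab'(1)[OF v0(1,2)] by (simp add: r_def H_def)
  have bH: "b \<notin> H" using rsig[OF b] A.sig_base[OF b] by simp
  have Hsub: "H \<subseteq> A" unfolding H_def by (rule A.half_sub)
  let ?I = "\<lambda>i s. \<forall>v<n. arrs s ''comp'' v = (if v \<in> ?q ` {..<i} \<inter> H then ?K else arrs s0 ''comp'' v)"
  have loop: "runs w (For ''i'' (Const 1) (Reg ''tl'') cut_vertex) (10 + 30 * card A) s0 (\<lambda>s. ?I ?t s \<and> regs s ''i'' = ?t)"
  proof (rule runs_For[where I = ?I and l = 1 and B = "\<lambda>_. 20"])
    show "?t < 2 ^ w" using tn word_n by linarith
    show "1 \<le> ?t" using c(3) by simp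
    show "?I 1 (set_reg s0 ''i'' 1)" using c(2) bH by (auto simp: lessThan_Suc)
    show "4 + expr_time (Const 1) + expr_time (Reg ''tl'') + (\<Sum>i = 1..<?t. 20 + 7 + expr_time (Reg ''tl'')) \<le> 10 + 30 * card A"
      using en'(4) by simp
    fix i s
    assume fr: "same_except (insert ''i'' (written_regs cut_vertex)) (written_arrs cut_vertex) s0 s"
    note e = same_exceptD[OF fr]
    show "expr_val w s (Reg ''tl'') = ?t" using e by simp
    assume i: "1 \<le> i" "i < ?t" "regs s ''i'' = i" and I: "?I i s"
    define v where "v = ?q i"
    have vA: "v \<in> A" unfolding v_def using en'(1) i by blast
    have vb: "v \<noteq> b" using c(8)[OF i(2)] i(1) by (simp add: v_def)
    obtain j where j: "j < i" "?par v = ?q j" using c(6)[of i] i by (auto simp: v_def)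
    note pv = lab'(2)[OF vA vb] and lv = lab'(1)[OF vA vb]
    note sig = A.sig_pred[OF b vA pv, folded lv]
    have pA: "?par v \<in> A" using A.predsD[OF pv] by blast
    have pn: "?par v < n" "v < n" using pA vA An by auto
    have H: "v \<in> H \<longleftrightarrow> ?lab v = r \<or> ?par v \<in> H"
      using rsig[OF vA] rsig[OF pA] sig by auto
    \<comment> \<open>\<open>K\<close> is a fresh number, so finding it at the parent, which
      precedes \<open>v\<close> in the queue, means that the parent has been moved.\<close>
    have cp: "arrs s ''comp'' (?par v) = ?K \<longleftrightarrow> ?par v \<in> H"
    proof -
      have "?par v \<in> ?q ` {..<i}" using j by auto
      then show ?thesis using I pn K(1)[OF pn(1)] by auto
    qed
    have lw: "?lab v < n" unfolding lv using A.lab_in_half[OF b vA pv] A.halfD An by blast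
    have "Suc (?lab v) < 2 ^ w" using lw word_n by linarith
    then have l: "Suc (?lab v) mod 2 ^ w = Suc (?lab v)" by simp
    define s1 where "s1 = eval_prog w cut_vertex s"
    have s1: "arrs s1 ''comp'' = (if v \<in> H then (arrs s ''comp'')(v := ?K) else arrs s ''comp'')" "regs s1 ''i'' = i"
      using e i l w_pos H cp unfolding v0(3)
      by (auto simp: s1_def cut_vertex_def v_def[symmetric] v0(3) r_def mod_Suc_eq)
    have "?q ` {..<Suc i} = insert v (?q ` {..<i})" by (auto simp: lessThan_Suc v_def)
    then have "?I (Suc i) (set_reg s1 ''i'' (Suc i))"
      using I by (auto simp: s1)
    then show "runs w cut_vertex 20 s (\<lambda>s'. regs s' ''i'' = i \<and> ?I (Suc i) (set_reg s' ''i'' (Suc i)))"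
      using s1(2) by (intro runs_loop_freeI[OF s1_def]) (simp_all add: cut_vertex_def)
  qed (use w_pos in simp_all)
  have qt: "?q ` {..<?t} = A" using c(1) unfolding enumerates_def by blast
  have Kw: "Suc ?K mod 2 ^ w = Suc ?K" using K(2) word_n by simp
  show ?thesis unfolding cut_def H_def[symmetric]
  proof (rule runs_Seq[OF loop])
    fix s assume I: "?I ?t s \<and> regs s ''i'' = ?t"
      and fr: "same_except (written_regs (For ''i'' (Const 1) (Reg ''tl'') cut_vertex)) (written_arrs (For ''i'' (Const 1) (Reg ''tl'') cut_vertex)) s0 s"
    have "A \<inter> H = H" using Hsub by blast
    then show "runs w (Put ''pa'' (Reg ''K'') (Reg ''a'') ;; ''K'' ::= Reg ''K'' +. Const 1) 20 s (\<lambda>s.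
     (\<forall>v<n. arrs s ''comp'' v = (if v \<in> H then ?K else arrs s0 ''comp'' v)) \<and>
     arrs s ''pa'' = (arrs s0 ''pa'')(?K := regs s0 ''a'') \<and> regs s ''K'' = Suc ?K)"
      using I Kw w_pos same_exceptD[OF fr] unfolding qt
      by (intro runs_loop_free) (simp_all add: mod_Suc_eq)
  qed simp
qed

section \<open>Eccentricities in a cell through its centre\<close>

definition ranked :: "nat set \<Rightarrow> nat \<Rightarrow> state \<Rightarrow> bool" where
  "ranked A c s \<longleftrightarrow> enumerates (arrs s ''ord'') (card A) A \<and> arrs s ''ord'' 0 = c \<and>
     (\<forall>v\<in>A. arrs s ''dep'' v = d c v) \<and>
     (\<forall>i j. i \<le> j \<longrightarrow> j < card A \<longrightarrow> d c (arrs s ''ord'' i) \<le> d c (arrs s ''ord'' j))"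

lemma runs_copy:
  assumes An: "A \<subseteq> {..<n}" and c: "c \<in> A" and cs: "cell_searched A c s0"
  shows "runs w copy (10 + 20 * card A) s0 (ranked A c)"
proof -
  let ?q = "arrs s0 ''q''" and ?t = "regs s0 ''tl''"
  have en: "enumerates ?q ?t A" and q0: "?q 0 = c" and dst: "\<forall>v\<in>A. arrs s0 ''dist'' v = d c v"
    and srt: "\<forall>i j. i \<le> j \<longrightarrow> j < ?t \<longrightarrow> d c (?q i) \<le> d c (?q j)"
    using cs by (simp_all add: cell_searched_def)
  note en' = enumeratesD[OF en]
  have tn: "?t \<le> n" using card_mono[OF _ An] en'(4) by simp
  let ?b = "Put ''ord'' (Reg ''i'') (Get ''q'' (Reg ''i'')) ;;
      Put ''dep'' (Get ''q'' (Reg ''i'')) (Get ''dist'' (Get ''q'' (Reg ''i'')))"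
  let ?I = "\<lambda>i s. \<forall>k<i. arrs s ''ord'' k = ?q k \<and> arrs s ''dep'' (?q k) = arrs s0 ''dist'' (?q k)"
  have "runs w copy (10 + 20 * card A) s0 (\<lambda>s. ?I ?t s \<and> regs s ''i'' = ?t)"
    unfolding copy_def
  proof (rule runs_For[where I = ?I and l = 0 and B = "\<lambda>_. 12"])
    show "?t < 2 ^ w" using tn word_n by linarith
    show "4 + expr_time (Const 0) + expr_time (Reg ''tl'') + (\<Sum>i = 0..<?t. 12 + 7 + expr_time (Reg ''tl'')) \<le> 10 + 20 * card A"
      using en'(4) by simp
    fix i s
    assume fr: "same_except (insert ''i'' (written_regs ?b)) (written_arrs ?b) s0 s"
    note e = same_exceptD[OF fr]
    show "expr_val w s (Reg ''tl'') = ?t" using e by simp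
    assume i: "i < ?t" "regs s ''i'' = i" and I: "?I i s"
    show "runs w ?b 12 s (\<lambda>s'. regs s' ''i'' = i \<and> ?I (Suc i) (set_reg s' ''i'' (Suc i)))"
      using e i I by (intro runs_loop_free) (simp_all add: less_Suc_eq)
  qed (use w_pos in simp_all)
  then show ?thesis
  proof (rule runs_mono)
    fix s :: state assume a: "?I ?t s \<and> regs s ''i'' = ?t"
    have o: "arrs s ''ord'' k = ?q k" if "k < card A" for k using a that en'(4) by simp
    have "enumerates (arrs s ''ord'') (card A) A"
      using en o unfolding enumerates_def by (auto simp: inj_on_def image_def)
    moreover have "\<forall>v\<in>A. arrs s ''dep'' v = d c v"
      using a en'(2) dst by metis
    moreover have "0 < ?t \<longrightarrow> arrs s ''ord'' 0 = c" using o q0 en'(4) by simp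
    moreover have "0 < ?t" using en'(2)[OF c] by auto
    ultimately show "ranked A c s" using srt o en'(4) unfolding ranked_def by simp
  qed simp
qed

text \<open>Every entry that is skipped belongs to \<open>N\<close>, so the cost is proportional to
  \<open>card N\<close> and not to the size of the cell. The entry of \<open>c\<close>, which is
  outside \<open>N\<close>, stops the descent before the index can wrap around.\<close>

lemma runs_scan:
  assumes m: "regs s0 ''m'' = card A" "card A < 2 ^ w" and en: "enumerates (arrs s0 ''ord'') (card A) A"
    and vis: "\<And>v. v \<in> A \<Longrightarrow> arrs s0 ''vis'' v = of_bool (v \<in> N)"
    and N: "N \<subseteq> A" "c \<notin> N" "c \<in> A"
  shows "runs w scan (20 + 10 * card N) s0 (\<lambda>s. regs s ''k'' < card A \<and> arrs s0 ''ord'' (regs s ''k'') \<notin> N \<and>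
    (\<forall>k'. regs s ''k'' < k' \<longrightarrow> k' < card A \<longrightarrow> arrs s0 ''ord'' k' \<in> N))"
proof -
  let ?o = "arrs s0 ''ord''"
  note en' = enumeratesD[OF en]
  obtain kc where kc: "kc < card A" "?o kc = c" using en'(2)[OF N(3)] by metis
  have "finite A" using en kc(1) card.infinite by fastforce
  let ?S = "\<lambda>k. {k'. k' \<le> k \<and> k' < card A \<and> ?o k' \<in> N}"
  let ?I = "\<lambda>s. kc \<le> regs s ''k'' \<and> regs s ''k'' < card A \<and> (\<forall>k'. regs s ''k'' < k' \<longrightarrow> k' < card A \<longrightarrow> ?o k' \<in> N)"
  let ?\<Phi> = "\<lambda>s. 10 * card (?S (regs s ''k''))"
  define s1 where "s1 = set_reg s0 ''k'' (card A - 1)"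
  have "card (?S k) \<le> card N" for k
  proof -
    have "inj_on ?o (?S k)" using en'(3) by (auto simp: inj_on_def)
    moreover have "?o ` ?S k \<subseteq> N" by auto
    ultimately show ?thesis
      by (rule card_inj_on_le) (rule finite_subset[OF N(1) \<open>finite A\<close>])
  qed
  then have Phi: "?\<Phi> s \<le> 10 * card N" for s by simp
  have "runs w (While (Get ''vis'' (Get ''ord'' (Reg ''k''))) (''k'' ::= Reg ''k'' -. Const 1))
    (10 + 10 * card N) s1 (\<lambda>s. ?I s \<and> expr_val w s (Get ''vis'' (Get ''ord'' (Reg ''k''))) = 0)"
  proof (rule runs_While[where \<Phi> = ?\<Phi>])
    show "?I s1" using kc by (auto simp: s1_def)
    show "?\<Phi> s1 + 1 + expr_time (Get ''vis'' (Get ''ord'' (Reg ''k''))) \<le> 10 + 10 * card N"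
      using Phi[of s1] by simp
    fix s assume I: "?I s" and fr: "same_except (written_regs (''k'' ::= Reg ''k'' -. Const 1))
        (written_arrs (''k'' ::= Reg ''k'' -. Const 1)) s1 s"
      and nz: "expr_val w s (Get ''vis'' (Get ''ord'' (Reg ''k''))) \<noteq> 0"
    let ?k = "regs s ''k''"
    have e: "arrs s ''vis'' = arrs s0 ''vis''" "arrs s ''ord'' = ?o"
      using same_exceptD[OF fr] by (simp_all add: s1_def)
    have kN: "?o ?k \<in> N" using nz vis[of "?o ?k"] en'(1)[of ?k] I by (auto simp: e split: if_splits)
    then have "?k \<noteq> kc" using kc N by auto
    then have k0: "kc \<le> ?k - 1" "?k - 1 < ?k" using I by auto
    have "(?k + 2 ^ w - 1) mod 2 ^ w = ?k - 1"
      using k0 I m by (intro word_minus) linarith+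
    then have ev: "expr_val w s (Reg ''k'' -. Const 1) = ?k - 1"
      using w_pos by simp
    have S: "?S ?k = insert ?k (?S (?k - 1))" using k0 I kN by auto
    have "?k \<notin> ?S (?k - 1)" using k0 by auto
    then have "card (?S ?k) = Suc (card (?S (?k - 1)))"
      unfolding S by (intro card_insert_disjoint) simp_all
    moreover have "?o k' \<in> N" if "?k - 1 < k'" "k' < card A" for k'
      using I kN that k0 by (cases "k' = ?k") auto
    ultimately have "runs w (''k'' ::= Reg ''k'' -. Const 1) 4 s (\<lambda>s'. ?I s' \<and>
      ?\<Phi> s' + 4 + 1 + expr_time (Get ''vis'' (Get ''ord'' (Reg ''k''))) \<le> ?\<Phi> s)"
      using k0 I ev by (intro runs_loop_free) (auto simp del: expr_val.simps)
    then show "\<exists>T. runs w (''k'' ::= Reg ''k'' -. Const 1) T s (\<lambda>s'. ?I s' \<and>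
      ?\<Phi> s' + T + 1 + expr_time (Get ''vis'' (Get ''ord'' (Reg ''k''))) \<le> ?\<Phi> s)" by (intro exI[of _ 4])
  qed
  then have loop: "runs w (While (Get ''vis'' (Get ''ord'' (Reg ''k''))) (''k'' ::= Reg ''k'' -. Const 1))
    (10 + 10 * card N) s1 (\<lambda>s. regs s ''k'' < card A \<and> ?o (regs s ''k'') \<notin> N \<and>
    (\<forall>k'. regs s ''k'' < k' \<longrightarrow> k' < card A \<longrightarrow> ?o k' \<in> N))"
  proof (rule runs_mono_frame)
    fix s assume I: "?I s \<and> expr_val w s (Get ''vis'' (Get ''ord'' (Reg ''k''))) = 0"
      and fr: "same_except (written_regs (While (Get ''vis'' (Get ''ord'' (Reg ''k''))) (''k'' ::= Reg ''k'' -. Const 1)))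
        (written_arrs (While (Get ''vis'' (Get ''ord'' (Reg ''k''))) (''k'' ::= Reg ''k'' -. Const 1))) s1 s"
    have e: "arrs s ''vis'' = arrs s0 ''vis''" "arrs s ''ord'' = ?o"
      using same_exceptD[OF fr] by (simp_all add: s1_def)
    have "?o (regs s ''k'') \<notin> N" using I vis[of "?o (regs s ''k'')"] en'(1) by (auto simp: e)
    with I show "regs s ''k'' < card A \<and> ?o (regs s ''k'') \<notin> N \<and>
      (\<forall>k'. regs s ''k'' < k' \<longrightarrow> k' < card A \<longrightarrow> ?o k' \<in> N)" by blast
  qed simp
  have "(card A + 2 ^ w - 1) mod 2 ^ w = card A - 1" using kc m by (intro word_minus) linarith+
  then have "set_reg s0 ''k'' (expr_val w s0 (Reg ''m'' -. Const 1)) = s1"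
    using m w_pos by (simp add: s1_def)
  with loop show ?thesis unfolding scan_def by (intro runs_Assign_Seq) (simp_all only:, simp)
qed

lemma near_test_val:
  assumes "regs s ''y'' = y" "regs s ''z'' = z" "regs s ''best'' = c" "regs s ''u'' = u"
    and "arrs s ''dist'' z + arrs s ''dep'' z < 2 ^ w"
  shows "expr_val w s near_test \<noteq> 0 \<longleftrightarrow> arrs s ''comp'' y = regs s ''a'' \<and> y \<noteq> c \<and>
    (arrs s ''dep'' z < arrs s ''dep'' y \<or> arrs s ''dist'' z + arrs s ''dep'' z = arrs s ''dep'' u)"
proof -
  \<comment> \<open>The sum encoding the disjunction can be 2, which must not wrap around to
    zero.\<close>
  have "(2::nat) < 2 ^ w" using word_n by linarith
  then have 2: "2 mod (2::nat) ^ w = 2" by simp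
  show ?thesis unfolding near_test_def using assms w_pos 2
    by (auto simp: of_bool_def numeral_2_eq_2)
qed

text \<open>The cost counts full degrees of the near vertices, because the scan inspects all their
  neighbours, near or not; \<open>near_cost\<close> sums this bound over \<open>u\<close>.\<close>

lemma runs_leaf_vertex:
  assumes st: "static s0" and un: "unvisited s0"
    and A: "A = {v. v < n \<and> arrs s0 ''comp'' v = regs s0 ''a''}" and med: "median_space A d"
    and c: "c \<in> A" "regs s0 ''best'' = c" and rk: "ranked A c s0" and m: "regs s0 ''m'' = card A"
    and u: "arrs s0 ''ord'' (regs s0 ''i'') = u" "u \<in> A" "u \<noteq> c"
  shows "runs w leaf_vertex (200 + (\<Sum>v\<in>median_space.near A d c u. 80 + 80 * deg v)) s0
    (\<lambda>s. unvisited s \<and> arrs s ''ecc'' = (arrs s0 ''ecc'')(u := ecc d A u))"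
proof -
  interpret A: median_space A d by (rule med)
  have An: "A \<subseteq> {..<n}" using A by auto
  have cn: "card A \<le> n" using card_mono[OF _ An] by simp
  have dn: "d x y \<le> n" if "x \<in> A" "y \<in> A" for x y using A.dist_less_card[OF that] cn by simp
  define N where "N = A.near c u"
  define R where "R = A.near_rel c u"
  have NA: "N \<subseteq> A" unfolding N_def by (rule A.near_sub)
  have uN: "u \<in> N" unfolding N_def using A.near_self u c by blast
  have cN: "c \<notin> N" by (auto simp: N_def A.near_def)
  have en: "enumerates (arrs s0 ''ord'') (card A) A" and dep: "\<And>v. v \<in> A \<Longrightarrow> arrs s0 ''dep'' v = d c v"
    and srt: "\<And>i j. i \<le> j \<Longrightarrow> j < card A \<Longrightarrow> d c (arrs s0 ''ord'' i) \<le> d c (arrs s0 ''ord'' j)"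
    using rk by (auto simp: ranked_def)
  define s1 where "s1 = eval_prog w (''u'' ::= Get ''ord'' (Reg ''i'') ;; start_search ''u'') s0"
  have s1: "arrs s1 ''q'' 0 = u" "regs s1 ''hd'' = 0" "regs s1 ''tl'' = 1" "regs s1 ''u'' = u"
    "arrs s1 ''vis'' = (arrs s0 ''vis'')(u := 1)" "arrs s1 ''dist'' u = 0"
    using w_pos u by (simp_all add: s1_def start_search_def)
  have fr1: "same_except {''u'', ''hd'', ''tl''} {''q'', ''vis'', ''dist''} s0 s1"
    by (auto simp: s1_def start_search_def same_except_def)
  note e1 = same_exceptD[OF fr1]
  have st1: "static s1" using static_same[OF st fr1] by simp
  have RA: "z \<in> A \<and> y \<in> A \<and> d z y = 1" if "(z, y) \<in> R" for z y
    using that by (auto simp: R_def A.near_rel_def)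
  have sp: "search_space N R (d u) 1 (arrs s1 ''q'') n"
  proof
    show "N \<subseteq> {..<n}" using NA An by blast
    show "y \<in> N" if "z \<in> N" "(z, y) \<in> R" for z y
      using that A.near_closed[OF u(2) c(1)] by (auto simp: N_def R_def)
    show "arrs s1 ''q'' i \<in> N" "d u (arrs s1 ''q'' i) = 0" if "i < 1" for i
      using that s1 uN by auto
    show "inj_on (arrs s1 ''q'') {..<1}" by (simp add: lessThan_Suc)
    show "d u y \<le> n" if "y \<in> N" for y using dn that NA u by blast
    show "d u y \<le> Suc (d u z)" if "z \<in> N" "(z, y) \<in> R" for z y
      using A.d_tri[OF u(2), of z y] RA[OF that(2)] by auto
    show "\<exists>z\<in>N. (z, y) \<in> R \<and> d u y = Suc (d u z)" if y: "y \<in> N" "y \<notin> arrs s1 ''q'' ` {..<1}" for y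
    proof -
      have "y \<noteq> u" using y s1 by auto
      then show ?thesis using A.near_pred[OF u(2) c(1), of y] y(1) by (metis N_def R_def)
    qed
  qed
  interpret S: search_space N R "d u" 1 "arrs s1 ''q''" n by (rule sp)
  let ?P = "\<lambda>s'. S.search_done (arrs s' ''q'') (regs s' ''tl'') (arrs s' ''vis'') (arrs s' ''dist'') (arrs s' ''par'')"
  have r2: "runs w (bfs near_test) (10 + (\<Sum>v\<in>N. 40 + 75 * deg v)) s1 ?P"
  proof (rule runs_bfs[OF sp _ st1])
    show "y < n \<and> d z y = 1" if "z \<in> N" "(z, y) \<in> R" for z y
      using RA[OF that(2)] An by blast
    show "regs s1 ''tl'' = 1" "regs s1 ''hd'' = 0" using s1 by simp_all
    show "\<forall>v<n. arrs s1 ''vis'' v = of_bool (v \<in> arrs s1 ''q'' ` {..<1})"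
      using s1 un by (auto simp: unvisited_def lessThan_Suc)
    show "\<forall>i<1. arrs s1 ''dist'' (arrs s1 ''q'' i) = 0" using s1 by simp
    show "(\<Sum>v\<in>N. 40 + (50 + expr_time near_test) * deg v) + 10 \<le> 10 + (\<Sum>v\<in>N. 40 + 75 * deg v)"
      by (simp add: near_test_def)
    fix s' z y
    assume fr: "same_except {''z'', ''hd'', ''j'', ''y'', ''tl''} {''vis'', ''dist'', ''par'', ''q''} s1 s'"
      and z: "z \<in> N" and y: "y < n" "d z y = 1" and r: "regs s' ''z'' = z" "regs s' ''y'' = y" "arrs s' ''dist'' z = d u z"
    have e: "arrs s' ''comp'' = arrs s0 ''comp''" "regs s' ''a'' = regs s0 ''a''" "regs s' ''best'' = c"
      "regs s' ''u'' = u" "arrs s' ''dep'' = arrs s0 ''dep''"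
      using same_exceptD[OF fr] e1 s1 c by simp_all
    have zA: "z \<in> A" using z NA by blast
    have "d u z + d c z < 2 ^ w" using dn[OF u(2) zA] dn[OF c(1) zA] word_n by linarith
    then have "expr_val w s' near_test \<noteq> 0 \<longleftrightarrow> arrs s0 ''comp'' y = regs s0 ''a'' \<and> y \<noteq> c \<and>
      (d c z < arrs s0 ''dep'' y \<or> d u z + d c z = d c u)"
      using near_test_val[OF r(2,1) e(3,4)] r(3) e dep[OF zA] dep[OF u(2)] by simp
    also have "\<dots> \<longleftrightarrow> (z, y) \<in> R"
    proof -
      have "y \<in> A \<longleftrightarrow> arrs s0 ''comp'' y = regs s0 ''a''" using y(1) unfolding A by simp
      then show ?thesis using y zA dep[of y] unfolding R_def A.near_rel_def by auto
    qed
    finally show "expr_val w s' near_test \<noteq> 0 \<longleftrightarrow> (z, y) \<in> R" .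
  qed
  let ?fin = "''x'' ::= Get ''dist'' (Get ''q'' (Reg ''tl'' -. Const 1)) ;;
       ''y'' ::= Get ''dep'' (Reg ''u'') +. Get ''dep'' (Get ''ord'' (Reg ''k'')) ;;
       Cond (Reg ''x'' <. Reg ''y'') (Put ''ecc'' (Reg ''u'') (Reg ''y'')) (Put ''ecc'' (Reg ''u'') (Reg ''x''))"
  have tail: "runs w (scan ;; ?fin ;; clean) (100 + 30 * card N) s2
    (\<lambda>s. unvisited s \<and> arrs s ''ecc'' = (arrs s0 ''ecc'')(u := ecc d A u))"
    if P: "?P s2" and fr2: "same_except (written_regs (bfs near_test)) (written_arrs (bfs near_test)) s1 s2" for s2
  proof -
    note e2 = same_exceptD[OF fr2]
    have P': "inj_on (arrs s2 ''q'') {..<regs s2 ''tl''}" "arrs s2 ''q'' ` {..<regs s2 ''tl''} = N" "regs s2 ''tl'' = card N"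
      "\<And>v. v < n \<Longrightarrow> arrs s2 ''vis'' v = of_bool (v \<in> N)" "\<And>v. v \<in> N \<Longrightarrow> arrs s2 ''dist'' v = d u v"
      "\<And>i j. i \<le> j \<Longrightarrow> j < regs s2 ''tl'' \<Longrightarrow> d u (arrs s2 ''q'' i) \<le> d u (arrs s2 ''q'' j)"
      using P unfolding S.search_done_def by auto
    have cN0: "0 < card N" using uN finite_subset[OF NA A.finite_V] by (auto simp: card_gt_0_iff)
    have cNn: "card N \<le> n" using card_mono[OF A.finite_V NA] cn by simp
    have sc: "runs w scan (20 + 10 * card N) s2 (\<lambda>s. regs s ''k'' < card A \<and> arrs s2 ''ord'' (regs s ''k'') \<notin> N \<and>
      (\<forall>k'. regs s ''k'' < k' \<longrightarrow> k' < card A \<longrightarrow> arrs s2 ''ord'' k' \<in> N))"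
    proof (rule runs_scan[where c = c])
      show "regs s2 ''m'' = card A" using e1 e2 m by simp
      show "card A < 2 ^ w" using cn word_n by linarith
      show "enumerates (arrs s2 ''ord'') (card A) A" using e1 e2 en by simp
      show "arrs s2 ''vis'' v = of_bool (v \<in> N)" if "v \<in> A" for v using P'(4) that An by blast
    qed (use NA cN c in auto)
    show ?thesis
    proof (rule runs_Seq[OF sc])
      fix s3 assume k: "regs s3 ''k'' < card A \<and> arrs s2 ''ord'' (regs s3 ''k'') \<notin> N \<and>
         (\<forall>k'. regs s3 ''k'' < k' \<longrightarrow> k' < card A \<longrightarrow> arrs s2 ''ord'' k' \<in> N)"
        and fr3: "same_except (written_regs scan) (written_arrs scan) s2 s3"
      note e3 = same_exceptD[OF fr3]
      let ?o = "arrs s0 ''ord''"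
      have o: "arrs s2 ''ord'' = ?o" using e1 e2 by simp
      define l where "l = ?o (regs s3 ''k'')"
      define kk where "kk = arrs s2 ''q'' (card N - 1)"
      have lA: "l \<in> A - N" using k enumeratesD(1)[OF en] by (auto simp: l_def o)
      have kkN: "kk \<in> N" using P'(2,3) cN0 unfolding kk_def by (metis diff_less imageI lessThan_iff zero_less_one)
      have ec: "ecc d A u = max (d u kk) (d c u + d c l)"
      proof (rule A.ecc_near[OF u(2) c(1) u(3)])
        show "kk \<in> A.near c u" "l \<in> A - A.near c u" using kkN lA by (simp_all add: N_def)
        show "d u v \<le> d u kk" if v: "v \<in> A.near c u" for v
        proof -
          obtain i where "i < card N" "v = arrs s2 ''q'' i" using v P'(2,3) unfolding N_def[symmetric] by auto
          then show ?thesis using P'(6)[of i "card N - 1"] P'(3) cN0 by (simp add: kk_def)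
        qed
        show "d c v \<le> d c l" if v: "v \<in> A - A.near c u" for v
        proof -
          obtain i where i: "i < card A" "v = ?o i" using v enumeratesD(2)[OF en] by blast
          then have "i \<le> regs s3 ''k''" using k v unfolding o N_def by (meson DiffD2 not_le)
          then show ?thesis using srt[of i "regs s3 ''k''"] k i by (simp add: l_def)
        qed
      qed
      have dw: "d c u + d c l < 2 ^ w" using dn[OF c(1) u(2)] dn[OF c(1), of l] lA word_n by auto
      have tm: "(card N + 2 ^ w - 1) mod 2 ^ w = card N - 1"
        using cN0 cNn word_n by (intro word_minus) linarith+
      define s4 where "s4 = eval_prog w ?fin s3"
      have v3: "arrs s3 ''q'' (card N - 1) = kk" "arrs s3 ''dist'' kk = d u kk" "regs s3 ''tl'' = card N" "regs s3 ''u'' = u"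
        "arrs s3 ''dep'' u = d c u" "arrs s3 ''ord'' (regs s3 ''k'') = l" "arrs s3 ''dep'' l = d c l" "arrs s3 ''ecc'' = arrs s0 ''ecc''"
        using e1 e2 e3 P'(3,5) kkN s1 dep[of u] dep[of l] lA u(2) by (simp_all add: kk_def l_def)
      have s4: "arrs s4 ''ecc'' = (arrs s0 ''ecc'')(u := ecc d A u)"
        using v3 tm dw w_pos ec by (auto simp: s4_def max_def)
      have fr4: "same_except {''x'', ''y''} {''ecc''} s3 s4"
        by (auto simp: s4_def same_except_def)
      note e4 = same_exceptD[OF fr4]
      have cl: "runs w clean (10 + 20 * card N) s4 unvisited"
      proof (rule runs_clean)
        show "inj_on (arrs s4 ''q'') {..<regs s4 ''tl''}" "arrs s4 ''q'' ` {..<regs s4 ''tl''} = N"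
          using P' e3 e4 by simp_all
        show "N \<subseteq> {..<n}" using NA An by blast
        show "arrs s4 ''vis'' v = 0" if "v < n" "v \<notin> N" for v using P'(4)[OF that(1)] that e3 e4 by simp
      qed
      show "runs w (?fin ;; clean) (80 + 20 * card N) s3
        (\<lambda>s. unvisited s \<and> arrs s ''ecc'' = (arrs s0 ''ecc'')(u := ecc d A u))"
      proof (rule runs_loop_free_Seq)
        show "runs w clean (10 + 20 * card N) (eval_prog w ?fin s3)
          (\<lambda>s. unvisited s \<and> arrs s ''ecc'' = (arrs s0 ''ecc'')(u := ecc d A u))"
          unfolding s4_def[symmetric]
          by (rule runs_mono_frame[OF cl order_refl]) (use s4 in \<open>auto dest: same_exceptD(2)[where a = "''ecc''"]\<close>)
      qed simp_all
    qed simp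
  qed
  show ?thesis unfolding leaf_vertex_def N_def[symmetric]
  proof (rule runs_Seq_assoc, rule runs_loop_free_Seq)
    show "runs w (bfs near_test ;; scan ;; ?fin ;; clean) (110 + (\<Sum>v\<in>N. 40 + 75 * deg v) + 30 * card N)
      (eval_prog w (''u'' ::= Get ''ord'' (Reg ''i'') ;; start_search ''u'') s0)
      (\<lambda>s. unvisited s \<and> arrs s ''ecc'' = (arrs s0 ''ecc'')(u := ecc d A u))"
      unfolding s1_def[symmetric] by (rule runs_Seq[OF r2 tail]) simp_all
    show "loop_free (''u'' ::= Get ''ord'' (Reg ''i'') ;; start_search ''u'')" by (simp add: start_search_def)
    have "(\<Sum>v\<in>N. 40 + 75 * deg v) + 30 * card N \<le> (\<Sum>v\<in>N. 80 + 80 * deg v)"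
      by (simp add: sum.distrib sum_distrib_left[symmetric])
    then show "prog_time (''u'' ::= Get ''ord'' (Reg ''i'') ;; start_search ''u'') + (110 + (\<Sum>v\<in>N. 40 + 75 * deg v) + 30 * card N)
      \<le> 200 + (\<Sum>v\<in>N. 80 + 80 * deg v)" by (simp add: start_search_def)
  qed
qed

lemma runs_leaf:
  assumes st: "static s0" and un: "unvisited s0"
    and A: "A = {v. v < n \<and> arrs s0 ''comp'' v = regs s0 ''a''}" and med: "median_space A d"
    and c: "regs s0 ''best'' = c" "c \<in> A"
  shows "runs w leaf (150 + (\<Sum>v\<in>A. 320 + 60 * deg v) + (\<Sum>u\<in>A - {c}. \<Sum>v\<in>median_space.near A d c u. 80 + 80 * deg v)) s0
    (\<lambda>s. unvisited s \<and> (\<forall>v. arrs s ''ecc'' v = (if v \<in> A then ecc d A v else arrs s0 ''ecc'' v)))"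
proof -
  interpret A: median_space A d by (rule med)
  have An: "A \<subseteq> {..<n}" using A by auto
  have cn: "card A \<le> n" using card_mono[OF _ An] by simp
  have c0: "0 < card A" using c A.finite_V by (metis card_gt_0_iff empty_iff)
  let ?c = "\<lambda>u. \<Sum>v\<in>A.near c u. 80 + 80 * deg v"
  let ?init = "''m'' ::= Reg ''tl'' ;; Put ''ecc'' (Reg ''best'') (Get ''dep'' (Get ''ord'' (Reg ''m'' -. Const 1)))"
  let ?loop = "For ''i'' (Const 1) (Reg ''m'') leaf_vertex"
  let ?post = "\<lambda>s. unvisited s \<and> (\<forall>v. arrs s ''ecc'' v = (if v \<in> A then ecc d A v else arrs s0 ''ecc'' v))"
  have r1: "runs w (cell_search ''best'') (50 + (\<Sum>v\<in>A. 60 + 54 * deg v)) s0 (\<lambda>s. cell_searched A c s \<and> unvisited s)"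
    using runs_cell_search[OF st un A med, of "''best''"] c by simp
  have rest: "runs w (copy ;; ?init ;; ?loop) (60 + 220 * card A + 20 * card A + sum ?c (A - {c}) + 10 * card A) s1 ?post"
    if cs: "cell_searched A c s1 \<and> unvisited s1"
      and fr1: "same_except (written_regs (cell_search ''best'')) (written_arrs (cell_search ''best'')) s0 s1" for s1
  proof -
    note e1 = same_exceptD[OF fr1]
    have st1: "static s1" using static_same[OF st fr1] by simp
    have tl: "regs s1 ''tl'' = card A" using cs by (simp add: cell_searched_def enumerates_def)
    show ?thesis
    proof (rule runs_Seq[OF runs_copy[OF An c(2) conjunct1[OF cs]]])
      fix s2 assume rk: "ranked A c s2" and fr2: "same_except (written_regs copy) (written_arrs copy) s1 s2"
      note e2 = same_exceptD[OF fr2]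
      let ?o = "arrs s2 ''ord''"
      have en: "enumerates ?o (card A) A" and o0: "?o 0 = c" and dep: "\<And>v. v \<in> A \<Longrightarrow> arrs s2 ''dep'' v = d c v"
        and srt: "\<And>i j. i \<le> j \<Longrightarrow> j < card A \<Longrightarrow> d c (?o i) \<le> d c (?o j)"
        using rk by (auto simp: ranked_def)
      note en' = enumeratesD[OF en]
      define s3 where "s3 = s2\<lparr>regs := (regs s2)(''m'' := card A), arrs := (arrs s2)(''ecc'' := (arrs s2 ''ecc'')(c := ecc d A c))\<rparr>"
      have ecc_c: "ecc d A c = d c (?o (card A - 1))"
        unfolding ecc_def
      proof (rule Max_eqI)
        show "finite (d c ` A)" using A.finite_V by simp
        show "d c (?o (card A - 1)) \<in> d c ` A" using en'(1) c0 by simp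
        show "y \<le> d c (?o (card A - 1))" if "y \<in> d c ` A" for y
        proof -
          from that obtain v where v: "v \<in> A" "y = d c v" by (rule imageE)
          then obtain i where "i < card A" "v = ?o i" using en'(2) by blast
          then show ?thesis using srt[of i "card A - 1"] v by simp
        qed
      qed
      have "(card A + 2 ^ w - 1) mod 2 ^ w = card A - 1"
        using c0 cn word_n by (intro word_minus) linarith+
      then have pre: "eval_prog w ?init s2 = s3"
        using tl e1 e2 c w_pos dep[of "?o (card A - 1)"] en'(1)[of "card A - 1"] c0
        by (simp add: s3_def ecc_c)
      have e3: "arrs s3 ''comp'' = arrs s0 ''comp''" "regs s3 ''a'' = regs s0 ''a''" "regs s3 ''best'' = c" "arrs s3 ''ord'' = ?o"
        "arrs s3 ''dep'' = arrs s2 ''dep''" "arrs s3 ''vis'' = arrs s1 ''vis''" "regs s3 ''m'' = card A"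
        using e1 e2 c by (simp_all add: s3_def)
      have st3: "static s3" using static_same[OF st1 fr2] by (simp add: s3_def static_def)
      have un3: "unvisited s3" using cs e3 by (simp add: unvisited_def)
      have rk3: "ranked A c s3" using rk e3 by (simp add: ranked_def)
      let ?I = "\<lambda>i s. unvisited s \<and> (\<forall>v. arrs s ''ecc'' v = (if v \<in> ?o ` {..<i} then ecc d A v else arrs s0 ''ecc'' v))"
      have "runs w ?loop (10 + 220 * card A + sum ?c (A - {c})) s3 (\<lambda>s. ?I (card A) s \<and> regs s ''i'' = card A)"
      proof (rule runs_For[where I = ?I and l = 1 and B = "\<lambda>i. 200 + ?c (?o i)"])
        show "card A < 2 ^ w" using cn word_n by linarith
        show "1 \<le> card A" using c0 by simp
        show "?I 1 (set_reg s3 ''i'' 1)" using un3 o0 e1 e2 by (auto simp: unvisited_def s3_def lessThan_Suc)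
        have "(\<Sum>i = 1..<card A. ?c (?o i)) = sum ?c (A - {c})"
        proof (rule sum.reindex_bij_betw)
          show "bij_betw ?o {1..<card A} (A - {c})"
          proof (rule bij_betw_imageI)
            show "inj_on ?o {1..<card A}" using en'(3) by (auto simp: inj_on_def)
            have "{..<card A} = insert 0 {1..<card A}" using c0 by auto
            then have "A = insert c (?o ` {1..<card A})" using en o0 unfolding enumerates_def by (metis image_insert)
            moreover have "c \<notin> ?o ` {1..<card A}" using en'(3)[of 0] c0 o0 by fastforce
            ultimately show "?o ` {1..<card A} = A - {c}" by blast
          qed
        qed
        then have "(\<Sum>i = 1..<card A. 200 + ?c (?o i) + 7 + expr_time (Reg ''m'')) = 208 * (card A - 1) + sum ?c (A - {c})"
          by (simp add: sum.distrib)
        then show "4 + expr_time (Const 1) + expr_time (Reg ''m'') + (\<Sum>i = 1..<card A. 200 + ?c (?o i) + 7 + expr_time (Reg ''m''))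
          \<le> 10 + 220 * card A + sum ?c (A - {c})" by simp
        fix i s
        assume fr: "same_except (insert ''i'' (written_regs leaf_vertex)) (written_arrs leaf_vertex) s3 s"
        note e = same_exceptD[OF fr]
        show "expr_val w s (Reg ''m'') = card A" using e e3 by simp
        assume i: "1 \<le> i" "i < card A" "regs s ''i'' = i" and I: "?I i s"
        have oA: "?o i \<in> A" "?o i \<noteq> c" using en'(1)[OF i(2)] en'(3)[of i 0] i c0 o0 by auto
        have r: "runs w leaf_vertex (200 + ?c (?o i)) s (\<lambda>s'. unvisited s' \<and> arrs s' ''ecc'' = (arrs s ''ecc'')(?o i := ecc d A (?o i)))"
        proof (rule runs_leaf_vertex)
          show "static s" using static_same[OF st3 fr] by simp
          show "A = {v. v < n \<and> arrs s ''comp'' v = regs s ''a''}" using e e3 A by simp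
          show "ranked A c s" using rk3 e unfolding ranked_def by simp
          show "arrs s ''ord'' (regs s ''i'') = ?o i" using e e3 i by simp
        qed (use I med c e e3 oA in simp_all)
        have "?o ` {..<Suc i} = insert (?o i) (?o ` {..<i})" by (simp add: lessThan_Suc)
        then show "runs w leaf_vertex (200 + ?c (?o i)) s (\<lambda>s'. regs s' ''i'' = i \<and> ?I (Suc i) (set_reg s' ''i'' (Suc i)))"
          using I i(3) by (intro runs_mono_frame[OF r]) (auto simp: unvisited_def dest: same_exceptD(1)[where x = "''i''"])
      qed (use w_pos in simp_all)
      then have main: "runs w ?loop (10 + 220 * card A + sum ?c (A - {c})) (eval_prog w ?init s2) ?post"
        unfolding pre
      proof (rule runs_mono)
        have "?o ` {..<card A} = A" using en by (simp add: enumerates_def)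
        then show "?post s" if "?I (card A) s \<and> regs s ''i'' = card A" for s using that by simp
      qed simp
      show "runs w (?init ;; ?loop) (50 + 220 * card A + sum ?c (A - {c})) s2 ?post"
        by (rule runs_loop_free_Seq[OF _ main]) simp_all
    qed simp
  qed
  show ?thesis unfolding leaf_def
  proof (rule runs_Seq[OF r1 rest])
    show "50 + (\<Sum>v\<in>A. 60 + 54 * deg v) + (60 + 220 * card A + 20 * card A + sum ?c (A - {c}) + 10 * card A)
      \<le> 150 + (\<Sum>v\<in>A. 320 + 60 * deg v) + sum ?c (A - {c})"
      by (simp add: sum.distrib sum_distrib_left[symmetric])
  qed
qed

end

section \<open>Undoing a cut\<close>

text \<open>Assigning \<open>val\<close> repeatedly is harmless: by \<open>far_boundary\<close>
  every neighbour across the cut yields the same value. The mark in \<open>vis\<close> keeps a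
  vertex from entering the queue twice.\<close>

definition frontier_edge :: prog where
  "frontier_edge =
     (''y'' ::= Get ''nbr'' (Reg ''j'') ;;
      Cond ((Get ''comp'' (Reg ''y'') =. Reg ''a'') +. (Get ''comp'' (Reg ''y'') =. Reg ''t''))
        (Cond (Get ''comp'' (Reg ''y'') =. Get ''comp'' (Reg ''i'')) Skip
          (Put ''val'' (Reg ''i'') (Get ''ecc'' (Reg ''y'') +. Const 1) ;;
           Cond (Get ''vis'' (Reg ''i'')) Skip
             (Put ''vis'' (Reg ''i'') (Const 1) ;; Put ''dist'' (Reg ''i'') (Const 0) ;;
              Put ''q'' (Reg ''tl'') (Reg ''i'') ;; ''tl'' ::= Reg ''tl'' +. Const 1)))
        Skip)"

definition frontier_vertex :: prog where
  "frontier_vertex =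
     Cond ((Get ''comp'' (Reg ''i'') =. Reg ''a'') +. (Get ''comp'' (Reg ''i'') =. Reg ''t''))
       (For ''j'' (Get ''off'' (Reg ''i'')) (Get ''off'' (Reg ''i'' +. Const 1)) frontier_edge) Skip"

text \<open>Scanning all vertices of the graph, and not just the two cells, is affordable because
  there are fewer than \<open>sqrt n\<close> cuts to undo.\<close>

definition frontier :: prog where
  "frontier = (''hd'' ::= Const 0 ;; ''tl'' ::= Const 0 ;; For ''i'' (Const 0) (Reg ''n'') frontier_vertex)"

text \<open>Parents precede their children in the queue, so one pass carries the values away from
  the cut. The first \<open>m\<close> entries are the boundary, where \<open>val\<close> is set
  already.\<close>

definition spread :: prog where
  "spread = For ''i'' (Reg ''m'') (Reg ''tl'')
     (''v'' ::= Get ''q'' (Reg ''i'') ;;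
      Put ''val'' (Reg ''v'') (Get ''val'' (Get ''par'' (Reg ''v'')) +. Const 1))"

definition join_vertex :: prog where
  "join_vertex =
     (''v'' ::= Get ''q'' (Reg ''i'') ;;
      Cond (Get ''ecc'' (Reg ''v'') <. Get ''val'' (Reg ''v''))
        (Put ''ecc'' (Reg ''v'') (Get ''val'' (Reg ''v''))) Skip ;;
      Put ''comp'' (Reg ''v'') (Reg ''a''))"

text \<open>Both sides are searched at the same time: the test lets no branch leave the side in
  which it started. Cell numbers change only afterwards, in \<open>join_vertex\<close>.\<close>

definition merge :: prog where
  "merge =
     (frontier ;; ''m'' ::= Reg ''tl'' ;;
      bfs (Get ''comp'' (Reg ''y'') =. Get ''comp'' (Reg ''z'')) ;;
      spread ;; For ''i'' (Const 0) (Reg ''tl'') join_vertex ;; clean)"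

lemma written_merge [simp]:
  "written_regs frontier_edge = {''y'', ''tl''}" "written_arrs frontier_edge = {''val'', ''vis'', ''dist'', ''q''}"
  "written_regs frontier_vertex = {''y'', ''tl'', ''j''}" "written_arrs frontier_vertex = {''val'', ''vis'', ''dist'', ''q''}"
  "written_regs frontier = {''y'', ''tl'', ''j'', ''hd'', ''i''}" "written_arrs frontier = {''val'', ''vis'', ''dist'', ''q''}"
  "written_regs spread = {''i'', ''v''}" "written_arrs spread = {''val''}"
  "written_regs join_vertex = {''v''}" "written_arrs join_vertex = {''ecc'', ''comp''}"
  "written_regs merge = {''y'', ''tl'', ''j'', ''hd'', ''i'', ''v'', ''m'', ''z'', ''e''}"
  "written_arrs merge = {''val'', ''vis'', ''dist'', ''q'', ''par'', ''ecc'', ''comp''}"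
  by (auto simp: frontier_edge_def frontier_vertex_def frontier_def spread_def join_vertex_def merge_def)

text \<open>The cells \<open>a\<close> and \<open>t\<close> are the two sides of the cut that is
  being undone, and \<open>ecc0\<close> holds the eccentricities within each side.\<close>

locale merging = ram_graph +
  fixes X :: "nat set" and x y :: nat and cmp ecc0 :: "nat \<Rightarrow> nat" and a t :: nat
  assumes X: "X = {v. v < n \<and> (cmp v = a \<or> cmp v = t)}" and medX: "median_space X d"
    and xX: "x \<in> X" and yX: "y \<in> X" and xy: "d x y = 1" and at: "a \<noteq> t"
    and hx: "median_space.half X d x y = {v. v < n \<and> cmp v = a}"
    and hy: "median_space.half X d y x = {v. v < n \<and> cmp v = t}"
    and ecc0: "\<And>v. v < n \<Longrightarrow> cmp v = a \<Longrightarrow> ecc0 v = ecc d {v. v < n \<and> cmp v = a} v"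
      "\<And>v. v < n \<Longrightarrow> cmp v = t \<Longrightarrow> ecc0 v = ecc d {v. v < n \<and> cmp v = t} v"
begin

sublocale X: median_space X d by (rule medX)

lemma yx: "d y x = 1"
  using xy adjacency_sym[of x y] by simp

text \<open>The gap is 1 on the boundary; subtracting 1 gives the sources of the search level
  0.\<close>

definition level :: "nat \<Rightarrow> nat" where
  "level v = (if cmp v = a then X.gap x y v else X.gap y x v) - 1"

definition far :: "nat \<Rightarrow> nat" where
  "far v = (if cmp v = a then ecc d (X.half y x) v else ecc d (X.half x y) v)"

definition boundary :: "nat set" where
  "boundary = {v \<in> X. \<exists>u\<in>X. d v u = 1 \<and> cmp u \<noteq> cmp v}"

definition R :: "(nat \<times> nat) set" where
  "R = {(z, u). z \<in> X \<and> u \<in> X \<and> d z u = 1 \<and> cmp z = cmp u}"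

lemma X_iff: "v \<in> X \<longleftrightarrow> v < n \<and> (cmp v = a \<or> cmp v = t)"
  by (subst X) simp

lemma X_sub: "X \<subseteq> {..<n}" by (auto simp: X_iff)

lemma X_cases:
  assumes "v \<in> X"
  obtains "cmp v = a" "v \<in> X.half x y" | "cmp v = t" "v \<in> X.half y x"
  using assms by (auto simp: X_iff hx hy)

lemma mem_half: "v \<in> X.half x y \<longleftrightarrow> v \<in> X \<and> cmp v = a" "v \<in> X.half y x \<longleftrightarrow> v \<in> X \<and> cmp v = t"
  by (auto simp: X_iff hx hy)

lemma far_le: "v \<in> X \<Longrightarrow> far v \<le> n"
proof -
  assume v: "v \<in> X"
  have c: "card X \<le> n" using card_mono[OF _ X_sub] by simp
  have "d v u \<le> n" if "u \<in> X" for u using X.dist_less_card[OF v that] c by simp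
  then have "ecc d B v \<le> n" if "B \<subseteq> X" "B \<noteq> {}" for B
    unfolding ecc_def using that finite_subset[OF that(1) X.finite_V] by (subst Max_le_iff) auto
  moreover have "X.half x y \<noteq> {}" "X.half y x \<noteq> {}" using X.half_self xX yX xy yx by blast+
  ultimately show "far v \<le> n" using X.half_sub by (simp add: far_def)
qed

lemma boundary_iff: "v \<in> boundary \<longleftrightarrow> v \<in> X \<and> level v = 0"
proof (cases "v \<in> X")
  case True
  then show ?thesis
  proof (cases rule: X_cases)
    case 1
    have "X.gap x y v > 0" using X.gap_pos[OF xX yX xy 1(2)] .
    then have "level v = 0 \<longleftrightarrow> X.gap x y v = 1" using 1 by (auto simp: level_def)
    also have "\<dots> \<longleftrightarrow> (\<exists>u\<in>X.half y x. d v u = 1)" using X.gap_eq_1_iff[OF xX yX xy 1(2)] .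
    also have "\<dots> \<longleftrightarrow> v \<in> boundary"
      using True 1 at by (auto simp: boundary_def mem_half X_iff)
    finally show ?thesis using True by blast
  next
    case 2
    have "X.gap y x v > 0" using X.gap_pos[OF yX xX yx 2(2)] .
    then have "level v = 0 \<longleftrightarrow> X.gap y x v = 1" using 2 at by (auto simp: level_def)
    also have "\<dots> \<longleftrightarrow> (\<exists>u\<in>X.half x y. d v u = 1)" using X.gap_eq_1_iff[OF yX xX yx 2(2)] .
    also have "\<dots> \<longleftrightarrow> v \<in> boundary"
      using True 2 at by (auto simp: boundary_def mem_half X_iff)
    finally show ?thesis using True by blast
  qed
qed (simp add: boundary_def)

lemma far_boundary:
  assumes "v \<in> X" "u \<in> X" "d v u = 1" "cmp u \<noteq> cmp v"
  shows "far v = Suc (ecc0 u)"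
  using assms(1)
proof (cases rule: X_cases)
  case 1
  then have u: "u \<in> X.half y x" "cmp u = t" using assms by (auto simp: mem_half X_iff)
  then have "ecc0 u = ecc d (X.half y x) u" using ecc0(2)[of u] assms(2) unfolding hy by (simp add: X_iff)
  then show ?thesis using X.ecc_across_edge[OF xX yX xy 1(2) u(1) assms(3)] 1 by (simp add: far_def)
next
  case 2
  then have u: "u \<in> X.half x y" "cmp u = a" using assms by (auto simp: mem_half X_iff)
  then have "ecc0 u = ecc d (X.half x y) u" using ecc0(1)[of u] assms(2) unfolding hx by (simp add: X_iff)
  then show ?thesis using X.ecc_across_edge[OF yX xX yx 2(2) u(1) assms(3)] 2 at by (simp add: far_def)
qed

lemma far_step:
  assumes "(z, v) \<in> R" "level v = Suc (level z)"
  shows "far v = Suc (far z)"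
proof -
  have zv: "z \<in> X" "v \<in> X" "d z v = 1" "cmp z = cmp v" using assms by (auto simp: R_def)
  from zv(2) show ?thesis
  proof (cases rule: X_cases)
    case 1
    then have z: "z \<in> X.half x y" using zv by (simp add: mem_half)
    have "X.gap x y v = Suc (X.gap x y z)"
      using assms(2) 1 zv X.gap_pos[OF xX yX xy z] X.gap_pos[OF xX yX xy 1(2)] by (simp add: level_def)
    then show ?thesis using X.ecc_across_step[OF xX yX xy z 1(2) zv(3)] 1 zv by (simp add: far_def)
  next
    case 2
    then have z: "z \<in> X.half y x" using zv by (simp add: mem_half)
    have "X.gap y x v = Suc (X.gap y x z)"
      using assms(2) 2 zv at X.gap_pos[OF yX xX yx z] X.gap_pos[OF yX xX yx 2(2)] by (simp add: level_def)
    then show ?thesis using X.ecc_across_step[OF yX xX yx z 2(2) zv(3)] 2 zv at by (simp add: far_def)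
  qed
qed

text \<open>\<open>gap_lipschitz\<close> bounds the growth of levels and \<open>gap_step\<close>
  provides predecessors; both survive the shift by 1 because gaps are positive within their
  side.\<close>

lemma search_space_merging:
  assumes en: "enumerates q m boundary"
  shows "search_space X R level m q n"
proof
  note en' = enumeratesD[OF en]
  show "X \<subseteq> {..<n}" by (rule X_sub)
  show "u \<in> X" if "(z, u) \<in> R" for z u using that by (simp add: R_def)
  show "q i \<in> X" "level (q i) = 0" if "i < m" for i using en'(1)[OF that] boundary_iff by blast+
  show "inj_on q {..<m}" using en unfolding enumerates_def by blast
  have c: "card X \<le> n" using card_mono[OF _ X_sub] by simp
  have "X.gap x y v \<le> n" "X.gap y x v \<le> n" if "v \<in> X" for v
  proof -
    have "x \<in> X.half x y" "y \<in> X.half y x" using X.half_self xX yX xy yx by blast+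
    then have "X.gap x y v \<le> d v y" "X.gap y x v \<le> d v x"
      using X.gap_le[OF xX yX xy that] X.gap_le[OF yX xX yx that] by blast+
    then show "X.gap x y v \<le> n" "X.gap y x v \<le> n"
      using X.dist_less_card[OF that xX] X.dist_less_card[OF that yX] c by linarith+
  qed
  then show "level v \<le> n" if "v \<in> X" for v using that by (auto simp: level_def intro: order_trans[OF diff_le_self])
  show "level u \<le> Suc (level z)" if "z \<in> X" "(z, u) \<in> R" for z u
  proof -
    have zu: "z \<in> X" "u \<in> X" "d z u = 1" "cmp z = cmp u" using that by (auto simp: R_def)
    have "X.gap x y u \<le> Suc (X.gap x y z)" "X.gap y x u \<le> Suc (X.gap y x z)"
      using X.gap_lipschitz[OF xX yX xy zu(1-3)] X.gap_lipschitz[OF yX xX yx zu(1-3)] by blast+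
    then show ?thesis using zu(4) by (cases "cmp u = a") (simp_all add: level_def)
  qed
  show "\<exists>z\<in>X. (z, v) \<in> R \<and> level v = Suc (level z)" if v: "v \<in> X" "v \<notin> q ` {..<m}" for v
  proof -
    have "q ` {..<m} = boundary" using en unfolding enumerates_def by blast
    then have "v \<notin> boundary" using v(2) by blast
    then have l: "level v \<noteq> 0" using v(1) by (simp add: boundary_iff)
    from v(1) show ?thesis
    proof (cases rule: X_cases)
      case 1
      have "X.gap x y v \<noteq> 1" using l 1 by (simp add: level_def)
      then obtain z where z: "z \<in> X.half x y" "d z v = 1" "X.gap x y v = Suc (X.gap x y z)"
        using X.gap_step[OF xX yX xy 1(2)] by metis
      have "level v = Suc (level z)" using z 1 X.gap_pos[OF xX yX xy z(1)] by (simp add: level_def mem_half)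
      then show ?thesis using z 1 v(1) by (auto simp: R_def mem_half)
    next
      case 2
      have "X.gap y x v \<noteq> 1" using l 2 at by (simp add: level_def)
      then obtain z where z: "z \<in> X.half y x" "d z v = 1" "X.gap y x v = Suc (X.gap y x z)"
        using X.gap_step[OF yX xX yx 2(2)] by metis
      have "level v = Suc (level z)" using z 2 at X.gap_pos[OF yX xX yx z(1)] by (simp add: level_def mem_half)
      then show ?thesis using z 2 v(1) by (auto simp: R_def mem_half)
    qed
  qed
qed

lemma ecc_join:
  assumes "v \<in> X" shows "ecc d X v = max (ecc0 v) (far v)"
proof -
  have fin: "finite (X.half x y)" "finite (X.half y x)" by simp_all
  have ne: "X.half x y \<noteq> {}" "X.half y x \<noteq> {}" using X.half_self xX yX xy yx by blast+
  have "X = X.half x y \<union> X.half y x" using X.half_partition(1)[OF xX yX xy] by simp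
  then have "ecc d X v = max (ecc d (X.half x y) v) (ecc d (X.half y x) v)"
    using ecc_Un[OF fin(1) ne(1) fin(2) ne(2)] by metis
  moreover from assms have v: "v < n" using X_sub by auto
  moreover from assms have "max (ecc d (X.half x y) v) (ecc d (X.half y x) v) = max (ecc0 v) (far v)"
  proof (cases rule: X_cases)
    case 1
    then show ?thesis using ecc0(1)[OF v] by (simp add: far_def hx)
  next
    case 2
    then show ?thesis using ecc0(2)[OF v] at by (simp add: far_def hy max.commute)
  qed
  ultimately show ?thesis by simp
qed

section \<open>Correctness of the merging program\<close>

definition input :: "state \<Rightarrow> bool" where
  "input s \<longleftrightarrow> static s \<and> arrs s ''comp'' = cmp \<and> arrs s ''ecc'' = ecc0 \<and> regs s ''a'' = a \<and> regs s ''t'' = t"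

definition front :: "nat set \<Rightarrow> state \<Rightarrow> bool" where
  "front S s \<longleftrightarrow> enumerates (arrs s ''q'') (regs s ''tl'') S \<and>
     (\<forall>v<n. arrs s ''vis'' v = of_bool (v \<in> S)) \<and> (\<forall>v\<in>S. arrs s ''dist'' v = 0 \<and> arrs s ''val'' v = far v)"

lemma ecc0_word: "u \<in> X \<Longrightarrow> Suc (ecc0 u) < 2 ^ w"
  using ecc_join[of u] far_le word_n
proof -
  assume u: "u \<in> X"
  have c: "card X \<le> n" using card_mono[OF _ X_sub] by simp
  have "ecc0 u \<le> ecc d X u" using ecc_join[OF u] by simp
  also have "ecc d X u \<le> n" unfolding ecc_def
    using X.finite_V u X.dist_less_card[OF u] c by (subst Max_le_iff) (auto intro: order.strict_implies_order less_le_trans)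
  finally show "Suc (ecc0 u) < 2 ^ w" using word_n by linarith
qed

text \<open>As \<open>a\<close> and \<open>t\<close> differ, at most one summand is 1, and the sum
  encodes the disjunction without overflow.\<close>

lemma comp_test:
  assumes "input s"
  shows "expr_val w s ((Get ''comp'' (Reg r) =. Reg ''a'') +. (Get ''comp'' (Reg r) =. Reg ''t'')) \<noteq> 0 \<longleftrightarrow>
    cmp (regs s r) = a \<or> cmp (regs s r) = t"
  using assms w_pos at by (auto simp: input_def)

lemma runs_frontier_edge:
  assumes inp: "input s" and S: "S \<subseteq> X" and fr: "front S s" and v: "regs s ''i'' = v" "v \<in> X"
    and j: "off v \<le> regs s ''j''" "regs s ''j'' < off (Suc v)"
  defines "u \<equiv> nbr (regs s ''j'')"
  shows "runs w frontier_edge 45 s (front (if u \<in> X \<and> cmp u \<noteq> cmp v then insert v S else S))"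
proof (rule runs_loop_freeI[OF refl])
  show "loop_free frontier_edge" "prog_time frontier_edge \<le> 45" by (simp_all add: frontier_edge_def)
  have vn: "v < n" using v X_sub by auto
  have u: "u < n" "d v u = 1" using nbr_adj[OF vn j] by (simp_all add: u_def)
  let ?s1 = "set_reg s ''y'' u"
  have inp1: "input ?s1" using inp by (simp add: input_def static_def)
  have e1: "eval_prog w (''y'' ::= Get ''nbr'' (Reg ''j'')) s = ?s1" using inp by (simp add: input_def static_def u_def)
  have uX: "u \<in> X \<longleftrightarrow> cmp u = a \<or> cmp u = t" using u by (simp add: X_iff)
  show "front (if u \<in> X \<and> cmp u \<noteq> cmp v then insert v S else S) (eval_prog w frontier_edge s)"
  proof (cases "u \<in> X \<and> cmp u \<noteq> cmp v")
    case False
    have "eval_prog w frontier_edge s = ?s1"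
      unfolding frontier_edge_def using e1 comp_test[OF inp1, of "''y''"] False uX inp v w_pos
      by (auto simp: input_def simp del: expr_val.simps(4)) (auto simp: input_def)
    then show ?thesis using fr False by (auto simp: front_def)
  next
    case True
    have far: "far v = Suc (ecc0 u)" using far_boundary[OF v(2) _ u(2)] True by blast
    have ew: "Suc (ecc0 u) mod 2 ^ w = Suc (ecc0 u)" using ecc0_word True by simp
    have tl: "regs s ''tl'' = card S" using fr by (simp add: front_def enumerates_def)
    have "card S \<le> n" using card_mono[OF _ subset_trans[OF S X_sub]] by simp
    then have tw: "Suc (card S) mod 2 ^ w = Suc (card S)" using word_n by simp
    have vis: "arrs s ''vis'' v = of_bool (v \<in> S)" using fr vn by (simp add: front_def)
    define s2 where "s2 = ?s1\<lparr>arrs := (arrs s)(''val'' := (arrs s ''val'')(v := far v))\<rparr>"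
    define s3 where "s3 = (if v \<in> S then s2 else s2\<lparr>regs := (regs s2)(''tl'' := Suc (card S)),
       arrs := (arrs s2)(''vis'' := (arrs s ''vis'')(v := 1), ''dist'' := (arrs s ''dist'')(v := 0), ''q'' := (arrs s ''q'')(card S := v))\<rparr>)"
    have t: "expr_val w ?s1 ((Get ''comp'' (Reg ''y'') =. Reg ''a'') +. (Get ''comp'' (Reg ''y'') =. Reg ''t'')) \<noteq> 0"
      using comp_test[OF inp1, of "''y''"] True uX by simp
    have "eval_prog w frontier_edge s = s3"
      unfolding frontier_edge_def eval_prog.simps(3)[of w "''y'' ::= _"] e1 eval_prog.simps(4)[of w "_ +. _"] if_not_P[OF t]
      using inp v w_pos ew tw vis tl True far by (auto simp: input_def s2_def s3_def mod_Suc_eq)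
    moreover have "front (insert v S) s3"
    proof (cases "v \<in> S")
      case True
      then show ?thesis using fr by (auto simp: front_def s3_def s2_def insert_absorb)
    next
      case False
      have en: "enumerates (arrs s ''q'') (card S) S" using fr tl by (simp add: front_def)
      have "enumerates ((arrs s ''q'')(card S := v)) (Suc (card S)) (insert v S)"
      proof -
        have "finite S" using S X.finite_V finite_subset by blast
        then have "card (insert v S) = Suc (card S)" using False by simp
        then show ?thesis using en append_segment[of 0 "card S" "arrs s ''q''" S v] False
          unfolding enumerates_def by (auto simp: atLeast0LessThan)
      qed
      then show ?thesis using fr False by (auto simp: front_def s3_def s2_def)
    qed
    ultimately show ?thesis using True by simp
  qed
qed

lemma runs_frontier:
  assumes inp: "input s0" and un: "unvisited s0"
  shows "runs w frontier (20 + (\<Sum>v<n. 40 + 65 * deg v)) s0 (\<lambda>s. front boundary s \<and> regs s ''hd'' = 0)"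
proof -
  define s1 where "s1 = s0\<lparr>regs := (regs s0)(''hd'' := 0, ''tl'' := 0)\<rparr>"
  have inp1: "input s1" using inp by (simp add: input_def s1_def static_def)
  have bX: "boundary \<subseteq> X" by (auto simp: boundary_def)
  have loop: "runs w (For ''i'' (Const 0) (Reg ''n'') frontier_vertex) (10 + (\<Sum>v<n. 40 + 65 * deg v)) s1
     (\<lambda>s. front (boundary \<inter> {..<n}) s \<and> regs s ''i'' = n)"
  proof (rule runs_For[where I = "\<lambda>i. front (boundary \<inter> {..<i})" and l = 0 and B = "\<lambda>i. 30 + 60 * deg i"])
    show "n < 2 ^ w" using word_n by linarith
    show "front (boundary \<inter> {..<0}) (set_reg s1 ''i'' 0)"
      using un by (simp add: front_def s1_def enumerates_def unvisited_def)
    show "4 + expr_time (Const 0) + expr_time (Reg ''n'') + (\<Sum>i = 0..<n. 30 + 60 * deg i + 7 + expr_time (Reg ''n''))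
      \<le> 10 + (\<Sum>v<n. 40 + 65 * deg v)"
      using sum_mono[of "{..<n}" "\<lambda>i. 38 + 60 * deg i" "\<lambda>i. 40 + 65 * deg i"] by (simp add: atLeast0LessThan)
    fix i s
    assume fr: "same_except (insert ''i'' (written_regs frontier_vertex)) (written_arrs frontier_vertex) s1 s"
    note e = same_exceptD[OF fr]
    have inps: "input s" using inp1 e by (simp add: input_def static_def)
    show "expr_val w s (Reg ''n'') = n" using inps by (simp add: input_def static_def)
    assume i: "i < n" "regs s ''i'' = i" and I: "front (boundary \<inter> {..<i}) s"
    let ?S = "boundary \<inter> {..<i}"
    have split: "boundary \<inter> {..<Suc i} = (if i \<in> boundary then insert i ?S else ?S)"
      by (auto simp: less_Suc_eq)
    have frontI: "front S (set_reg s ''i'' k) = front S s" "front S (set_reg s ''j'' k) = front S s" for S s k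
      by (simp_all add: front_def)
    show "runs w frontier_vertex (30 + 60 * deg i) s (\<lambda>s'. regs s' ''i'' = i \<and> front (boundary \<inter> {..<Suc i}) (set_reg s' ''i'' (Suc i)))"
      unfolding frontier_vertex_def frontI
    proof (rule runs_Cond)
      assume "expr_val w s ((Get ''comp'' (Reg ''i'') =. Reg ''a'') +. (Get ''comp'' (Reg ''i'') =. Reg ''t'')) = 0"
      then have "i \<notin> X" using comp_test[OF inps, of "''i''"] i X_iff by auto
      then have "i \<notin> boundary" using bX by blast
      then show "runs w Skip (20 + 60 * deg i) s (\<lambda>s'. regs s' ''i'' = i \<and> front (boundary \<inter> {..<Suc i}) s')"
        using I i split by (intro runs_loop_free) simp_all
    next
      assume "expr_val w s ((Get ''comp'' (Reg ''i'') =. Reg ''a'') +. (Get ''comp'' (Reg ''i'') =. Reg ''t'')) \<noteq> 0"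
      then have iX: "i \<in> X" using comp_test[OF inps, of "''i''"] i X_iff by auto
      have offw: "off (Suc i) < 2 ^ w" "Suc i < 2 ^ w" using off_word[of "Suc i"] i(1) word_n by auto
      let ?P = "\<lambda>j. \<exists>j'. off i \<le> j' \<and> j' < j \<and> nbr j' \<in> X \<and> cmp (nbr j') \<noteq> cmp i"
      \<comment> \<open>While the edges at \<open>i\<close> are scanned, \<open>i\<close> joins the
        set as soon as one neighbour across the cut has been seen.\<close>
      let ?T = "\<lambda>j. if ?P j then insert i ?S else ?S"
      have bP: "i \<in> boundary \<longleftrightarrow> ?P (off (Suc i))"
      proof
        assume "i \<in> boundary"
        then obtain u where u: "u \<in> X" "d i u = 1" "cmp u \<noteq> cmp i" by (auto simp: boundary_def)
        then obtain j where "off i \<le> j" "j < off (Suc i)" "nbr j = u" using adj_nbr[OF i(1)] X_sub by blast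
        with u show "?P (off (Suc i))" by blast
      next
        assume "?P (off (Suc i))"
        then show "i \<in> boundary" using iX nbr_adj[OF i(1)] by (auto simp: boundary_def)
      qed
      have "runs w (For ''j'' (Get ''off'' (Reg ''i'')) (Get ''off'' (Reg ''i'' +. Const 1)) frontier_edge)
        (15 + 60 * deg i) s (\<lambda>s'. front (?T (off (Suc i))) s' \<and> regs s' ''j'' = off (Suc i))"
      proof (rule runs_For[where I = "\<lambda>j. front (?T j)" and l = "off i" and B = "\<lambda>_. 45"])
        show "expr_val w s (Get ''off'' (Reg ''i'')) = off i" using inps i by (simp add: input_def static_def)
        show "off i \<le> off (Suc i)" using off_step i by blast
        show "off (Suc i) < 2 ^ w" by (rule offw)
        have "\<not> ?P (off i)" by auto
        then show "front (?T (off i)) (set_reg s ''j'' (off i))" using I unfolding frontI by (simp only: if_False)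
        show "4 + expr_time (Get ''off'' (Reg ''i'')) + expr_time (Get ''off'' (Reg ''i'' +. Const 1)) +
         (\<Sum>j = off i..<off (Suc i). 45 + 7 + expr_time (Get ''off'' (Reg ''i'' +. Const 1))) \<le> 15 + 60 * deg i"
          by (simp add: deg_def)
        fix j s'
        assume fr': "same_except (insert ''j'' (written_regs frontier_edge)) (written_arrs frontier_edge) s s'"
        note e' = same_exceptD[OF fr']
        have inp': "input s'" using inps e' by (simp add: input_def static_def)
        have i': "regs s' ''i'' = i" using e' i by simp
        show "expr_val w s' (Get ''off'' (Reg ''i'' +. Const 1)) = off (Suc i)"
          using inp' i' offw w_pos by (simp add: input_def static_def mod_Suc_eq)
        assume j: "off i \<le> j" "j < off (Suc i)" "regs s' ''j'' = j" and J: "front (?T j) s'"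
        have T: "?T j \<subseteq> X" using bX iX by auto
        have "?T (Suc j) = (if nbr j \<in> X \<and> cmp (nbr j) \<noteq> cmp i then insert i (?T j) else ?T j)"
          using j(1) by (auto simp: less_Suc_eq)
        then show "runs w frontier_edge 45 s' (\<lambda>s''. regs s'' ''j'' = j \<and> front (?T (Suc j)) (set_reg s'' ''j'' (Suc j)))"
          using runs_frontier_edge[OF inp' T J i' iX, unfolded j(3), OF j(1,2)] j(3)
          by (elim runs_mono_frame) (auto simp: front_def dest: same_exceptD(1)[where x = "''j''"])
      qed (rule w_pos)
      then show "runs w (For ''j'' (Get ''off'' (Reg ''i'')) (Get ''off'' (Reg ''i'' +. Const 1)) frontier_edge)
        (20 + 60 * deg i) s (\<lambda>s'. regs s' ''i'' = i \<and> front (boundary \<inter> {..<Suc i}) s')"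
        using i(2) by (elim runs_mono_frame) (auto simp: split bP dest: same_exceptD(1)[where x = "''i''"])
    qed simp
  qed (use w_pos in simp_all)
  have all: "boundary \<inter> {..<n} = boundary" using bX X_sub by blast
  have loop': "runs w (For ''i'' (Const 0) (Reg ''n'') frontier_vertex) (10 + (\<Sum>v<n. 40 + 65 * deg v)) s1
     (\<lambda>s. front boundary s \<and> regs s ''hd'' = 0)"
  proof (rule runs_mono_frame[OF loop[unfolded all] order_refl])
    fix s assume "front boundary s \<and> regs s ''i'' = n"
      and fr: "same_except (written_regs (For ''i'' (Const 0) (Reg ''n'') frontier_vertex))
        (written_arrs (For ''i'' (Const 0) (Reg ''n'') frontier_vertex)) s1 s"
    then show "front boundary s \<and> regs s ''hd'' = 0"
      using same_exceptD(1)[OF fr, of "''hd''"] by (simp add: s1_def)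
  qed
  have pre: "eval_prog w (''hd'' ::= Const 0 ;; ''tl'' ::= Const 0) s0 = s1" by (simp add: s1_def)
  show ?thesis unfolding frontier_def
    by (rule runs_Seq_assoc, rule runs_loop_free_Seq[OF _ loop'[folded pre]]) simp_all
qed

lemma far_word: "v \<in> X \<Longrightarrow> far v < 2 ^ w"
  using far_le[of v] word_n by linarith

lemma runs_spread:
  assumes en: "enumerates (arrs s0 ''q'') (regs s0 ''tl'') X"
    and m: "regs s0 ''m'' = m" "m \<le> regs s0 ''tl''"
    and val: "\<And>i. i < m \<Longrightarrow> arrs s0 ''val'' (arrs s0 ''q'' i) = far (arrs s0 ''q'' i)"
    and par: "\<And>i. m \<le> i \<Longrightarrow> i < regs s0 ''tl'' \<Longrightarrow> \<exists>j<i. arrs s0 ''par'' (arrs s0 ''q'' i) = arrs s0 ''q'' j \<and>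
      (arrs s0 ''q'' j, arrs s0 ''q'' i) \<in> R \<and> level (arrs s0 ''q'' i) = Suc (level (arrs s0 ''q'' j))"
  shows "runs w spread (10 + 30 * card X) s0 (\<lambda>s. \<forall>v\<in>X. arrs s ''val'' v = far v)"
proof -
  let ?q = "arrs s0 ''q''" and ?t = "regs s0 ''tl''"
  note en' = enumeratesD[OF en]
  have tn: "?t \<le> n" using card_mono[OF _ X_sub] en'(4) by simp
  let ?b = "''v'' ::= Get ''q'' (Reg ''i'') ;;
      Put ''val'' (Reg ''v'') (Get ''val'' (Get ''par'' (Reg ''v'')) +. Const 1)"
  let ?I = "\<lambda>i s. \<forall>k<i. arrs s ''val'' (?q k) = far (?q k)"
  have "runs w spread (10 + 30 * card X) s0 (\<lambda>s. ?I ?t s \<and> regs s ''i'' = ?t)"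
    unfolding spread_def
  proof (rule runs_For[where I = ?I and l = m and B = "\<lambda>_. 12"])
    show "?t < 2 ^ w" using tn word_n by linarith
    show "?I m (set_reg s0 ''i'' m)" using val by simp
    show "4 + expr_time (Reg ''m'') + expr_time (Reg ''tl'') + (\<Sum>i = m..<?t. 12 + 7 + expr_time (Reg ''tl'')) \<le> 10 + 30 * card X"
      using en'(4) by simp
    fix i s
    assume fr: "same_except (insert ''i'' (written_regs ?b)) (written_arrs ?b) s0 s"
    note e = same_exceptD[OF fr]
    show "expr_val w s (Reg ''tl'') = ?t" using e by simp
    assume i: "m \<le> i" "i < ?t" "regs s ''i'' = i" and I: "?I i s"
    obtain j where j: "j < i" "arrs s0 ''par'' (?q i) = ?q j" "(?q j, ?q i) \<in> R" "level (?q i) = Suc (level (?q j))"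
      using par i by blast
    have f: "far (?q i) = Suc (far (?q j))" using far_step j by blast
    have "far (?q i) < 2 ^ w" using far_word en'(1) i by blast
    then have fw: "Suc (far (?q j)) mod 2 ^ w = far (?q i)" using f by simp
    define s1 where "s1 = eval_prog w ?b s"
    have "arrs s1 ''val'' = (arrs s ''val'')(?q i := far (?q i))" "regs s1 ''i'' = i"
      using e i j(2) I j(1) fw w_pos by (simp_all add: s1_def mod_Suc_eq)
    then show "runs w ?b 12 s (\<lambda>s'. regs s' ''i'' = i \<and> ?I (Suc i) (set_reg s' ''i'' (Suc i)))"
      using I by (intro runs_loop_freeI[OF s1_def]) (simp_all add: less_Suc_eq)
  qed (use w_pos m in simp_all)
  then show ?thesis
  proof (rule runs_mono)
    fix s :: state assume a: "?I ?t s \<and> regs s ''i'' = ?t"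
    show "\<forall>v\<in>X. arrs s ''val'' v = far v"
    proof
      fix v assume "v \<in> X"
      from en'(2)[OF this] obtain k where "k < ?t" "v = ?q k" by blast
      with a show "arrs s ''val'' v = far v" by simp
    qed
  qed simp
qed

lemma runs_join:
  assumes en: "enumerates (arrs s0 ''q'') (regs s0 ''tl'') X" and val: "\<forall>v\<in>X. arrs s0 ''val'' v = far v"
    and inp: "input s0"
  shows "runs w (For ''i'' (Const 0) (Reg ''tl'') join_vertex) (10 + 40 * card X) s0 (\<lambda>s.
    (\<forall>v. arrs s ''comp'' v = (if v \<in> X then a else cmp v)) \<and>
    (\<forall>v. arrs s ''ecc'' v = (if v \<in> X then ecc d X v else ecc0 v)))"
proof -
  let ?q = "arrs s0 ''q''" and ?t = "regs s0 ''tl''"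
  note en' = enumeratesD[OF en]
  have tn: "?t \<le> n" using card_mono[OF _ X_sub] en'(4) by simp
  have qX: "?q ` {..<?t} = X" using en unfolding enumerates_def by blast
  let ?I = "\<lambda>i s. (\<forall>v. arrs s ''comp'' v = (if v \<in> ?q ` {..<i} then a else cmp v)) \<and>
    (\<forall>v. arrs s ''ecc'' v = (if v \<in> ?q ` {..<i} then ecc d X v else ecc0 v))"
  have "runs w (For ''i'' (Const 0) (Reg ''tl'') join_vertex) (10 + 40 * card X) s0 (\<lambda>s. ?I ?t s \<and> regs s ''i'' = ?t)"
  proof (rule runs_For[where I = ?I and l = 0 and B = "\<lambda>_. 25"])
    show "?t < 2 ^ w" using tn word_n by linarith
    show "?I 0 (set_reg s0 ''i'' 0)" using inp by (simp add: input_def)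
    show "4 + expr_time (Const 0) + expr_time (Reg ''tl'') + (\<Sum>i = 0..<?t. 25 + 7 + expr_time (Reg ''tl'')) \<le> 10 + 40 * card X"
      using en'(4) by simp
    fix i s
    assume fr: "same_except (insert ''i'' (written_regs join_vertex)) (written_arrs join_vertex) s0 s"
    note e = same_exceptD[OF fr]
    show "expr_val w s (Reg ''tl'') = ?t" using e by simp
    assume i: "i < ?t" "regs s ''i'' = i" and I: "?I i s"
    define v where "v = ?q i"
    have vX: "v \<in> X" using en'(1) i by (simp add: v_def)
    have new: "v \<notin> ?q ` {..<i}"
    proof
      assume "v \<in> ?q ` {..<i}"
      then obtain k where "k < i" "?q k = ?q i" by (auto simp: v_def)
      then show False using en'(3)[of k i] i by simp
    qed
    have ev: "arrs s ''ecc'' v = ecc0 v" using I new by simp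
    have av: "regs s ''a'' = a" using e inp by (simp add: input_def)
    define s1 where "s1 = eval_prog w join_vertex s"
    have s1: "arrs s1 ''comp'' = (arrs s ''comp'')(v := a)"
      "arrs s1 ''ecc'' = (arrs s ''ecc'')(v := max (ecc0 v) (far v))" "regs s1 ''i'' = i"
    proof -
      have vv: "arrs s ''val'' v = far v" and vq: "arrs s ''q'' i = v" using val vX e by (simp_all add: v_def)
      have ecc: "(arrs s ''ecc'')(v := ecc0 v) = arrs s ''ecc''" using ev by (simp add: fun_upd_idem)
      show "arrs s1 ''comp'' = (arrs s ''comp'')(v := a)" "regs s1 ''i'' = i"
        using i av vq by (simp_all add: s1_def join_vertex_def)
      show "arrs s1 ''ecc'' = (arrs s ''ecc'')(v := max (ecc0 v) (far v))"
      proof (cases "ecc0 v < far v")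
        case True
        then show ?thesis using i vv vq ev w_pos by (simp add: s1_def join_vertex_def)
      next
        case False
        then have "max (ecc0 v) (far v) = ecc0 v" by simp
        then show ?thesis using False i vv vq ev w_pos ecc by (simp add: s1_def join_vertex_def)
      qed
    qed
    have img: "?q ` {..<Suc i} = insert v (?q ` {..<i})" by (simp add: lessThan_Suc v_def)
    have "?I (Suc i) (set_reg s1 ''i'' (Suc i))"
      unfolding img using I by (auto simp: s1 ecc_join[OF vX])
    then show "runs w join_vertex 25 s (\<lambda>s'. regs s' ''i'' = i \<and> ?I (Suc i) (set_reg s' ''i'' (Suc i)))"
      using s1(3) by (intro runs_loop_freeI[OF s1_def]) (simp_all add: join_vertex_def)
  qed (use w_pos in simp_all)
  then show ?thesis by (rule runs_mono) (simp_all only: qX order_refl, blast)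
qed

lemma runs_merge:
  assumes inp: "input s0" and un: "unvisited s0"
  shows "runs w merge (100 + (\<Sum>v<n. 200 + 130 * deg v)) s0 (\<lambda>s. unvisited s \<and>
    (\<forall>v. arrs s ''comp'' v = (if v \<in> X then a else cmp v)) \<and>
    (\<forall>v. arrs s ''ecc'' v = (if v \<in> X then ecc d X v else ecc0 v)))"
    (is "runs _ _ _ _ ?post")
proof -
  let ?ok = "Get ''comp'' (Reg ''y'') =. Get ''comp'' (Reg ''z'')"
  let ?join = "For ''i'' (Const 0) (Reg ''tl'') join_vertex"
  have c: "card X \<le> n" using card_mono[OF _ X_sub] by simp
  have rest: "runs w (bfs ?ok ;; spread ;; ?join ;; clean) (10 + (\<Sum>v<n. 40 + 55 * deg v) + 30 + 90 * n) s1 ?post"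
    if fr: "front boundary s1" "regs s1 ''hd'' = 0" and inp1: "input s1" and m: "regs s1 ''m'' = regs s1 ''tl''" for s1
  proof -
    let ?m = "regs s1 ''m''"
    have en: "enumerates (arrs s1 ''q'') ?m boundary" using fr m by (simp add: front_def)
    have sp: "search_space X R level ?m (arrs s1 ''q'') n" by (rule search_space_merging[OF en])
    interpret S: search_space X R level ?m "arrs s1 ''q''" n by (rule sp)
    have img: "arrs s1 ''q'' ` {..<?m} = boundary" using en unfolding enumerates_def by blast
    have st1: "static s1" using inp1 by (simp add: input_def)
    let ?P = "\<lambda>s'. S.search_done (arrs s' ''q'') (regs s' ''tl'') (arrs s' ''vis'') (arrs s' ''dist'') (arrs s' ''par'')"
    have r1: "runs w (bfs ?ok) (10 + (\<Sum>v<n. 40 + 55 * deg v)) s1 ?P"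
    proof (rule runs_bfs[OF sp _ st1])
      show "y < n \<and> d z y = 1" if "z \<in> X" "(z, y) \<in> R" for z y using that X_sub by (auto simp: R_def)
      show "regs s1 ''tl'' = ?m" "regs s1 ''hd'' = 0" using fr m by simp_all
      show "\<forall>v<n. arrs s1 ''vis'' v = of_bool (v \<in> arrs s1 ''q'' ` {..<?m})"
        using fr(1) unfolding img by (simp add: front_def)
      show "\<forall>i<?m. arrs s1 ''dist'' (arrs s1 ''q'' i) = 0"
        using fr(1) enumeratesD(1)[OF en] by (simp add: front_def)
      show "(\<Sum>v\<in>X. 40 + (50 + expr_time ?ok) * deg v) + 10 \<le> 10 + (\<Sum>v<n. 40 + 55 * deg v)"
        using sum_mono2[OF _ X_sub, of "\<lambda>v. 40 + 55 * deg v"] by simp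
      fix s' z y
      assume fr': "same_except {''z'', ''hd'', ''j'', ''y'', ''tl''} {''vis'', ''dist'', ''par'', ''q''} s1 s'"
        and z: "z \<in> X" and y: "y < n" "d z y = 1" and r: "regs s' ''z'' = z" "regs s' ''y'' = y"
      have "arrs s' ''comp'' = cmp" using same_exceptD[OF fr'] inp1 by (simp add: input_def)
      then show "expr_val w s' ?ok \<noteq> 0 \<longleftrightarrow> (z, y) \<in> R"
        using r y z w_pos by (auto simp: R_def X_iff)
    qed
    have r2: "runs w (spread ;; ?join ;; clean) (30 + 90 * n) s2 ?post"
      if P: "?P s2" and fr2: "same_except (written_regs (bfs ?ok)) (written_arrs (bfs ?ok)) s1 s2" for s2
    proof -
      note e2 = same_exceptD[OF fr2]
      have P': "enumerates (arrs s2 ''q'') (regs s2 ''tl'') X" "?m \<le> regs s2 ''tl''"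
        "\<And>i. i < ?m \<Longrightarrow> arrs s2 ''q'' i = arrs s1 ''q'' i"
        "\<And>v. v < n \<Longrightarrow> arrs s2 ''vis'' v = of_bool (v \<in> X)"
        using P unfolding S.search_done_def enumerates_def by auto
      have inp2: "input s2" using inp1 e2 by (simp add: input_def static_def)
      have sp: "runs w spread (10 + 30 * card X) s2 (\<lambda>s. \<forall>v\<in>X. arrs s ''val'' v = far v)"
      proof (rule runs_spread[where m = ?m])
        show "regs s2 ''m'' = ?m" using e2 by simp
        show "arrs s2 ''val'' (arrs s2 ''q'' i) = far (arrs s2 ''q'' i)" if "i < ?m" for i
          using fr(1) enumeratesD(1)[OF en that] P'(3)[OF that] e2 by (simp add: front_def)
        show "\<exists>j<i. arrs s2 ''par'' (arrs s2 ''q'' i) = arrs s2 ''q'' j \<and>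
          (arrs s2 ''q'' j, arrs s2 ''q'' i) \<in> R \<and> level (arrs s2 ''q'' i) = Suc (level (arrs s2 ''q'' j))"
          if "?m \<le> i" "i < regs s2 ''tl''" for i
          using P that unfolding S.search_done_def by blast
      qed (use P' in simp_all)
      show ?thesis
      proof (rule runs_Seq[OF sp])
        fix s3 assume val: "\<forall>v\<in>X. arrs s3 ''val'' v = far v"
          and fr3: "same_except (written_regs spread) (written_arrs spread) s2 s3"
        note e3 = same_exceptD[OF fr3]
        have inp3: "input s3" using inp2 e3 by (simp add: input_def static_def)
        have en3: "enumerates (arrs s3 ''q'') (regs s3 ''tl'') X" using P'(1) e3 by simp
        show "runs w (?join ;; clean) (20 + 60 * n) s3 ?post"
        proof (rule runs_Seq[OF runs_join[OF en3 val inp3]])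
          fix s4 assume J: "(\<forall>v. arrs s4 ''comp'' v = (if v \<in> X then a else cmp v)) \<and>
             (\<forall>v. arrs s4 ''ecc'' v = (if v \<in> X then ecc d X v else ecc0 v))"
            and fr4: "same_except (written_regs ?join) (written_arrs ?join) s3 s4"
          note e4 = same_exceptD[OF fr4]
          have en4: "enumerates (arrs s4 ''q'') (regs s4 ''tl'') X" using en3 e4 by simp
          have "runs w clean (10 + 20 * card X) s4 unvisited"
          proof (rule runs_clean)
            show "inj_on (arrs s4 ''q'') {..<regs s4 ''tl''}" "arrs s4 ''q'' ` {..<regs s4 ''tl''} = X"
              using en4 unfolding enumerates_def by blast+
            show "X \<subseteq> {..<n}" by (rule X_sub)
            show "arrs s4 ''vis'' v = 0" if "v < n" "v \<notin> X" for v using P'(4)[OF that(1)] that e3 e4 by simp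
          qed
          then show "runs w clean (10 + 20 * card X) s4 ?post"
          proof (rule runs_mono_frame)
            fix s5 assume "unvisited s5" and fr5: "same_except (written_regs clean) (written_arrs clean) s4 s5"
            then show "?post s5" using J same_exceptD[OF fr5] by simp
          qed simp
        qed (use c in simp)
      qed (use c in simp)
    qed
    show ?thesis by (rule runs_Seq[OF r1 r2]) simp_all
  qed
  show ?thesis unfolding merge_def
  proof (rule runs_Seq[OF runs_frontier[OF inp un]])
    fix s1 assume F: "front boundary s1 \<and> regs s1 ''hd'' = 0"
      and fr: "same_except (written_regs frontier) (written_arrs frontier) s0 s1"
    note e = same_exceptD[OF fr]
    show "runs w (''m'' ::= Reg ''tl'' ;; bfs ?ok ;; spread ;; ?join ;; clean)
      (45 + (\<Sum>v<n. 40 + 55 * deg v) + 90 * n) s1 ?post"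
    proof (rule runs_Assign_Seq[OF rest])
      let ?s = "set_reg s1 ''m'' (expr_val w s1 (Reg ''tl''))"
      show "front boundary ?s" "regs ?s ''hd'' = 0" "regs ?s ''m'' = regs ?s ''tl''"
        using F by (simp_all add: front_def)
      show "input ?s" using inp e by (simp add: input_def static_def)
    qed simp
  next
    show "20 + (\<Sum>v<n. 40 + 65 * deg v) + (45 + (\<Sum>v<n. 40 + 55 * deg v) + 90 * n) \<le> 100 + (\<Sum>v<n. 200 + 130 * deg v)"
      by (simp add: sum.distrib sum_distrib_left[symmetric])
  qed
qed

end

section \<open>The whole algorithm\<close>

definition find_base :: prog where
  "find_base = For ''i'' (Const 0) (Reg ''n'')
     (Cond (Get ''comp'' (Reg ''i'') =. Reg ''a'') (''b'' ::= Reg ''i'') Skip)"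

definition analyse :: prog where
  "analyse = (find_base ;; cell_search ''b'' ;; collect ;; hashes ;; count ;; centre)"

text \<open>After a cut, what is left of cell \<open>a\<close> is examined again; \<open>a\<close>
  advances only when no balanced class remains and the eccentricities inside the cell are
  known.\<close>

definition process :: prog where
  "process = (analyse ;; Cond (Reg ''fnd'') cut (leaf ;; ''a'' ::= Reg ''a'' +. Const 1))"

definition split_all :: prog where
  "split_all = (''a'' ::= Const 0 ;; ''K'' ::= Const 1 ;; While (Reg ''a'' <. Reg ''K'') process)"

lemma written_analyse [simp]:
  "written_regs find_base = {''i'', ''b''}" "written_arrs find_base = {}"
  "written_regs analyse = {''i'', ''b'', ''hd'', ''tl'', ''z'', ''j'', ''y'', ''e'', ''v'', ''c'', ''p'', ''r'', ''g'', ''k'',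
     ''x'', ''u'', ''best'', ''fnd''}"
  "written_arrs analyse = {''q'', ''vis'', ''dist'', ''par'', ''prd'', ''pe'', ''sz'', ''cnt'', ''h'', ''lab'', ''D''}"
  by (auto simp: find_base_def analyse_def)

lemma written_process [simp]:
  "written_regs process = {''i'', ''b'', ''hd'', ''tl'', ''z'', ''j'', ''y'', ''e'', ''v'', ''c'', ''p'', ''r'', ''g'', ''k'',
     ''x'', ''u'', ''best'', ''fnd'', ''m'', ''K'', ''a''}"
  "written_arrs process = {''q'', ''vis'', ''dist'', ''par'', ''prd'', ''pe'', ''sz'', ''cnt'', ''h'', ''lab'', ''D'',
     ''ecc'', ''ord'', ''dep'', ''comp'', ''pa''}"
  by (auto simp: process_def)

text \<open>By minimality of \<open>dist_sum\<close> the side of \<open>x\<close> holds at most half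
  of \<open>V\<close>, so if it were large, the class would be balanced. The hypothesis
  \<open>unb\<close> speaks of tree edges only, but the tree edge at the vertex naming a class
  belongs to that class by \<open>lab_half_pred\<close>, so every class is covered.\<close>

lemma (in median_space) small_halves:
  assumes b: "b \<in> V" and c: "c \<in> V" and min: "\<And>v. v \<in> V \<Longrightarrow> dist_sum c \<le> dist_sum v"
    and par: "\<And>v. v \<in> V \<Longrightarrow> v \<noteq> b \<Longrightarrow> par v \<in> preds b v"
    and unb: "\<And>v. v \<in> V \<Longrightarrow> v \<noteq> b \<Longrightarrow>
      \<not> (n \<le> card (half v (par v)) * card (half v (par v)) \<and>
         n \<le> (card V - card (half v (par v))) * (card V - card (half v (par v))))"
    and x: "x \<in> V" "d c x = 1"
  shows "card (half x c) * card (half x c) < n"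
proof -
  let ?w = "card (half x c)"
  have xc: "d x c = 1" using x d_sym[of x c] by simp
  have sum: "?w + card (half c x) = card V" using half_partition(3)[OF x(1) c xc] .
  have le: "2 * ?w \<le> card V" using dist_sum_adj[OF x(1) c xc] min[OF x(1)] by linarith
  have unb': "\<not> (n \<le> card (half v p) * card (half v p) \<and> n \<le> (card V - card (half v p)) * (card V - card (half v p)))"
    if v: "v \<in> V" and p: "p \<in> preds b v" for v p
  proof -
    define r where "r = lab b p v"
    have rh: "r \<in> half v p" unfolding r_def using lab_in_half[OF b v p] .
    have rb: "r \<noteq> b" using rh base_notin_half[OF b p] by blast
    have "half r (par r) = half v p"
      unfolding r_def by (rule lab_half_pred[OF b v p]) (use par rh rb halfD in \<open>auto simp: r_def\<close>)
    then show ?thesis using unb[of r] rb rh halfD by metis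
  qed
  have mono: "?w * ?w \<le> card (half c x) * card (half c x)" using le sum by (intro mult_le_mono) linarith+
  from adj_dist_cases[OF x(1) c b xc] show ?thesis
  proof
    assume "d b x = Suc (d b c)"
    then have "c \<in> preds b x" using c x by (simp add: preds_def)
    moreover have "card V - ?w = card (half c x)" using sum by linarith
    ultimately show ?thesis using unb'[OF x(1), of c] mono by (metis le_trans not_le)
  next
    assume "d b c = Suc (d b x)"
    then have "x \<in> preds b c" using x xc by (simp add: preds_def)
    moreover have "card V - card (half c x) = ?w" using sum by linarith
    ultimately show ?thesis using unb'[OF c, of x] mono by (metis le_trans not_le)
  qed
qed

section \<open>Number of edges and cost of analysing a cell\<close>

context ram_graph begin

definition L :: nat where "L = floorlog 2 n"

definition size :: nat where "size = (\<Sum>v<n. 1 + deg v)"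

lemma n_pos: "0 < n"
  using median_space.V_nonempty[OF median] by auto

lemma card_preds_L:
  assumes "median_space A d" "A \<subseteq> {..<n}" "b \<in> A" "v \<in> A"
  shows "card (median_space.preds A d b v) \<le> L"
proof -
  interpret A: median_space A d by fact
  have "2 ^ card (A.preds b v) \<le> card A" using A.card_preds_V assms by blast
  also have "\<dots> \<le> n" using card_mono[OF _ assms(2)] by simp
  also have "\<dots> < 2 ^ L" using floorlog_bounds[of n 2] n_pos by (simp add: L_def)
  finally have "card (A.preds b v) < L" by simp
  then show ?thesis by simp
qed

lemma deg_eq: "u < n \<Longrightarrow> deg u = card {v. v < n \<and> d u v = 1}"
  using card_image[OF nbrs_inj, of u] nbrs[of u] by (simp add: deg_def)

text \<open>Each edge is charged to its end farther from vertex 0, and a vertex has at most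
  \<open>L\<close> predecessors; a median graph thus has only O(n log n) edges.\<close>

lemma size_le: "size \<le> n * (1 + 2 * L)"
proof -
  interpret V: median_space "{..<n}" d by (rule median)
  have z: "0 \<in> {..<n}" using n_pos by simp
  have "deg v = card (V.preds 0 v) + card {u \<in> {..<n}. v \<in> V.preds 0 u}" if "v < n" for v
  proof -
    have "{u. u < n \<and> d v u = 1} = V.preds 0 v \<union> {u \<in> {..<n}. v \<in> V.preds 0 u}"
      using V.adj_dist_cases[of v _ 0] that z adjacency_sym[of _ v] by (fastforce simp: V.preds_def)
    moreover have "V.preds 0 v \<inter> {u \<in> {..<n}. v \<in> V.preds 0 u} = {}" by (auto simp: V.preds_def)
    ultimately show ?thesis unfolding deg_eq[OF that] by (simp add: card_Un_disjoint)
  qed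
  then have "(\<Sum>v<n. deg v) = (\<Sum>v<n. card (V.preds 0 v)) + (\<Sum>v<n. card {u \<in> {..<n}. v \<in> V.preds 0 u})"
    by (simp add: sum.distrib)
  also have "(\<Sum>v<n. card {u \<in> {..<n}. v \<in> V.preds 0 u}) = (\<Sum>u<n. card {v \<in> {..<n}. v \<in> V.preds 0 u})"
    by (rule sum_multicount_gen[OF finite_lessThan finite_lessThan, symmetric]) simp
  also have "\<dots> = (\<Sum>u<n. card (V.preds 0 u))"
    by (intro sum.cong refl arg_cong[where f = card]) (auto simp: V.preds_def)
  also have "(\<Sum>v<n. card (V.preds 0 v)) + (\<Sum>u<n. card (V.preds 0 u)) \<le> (\<Sum>v<n. L) + (\<Sum>v<n. L)"
    using card_preds_L[OF median order_refl z] by (intro add_mono sum_mono) auto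
  finally show ?thesis unfolding size_def sum.distrib by (simp add: algebra_simps)
qed

lemma sum_le_size:
  assumes "A \<subseteq> {..<n}" "\<And>v. v \<in> A \<Longrightarrow> f v \<le> k * (1 + deg v)"
  shows "sum f A \<le> k * size"
proof -
  have "sum f A \<le> (\<Sum>v\<in>A. k * (1 + deg v))" using assms(2) by (rule sum_mono)
  also have "\<dots> \<le> (\<Sum>v<n. k * (1 + deg v))" using assms(1) by (intro sum_mono2) auto
  finally show ?thesis by (simp only: size_def sum_distrib_left)
qed

lemma card_le_size: "A \<subseteq> {..<n} \<Longrightarrow> card A \<le> size" "n \<le> size"
  using sum_le_size[of A "\<lambda>_. 1" 1] sum_le_size[of "{..<n}" "\<lambda>_. 1" 1] by simp_all

lemma runs_find_base:
  assumes st: "static s0" and A: "A = {v. v < n \<and> arrs s0 ''comp'' v = regs s0 ''a''}" "A \<noteq> {}"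
  shows "runs w find_base (10 + 20 * n) s0 (\<lambda>s. regs s ''b'' \<in> A)"
proof -
  let ?b = "Cond (Get ''comp'' (Reg ''i'') =. Reg ''a'') (''b'' ::= Reg ''i'') Skip"
  let ?I = "\<lambda>i s. (\<exists>v<i. v \<in> A) \<longrightarrow> regs s ''b'' \<in> A"
  have "runs w find_base (10 + 20 * n) s0 (\<lambda>s. ?I n s \<and> regs s ''i'' = n)"
    unfolding find_base_def
  proof (rule runs_For[where I = ?I and l = 0 and B = "\<lambda>_. 10"])
    show "n < 2 ^ w" using word_n by linarith
    show "4 + expr_time (Const 0) + expr_time (Reg ''n'') + (\<Sum>i = 0..<n. 10 + 7 + expr_time (Reg ''n'')) \<le> 10 + 20 * n"
      by simp
    fix i s
    assume fr: "same_except (insert ''i'' (written_regs ?b)) (written_arrs ?b) s0 s"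
    note e = same_exceptD[OF fr]
    show "expr_val w s (Reg ''n'') = n" using e st by (simp add: static_def)
    assume i: "i < n" "regs s ''i'' = i" and I: "?I i s"
    have iA: "i \<in> A \<longleftrightarrow> arrs s0 ''comp'' i = regs s0 ''a''" using i by (simp add: A(1))
    show "runs w ?b 10 s (\<lambda>s'. regs s' ''i'' = i \<and> ?I (Suc i) (set_reg s' ''i'' (Suc i)))"
    proof (cases "i \<in> A")
      case True
      then show ?thesis using e i iA w_pos by (intro runs_loop_free) simp_all
    next
      case False
      then have "?I (Suc i) s" using I by (auto simp: less_Suc_eq)
      with False show ?thesis using e i iA w_pos by (intro runs_loop_free) simp_all
    qed
  qed (use w_pos in simp_all)
  then show ?thesis by (rule runs_mono) (use A in auto)
qed

definition analysed :: "nat set \<Rightarrow> state \<Rightarrow> bool" where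
  "analysed A s \<longleftrightarrow> (\<exists>b\<in>A. cell_searched A b s \<and> (\<forall>v\<in>A. labelled A b s v) \<and> regs s ''best'' \<in> A \<and>
     (\<forall>v\<in>A. median_space.dist_sum A d (regs s ''best'') \<le> median_space.dist_sum A d v) \<and>
     (if regs s ''fnd'' = 0
      then \<forall>v\<in>A - {b}. \<not> balanced (card A) (card (median_space.half A d v (arrs s ''par'' v)))
      else \<exists>v\<in>A - {b}. regs s ''fnd'' = Suc (arrs s ''lab'' v) \<and>
        balanced (card A) (card (median_space.half A d v (arrs s ''par'' v)))))"

lemma runs_analyse:
  assumes st: "static s0" and un: "unvisited s0"
    and A: "A = {v. v < n \<and> arrs s0 ''comp'' v = regs s0 ''a''}" and med: "median_space A d"
  shows "runs w analyse (120 + size * (350 + L * (30 + 30 * L))) s0 (\<lambda>s. analysed A s \<and> unvisited s)"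
proof -
  interpret A: median_space A d by (rule med)
  have An: "A \<subseteq> {..<n}" using A by auto
  have cs: "card A \<le> size" using card_le_size(1)[OF An] .
  let ?T1 = "50 + (\<Sum>v\<in>A. 60 + 54 * deg v)" and ?T2 = "10 + (\<Sum>v\<in>A. 40 + 40 * deg v)"
    and ?T3 = "10 + card A * (90 + L * (30 + 30 * L))" and ?T4 = "10 + 50 * card A" and ?T5 = "30 + 70 * card A"
  have T: "(10 + 20 * n) + (?T1 + (?T2 + (?T3 + (?T4 + ?T5)))) \<le> 120 + size * (350 + L * (30 + 30 * L))"
  proof -
    have "(\<Sum>v\<in>A. 60 + 54 * deg v) \<le> 60 * size" "(\<Sum>v\<in>A. 40 + 40 * deg v) \<le> 40 * size"
      by (rule sum_le_size[OF An], simp)+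
    moreover have "card A * (90 + L * (30 + 30 * L)) \<le> size * (90 + L * (30 + 30 * L))"
      using cs by (rule mult_le_mono1)
    ultimately show ?thesis using cs card_le_size(2) by (simp add: algebra_simps)
  qed
  show ?thesis unfolding analyse_def
  proof (rule runs_Seq[OF runs_find_base[OF st A A.V_nonempty]])
    fix s1 assume b: "regs s1 ''b'' \<in> A" and fr: "same_except (written_regs find_base) (written_arrs find_base) s0 s1"
    note e1 = same_exceptD[OF fr]
    define b where "b = regs s1 ''b''"
    have bA: "b \<in> A" using b by (simp add: b_def)
    have st1: "static s1" using static_same[OF st fr] by simp
    have un1: "unvisited s1" using un e1 by (simp add: unvisited_def)
    have A1: "A = {v. v < n \<and> arrs s1 ''comp'' v = regs s1 ''a''}" using A e1 by simp
    have r1: "runs w (cell_search ''b'') ?T1 s1 (\<lambda>s. cell_searched A b s \<and> unvisited s)"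
      using runs_cell_search[OF st1 un1 A1 med, of "''b''"] b by (simp add: b_def)
    show "runs w (cell_search ''b'' ;; collect ;; hashes ;; count ;; centre) (?T1 + (?T2 + (?T3 + (?T4 + ?T5)))) s1
      (\<lambda>s. analysed A s \<and> unvisited s)"
    proof (rule runs_Seq[OF r1])
      fix s2 assume c2: "cell_searched A b s2 \<and> unvisited s2"
        and fr2: "same_except (written_regs (cell_search ''b'')) (written_arrs (cell_search ''b'')) s1 s2"
      note e2 = same_exceptD[OF fr2]
      have st2: "static s2" using static_same[OF st1 fr2] by simp
      have A2: "A = {v. v < n \<and> arrs s2 ''comp'' v = regs s2 ''a''}" using A1 e2 by simp
      show "runs w (collect ;; hashes ;; count ;; centre) (?T2 + (?T3 + (?T4 + ?T5))) s2 (\<lambda>s. analysed A s \<and> unvisited s)"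
      proof (rule runs_Seq[OF runs_collect[OF st2 A2 med bA conjunct1[OF c2]]])
        fix s3 assume lp: "\<forall>v\<in>A. lists_preds A b (arrs s3 ''prd'') (arrs s3 ''pe'' v) v \<and> arrs s3 ''sz'' v = 1 \<and> arrs s3 ''cnt'' v = 0"
          and fr3: "same_except (written_regs collect) (written_arrs collect) s2 s3"
        note e3 = same_exceptD[OF fr3]
        have st3: "static s3" using static_same[OF st2 fr3] by simp
        have c3: "cell_searched A b s3" using c2 e3 by (simp add: cell_searched_def)
        have r3: "runs w hashes ?T3 s3 (\<lambda>s. \<forall>v\<in>A. labelled A b s v)"
          using lp card_preds_L[OF med An bA] by (intro runs_hashes[OF st3 An med bA c3]) auto
        show "runs w (hashes ;; count ;; centre) (?T3 + (?T4 + ?T5)) s3 (\<lambda>s. analysed A s \<and> unvisited s)"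
        proof (rule runs_Seq[OF r3])
          fix s4 assume lb: "\<forall>v\<in>A. labelled A b s4 v"
            and fr4: "same_except (written_regs hashes) (written_arrs hashes) s3 s4"
          note e4 = same_exceptD[OF fr4]
          have st4: "static s4" using static_same[OF st3 fr4] by simp
          have c4: "cell_searched A b s4" using c3 e4 by (simp add: cell_searched_def)
          have r4: "runs w count ?T4 s4 (\<lambda>s. \<forall>v\<in>A - {b}. arrs s ''cnt'' (arrs s ''lab'' v) = card (A.half v (arrs s ''par'' v)))"
            using lp lb e4 by (intro runs_count[OF An med bA c4]) simp_all
          show "runs w (count ;; centre) (?T4 + ?T5) s4 (\<lambda>s. analysed A s \<and> unvisited s)"
          proof (rule runs_Seq[OF r4])
            fix s5 assume ct: "\<forall>v\<in>A - {b}. arrs s5 ''cnt'' (arrs s5 ''lab'' v) = card (A.half v (arrs s5 ''par'' v))"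
              and fr5: "same_except (written_regs count) (written_arrs count) s4 s5"
            note e5 = same_exceptD[OF fr5]
            have st5: "static s5" using static_same[OF st4 fr5] by simp
            have c5: "cell_searched A b s5" using c4 e5 by (simp add: cell_searched_def)
            have lb5: "labelled A b s5 v" if "v \<in> A" for v using lb that e5 by (simp add: labelled_def)
            have b5: "regs s5 ''b'' = b" using e2 e3 e4 e5 by (simp add: b_def)
            have u5: "unvisited s5" using c2 e3 e4 e5 by (simp add: unvisited_def)
            show "runs w centre ?T5 s5 (\<lambda>s. analysed A s \<and> unvisited s)"
            proof (rule runs_mono_frame[OF runs_centre[OF st5 An med bA b5 c5 lb5] order_refl])
              show "arrs s5 ''cnt'' (arrs s5 ''lab'' v) = card (A.half v (arrs s5 ''par'' v))" if "v \<in> A - {b}" for v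
                using ct that by blast
              fix s6 assume C: "regs s6 ''best'' \<in> A \<and>
                 (\<forall>v\<in>A. A.dist_sum (regs s6 ''best'') \<le> A.dist_sum v) \<and>
                 (if regs s6 ''fnd'' = 0
                  then \<forall>v\<in>A - {b}. \<not> balanced (card A) (card (A.half v (arrs s6 ''par'' v)))
                  else \<exists>v\<in>A - {b}. regs s6 ''fnd'' = Suc (arrs s6 ''lab'' v) \<and>
                    balanced (card A) (card (A.half v (arrs s6 ''par'' v))))"
                and fr6: "same_except (written_regs centre) (written_arrs centre) s5 s6"
              note e6 = same_exceptD[OF fr6]
              have c6: "cell_searched A b s6" using c5 e6 by (simp add: cell_searched_def)
              have l6: "\<forall>v\<in>A. labelled A b s6 v" using lb5 e6 by (simp add: labelled_def)
              have u6: "unvisited s6" using u5 e6 by (simp add: unvisited_def)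
              show "analysed A s6 \<and> unvisited s6" unfolding analysed_def using bA c6 l6 u6 C by blast
            qed
          qed simp
        qed simp
      qed simp
    qed simp
  qed (use T in simp)
qed

end

text \<open>\<open>t\<close> runs from \<open>K - 1\<close> down to 1. When cut \<open>t\<close> is
  undone, all later cells have been merged, so \<open>t\<close> and \<open>pa t\<close> name the two
  sides as the cut left them.\<close>

definition merge_all :: prog where
  "merge_all = For ''k'' (Const 1) (Reg ''K'')
     (''t'' ::= Reg ''K'' -. Reg ''k'' ;; ''a'' ::= Get ''pa'' (Reg ''t'') ;; merge)"

section \<open>Number of cells, total cost of the leaves, and the splitting loop\<close>

context ram_graph begin

definition rt :: nat where "rt = floor_sqrt n"

definition cell :: "state \<Rightarrow> nat \<Rightarrow> nat set" where
  "cell s j = {v. v < n \<and> arrs s ''comp'' v = j}"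

definition solved :: "state \<Rightarrow> nat \<Rightarrow> bool" where
  "solved s v \<longleftrightarrow> arrs s ''ecc'' v = ecc d (cell s (arrs s ''comp'' v)) v"

text \<open>Cells numbered below \<open>a\<close> are finished. The condition on sizes bounds
  \<open>K\<close>, and it survives a cut because only balanced classes are cut along.\<close>

definition split_ok :: "state \<Rightarrow> bool" where
  "split_ok s \<longleftrightarrow> static s \<and> unvisited s \<and> 1 \<le> regs s ''K'' \<and> regs s ''a'' \<le> regs s ''K'' \<and>
     splitting d {..<n} (arrs s ''pa'') (regs s ''K'' - 1) (arrs s ''comp'') \<and>
     (regs s ''K'' = 1 \<or> (\<forall>j<regs s ''K''. n \<le> card (cell s j) * card (cell s j))) \<and>
     (\<forall>v<n. arrs s ''comp'' v < regs s ''a'' \<longrightarrow> solved s v)"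

lemma cell_eq: "cell s j = {v \<in> {..<n}. arrs s ''comp'' v = j}"
  by (auto simp: cell_def)

lemma split_ok_median: "split_ok s \<Longrightarrow> j < regs s ''K'' \<Longrightarrow> median_space (cell s j) d"
  unfolding cell_eq split_ok_def by (intro splitting_median[OF median]) auto

lemma split_ok_comp: "split_ok s \<Longrightarrow> v < n \<Longrightarrow> arrs s ''comp'' v < regs s ''K''"
  unfolding split_ok_def
  using splitting_le[of d "{..<n}" "arrs s ''pa''" "regs s ''K'' - 1" "arrs s ''comp''" v] by auto

text \<open>Otherwise every cell, having at least \<open>sqrt n\<close> elements, would have size
  times \<open>K\<close> above \<open>n\<close>; summed over the \<open>K\<close> cells, whose sizes
  add up to \<open>n\<close>, this is contradictory. Products are compared in place of
  roots.\<close>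

lemma cells_le_rt:
  assumes "split_ok s" shows "regs s ''K'' \<le> rt"
proof -
  let ?K = "regs s ''K''"
  have "?K * ?K \<le> n"
  proof (cases "?K = 1")
    case True
    then show ?thesis using n_pos by simp
  next
    case False
    then have big: "\<And>j. j < ?K \<Longrightarrow> n \<le> card (cell s j) * card (cell s j)" using assms by (simp add: split_ok_def)
    have "(\<Sum>j<?K. card (cell s j)) = (\<Sum>j<?K. \<Sum>v\<in>{v \<in> {..<n}. arrs s ''comp'' v = j}. 1)"
      by (simp add: cell_eq)
    also have "\<dots> = (\<Sum>v<n. 1)"
      using split_ok_comp[OF assms] by (intro sum.group) auto
    finally have sum: "(\<Sum>j<?K. card (cell s j)) = n" by simp
    show ?thesis
    proof (rule ccontr)
      assume "\<not> ?K * ?K \<le> n"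
      then have gt: "n < ?K * ?K" by simp
      have c: "n + 1 \<le> card (cell s j) * ?K" if "j < ?K" for j
      proof (rule ccontr)
        let ?c = "card (cell s j)"
        assume "\<not> n + 1 \<le> ?c * ?K"
        then have "(?c * ?K) * (?c * ?K) \<le> n * n" by (intro mult_le_mono) simp_all
        moreover have "n * n < (?c * ?c) * (?K * ?K)"
          using big[OF that] gt n_pos by (intro mult_le_less_imp_less) simp_all
        ultimately show False by (simp add: algebra_simps)
      qed
      have "(\<Sum>j<?K. n + 1) \<le> (\<Sum>j<?K. card (cell s j) * ?K)" using c by (intro sum_mono) simp
      also have "\<dots> = n * ?K" by (simp add: sum flip: sum_distrib_right)
      finally show False using assms by (simp add: split_ok_def)
    qed
  qed
  then show ?thesis unfolding rt_def by (simp add: le_floor_sqrtI power2_eq_square)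
qed

lemma rt_le: "rt \<le> n"
  by (simp add: rt_def floor_sqrt_le)

text \<open>After exchanging the sums, \<open>v\<close> is charged once for each \<open>u\<close>
  that finds it near. By \<open>near_sym\<close> these \<open>u\<close> are in turn near
  \<open>v\<close>, so there are at most \<open>L * rt\<close> of them, however the degrees are
  distributed.\<close>

lemma near_cost:
  assumes med: "median_space A d" and An: "A \<subseteq> {..<n}" and c: "c \<in> A"
    and small: "\<And>x. x \<in> A \<Longrightarrow> d c x = 1 \<Longrightarrow> card (median_space.half A d x c) * card (median_space.half A d x c) < n"
  shows "(\<Sum>u\<in>A - {c}. \<Sum>v\<in>median_space.near A d c u. 80 + 80 * deg v) \<le> (\<Sum>v\<in>A. (80 + 80 * deg v) * (L * rt))"
proof -
  interpret A: median_space A d by (rule med)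
  let ?f = "\<lambda>v. 80 + 80 * deg v"
  have h: "card (A.half x c) \<le> rt" if "x \<in> A" "d c x = 1" for x
    using small[OF that] unfolding rt_def by (intro le_floor_sqrtI) (simp add: power2_eq_square)
  have near: "card (A.near c v) \<le> L * rt" if "v \<in> A" for v
  proof -
    have "card (A.near c v) \<le> card (A.preds v c) * rt" using A.card_near[OF that c h] .
    also have "\<dots> \<le> L * rt" using card_preds_L[OF med An that c] by (rule mult_le_mono1)
    finally show ?thesis .
  qed
  have "(\<Sum>u\<in>A - {c}. \<Sum>v\<in>A.near c u. ?f v) = (\<Sum>u\<in>A - {c}. \<Sum>v\<in>A. of_bool (v \<in> A.near c u) * ?f v)"
    using A.near_sub A.finite_V by (intro sum.cong refl sum.mono_neutral_cong_left) auto
  also have "\<dots> = (\<Sum>v\<in>A. \<Sum>u\<in>A - {c}. of_bool (v \<in> A.near c u) * ?f v)"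
    by (rule sum.swap)
  also have "\<dots> = (\<Sum>v\<in>A. card {u \<in> A - {c}. v \<in> A.near c u} * ?f v)"
    using A.finite_V by (simp add: of_bool_def sum.If_cases Int_def flip: sum_distrib_right)
  also have "\<dots> \<le> (\<Sum>v\<in>A. ?f v * (L * rt))"
  proof (rule sum_mono)
    fix v assume v: "v \<in> A"
    have "{u \<in> A - {c}. v \<in> A.near c u} \<subseteq> A.near c v" using A.near_sym by blast
    then have "card {u \<in> A - {c}. v \<in> A.near c u} \<le> card (A.near c v)" by (intro card_mono) simp_all
    then have "card {u \<in> A - {c}. v \<in> A.near c u} \<le> L * rt" using near[OF v] by linarith
    then have "?f v * card {u \<in> A - {c}. v \<in> A.near c u} \<le> ?f v * (L * rt)"
      by (rule mult_le_mono2)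
    then show "card {u \<in> A - {c}. v \<in> A.near c u} * ?f v \<le> ?f v * (L * rt)"
      by (subst mult.commute)
  qed
  finally show ?thesis .
qed

text \<open>Covers one analysis and either a cut or the part of a leaf that is linear in the cell,
  with some slack for the tests.\<close>

definition cell_time :: nat where
  "cell_time = 350 + size * (750 + L * (30 + 30 * L))"

definition leaf_time :: "nat \<Rightarrow> nat" where
  "leaf_time v = (80 + 80 * deg v) * (L * rt)"

text \<open>Every round creates a cell or finishes one, that is, increments \<open>K\<close> or \<open>a\<close>, and both stay below
  the root of \<open>n\<close>; finishing a cell also consumes the summands of its vertices.\<close>

definition split_potential :: "state \<Rightarrow> nat" where
  "split_potential s = (2 * rt - (regs s ''K'' + regs s ''a'')) * cell_time +
     (\<Sum>v\<in>{v. v < n \<and> regs s ''a'' \<le> arrs s ''comp'' v}. leaf_time v)"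

lemma runs_process:
  assumes ok: "split_ok s0" and aK: "regs s0 ''a'' < regs s0 ''K''"
  shows "\<exists>T. runs w process T s0 (\<lambda>s. split_ok s \<and> split_potential s + T + 1 + 3 \<le> split_potential s0)"
proof -
  let ?a = "regs s0 ''a''" and ?K = "regs s0 ''K''"
  define A where "A = cell s0 ?a"
  have st: "static s0" and un: "unvisited s0"
    and spl: "splitting d {..<n} (arrs s0 ''pa'') (?K - 1) (arrs s0 ''comp'')"
    and big: "?K = 1 \<or> (\<forall>j<?K. n \<le> card (cell s0 j) * card (cell s0 j))"
    and sol: "\<And>v. v < n \<Longrightarrow> arrs s0 ''comp'' v < ?a \<Longrightarrow> solved s0 v"
    using ok by (auto simp: split_ok_def)
  have med: "median_space A d" unfolding A_def using split_ok_median[OF ok aK] .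
  interpret A: median_space A d by (rule med)
  have Aeq: "A = {v. v < n \<and> arrs s0 ''comp'' v = ?a}" by (simp add: A_def cell_def)
  have An: "A \<subseteq> {..<n}" by (auto simp: Aeq)
  have Krt: "?K \<le> rt" by (rule cells_le_rt[OF ok])
  let ?Ta = "120 + size * (350 + L * (30 + 30 * L))"
  let ?S = "\<Sum>v\<in>A. leaf_time v"
  have cA: "card A \<le> size" using card_le_size(1)[OF An] .
  have an: "runs w analyse ?Ta s0 (\<lambda>s. analysed A s \<and> unvisited s)"
    by (rule runs_analyse[OF st un Aeq med])
  \<comment> \<open>Each round is paid by \<open>cell_time\<close>; only a round that finishes the
    cell also spends \<open>?S\<close>, the leaf costs of its vertices, which then leave the
    potential.\<close>
  have rest: "runs w (Cond (Reg ''fnd'') cut (leaf ;; ''a'' ::= Reg ''a'' +. Const 1))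
      (cell_time - ?Ta - 10 + (if regs s1 ''fnd'' = 0 then ?S else 0)) s1
      (\<lambda>s. split_ok s \<and> split_potential s + cell_time + (if regs s1 ''fnd'' = 0 then ?S else 0) \<le> split_potential s0)"
    if an1: "analysed A s1" "unvisited s1" and fr: "same_except (written_regs analyse) (written_arrs analyse) s0 s1" for s1
  proof -
    note e = same_exceptD[OF fr]
    have e1: "arrs s1 ''comp'' = arrs s0 ''comp''" "arrs s1 ''ecc'' = arrs s0 ''ecc''" "arrs s1 ''pa'' = arrs s0 ''pa''"
      "regs s1 ''a'' = ?a" "regs s1 ''K'' = ?K"
      using e by simp_all
    have st1: "static s1" using static_same[OF st fr] by simp
    obtain b where b: "b \<in> A" and cs: "cell_searched A b s1" and lb: "\<And>v. v \<in> A \<Longrightarrow> labelled A b s1 v"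
      and best: "regs s1 ''best'' \<in> A" "\<And>v. v \<in> A \<Longrightarrow> A.dist_sum (regs s1 ''best'') \<le> A.dist_sum v"
      and fnd: "if regs s1 ''fnd'' = 0
        then \<forall>v\<in>A - {b}. \<not> balanced (card A) (card (A.half v (arrs s1 ''par'' v)))
        else \<exists>v\<in>A - {b}. regs s1 ''fnd'' = Suc (arrs s1 ''lab'' v) \<and>
          balanced (card A) (card (A.half v (arrs s1 ''par'' v)))"
      using an1(1) unfolding analysed_def by blast
    note csD = cell_searchedD[OF cs med b]
    have par: "arrs s1 ''par'' v \<in> A.preds b v" if v: "v \<in> A" "v \<noteq> b" for v
    proof -
      obtain k where k: "k < regs s1 ''tl''" "v = arrs s1 ''q'' k" using enumeratesD(2)[OF csD(1) v(1)] by blast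
      then have "0 < k" using csD(8)[OF k(1)] v(2) by auto
      then show ?thesis using csD(5) k by simp
    qed
    show ?thesis
    proof (cases "regs s1 ''fnd'' = 0")
      case False
      then obtain v0 where v0: "v0 \<in> A" "v0 \<noteq> b" "regs s1 ''fnd'' = Suc (arrs s1 ''lab'' v0)"
        and bal: "balanced (card A) (card (A.half v0 (arrs s1 ''par'' v0)))"
        using fnd by auto
      define p where "p = arrs s1 ''par'' v0"
      define H where "H = A.half v0 p"
      have pA: "p \<in> A" "d p v0 = 1" "d v0 p = 1" using A.predsD[OF par[OF v0(1,2)]] by (simp_all add: p_def)
      have HA: "H \<subseteq> A" unfolding H_def by (rule A.half_sub)
      have Kn: "?K \<le> n" using Krt rt_le by simp
      have ct: "runs w cut (30 + 30 * card A) s1 (\<lambda>s.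
         (\<forall>v<n. arrs s ''comp'' v = (if v \<in> H then ?K else arrs s0 ''comp'' v)) \<and>
         arrs s ''pa'' = (arrs s0 ''pa'')(?K := ?a) \<and> regs s ''K'' = Suc ?K)"
        unfolding H_def p_def e1[symmetric]
        by (rule runs_cut[OF An med b cs lb v0]) (use split_ok_comp[OF ok] Kn in \<open>simp_all add: e1\<close>)
      have post: "split_ok s \<and> split_potential s + cell_time \<le> split_potential s0"
        if Q: "(\<forall>v<n. arrs s ''comp'' v = (if v \<in> H then ?K else arrs s0 ''comp'' v)) \<and>
           arrs s ''pa'' = (arrs s0 ''pa'')(?K := ?a) \<and> regs s ''K'' = Suc ?K"
          and fr2: "same_except (written_regs cut) (written_arrs cut) s1 s" for s
      proof -
        note e2 = same_exceptD[OF fr2]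
        have f: "regs s ''a'' = ?a" "arrs s ''ecc'' = arrs s0 ''ecc''" using e2 e1 by simp_all
        have cmp: "arrs s ''comp'' v = (if v \<in> H then ?K else arrs s0 ''comp'' v)" if "v < n" for v using Q that by blast
        have K: "regs s ''K'' = Suc ?K" using Q by blast
        have c1: "cell s j = cell s0 j" if "j \<noteq> ?a" "j \<noteq> ?K" for j
          using that HA unfolding cell_def Aeq by (auto simp: cmp)
        have c2: "cell s ?K = H"
        proof -
          have "arrs s0 ''comp'' v \<noteq> ?K" if "v < n" for v using split_ok_comp[OF ok that] by simp
          then show ?thesis using HA An unfolding cell_def by (auto simp: cmp split: if_splits)
        qed
        have c3: "cell s ?a = A - H" using aK unfolding cell_def Aeq by (auto simp: cmp split: if_splits)
        have H_iff: "v \<in> H \<longleftrightarrow> v < n \<and> arrs s0 ''comp'' v = ?a \<and> d v v0 < d v p" for v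
          unfolding H_def A.half_def by (simp add: Aeq)
        have pos: "?K = Suc (?K - 1)" using aK by simp
        have "splitting d {..<n} (arrs s ''pa'') (Suc (?K - 1)) (arrs s ''comp'')"
        proof -
          have 1: "splitting d {..<n} (arrs s ''pa'') (?K - 1) (arrs s0 ''comp'')"
            by (rule splitting_cong[OF spl]) (use Q in auto)
          have 2: "arrs s ''pa'' (Suc (?K - 1)) = ?a" unfolding pos[symmetric] using Q by simp
          have 3: "\<forall>v\<in>{..<n}. arrs s ''comp'' v = (if arrs s0 ''comp'' v = ?a \<and> d v v0 < d v p then Suc (?K - 1) else arrs s0 ''comp'' v)"
            unfolding pos[symmetric] by (auto simp: cmp H_iff)
          have 4: "arrs s0 ''comp'' p = ?a" "arrs s0 ''comp'' v0 = ?a" "p \<in> {..<n}" "v0 \<in> {..<n}"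
            using pA v0 by (auto simp: Aeq)
          have "arrs s ''pa'' (Suc (?K - 1)) \<le> ?K - 1" using 2 aK by simp
          then show ?thesis unfolding splitting.simps using 1 2 3 4 pA(2) by metis
        qed
        moreover have "n \<le> card (cell s j) * card (cell s j)" if j: "j < Suc ?K" for j
        proof -
          have fH: "finite H" using HA A.finite_V finite_subset by blast
          have "card (A - H) = card A - card H" using card_Diff_subset[OF fH HA] .
          then have "n \<le> card H * card H" "n \<le> card (A - H) * card (A - H)"
            using bal unfolding balanced_def H_def p_def by simp_all
          then show ?thesis using c1[of j] c2 c3 big j aK by (cases "j = ?a \<or> j = ?K") (auto simp: less_Suc_eq)
        qed
        moreover have "solved s v" if v: "v < n" "arrs s ''comp'' v < ?a" for v
        proof -
          have "v \<notin> H" using v aK cmp[OF v(1)] by auto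
          then have cv: "arrs s ''comp'' v = arrs s0 ''comp'' v" using cmp v by simp
          then have "cell s (arrs s ''comp'' v) = cell s0 (arrs s0 ''comp'' v)" using c1 v aK by simp
          then show ?thesis using sol[OF v(1)] v cv f by (simp add: solved_def)
        qed
        moreover have "static s" using static_same[OF st1 fr2] by simp
        moreover have "unvisited s" using an1(2) e2 by (simp add: unvisited_def)
        ultimately have ok': "split_ok s" unfolding split_ok_def using K f(1) aK pos by simp
        \<comment> \<open>The invariant of the new state bounds the new \<open>K\<close>, so the
          truncated subtraction in the potential really drops by one.\<close>
        have "Suc ?K \<le> rt" using cells_le_rt[OF ok'] K by simp
        then have "2 * rt - (?K + ?a) = Suc (2 * rt - (Suc ?K + ?a))" using aK by simp
        moreover have "{v. v < n \<and> ?a \<le> arrs s ''comp'' v} = {v. v < n \<and> ?a \<le> arrs s0 ''comp'' v}"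
          using aK HA Aeq by (auto simp: cmp split: if_splits)
        ultimately have "split_potential s + cell_time = split_potential s0"
          unfolding split_potential_def K f(1) by simp
        with ok' show ?thesis by simp
      qed
      have T: "1 + expr_time (Reg ''fnd'') + (30 + 30 * card A) \<le> cell_time - ?Ta - 10"
        using cA by (simp add: cell_time_def algebra_simps)
      show ?thesis
      proof (rule runs_Cond)
        show "runs w cut (30 + 30 * card A) s1 (\<lambda>s. split_ok s \<and> split_potential s + cell_time + (if regs s1 ''fnd'' = 0 then ?S else 0) \<le> split_potential s0)"
          using False by (intro runs_mono_frame[OF ct order_refl]) (use post in simp)
      qed (use False T in simp_all)
    next
      case True
      define c where "c = regs s1 ''best''"
      have cA': "c \<in> A" using best(1) by (simp add: c_def)
      have small: "card (A.half x c) * card (A.half x c) < n" if "x \<in> A" "d c x = 1" for x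
      proof (rule A.small_halves[OF b cA' _ par _ that])
        show "A.dist_sum c \<le> A.dist_sum v" if "v \<in> A" for v using best(2)[OF that] by (simp add: c_def)
        show "\<not> (n \<le> card (A.half v (arrs s1 ''par'' v)) * card (A.half v (arrs s1 ''par'' v)) \<and>
          n \<le> (card A - card (A.half v (arrs s1 ''par'' v))) * (card A - card (A.half v (arrs s1 ''par'' v))))"
          if "v \<in> A" "v \<noteq> b" for v using fnd True that unfolding balanced_def by simp
      qed simp_all
      have Aeq1: "A = {v. v < n \<and> arrs s1 ''comp'' v = regs s1 ''a''}" using Aeq e1 by simp
      let ?near = "\<Sum>u\<in>A - {c}. \<Sum>v\<in>A.near c u. 80 + 80 * deg v"
      have near: "?near \<le> ?S" using near_cost[OF med An cA' small] by (simp add: leaf_time_def)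
      have lf: "runs w leaf (150 + (\<Sum>v\<in>A. 320 + 60 * deg v) + ?near) s1
        (\<lambda>s. unvisited s \<and> (\<forall>v. arrs s ''ecc'' v = (if v \<in> A then ecc d A v else arrs s1 ''ecc'' v)))"
        by (rule runs_leaf[OF st1 an1(2) Aeq1 med c_def[symmetric] cA'])
      have aw: "Suc ?a mod 2 ^ w = Suc ?a" using aK Krt rt_le word_n by simp
      have post: "runs w (''a'' ::= Reg ''a'' +. Const 1) 4 s2 (\<lambda>s. split_ok s \<and> split_potential s + cell_time + ?S \<le> split_potential s0)"
        if Q: "unvisited s2 \<and> (\<forall>v. arrs s2 ''ecc'' v = (if v \<in> A then ecc d A v else arrs s1 ''ecc'' v))"
          and fr2: "same_except (written_regs leaf) (written_arrs leaf) s1 s2" for s2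
      proof -
        note e2 = same_exceptD[OF fr2]
        define s where "s = set_reg s2 ''a'' (Suc ?a)"
        have f: "regs s ''a'' = Suc ?a" "regs s ''K'' = ?K" "arrs s ''comp'' = arrs s0 ''comp''" "arrs s ''pa'' = arrs s0 ''pa''"
          "arrs s ''ecc'' = arrs s2 ''ecc''" "arrs s ''vis'' = arrs s2 ''vis''" using e2 e1 by (simp_all add: s_def)
        have cl: "cell s j = cell s0 j" for j by (simp add: cell_def f)
        have "static s" using static_same[OF st1 fr2] by (simp add: s_def static_def)
        moreover have "unvisited s" using Q by (simp add: unvisited_def f)
        moreover have "solved s v" if v: "v < n" "arrs s0 ''comp'' v < Suc ?a" for v
        proof (cases "v \<in> A")
          case True
          then have "arrs s0 ''comp'' v = ?a" by (simp add: Aeq)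
          then show ?thesis using Q True by (simp add: solved_def cl f A_def)
        next
          case False
          then have "arrs s0 ''comp'' v < ?a" using v by (auto simp: Aeq)
          then show ?thesis using sol[OF v(1)] Q False by (simp add: solved_def cl f e1)
        qed
        ultimately have ok': "split_ok s" unfolding split_ok_def f cl using aK spl big by simp
        have "2 * rt - (?K + ?a) = Suc (2 * rt - (?K + Suc ?a))" using aK Krt by simp
        moreover have "{v. v < n \<and> ?a \<le> arrs s0 ''comp'' v} = {v. v < n \<and> Suc ?a \<le> arrs s0 ''comp'' v} \<union> A"
          by (auto simp: Aeq)
        moreover have "{v. v < n \<and> Suc ?a \<le> arrs s0 ''comp'' v} \<inter> A = {}" by (auto simp: Aeq)
        ultimately have "split_potential s + cell_time + ?S = split_potential s0"
          unfolding split_potential_def f by (simp add: sum.union_disjoint A.finite_V)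
        moreover have "eval_prog w (''a'' ::= Reg ''a'' +. Const 1) s2 = s"
          using e2 e1 aw w_pos by (simp add: s_def mod_Suc_eq)
        ultimately show ?thesis using ok' by (intro runs_loop_free) simp_all
      qed
      have "(\<Sum>v\<in>A. 320 + 60 * deg v) \<le> 320 * size" by (rule sum_le_size[OF An]) simp
      then have T: "1 + expr_time (Reg ''fnd'') + (150 + (\<Sum>v\<in>A. 320 + 60 * deg v) + ?near + 4) \<le> cell_time - ?Ta - 10 + ?S"
        using near by (simp add: cell_time_def algebra_simps)
      show ?thesis
      proof (rule runs_Cond)
        show "runs w (leaf ;; ''a'' ::= Reg ''a'' +. Const 1) (150 + (\<Sum>v\<in>A. 320 + 60 * deg v) + ?near + 4) s1
          (\<lambda>s. split_ok s \<and> split_potential s + cell_time + (if regs s1 ''fnd'' = 0 then ?S else 0) \<le> split_potential s0)"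
          using True by (simp only: if_True refl) (rule runs_Seq[OF lf post order_refl])
      qed (use True T in simp_all)
    qed
  qed
  obtain t1 s1 where 1: "exec w s0 analyse t1 s1" "t1 \<le> ?Ta" "analysed A s1" "unvisited s1"
    using an unfolding runs_def by blast
  let ?S1 = "if regs s1 ''fnd'' = 0 then ?S else 0"
  obtain t2 s2 where 2: "exec w s1 (Cond (Reg ''fnd'') cut (leaf ;; ''a'' ::= Reg ''a'' +. Const 1)) t2 s2"
    "t2 \<le> cell_time - ?Ta - 10 + ?S1" "split_ok s2" "split_potential s2 + cell_time + ?S1 \<le> split_potential s0"
    using rest[OF 1(3,4) exec_frame[OF 1(1)]] unfolding runs_def by blast
  have "?Ta + 10 \<le> cell_time" by (simp add: cell_time_def algebra_simps)
  then have "t1 + t2 \<le> cell_time - 10 + ?S1" using 1(2) 2(2) by linarith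
  moreover have "split_potential s2 + (cell_time - 10 + ?S1) + 1 + 3 \<le> split_potential s0"
    using 2(4) \<open>?Ta + 10 \<le> cell_time\<close> by linarith
  ultimately have "runs w process (cell_time - 10 + ?S1) s0
    (\<lambda>s. split_ok s \<and> split_potential s + (cell_time - 10 + ?S1) + 1 + 3 \<le> split_potential s0)"
    unfolding runs_def process_def by - (intro exI conjI, rule exec.Seq[OF 1(1) 2(1)], assumption, rule 2(3), assumption)
  then show ?thesis by - (rule exI[of _ "cell_time - 10 + ?S1"], assumption)
qed

end

section \<open>Running time of the whole program\<close>

definition eccentricities :: prog where
  "eccentricities = (split_all ;; merge_all)"

context ram_graph begin

definition split_time :: nat where
  "split_time = 20 + 2 * rt * cell_time + (\<Sum>v<n. leaf_time v)"

lemma runs_split_all: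
  assumes st: "static s0" and un: "unvisited s0" and c0: "\<And>v. v < n \<Longrightarrow> arrs s0 ''comp'' v = 0"
  shows "runs w split_all split_time s0 (\<lambda>s. split_ok s \<and> regs s ''a'' = regs s ''K'')"
proof -
  define s1 where "s1 = s0\<lparr>regs := (regs s0)(''a'' := 0, ''K'' := 1)\<rparr>"
  have "split_ok s1"
    using st un c0 by (simp add: split_ok_def s1_def static_def unvisited_def)
  then have "runs w (While (Reg ''a'' <. Reg ''K'') process) (split_time - 4) s1
    (\<lambda>s. split_ok s \<and> expr_val w s (Reg ''a'' <. Reg ''K'') = 0)"
  proof (rule runs_While[where \<Phi> = split_potential])
    fix s assume ok: "split_ok s" and nz: "expr_val w s (Reg ''a'' <. Reg ''K'') \<noteq> 0"
    then have "regs s ''a'' < regs s ''K''" using w_pos by (auto split: if_splits)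
    from runs_process[OF ok this]
    show "\<exists>T. runs w process T s (\<lambda>s'. split_ok s' \<and> split_potential s' + T + 1 + expr_time (Reg ''a'' <. Reg ''K'') \<le> split_potential s)"
      by (simp add: numeral_eq_Suc)
  next
    have "{v. v < n} = {..<n}" by auto
    moreover have "(2 * rt - Suc 0) * cell_time \<le> 12 + 2 * rt * cell_time"
      by (rule trans_le_add2, rule mult_le_mono1) simp
    ultimately show "split_potential s1 + 1 + expr_time (Reg ''a'' <. Reg ''K'') \<le> split_time - 4"
      by (simp add: split_potential_def split_time_def s1_def)
  qed
  then have loop: "runs w (While (Reg ''a'' <. Reg ''K'') process) (split_time - 4) s1
    (\<lambda>s. split_ok s \<and> regs s ''a'' = regs s ''K'')"
    by (rule runs_mono) (use w_pos in \<open>auto simp: split_ok_def split: if_splits\<close>)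
  have pre: "eval_prog w (''a'' ::= Const 0 ;; ''K'' ::= Const 1) s0 = s1"
    using w_pos by (simp add: s1_def)
  show ?thesis unfolding split_all_def
    by (rule runs_Seq_assoc, rule runs_loop_free_Seq[OF _ loop[folded pre]]) (simp_all add: split_time_def)
qed

definition merge_time :: nat where
  "merge_time = 10 + rt * (140 + 200 * size)"

lemma runs_merge_all:
  assumes ok: "split_ok s0" and aK: "regs s0 ''a'' = regs s0 ''K''"
  shows "runs w merge_all merge_time s0 (\<lambda>s. \<forall>v<n. arrs s ''ecc'' v = ecc d {..<n} v)"
proof -
  let ?K = "regs s0 ''K''" and ?pa = "arrs s0 ''pa''"
  let ?body = "''t'' ::= Reg ''K'' -. Reg ''k'' ;; ''a'' ::= Get ''pa'' (Reg ''t'') ;; merge"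
  have Krt: "?K \<le> rt" by (rule cells_le_rt[OF ok])
  \<comment> \<open>At counter \<open>k\<close> the cuts \<open>1, ..., K - k\<close> are still in
    force, and every vertex knows its eccentricity within its current cell; at \<open>k = K\<close>
    the only cell left is the whole vertex set.\<close>
  let ?I = "\<lambda>k s. static s \<and> unvisited s \<and> splitting d {..<n} ?pa (?K - k) (arrs s ''comp'') \<and> (\<forall>v<n. solved s v)"
  have "runs w merge_all merge_time s0 (\<lambda>s. ?I ?K s \<and> regs s ''k'' = ?K)"
    unfolding merge_all_def
  proof (rule runs_For[where I = ?I and l = 1 and B = "\<lambda>_. 110 + 200 * size"])
    show "1 \<le> ?K" using ok by (simp add: split_ok_def)
    show "?K < 2 ^ w" using Krt rt_le word_n by linarith
    have "solved s0 v" if "v < n" for v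
      using ok that split_ok_comp[OF ok that] aK by (simp add: split_ok_def)
    then show "?I 1 (set_reg s0 ''k'' 1)"
      using ok by (simp add: split_ok_def static_def unvisited_def solved_def cell_def)
    have "(?K - 1) * (119 + 200 * size) \<le> rt * (140 + 200 * size)"
      using Krt by (intro mult_le_mono) simp_all
    then show "4 + expr_time (Const 1) + expr_time (Reg ''K'') + (\<Sum>i = 1..<?K. 110 + 200 * size + 7 + expr_time (Reg ''K'')) \<le> merge_time"
      using ok by (cases ?K) (simp_all add: merge_time_def split_ok_def algebra_simps)
    fix k s
    assume fr: "same_except (insert ''k'' (written_regs ?body)) (written_arrs ?body) s0 s"
    note e = same_exceptD[OF fr]
    have eK: "regs s ''K'' = ?K" "arrs s ''pa'' = ?pa" using e by simp_all
    show "expr_val w s (Reg ''K'') = ?K" using eK by simp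
    assume k: "1 \<le> k" "k < ?K" "regs s ''k'' = k" and I: "?I k s"
    define t where "t = ?K - k"
    define a where "a = ?pa t"
    define cmp where "cmp = arrs s ''comp''"
    define X where "X = {v. v < n \<and> (cmp v = a \<or> cmp v = t)}"
    have t0: "0 < t" "?K - Suc k = t - 1" using k by (simp_all add: t_def)
    have spl: "splitting d {..<n} ?pa t cmp" using I by (simp add: t_def cmp_def)
    obtain comp0 x y where u: "splitting d {..<n} ?pa (t - 1) comp0" "a < t"
      "\<forall>v\<in>{..<n}. comp0 v = (if cmp v = t then a else cmp v)"
      "median_space {v \<in> {..<n}. comp0 v = a} d"
      "x \<in> {..<n}" "y \<in> {..<n}" "comp0 x = a" "comp0 y = a" "d x y = 1"
      "median_space.half {v \<in> {..<n}. comp0 v = a} d x y = {v \<in> {..<n}. cmp v = a}"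
      "median_space.half {v \<in> {..<n}. comp0 v = a} d y x = {v \<in> {..<n}. cmp v = t}"
      using splitting_unsplit[OF median spl t0(1)] unfolding a_def[symmetric] by blast
    have X0: "{v \<in> {..<n}. comp0 v = a} = X" using u(2,3) by (auto simp: X_def)
    have c: "{v \<in> {..<n}. cmp v = j} = {v. v < n \<and> cmp v = j}" for j by auto
    define s1 where "s1 = s\<lparr>regs := (regs s)(''t'' := t, ''a'' := a)\<rparr>"
    interpret merging w n off nbr d X x y cmp "arrs s ''ecc''" a t
    proof (intro merging.intro merging_axioms.intro)
      show "ram_graph w n off nbr d" by (rule ram_graph_axioms)
      show "X = {v. v < n \<and> (cmp v = a \<or> cmp v = t)}" by (rule X_def)
      show "median_space X d" using u(4) unfolding X0 .
      show "x \<in> X" "y \<in> X" using u(5-8) unfolding X0[symmetric] by simp_all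
      show "d x y = 1" "a \<noteq> t" using u(2,9) by simp_all
      show "median_space.half X d x y = {v. v < n \<and> cmp v = a}"
        "median_space.half X d y x = {v. v < n \<and> cmp v = t}"
        using u(10,11) unfolding X0 c by simp_all
      show "arrs s ''ecc'' v = ecc d {v. v < n \<and> cmp v = a} v" if "v < n" "cmp v = a" for v
        using I that by (simp add: solved_def cell_def cmp_def)
      show "arrs s ''ecc'' v = ecc d {v. v < n \<and> cmp v = t} v" if "v < n" "cmp v = t" for v
        using I that by (simp add: solved_def cell_def cmp_def)
    qed
    have inp: "input s1" "unvisited s1"
      unfolding input_def using I by (simp_all add: s1_def static_def cmp_def unvisited_def)
    have "(\<Sum>v<n. 200 + 130 * deg v) \<le> 200 * size" by (rule sum_le_size) simp_all
    then have mg: "runs w merge (100 + 200 * size) s1 (\<lambda>s'. unvisited s' \<and>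
      (\<forall>v. arrs s' ''comp'' v = (if v \<in> X then a else cmp v)) \<and>
      (\<forall>v. arrs s' ''ecc'' v = (if v \<in> X then ecc d X v else arrs s ''ecc'' v)))"
      by (intro runs_mono[OF runs_merge[OF inp]]) simp_all
    have post: "regs s' ''k'' = k \<and> ?I (Suc k) (set_reg s' ''k'' (Suc k))"
      if Q: "unvisited s' \<and> (\<forall>v. arrs s' ''comp'' v = (if v \<in> X then a else cmp v)) \<and>
          (\<forall>v. arrs s' ''ecc'' v = (if v \<in> X then ecc d X v else arrs s ''ecc'' v))"
        and fr2: "same_except (written_regs merge) (written_arrs merge) s1 s'" for s'
    proof -
      have st': "static s'" using static_same[OF _ fr2] inp by (simp add: input_def)
      have cm: "arrs s' ''comp'' v = (if v \<in> X then a else cmp v)" for v using Q by blast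
      have "splitting d {..<n} ?pa (t - 1) (arrs s' ''comp'')"
        by (rule splitting_cong[OF u(1)]) (use u(2,3) in \<open>auto simp: cm X_def\<close>)
      moreover have "arrs s' ''ecc'' v = ecc d (cell s' (arrs s' ''comp'' v)) v" if v: "v < n" for v
      proof (cases "v \<in> X")
        case True
        have "cell s' a = X" by (auto simp: cell_def cm X_def)
        then show ?thesis using Q True cm by simp
      next
        case False
        then have "cmp v \<noteq> a" "cmp v \<noteq> t" using v by (auto simp: X_def)
        then have "cell s' (cmp v) = cell s (cmp v)" by (auto simp: cell_def cm X_def cmp_def[symmetric])
        moreover have "arrs s ''ecc'' v = ecc d (cell s (cmp v)) v" using I v by (simp add: solved_def cmp_def)
        ultimately show ?thesis using Q False cm by simp
      qed
      moreover have "regs s' ''k'' = k" using same_exceptD(1)[OF fr2, of "''k''"] k(3) by (simp add: s1_def)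
      ultimately show ?thesis using Q st' unfolding t0(2)
        by (simp add: static_def unvisited_def solved_def cell_def)
    qed
    have "(?K + 2 ^ w - k) mod 2 ^ w = t"
      unfolding t_def using k Krt rt_le word_n by (intro word_minus) linarith+
    then have pre: "eval_prog w (''t'' ::= Reg ''K'' -. Reg ''k'' ;; ''a'' ::= Get ''pa'' (Reg ''t'')) s = s1"
      using eK k by (simp add: s1_def a_def)
    show "runs w ?body (110 + 200 * size) s (\<lambda>s'. regs s' ''k'' = k \<and> ?I (Suc k) (set_reg s' ''k'' (Suc k)))"
    proof (rule runs_Seq_assoc, rule runs_loop_free_Seq)
      show "runs w merge (100 + 200 * size) (eval_prog w (''t'' ::= Reg ''K'' -. Reg ''k'' ;; ''a'' ::= Get ''pa'' (Reg ''t'')) s)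
        (\<lambda>s'. regs s' ''k'' = k \<and> ?I (Suc k) (set_reg s' ''k'' (Suc k)))"
        unfolding pre by (rule runs_mono_frame[OF mg order_refl post])
    qed simp_all
  qed (use w_pos in simp_all)
  then show ?thesis
  proof (rule runs_mono)
    fix s :: state assume a: "?I ?K s \<and> regs s ''k'' = ?K"
    show "\<forall>v<n. arrs s ''ecc'' v = ecc d {..<n} v"
    proof (intro allI impI)
      fix v assume v: "v < n"
      have "cell s 0 = {..<n}" "arrs s ''comp'' v = 0" using a v by (auto simp: cell_def)
      then show "arrs s ''ecc'' v = ecc d {..<n} v" using a v by (simp add: solved_def)
    qed
  qed simp
qed

lemma runs_eccentricities:
  assumes "static s0" "unvisited s0" "\<And>v. v < n \<Longrightarrow> arrs s0 ''comp'' v = 0"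
  shows "runs w eccentricities (split_time + merge_time) s0 (\<lambda>s. \<forall>v<n. arrs s ''ecc'' v = ecc d {..<n} v)"
  unfolding eccentricities_def
  by (rule runs_Seq[OF runs_split_all[OF assms] runs_merge_all]) auto

text \<open>Up to constants, the \<open>2 * rt\<close> rounds of splitting cost \<open>size\<close>
  times a quadratic polynomial in \<open>L\<close> each, all leaves together
  \<open>size * L * rt\<close>, and each of the at most \<open>rt\<close> merges
  \<open>size\<close>. As \<open>size\<close> is \<open>n\<close> times one more logarithm, the
  third power absorbs everything.\<close>

lemma time_le: "split_time + merge_time \<le> 6000 * (n * rt * (1 + L) ^ 3)"
proof -
  have r1: "1 \<le> rt" using n_pos by (simp add: rt_def Suc_le_eq)
  define M where "M = 1 + L"
  define N where "N = n * rt * M ^ 3"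
  have M1: "1 \<le> M" by (simp add: M_def)
  have sz: "size \<le> 2 * (n * M)" using size_le by (simp add: M_def algebra_simps)
  have pw: "M ^ i \<le> M ^ 3" if "i \<le> 3" for i using that M1 by (rule power_increasing)
  have base: "n * rt * x \<le> N" if "x \<le> M ^ 3" for x unfolding N_def using that by (rule mult_le_mono2)
  have a: "rt * (size * (750 + L * (30 + 30 * L))) \<le> 1620 * N"
  proof -
    have "750 + L * (30 + 30 * L) \<le> 810 * M ^ 2" by (simp add: M_def power2_eq_square algebra_simps)
    then have "size * (750 + L * (30 + 30 * L)) \<le> 2 * (n * M) * (810 * M ^ 2)" by (rule mult_le_mono[OF sz])
    then have "rt * (size * (750 + L * (30 + 30 * L))) \<le> rt * (2 * (n * M) * (810 * M ^ 2))" by (rule mult_le_mono2)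
    also have "\<dots> = 1620 * N" by (simp add: N_def power2_eq_square power3_eq_cube)
    finally show ?thesis .
  qed
  have N1: "n * rt \<le> N" using base[of 1] pw[of 0] by simp
  have b: "rt \<le> N" using N1 n_pos by (metis le_trans mult_le_mono1 Suc_leI One_nat_def mult_1)
  have one: "1 \<le> N" using b r1 by linarith
  have c: "(\<Sum>v<n. leaf_time v) \<le> 160 * N"
  proof -
    have "(\<Sum>v<n. leaf_time v) = (\<Sum>v<n. 80 + 80 * deg v) * (L * rt)"
      by (simp only: leaf_time_def sum_distrib_right)
    also have "\<dots> \<le> (80 * size) * (M * rt)"
      by (intro mult_le_mono sum_le_size) (simp_all add: M_def)
    also have "\<dots> \<le> (80 * (2 * (n * M))) * (M * rt)" using sz by (intro mult_le_mono) simp_all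
    also have "\<dots> = 160 * (n * rt * M ^ 2)" by (simp add: power2_eq_square)
    also have "\<dots> \<le> 160 * N" using base[of "M ^ 2"] pw[of 2] by simp
    finally show ?thesis .
  qed
  have e: "rt * size \<le> 2 * N"
  proof -
    have "rt * size \<le> rt * (2 * (n * M))" using sz by (rule mult_le_mono2)
    also have "\<dots> = 2 * (n * rt * M)" by simp
    also have "\<dots> \<le> 2 * N" using base[of M] pw[of 1] by simp
    finally show ?thesis .
  qed
  have sum_bound: "30 + 2 * (350 * r + i) + j + (140 * r + 200 * k)
      \<le> 30 * N + 2 * (350 * N + 1620 * N) + 160 * N + (140 * N + 200 * (2 * N))"
    if "i \<le> 1620 * N" "r \<le> N" "j \<le> 160 * N" "k \<le> 2 * N" for i j k r
    by (intro add_mono mult_le_mono2 that) (use one in simp)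
  have "split_time + merge_time = 30 + 2 * (350 * rt + rt * (size * (750 + L * (30 + 30 * L)))) +
     (\<Sum>v<n. leaf_time v) + (140 * rt + 200 * (rt * size))"
    by (simp add: split_time_def merge_time_def cell_time_def algebra_simps)
  also have "\<dots> \<le> 30 * N + 2 * (350 * N + 1620 * N) + 160 * N + (140 * N + 200 * (2 * N))"
    by (rule sum_bound[OF a b c e])
  also have "\<dots> \<le> 6000 * N" by simp
  finally show ?thesis by (simp add: N_def M_def)
qed

end

section \<open>From graphs to median metrics\<close>

text \<open>Distances as natural numbers, which words can hold; the library's distance is an infimum
  of walk costs in \<open>ereal\<close>. Without a walk from \<open>u\<close> to \<open>v\<close>
  the \<open>LEAST\<close> would be uninformative; connectedness provides one.\<close>

definition steps :: "'a rel \<Rightarrow> 'a \<Rightarrow> 'a \<Rightarrow> nat" where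
  "steps R u v = (LEAST k. (u, v) \<in> R ^^ k)"

lemma steps_self [simp]: "steps R u u = 0"
  by (simp add: steps_def Least_eq_0)

lemma sym_relpow: "sym R \<Longrightarrow> (u, v) \<in> R ^^ k \<Longrightarrow> (v, u) \<in> R ^^ k"
proof (induction k arbitrary: v)
  case (Suc k)
  then obtain z where "(u, z) \<in> R ^^ k" "(z, v) \<in> R" by auto
  then show ?case using Suc by (meson relpow_Suc_I2 symD)
qed simp

lemma steps_sym: "sym R \<Longrightarrow> steps R u v = steps R v u"
  unfolding steps_def by (rule arg_cong[where f = Least], rule ext, rule iffI) (rule sym_relpow, assumption+)+

context pair_graph begin

lemma awalk_relpow: "awalk u p v \<Longrightarrow> (u, v) \<in> parcs G ^^ length p"
proof (induction p arbitrary: u)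
  case (Cons e p)
  then have "(u, snd e) \<in> parcs G" "(snd e, v) \<in> parcs G ^^ length p"
    by (auto simp: awalk_Cons_iff)
  then show ?case unfolding length_Cons by (rule relpow_Suc_I2)
qed (simp add: awalk_Nil_iff)

lemma relpow_awalk: "u \<in> pverts G \<Longrightarrow> (u, v) \<in> parcs G ^^ k \<Longrightarrow> \<exists>p. awalk u p v \<and> length p = k"
proof (induction k arbitrary: u)
  case (Suc k)
  from Suc.prems(2) obtain z where z: "(u, z) \<in> parcs G" "(z, v) \<in> parcs G ^^ k"
    by (meson relpow_Suc_D2)
  obtain p where "awalk z p v" "length p = k" using Suc.IH[OF in_arcsD2[OF z(1)] z(2)] by blast
  then have "awalk u ((u, z) # p) v \<and> length ((u, z) # p) = Suc k" using z(1) by (simp add: awalk_Cons_iff)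
  then show ?case by blast
qed (auto simp: awalk_Nil_iff)

abbreviation gd :: "'a \<Rightarrow> 'a \<Rightarrow> nat" where
  "gd \<equiv> steps (parcs G)"

lemma sym_parcs: "sym (parcs G)"
  using pair_sym_arcs by (simp add: symmetric_def)

lemma gd_le: "(u, v) \<in> parcs G ^^ k \<Longrightarrow> gd u v \<le> k"
  unfolding steps_def by (rule Least_le)

lemma gd_eq_1_iff: "gd u v = 1 \<longleftrightarrow> (u, v) \<in> parcs G" if "(u, v) \<in> parcs G ^^ k"
proof -
  have walk: "(u, v) \<in> parcs G ^^ gd u v" unfolding steps_def using that by (rule LeastI)
  show ?thesis
  proof
    show "(u, v) \<in> parcs G" if "gd u v = 1" using walk that by simp
  next
    assume a: "(u, v) \<in> parcs G"
    then have "u \<noteq> v" using pair_no_loops by fastforce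
    then have "gd u v \<noteq> 0" using walk by (metis relpow_0_E)
    then show "gd u v = 1" using gd_le[of u v 1] a by simp
  qed
qed

context
  assumes con: "connected (with_proj G)"
begin

lemma relpow_ex:
  assumes "u \<in> pverts G" "v \<in> pverts G"
  shows "(u, v) \<in> parcs G ^^ gd u v"
proof -
  have "strongly_connected (with_proj G)"
    using symmetric_connected_imp_strongly_connected[OF pair_sym_arcs con] .
  then have "u \<rightarrow>\<^sup>*\<^bsub>with_proj G\<^esub> v" using assms by (auto simp: strongly_connected_def)
  then obtain p where "awalk u p v" by (auto simp: reachable_awalk)
  from awalk_relpow[OF this] show ?thesis unfolding steps_def by (rule LeastI)
qed

lemma gdist_eq:
  assumes uv: "u \<in> pverts G" "v \<in> pverts G"
  shows "gdist G u v = ereal (real (gd u v))"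
proof -
  have cost: "awalk_cost (\<lambda>_. 1) p = real (length p)" for p by (induction p) auto
  obtain p where p: "awalk u p v" "length p = gd u v" using relpow_awalk[OF uv(1) relpow_ex[OF uv]] by blast
  show ?thesis unfolding gdist_def \<mu>_def
  proof (rule antisym)
    show "(INF p\<in>{p. awalk u p v}. ereal (awalk_cost (\<lambda>_. 1) p)) \<le> ereal (real (gd u v))"
      using p by (intro INF_lower2[of p]) (simp_all add: cost)
    show "ereal (real (gd u v)) \<le> (INF p\<in>{p. awalk u p v}. ereal (awalk_cost (\<lambda>_. 1) p))"
      by (intro INF_greatest) (simp add: cost gd_le awalk_relpow)
  qed
qed

lemma pverts_nonempty: "pverts G \<noteq> {}"
  using symmetric_connected_imp_strongly_connected[OF pair_sym_arcs con] by (simp add: strongly_connected_def)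

lemma eccentricity_eq:
  assumes "u \<in> pverts G"
  shows "eccentricity G u = ereal (real (Max (gd u ` pverts G)))"
proof -
  have "ereal (real (Max (gd u ` pverts G))) = Max ((\<lambda>k. ereal (real k)) ` gd u ` pverts G)"
    by (rule mono_Max_commute) (use pverts_nonempty pair_finite_verts in \<open>auto intro: monoI\<close>)
  also have "(\<lambda>k. ereal (real k)) ` gd u ` pverts G = gdist G u ` pverts G"
    unfolding image_image using gdist_eq[OF assms] by (intro image_cong) simp_all
  finally show ?thesis by (simp add: eccentricity_def)
qed

lemma interval_iff:
  assumes "a \<in> pverts G" "b \<in> pverts G" "m \<in> pverts G"
  shows "m \<in> interval G a b \<longleftrightarrow> gd a m + gd m b = gd a b"
  unfolding interval_def using assms by (simp add: gdist_eq flip: of_nat_add)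

text \<open>Median graphs constrain only triples of distinct vertices. If two of the three coincide,
  the repeated vertex is a median, and it is unique because the interval between equal vertices
  contains nothing else.\<close>

lemma median_space_gd:
  assumes med: "\<And>x y z. x \<in> pverts G \<Longrightarrow> y \<in> pverts G \<Longrightarrow> z \<in> pverts G \<Longrightarrow>
    x \<noteq> y \<Longrightarrow> y \<noteq> z \<Longrightarrow> x \<noteq> z \<Longrightarrow> \<exists>!m. m \<in> interval G x y \<inter> interval G y z \<inter> interval G z x"
  shows "median_space (pverts G) gd"
proof
  show "finite (pverts G)" by (rule pair_finite_verts)
  show "pverts G \<noteq> {}" by (rule pverts_nonempty)
  show sy: "gd u v = gd v u" for u v using sym_parcs by (rule steps_sym)
  show d0: "u = v" if "u \<in> pverts G" "v \<in> pverts G" "gd u v = 0" for u v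
    using relpow_ex[OF that(1,2)] that(3) by simp
  show "gd u z \<le> gd u v + gd v z" if "u \<in> pverts G" "v \<in> pverts G" "z \<in> pverts G" for u v z
  proof (rule gd_le)
    show "(u, z) \<in> parcs G ^^ (gd u v + gd v z)"
      unfolding relpow_add using relpow_ex that by blast
  qed
  show "\<exists>z\<in>pverts G. gd u z = 1 \<and> gd u v = Suc (gd z v)"
    if uv: "u \<in> pverts G" "v \<in> pverts G" "u \<noteq> v" for u v
  proof -
    obtain k where k: "gd u v = Suc k" using d0[OF uv(1,2)] uv(3) not0_implies_Suc by blast
    have "(u, v) \<in> parcs G ^^ Suc k" using relpow_ex[OF uv(1,2)] by (simp only: k)
    then obtain z where z: "(u, z) \<in> parcs G" "(z, v) \<in> parcs G ^^ k" by (meson relpow_Suc_D2)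
    have zV: "z \<in> pverts G" using z(1) by (rule in_arcsD2)
    have "(u, v) \<in> parcs G ^^ Suc (gd z v)" using z(1) relpow_ex[OF zV uv(2)] by (rule relpow_Suc_I2)
    then have "Suc k \<le> Suc (gd z v)" unfolding k[symmetric] by (rule gd_le)
    then have "gd u v = Suc (gd z v)" using gd_le[OF z(2)] k by linarith
    moreover have "gd u z = 1" using gd_eq_1_iff[of u z 1] z(1) by simp
    ultimately show ?thesis using zV by blast
  qed
  have int: "m \<in> interval G x y \<inter> interval G y z \<inter> interval G z x \<longleftrightarrow> m \<in> pverts G \<and>
      gd x m + gd m y = gd x y \<and> gd y m + gd m z = gd y z \<and> gd x m + gd m z = gd x z"
    if V: "x \<in> pverts G" "y \<in> pverts G" "z \<in> pverts G" for x y z m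
  proof (cases "m \<in> pverts G")
    case True
    have "gd z m + gd m x = gd x m + gd m z" by (subst sy, subst sy[of m x], rule add.commute)
    then show ?thesis using True V sy[of z x] by (simp add: interval_iff)
  qed (simp add: interval_def)
  show "\<exists>m\<in>pverts G. gd x m + gd m y = gd x y \<and> gd y m + gd m z = gd y z \<and> gd x m + gd m z = gd x z"
    if V: "x \<in> pverts G" "y \<in> pverts G" "z \<in> pverts G" for x y z
  proof (cases "x \<noteq> y \<and> y \<noteq> z \<and> x \<noteq> z")
    case True
    then show ?thesis using med[OF V] int[OF V] by blast
  next
    case False
    then consider "x = y" | "y = z" | "x = z" by blast
    then show ?thesis
    proof cases
      case 1 then show ?thesis using V by (intro bexI[of _ x]) auto
    next
      case 2 then show ?thesis using V by (intro bexI[of _ y]) auto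
    next
      case 3 then show ?thesis using V by (intro bexI[of _ x]) auto
    qed
  qed
  show "m = m'"
    if V: "x \<in> pverts G" "y \<in> pverts G" "z \<in> pverts G" "m \<in> pverts G" "m' \<in> pverts G"
      and m: "gd x m + gd m y = gd x y" "gd y m + gd m z = gd y z" "gd x m + gd m z = gd x z"
      and m': "gd x m' + gd m' y = gd x y" "gd y m' + gd m' z = gd y z" "gd x m' + gd m' z = gd x z"
    for x y z m m'
  proof (cases "x \<noteq> y \<and> y \<noteq> z \<and> x \<noteq> z")
    case True
    then have "\<exists>!m. m \<in> interval G x y \<inter> interval G y z \<inter> interval G z x" using med[OF V(1-3)] by blast
    moreover have "m \<in> interval G x y \<inter> interval G y z \<inter> interval G z x" using int[OF V(1-3)] V m by blast
    moreover have "m' \<in> interval G x y \<inter> interval G y z \<inter> interval G z x" using int[OF V(1-3)] V m' by blast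
    ultimately show ?thesis by blast
  next
    case False
    then consider "x = y" | "y = z" | "x = z" by blast
    then show ?thesis
    proof cases
      case 1
      then have "gd x m = 0" "gd x m' = 0" using m(1) m'(1) by auto
      then show ?thesis using d0 V by metis
    next
      case 2
      then have "gd y m = 0" "gd y m' = 0" using m(2) m'(2) by auto
      then show ?thesis using d0 V by metis
    next
      case 3
      then have "gd x m = 0" "gd x m' = 0" using m(3) m'(3) by auto
      then show ?thesis using d0 V by metis
    qed
  qed
qed simp

end

end

lemma concat_nth:
  assumes "u < length xss" "i < length (xss ! u)"
  defines "j \<equiv> sum_list (map length (take u xss)) + i"
  shows "j < length (concat xss)" "concat xss ! j = xss ! u ! i"
proof -
  have split: "concat xss = concat (take u xss) @ xss ! u @ concat (drop (Suc u) xss)"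
    using assms(1) by (metis append.assoc concat.simps(2) concat_append id_take_nth_drop)
  have j: "j = length (concat (take u xss)) + i" by (simp add: j_def length_concat)
  show "j < length (concat xss)" using assms(2) unfolding split j by simp
  show "concat xss ! j = xss ! u ! i" using assms(2) unfolding split j by (simp add: nth_append)
qed

lemma ram_graph_input:
  fixes G :: "nat pair_pre_digraph"
  assumes G: "median_graph G" and adj: "adjacency_lists adj G" and n: "n = length adj"
  shows "ram_graph (8 * floorlog 2 n) n (arrs (graph_input adj) ''off'') (arrs (graph_input adj) ''nbr'') (steps (parcs G))"
proof -
  interpret pair_graph G using G by (simp add: median_graph_def)
  have con: "connected (with_proj G)" using G by (simp add: median_graph_def)
  have V: "pverts G = {..<n}" using adj n by (simp add: adjacency_lists_def)
  let ?off = "arrs (graph_input adj) ''off''" and ?nbr = "arrs (graph_input adj) ''nbr''"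
  have adj_u: "distinct (adj ! u)" "set (adj ! u) = {v. (u, v) \<in> parcs G}" if "u < n" for u
    using adj that n by (simp_all add: adjacency_lists_def)
  have off: "?off u = sum_list (map length (take u adj))" if "u \<le> n" for u
    using that n by (simp add: graph_input_def)
  have off_Suc: "?off (Suc u) = ?off u + length (adj ! u)" if "u < n" for u
    using that n by (simp add: off take_Suc_conv_app_nth)
  have nbr: "?nbr (?off u + i) = adj ! u ! i" if "u < n" "i < length (adj ! u)" for u i
    using concat_nth[of u adj i] that n by (simp add: graph_input_def)
  have range: "{?off u..<?off (Suc u)} = (+) (?off u) ` {..<length (adj ! u)}" if "u < n" for u
    using off_Suc[OF that] by (simp add: lessThan_atLeast0 add.commute)
  have n0: "0 < n" using pverts_nonempty[OF con] V by auto
  show ?thesis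
  proof (rule ram_graph.intro)
    show "median_space {..<n} (steps (parcs G))"
      unfolding V[symmetric] using G by (intro median_space_gd[OF con]) (simp add: median_graph_def)
    show "?off u \<le> ?off (Suc u)" if "u < n" for u using off_Suc[OF that] by simp
    have "length (adj ! u) \<le> n" if "u < n" for u
    proof -
      have "set (adj ! u) \<subseteq> {..<n}" using adj_u(2)[OF that] in_arcsD2 V by auto
      then have "card (set (adj ! u)) \<le> card {..<n}" by (intro card_mono) auto
      then show ?thesis using adj_u(1)[OF that] by (simp add: distinct_card)
    qed
    then have "sum_list (map length adj) \<le> sum_list (map (\<lambda>_. n) adj)"
      by (intro sum_list_mono) (auto simp: in_set_conv_nth n)
    then show "?off n \<le> n * n" using n by (simp add: off sum_list_triv)
    show "?nbr ` {?off u..<?off (Suc u)} = {v. v < n \<and> steps (parcs G) u v = 1}" if u: "u < n" for u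
    proof -
      have "?nbr ` {?off u..<?off (Suc u)} = (!) (adj ! u) ` {..<length (adj ! u)}"
        unfolding range[OF u] image_image by (rule image_cong) (use nbr[OF u] in simp_all)
      also have "\<dots> = set (adj ! u)" by (auto simp: set_conv_nth)
      also have "\<dots> = {v. v < n \<and> steps (parcs G) u v = 1}"
      proof -
        have "steps (parcs G) u v = 1 \<longleftrightarrow> (u, v) \<in> parcs G" if "v < n" for v
          using gd_eq_1_iff[OF relpow_ex[OF con]] u that V by blast
        moreover have "v < n" if "(u, v) \<in> parcs G" for v using in_arcsD2[OF that] V by simp
        ultimately show ?thesis using adj_u(2)[OF u] by blast
      qed
      finally show ?thesis .
    qed
    show "inj_on ?nbr {?off u..<?off (Suc u)}" if u: "u < n" for u
      unfolding range[OF u] by (rule inj_onI) (use nbr[OF u] adj_u(1)[OF u] in \<open>auto simp: nth_eq_iff_index_eq\<close>)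
    let ?L = "floorlog 2 n"
    \<comment> \<open>The word size factor 8 gives at least \<open>(n + 1) ^ 8\<close>: six factors,
      each at least 2, pay for the 64, and the other two remain.\<close>
    have "n + 1 \<le> 2 ^ ?L" using floorlog_bounds[of n 2] n0 by simp
    then have "(n + 1) ^ 8 \<le> (2 ^ ?L) ^ 8" by (rule power_mono) simp
    moreover have "64 * (n + 1) * (n + 1) \<le> (n + 1) ^ 8"
    proof -
      have "2 ^ 6 \<le> (n + 1) ^ 6" using n0 by (intro power_mono) simp_all
      then have "2 ^ 6 * (n + 1) ^ 2 \<le> (n + 1) ^ 6 * (n + 1) ^ 2" by (rule mult_le_mono1)
      then show ?thesis by (simp only: power_add[symmetric]) (simp add: power2_eq_square algebra_simps)
    qed
    ultimately show "64 * (n + 1) * (n + 1) \<le> 2 ^ (8 * ?L)" by (simp add: power_mult[symmetric] mult.commute)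
  qed
qed

definition time_bound :: "nat \<Rightarrow> real" where
  "time_bound n = real (6000 * (n * floor_sqrt n * (1 + floorlog 2 n) ^ 3))"

lemma eccentricities_correct: "computes_median_eccentricities eccentricities 8 time_bound"
  unfolding computes_median_eccentricities_def
proof (rule conjI, simp, intro allI impI, elim conjE)
  fix n and G :: "nat pair_pre_digraph" and adj
  assume G: "median_graph G" and card: "card (pverts G) = n" and adj: "adjacency_lists adj G"
  have V: "pverts G = {..<length adj}" using adj by (simp add: adjacency_lists_def)
  have n: "n = length adj" using card V by simp
  let ?s = "graph_input adj"
  interpret pair_graph G using G by (simp add: median_graph_def)
  have con: "connected (with_proj G)" using G by (simp add: median_graph_def)
  interpret ram_graph "8 * floorlog 2 n" n "arrs ?s ''off''" "arrs ?s ''nbr''" "steps (parcs G)"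
    by (rule ram_graph_input[OF G adj n])
  have "static ?s" "unvisited ?s" unfolding static_def unvisited_def using n by (simp_all add: graph_input_def)
  moreover have "arrs ?s ''comp'' v = 0" for v by (simp add: graph_input_def)
  ultimately obtain t s where t: "exec (8 * floorlog 2 n) ?s eccentricities t s"
    "t \<le> split_time + merge_time" "\<forall>v<n. arrs s ''ecc'' v = ecc (steps (parcs G)) {..<n} v"
    using runs_eccentricities unfolding runs_def by blast
  have "t \<le> 6000 * (n * floor_sqrt n * (1 + floorlog 2 n) ^ 3)"
    using t(2) time_le by (simp add: rt_def L_def)
  then have "real t \<le> time_bound n" unfolding time_bound_def by (rule of_nat_mono)
  moreover have "ereal (real (arrs s ''ecc'' u)) = eccentricity G u" if "u \<in> pverts G" for u
    using t(3) that V n by (simp add: eccentricity_eq[OF con] ecc_def)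
  ultimately show "\<exists>t s. exec (8 * floorlog 2 n) ?s eccentricities t s \<and> real t \<le> time_bound n \<and>
      (\<forall>u\<in>pverts G. ereal (real (arrs s ''ecc'' u)) = eccentricity G u)"
    using t(1) by blast
qed

text \<open>The constant is 6000 times \<open>4 ^ 3\<close>, as \<open>1 + floorlog 2 n\<close> is
  at most four times the natural logarithm for \<open>n \<ge> 3\<close>. Bounding
  \<open>sqrt n\<close> by \<open>n powr (2 / 3)\<close> relaxes the exponent from 3/2 to
  5/3.\<close>

lemma time_bound_soft_O: "time_bound \<in> soft_O (\<lambda>n. real n powr (5 / 3))"
proof -
  have "time_bound \<in> O(\<lambda>n. real n powr (5 / 3) * ln (real n) ^ 3)"
  proof (rule bigoI[where c = 384000])
    show "\<forall>\<^sub>F n in sequentially. norm (time_bound n) \<le> 384000 * norm (real n powr (5 / 3) * ln (real n) ^ 3)"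
    proof (rule eventually_mono[OF eventually_ge_at_top[of 3]])
      fix n :: nat assume n: "3 \<le> n"
      define l where "l = ln (real n)"
      \<comment> \<open>From 3 on the logarithm is at least 1 and can absorb additive
        constants.\<close>
      have "exp 1 \<le> real n" using exp_le n by linarith
      then have l1: "1 \<le> l" unfolding l_def using n by (subst ln_ge_iff) simp_all
      have "real (floor_sqrt n) \<le> sqrt (real n)"
        by (rule real_le_rsqrt) (use floor_sqrt_power2_le[of n] in \<open>simp flip: of_nat_power\<close>)
      also have "\<dots> \<le> real n powr (2 / 3)"
        using n by (simp flip: powr_half_sqrt)
      finally have "real n * real (floor_sqrt n) \<le> real n * real n powr (2 / 3)" by (rule mult_left_mono) simp
      also have "\<dots> = real n powr (5 / 3)" using n powr_add[of "real n" 1 "2 / 3"] by simp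
      finally have a: "real n * real (floor_sqrt n) \<le> real n powr (5 / 3)" .
      have "real (floorlog 2 n) \<le> 1 + log 2 (real n)" using n by (simp add: floorlog_def nat_add_distrib)
      moreover have "log 2 (real n) \<le> 2 * l"
      proof -
        \<comment> \<open>The inequality \<open>ln x \<le> x - 1\<close> at \<open>x = 1 / 2\<close>
          gives \<open>ln 2 \<ge> 1 / 2\<close>, so binary logarithms are at most twice natural
          ones.\<close>
        have ln2: "1 \<le> 2 * ln (2 :: real)" using ln_le_minus_one[of "1 / 2 :: real"] by (simp add: ln_div)
        then have "l * 1 \<le> l * (2 * ln 2)" using l1 by (intro mult_left_mono) simp_all
        then show ?thesis using ln2 by (simp add: log_def l_def field_simps)
      qed
      ultimately have "real (1 + floorlog 2 n) \<le> 4 * l" using l1 by simp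
      then have b: "real (1 + floorlog 2 n) ^ 3 \<le> (4 * l) ^ 3" by (rule power_mono) simp
      have "real n * real (floor_sqrt n) * real (1 + floorlog 2 n) ^ 3 \<le> real n powr (5 / 3) * (4 * l) ^ 3"
        using a b by (intro mult_mono) simp_all
      then show "norm (time_bound n) \<le> 384000 * norm (real n powr (5 / 3) * ln (real n) ^ 3)"
        using l1 by (simp add: time_bound_def l_def[symmetric] power_mult_distrib abs_mult ac_simps)
    qed
  qed
  then show ?thesis unfolding soft_O_def by blast
qed

theorem theorem11:
  shows "\<exists>p c T. computes_median_eccentricities p c T \<and>
           T \<in> soft_O (\<lambda>n. real n powr (5 / 3))"
  using eccentricities_correct time_bound_soft_O by blast

end
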